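(* Consider the dynamical system $\frac{d}{dt}\boldsymbol y(t)=f(\boldsymbol y(t))$, $\boldsymbol y(0)=\boldsymbol x$, with state in $\mathbb{R}^D$ and time-$t$ flow $\phi_{t,f}$, a consistent implicit Runge–Kutta scheme $\Phi_h$, and its unrolled approximation $\Phi_h^L$ obtained by $L$ steps of either fixed-point iteration or Newton–Raphson iteration. Let $f_\theta$ be the network vector field learned by minimizing the loss $\mathcal{L}_{unrolled}$. Let $s\ge 1$ be the number of compositions and $\Delta t=sh$. For $\boldsymbol x\in\mathbb{R}^D$ and $r_1,r_2>0$ denote $$\mathcal{L}=\big\|(\Phi^L_{h,f_\theta})^s-\phi_{sh,f}\big\|_{\mathcal{B}(\boldsymbol x,r_1)}/\Delta t ,$$ and suppose that the true vector field $f$ and the learned vector field $f_\theta$ are analytic and satisfy $\|f\|_{\mathcal{B}(\boldsymbol x,r_1+r_2)}\le m$ and $\|f_\theta\|_{\mathcal{B}(\boldsymbol x,r_1+r_2)}\le m$. Then there exists a uniquely defined vector field $f_h^K=\sum_{k=0}^K h^kf_k$, namely the truncation at index $K$ of the inverse modified differential equation (IMDE) of $\Phi_h^L$, such that, if $0<\Delta t<\Delta t_0$, $$\|f_\theta(\boldsymbol x)-f_h^K(\boldsymbol x)\|\le c_1\,m\,e^{-\gamma_1/\Delta t^{1/q}}+\frac{e}{e-1}\,\mathcal{L},$$ where the integer $K=K(h)$ and the constants $\Delta t_0,q,\gamma_1,c_1$ depend only on $m/r_1$, $m/r_2$, $s$, the scheme $\Phi_h$ and the choice of implicit solver.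
   Context: Norms: $\|\cdot\|=\|\cdot\|_\infty$ on $\mathbb{C}^D$; $\mathcal{B}(\boldsymbol x,r)\subset\mathbb{C}^D$ is the complex ball of radius $r$ centered at $\boldsymbol x$ for this norm; for a set $\mathcal{K}\subset\mathbb{C}^D$ and a map $g$, $\|g\|_{\mathcal{K}}=\sup_{\boldsymbol x\in\mathcal{K}}\|g(\boldsymbol x)\|$. Vector fields analytic near a real point are extended to complex arguments. Runge–Kutta scheme: with coefficients $a_{ij},b_i$ ($1\le i,j\le I$), for a vector field $g$, $\boldsymbol v_i=\boldsymbol x+h\sum_{j=1}^I a_{ij}g(\boldsymbol v_j)$ $(i=1,\dots,I)$, $\Phi_{h,g}(\boldsymbol x)=\boldsymbol x+h\sum_{i=1}^I b_ig(\boldsymbol v_i)$. It is explicit only if $a_{ij}=0$ for $i\le j$, otherwise implicit. Consistent means $\sum_i b_i=1$. Unrolled approximation $\Phi^L_{h,g}$: set $\boldsymbol v_i^0=\boldsymbol x$, and for $l=1,\dots,L$, either (fixed-point iteration) $\boldsymbol v_i^l=\boldsymbol x+h\sum_j a_{ij}g(\boldsymbol v_j^{l-1})$, or (Newton–Raphson iteration) $\boldsymbol v_i^l=\boldsymbol x+h\sum_j a_{ij}\big(g(\boldsymbol v_j^{l-1})+g'(\boldsymbol v_j^{l-1})(\boldsymbol v_j^l-\boldsymbol v_j^{l-1})\big)$ (a linear system for $(\boldsymbol v_j^l)_j$); then $\Phi^L_{h,g}(\boldsymbol x)=\boldsymbol x+h\sum_i b_ig(\boldsymbol v_i^L)$.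 "Implicit solver" refers to the choice between these two iterations. A power $(\cdot)^s$ of a map is $s$-fold composition. Loss: for data $\phi_{m\Delta t,f}(\boldsymbol x_n)$, $1\le n\le N$, $0\le m\le M$, $\mathcal{L}_{unrolled}=\sum_{n=1}^N\sum_{m=1}^M\|(\Phi^L_{h,f_\theta})^{ms}(\boldsymbol x_n)-\phi_{m\Delta t,f}(\boldsymbol x_n)\|_2^2/(m\Delta t)^2$ (in this formula $m$ is a summation index, unrelated to the bound $m$ in the claim). IMDE: the IMDE of a consistent one-step scheme $\Psi_h$ (here $\Psi_h=\Phi_h^L$) for $f$ is the formal vector field $f_h=\sum_{k\ge0}h^kf_k$ such that $\Psi_{h,f_h}(\boldsymbol x)=\phi_{h,f}(\boldsymbol x)$ as formal power series in $h$. Since the coefficient of $h^{k+1}$ in the expansion of $\Psi_{h,f_h}(\boldsymbol x)$ is $f_k(\boldsymbol x)$ plus terms built from $f_j$, $j<k$, and their derivatives, the $f_k$ are determined recursively and uniquely from $f$ and its derivatives. The truncation is $f_h^K=\sum_{k=0}^Kh^kf_k$. *)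

theory Defs
  imports "HOL-Analysis.Analysis" "HOL-Computational_Algebra.Formal_Power_Series"
begin

section \<open>Vectors of arbitrary dimension\<close>

text \<open>The constants of the error bound must not depend on the dimension $D$, so $D$ has to be
  quantified inside the statement. Vectors of dimension $D$ are therefore functions on \<^typ>\<open>nat\<close>
  that vanish from index $D$ on; the entries are real, complex, or formal power series.\<close>

type_synonym 'a nvec = "nat \<Rightarrow> 'a"

definition nvecs :: "nat \<Rightarrow> 'a::zero nvec set" where
  "nvecs D = {v. \<forall>p\<ge>D. v p = 0}"

text \<open>Only meaningful for $D \ge 1$ (maximum of a nonempty set).\<close>

definition supnorm :: "nat \<Rightarrow> 'a::real_normed_vector nvec \<Rightarrow> real" where
  "supnorm D v = Max ((\<lambda>p. norm (v p)) ` {..<D})"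

definition nball :: "nat \<Rightarrow> 'a::real_normed_vector nvec \<Rightarrow> real \<Rightarrow> 'a nvec set" where
  "nball D x r = {z \<in> nvecs D. supnorm D (\<lambda>p. z p - x p) < r}"

definition cvec :: "real nvec \<Rightarrow> complex nvec" where
  "cvec y = (\<lambda>p. complex_of_real (y p))"

section \<open>Vector fields\<close>

definition jacobian :: "('a::real_normed_field nvec \<Rightarrow> 'a nvec) \<Rightarrow> 'a nvec \<Rightarrow> nat \<Rightarrow> nat \<Rightarrow> 'a" where
  "jacobian g z p q = deriv (\<lambda>t. g (z(q := t)) p) (z q)"

text \<open>As in one variable in the library, analyticity on an open subset of $\mathbb{C}^D$ is
  complex (Frechet) differentiability at every point.\<close>

definition holomorphic_field ::
  "nat \<Rightarrow> complex nvec set \<Rightarrow> (complex nvec \<Rightarrow> complex nvec) \<Rightarrow> bool" where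
  "holomorphic_field D U G \<longleftrightarrow>
     (\<forall>z\<in>U. G z \<in> nvecs D \<and>
       (\<forall>p<D. \<exists>c :: nat \<Rightarrow> complex. \<forall>\<epsilon>>0. \<exists>\<delta>>0. \<forall>w\<in>nvecs D.
          supnorm D (\<lambda>q. w q - z q) < \<delta> \<longrightarrow>
          norm (G w p - G z p - (\<Sum>q<D. c q * (w q - z q))) \<le> \<epsilon> * supnorm D (\<lambda>q. w q - z q)))"

text \<open>\<open>G\<close> extends the real vector field \<open>g\<close> analytically to the complex ball of radius \<open>r\<close>
  around the real point \<open>x\<close>.\<close>

definition analytic_extension ::
  "nat \<Rightarrow> real nvec \<Rightarrow> real \<Rightarrow> (real nvec \<Rightarrow> real nvec) \<Rightarrow> (complex nvec \<Rightarrow> complex nvec) \<Rightarrow> bool" where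
  "analytic_extension D x r g G \<longleftrightarrow>
     holomorphic_field D (nball D (cvec x) r) G \<and> (\<forall>y\<in>nball D x r. G (cvec y) = cvec (g y))"

text \<open>\<open>flow U g t z\<close> is the value at time \<open>t\<close> (of either sign) of the solution of $u' = g(u)$,
  $u(0) = z$ in the domain \<open>U\<close>; meaningful where that solution exists and is unique.\<close>

definition flow ::
  "'a::real_normed_vector nvec set \<Rightarrow> ('a nvec \<Rightarrow> 'a nvec) \<Rightarrow> real \<Rightarrow> 'a nvec \<Rightarrow> 'a nvec" where
  "flow U g t z = (THE w. \<exists>u. u 0 = z \<and> u t = w \<and>
     (\<forall>\<tau>\<in>closed_segment 0 t. u \<tau> \<in> U \<and>
       (\<forall>p. ((\<lambda>\<sigma>. u \<sigma> p) has_vector_derivative g (u \<tau>) p) (at \<tau> within closed_segment 0 t))))"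

section \<open>Runge--Kutta schemes and their unrolled approximations\<close>

text \<open>A scheme is given by the number \<open>I\<close> of stages and real coefficients \<open>a\<close>, \<open>b\<close>;
  only the entries with indices below \<open>I\<close> matter.\<close>

definition rk_consistent :: "nat \<Rightarrow> (nat \<Rightarrow> real) \<Rightarrow> bool" where
  "rk_consistent I b \<longleftrightarrow> (\<Sum>i<I. b i) = 1"

definition rk_explicit :: "nat \<Rightarrow> (nat \<Rightarrow> nat \<Rightarrow> real) \<Rightarrow> bool" where
  "rk_explicit I a \<longleftrightarrow> (\<forall>i<I. \<forall>j<I. i \<le> j \<longrightarrow> a i j = 0)"

datatype implicit_solver = Fixed_Point | Newton_Raphson

text \<open>The stage vectors and the step are defined over an arbitrary commutative ring, with the vector
  field \<open>g\<close> and its Jacobian \<open>J\<close> as separate arguments and \<open>\<iota>\<close> embedding the real coefficients. This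
  covers real and complex vectors (\<open>\<iota> = of_real\<close>) and formal power series in the step
  size (\<open>\<iota> = fps_const\<close>, \<open>h = fps_X\<close>) at once.\<close>

primrec rk_stages ::
  "(real \<Rightarrow> 'a::comm_ring_1) \<Rightarrow> implicit_solver \<Rightarrow> nat \<Rightarrow> (nat \<Rightarrow> nat \<Rightarrow> real) \<Rightarrow> nat \<Rightarrow> 'a \<Rightarrow>
   ('a nvec \<Rightarrow> 'a nvec) \<Rightarrow> ('a nvec \<Rightarrow> nat \<Rightarrow> nat \<Rightarrow> 'a) \<Rightarrow> 'a nvec \<Rightarrow> nat \<Rightarrow> nat \<Rightarrow> 'a nvec" where
  "rk_stages \<iota> sv I a D h g J x 0 = (\<lambda>i. x)"
| "rk_stages \<iota> sv I a D h g J x (Suc l) =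
     (let v = rk_stages \<iota> sv I a D h g J x l in
      case sv of
        Fixed_Point \<Rightarrow> (\<lambda>i p. x p + h * (\<Sum>j<I. \<iota> (a i j) * g (v j) p))
      | Newton_Raphson \<Rightarrow>
          (THE w. w = (\<lambda>i p. x p + h * (\<Sum>j<I. \<iota> (a i j) *
             (g (v j) p + (\<Sum>q<D. J (v j) p q * (w j q - v j q)))))))"

definition rk_unrolled ::
  "(real \<Rightarrow> 'a::comm_ring_1) \<Rightarrow> implicit_solver \<Rightarrow> nat \<Rightarrow> (nat \<Rightarrow> nat \<Rightarrow> real) \<Rightarrow> (nat \<Rightarrow> real) \<Rightarrow> nat \<Rightarrow>
   nat \<Rightarrow> 'a \<Rightarrow> ('a nvec \<Rightarrow> 'a nvec) \<Rightarrow> ('a nvec \<Rightarrow> nat \<Rightarrow> nat \<Rightarrow> 'a) \<Rightarrow> 'a nvec \<Rightarrow> 'a nvec" where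
  "rk_unrolled \<iota> sv I a b L D h g J x =
     (\<lambda>p. x p + h * (\<Sum>i<I. \<iota> (b i) * g (rk_stages \<iota> sv I a D h g J x L i) p))"

definition unrolled ::
  "implicit_solver \<Rightarrow> nat \<Rightarrow> (nat \<Rightarrow> nat \<Rightarrow> real) \<Rightarrow> (nat \<Rightarrow> real) \<Rightarrow> nat \<Rightarrow> nat \<Rightarrow>
   real \<Rightarrow> ('a::real_normed_field nvec \<Rightarrow> 'a nvec) \<Rightarrow> 'a nvec \<Rightarrow> 'a nvec" where
  "unrolled sv I a b L D h g = rk_unrolled of_real sv I a b L D (of_real h) g (jacobian g)"

section \<open>Training loss\<close>

text \<open>\<open>X n\<close> for \<open>1 \<le> n \<le> N\<close> are the initial data and $\Delta t = s h$.\<close>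

definition loss_unrolled ::
  "implicit_solver \<Rightarrow> nat \<Rightarrow> (nat \<Rightarrow> nat \<Rightarrow> real) \<Rightarrow> (nat \<Rightarrow> real) \<Rightarrow> nat \<Rightarrow> nat \<Rightarrow> nat \<Rightarrow> real \<Rightarrow>
   (real nvec \<Rightarrow> real nvec) \<Rightarrow> nat \<Rightarrow> nat \<Rightarrow> (nat \<Rightarrow> real nvec) \<Rightarrow> (real nvec \<Rightarrow> real nvec) \<Rightarrow> real" where
  "loss_unrolled sv I a b L s D h f N M X g =
     (\<Sum>n=1..N. \<Sum>k=1..M.
        (L2_set (\<lambda>p. ((unrolled sv I a b L D h g) ^^ (k * s)) (X n) p
                     - flow (nvecs D) f (real k * (real s * h)) (X n) p) {..<D})\<^sup>2
        / (real k * (real s * h))\<^sup>2)"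

section \<open>Inverse modified differential equation\<close>

text \<open>Substitution of a vector \<open>v\<close> of formal power series into a map \<open>g\<close> that is analytic near the
  constant term of \<open>v\<close>, i.e. composition with the Taylor series of \<open>g\<close>. The $n$-th coefficient of
  $g(v(t))$ depends on \<open>v\<close> only up to order $n$, so it is computed as a Taylor coefficient at $t = 0$
  after truncating \<open>v\<close> to a polynomial of degree $n$.\<close>

definition formal_subst :: "(real nvec \<Rightarrow> real) \<Rightarrow> real fps nvec \<Rightarrow> real fps" where
  "formal_subst g v =
     Abs_fps (\<lambda>n. (deriv ^^ n) (\<lambda>t. g (\<lambda>q. \<Sum>k\<le>n. fps_nth (v q) k * t ^ k)) 0 / fact n)"

text \<open>The formal sum $\sum_k h^k\, g_k(v)$, where $h$ is the series variable.\<close>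

definition formal_sum :: "(nat \<Rightarrow> real nvec \<Rightarrow> real) \<Rightarrow> real fps nvec \<Rightarrow> real fps" where
  "formal_sum gs v = Abs_fps (\<lambda>n. \<Sum>k\<le>n. fps_nth (formal_subst (gs k) v) (n - k))"

definition formal_unrolled ::
  "implicit_solver \<Rightarrow> nat \<Rightarrow> (nat \<Rightarrow> nat \<Rightarrow> real) \<Rightarrow> (nat \<Rightarrow> real) \<Rightarrow> nat \<Rightarrow> nat \<Rightarrow>
   (nat \<Rightarrow> real nvec \<Rightarrow> real nvec) \<Rightarrow> real nvec \<Rightarrow> real fps nvec" where
  "formal_unrolled sv I a b L D fs z =
     rk_unrolled fps_const sv I a b L D fps_X
       (\<lambda>v p. formal_sum (\<lambda>k y. fs k y p) v)
       (\<lambda>v p q. formal_sum (\<lambda>k y. jacobian (fs k) y p q) v)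
       (\<lambda>p. fps_const (z p))"

text \<open>\<open>fs\<close> are the coefficients of the IMDE of the unrolled scheme for \<open>f\<close> on the ball of radius \<open>r\<close>
  around \<open>x\<close>: the formal power series $\Psi_{h,f_h}(z)$ is the expansion of $\phi_{h,f}(z)$ in $h$.\<close>

definition imde ::
  "implicit_solver \<Rightarrow> nat \<Rightarrow> (nat \<Rightarrow> nat \<Rightarrow> real) \<Rightarrow> (nat \<Rightarrow> real) \<Rightarrow> nat \<Rightarrow> nat \<Rightarrow>
   real nvec \<Rightarrow> real \<Rightarrow> (real nvec \<Rightarrow> real nvec) \<Rightarrow> (nat \<Rightarrow> real nvec \<Rightarrow> real nvec) \<Rightarrow> bool" where
  "imde sv I a b L D x r f fs \<longleftrightarrow>
     (\<forall>k. \<exists>G. analytic_extension D x r (fs k) G) \<and>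
     (\<forall>z\<in>nball D x r. \<forall>p<D.
        (\<lambda>h. flow (nvecs D) f h z p) has_fps_expansion formal_unrolled sv I a b L D fs z p)"

definition imde_truncation ::
  "(nat \<Rightarrow> real nvec \<Rightarrow> real nvec) \<Rightarrow> nat \<Rightarrow> real \<Rightarrow> real nvec \<Rightarrow> real nvec" where
  "imde_truncation fs K h y = (\<lambda>p. \<Sum>k\<le>K. h ^ k * fs k y p)"

section \<open>The quantity $\mathcal{L}$ of the error bound\<close>

text \<open>\<open>F\<close> and \<open>G\<close> are the complex extensions of \<open>f\<close> and \<open>f\<^sub>\<theta>\<close>.\<close>

definition discrepancy ::
  "implicit_solver \<Rightarrow> nat \<Rightarrow> (nat \<Rightarrow> nat \<Rightarrow> real) \<Rightarrow> (nat \<Rightarrow> real) \<Rightarrow> nat \<Rightarrow> nat \<Rightarrow> nat \<Rightarrow> real \<Rightarrow>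
   real nvec \<Rightarrow> real \<Rightarrow> real \<Rightarrow> (complex nvec \<Rightarrow> complex nvec) \<Rightarrow> (complex nvec \<Rightarrow> complex nvec) \<Rightarrow> real" where
  "discrepancy sv I a b L s D h x r1 r2 F G =
     (SUP z\<in>nball D (cvec x) r1.
        supnorm D (\<lambda>p. ((unrolled sv I a b L D h G) ^^ s) z p
                       - flow (nball D (cvec x) (r1 + r2)) F (real s * h) z p))
     / (real s * h)"

end

theory Submission
  imports Defs "HOL-Complex_Analysis.Complex_Analysis" "HOL-Real_Asymp.Real_Asymp"
begin

text \<open>
  Write $\Psi_{h,g}$ for the unrolled step; it is $z + h\,\mathrm{inc}_{h,g}(z)$ with an increment that is
  analytic in $h$, $z$ and $g$, and the flow of $f$ is $z + h\,A_h(z)$ with $A_h$ the average of $f$ along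
  the orbit. The map $g \mapsto g - \mathrm{inc}_{h,g} + A_h$ contracts by a factor $O(h/\delta)$ at the price
  of shrinking the domain by $3\delta$. Its iterates $g^{(j)}$, started at $f$, are analytic in $h$, and
  $\Psi_{h,g^{(j)}}$ agrees with the flow up to $O(h^{j+2})$; so the $k$-th Taylor coefficient of
  $g^{(k)}$ in $h$ is the IMDE coefficient $f_k$. With $\delta \sim r_2/K$ and $K \sim 1/h$ the defect of
  $g^{(K)}$ and, by Cauchy's estimates in $h$, its distance to the truncation $f_h^K$ are exponentially small.

  To compare $f_\theta$ with $g = g^{(K)}$, note that
  $\Psi_{h,f_\theta}^s - \Psi_{h,g}^s = s h\,(f_\theta - g)$ up to $O(h^2/\delta)\,\|f_\theta - g\|$, again with a
  loss of domain of size $\delta$. Hence $\|f_\theta - g\| \le E + e^{-1}\,\|f_\theta - g\|'$ with $E$ the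
  discrepancy of the $s$-fold steps and the norm on the right taken on a slightly larger ball.
  Iterating $n \sim 1/h$ times sums a geometric series to $e/(e-1)$ and leaves a remainder $e^{-n}$.
  In particular the bound holds with $q = 1$.
\<close>

text \<open>No constant may depend on the dimension or on \<open>L\<close>. Derivatives in
  \<open>D\<close> variables are therefore estimated only as one-variable derivatives on complex
  discs: a Jacobian applied to a vector is one directional derivative, bounded in the sup norm
  without a factor \<open>D\<close>. The stage bounds reproduce themselves at every inner iteration,
  which makes them uniform in \<open>L\<close>. Each such Cauchy estimate costs a collar of the
  ball, so \<open>r1\<close> and \<open>r2\<close> limit the number of rounds. The IMDE must exist
  and be unique on the whole ball, whereas the iterates are controlled on shrunken balls only. The
  iteration refers to no ball, so small balls around different centres yield the same coefficients,
  and the quantitative estimate is made at the centre alone. The formal series of the IMDE may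
  diverge: only its polynomial truncations are put into the actual step, and the formal step is
  compared with these modulo powers of the series variable. Reality on real points is carried along
  to return from complex fields to the real IMDE.\<close>

section \<open>Cauchy estimates, parameter derivatives and geometric limits in one complex
  variable\<close>

lemma Cauchy_bound_ball:
  assumes "f holomorphic_on ball a r" and "0 < r" and M: "\<And>z. z \<in> ball a r \<Longrightarrow> cmod (f z) \<le> M"
  shows "cmod ((deriv ^^ n) f a) \<le> fact n * M / r ^ n"
proof -
  \<comment> \<open>Continuity up to the boundary holds on smaller closed balls only, so Cauchy's
    inequality is applied at radius \<open>t\<close>, and \<open>t\<close> tends to
    \<open>r\<close>.\<close>
  have *: "cmod ((deriv ^^ n) f a) * t ^ n \<le> fact n * M" if "0 < t" "t < r" for t
  proof -
    have "cmod ((deriv ^^ n) f a) \<le> fact n * M / t ^ n"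
    proof (rule Cauchy_inequality)
      show "f holomorphic_on ball a t"
        using assms(1) by (rule holomorphic_on_subset) (use that in auto)
      show "continuous_on (cball a t) f"
        by (rule holomorphic_on_imp_continuous_on, rule holomorphic_on_subset[OF assms(1)])
          (use that in auto)
      show "cmod (f x) \<le> M" if "cmod (a - x) = t" for x
        using that \<open>t < r\<close> by (intro M) (auto simp: dist_norm)
    qed (use that in auto)
    then show ?thesis using that by (simp add: field_simps)
  qed
  have "((\<lambda>t. cmod ((deriv ^^ n) f a) * t ^ n) \<longlongrightarrow> cmod ((deriv ^^ n) f a) * r ^ n) (at_left r)"
    by (intro tendsto_intros)
  moreover have "eventually (\<lambda>t. cmod ((deriv ^^ n) f a) * t ^ n \<le> fact n * M) (at_left r)"
    using eventually_at_left_real[OF \<open>0 < r\<close>] by eventually_elim (auto intro: *)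
  ultimately have "cmod ((deriv ^^ n) f a) * r ^ n \<le> fact n * M"
    using tendsto_upperbound trivial_limit_at_left_real by blast
  then show ?thesis using assms(2) by (simp add: field_simps)
qed

lemma Cauchy_bound_deriv:
  assumes "f holomorphic_on ball a r" and "0 < r" and "\<And>z. z \<in> ball a r \<Longrightarrow> cmod (f z) \<le> M"
  shows "cmod (deriv f a) \<le> M / r"
  using Cauchy_bound_ball[OF assms, of 1] by simp

text \<open>The collar of width \<open>r\<close> around \<open>S\<close> turns the bound on
  \<open>f\<close> into the bound \<open>M / r\<close> on its derivative, which is then used along
  segments of the convex set \<open>S\<close>.\<close>

lemma holomorphic_Lipschitz:
  assumes "f holomorphic_on T" and "open T" and "convex S" and "0 < r"
    and "\<And>x. x \<in> S \<Longrightarrow> ball x r \<subseteq> T" and "\<And>x. x \<in> T \<Longrightarrow> cmod (f x) \<le> M"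
    and "x \<in> S" and "y \<in> S"
  shows "cmod (f x - f y) \<le> M / r * cmod (x - y)"
proof (rule field_differentiable_bound[OF \<open>convex S\<close>])
  fix z assume z: "z \<in> S"
  then have "z \<in> T" using assms(4,5) by force
  then show "(f has_field_derivative deriv f z) (at z within S)"
    using assms(1,2) holomorphic_derivI by (metis has_field_derivative_at_within)
  show "cmod (deriv f z) \<le> M / r"
    using z assms(1,4,5,6) by (intro Cauchy_bound_deriv) (meson holomorphic_on_subset subsetD)+
qed (use assms in auto)

text \<open>Within half the radius, Cauchy's estimate on discs of radius \<open>r/2\<close> bounds
  the second derivative by \<open>2 * M / (r/2)^2 = 8 * M / r^2\<close>. Two mean value estimates,
  which forgo the factor 1/2, give the constant.\<close>

lemma Taylor_bound_1:
  assumes "f holomorphic_on ball 0 r" and "0 < r" and "\<And>z. z \<in> ball 0 r \<Longrightarrow> cmod (f z) \<le> M"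
    and "cmod \<eta> \<le> r / 2"
  shows "cmod (f \<eta> - f 0 - \<eta> * deriv f 0) \<le> 8 * M * (cmod \<eta>)\<^sup>2 / r\<^sup>2"
proof -
  have df: "deriv f holomorphic_on ball 0 r" using assms(1) by (simp add: holomorphic_deriv)
  have half: "ball z (r/2) \<subseteq> ball 0 r" if "cmod z \<le> r/2" for z
    using that by (smt (verit) field_sum_of_halves in_mono mem_ball_0 norm_minus_commute norm_triangle_sub subsetI dist_norm mem_ball)
  have dd: "cmod (deriv (deriv f) z) \<le> 8 * M / r\<^sup>2" if z: "cmod z \<le> r/2" for z
  proof -
    have "cmod ((deriv ^^ 2) f z) \<le> fact 2 * M / (r/2)^2"
      by (rule Cauchy_bound_ball) (use half[OF z] assms in \<open>auto intro: holomorphic_on_subset\<close>)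
    then show ?thesis by (simp add: eval_nat_numeral field_simps)
  qed
  have d1: "cmod (deriv f z - deriv f 0) \<le> 8 * M / r\<^sup>2 * cmod (z - 0)" if z: "cmod z \<le> r/2" for z
  proof (rule field_differentiable_bound[where S = "cball 0 (r/2)"])
    fix w assume "w \<in> cball (0::complex) (r/2)"
    then have "w \<in> ball 0 r" using \<open>0 < r\<close> by auto
    then show "(deriv f has_field_derivative deriv (deriv f) w) (at w within cball 0 (r/2))"
      using df open_ball holomorphic_derivI by (metis has_field_derivative_at_within)
  qed (use dd z \<open>0 < r\<close> in auto)
  let ?S = "cball (0::complex) (cmod \<eta>)"
  have "cmod ((f \<eta> - \<eta> * deriv f 0) - (f 0 - 0 * deriv f 0)) \<le> (8 * M / r\<^sup>2 * cmod \<eta>) * cmod (\<eta> - 0)"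
  proof (rule field_differentiable_bound[where S = ?S])
    fix w assume w: "w \<in> ?S"
    then have "w \<in> ball 0 r" using \<open>0 < r\<close> assms(4) by auto
    then have "(f has_field_derivative deriv f w) (at w within ?S)"
      using assms(1) open_ball holomorphic_derivI by (metis has_field_derivative_at_within)
    then show "((\<lambda>z. f z - z * deriv f 0) has_field_derivative deriv f w - deriv f 0) (at w within ?S)"
      by (auto intro!: derivative_eq_intros)
    have "0 \<le> M" using assms(3)[of 0] \<open>0 < r\<close> norm_ge_zero order_trans by (metis centre_in_ball)
    then show "cmod (deriv f w - deriv f 0) \<le> 8 * M / r\<^sup>2 * cmod \<eta>"
      using d1[of w] w assms(4)
      by (smt (verit, best) diff_zero divide_nonneg_nonneg mem_cball_0 mult_left_mono zero_le_power2)
  qed auto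
  then show ?thesis by (simp add: power2_eq_square algebra_simps)
qed

text \<open>A rate that is independent of the point makes the convergence locally uniform. Newton
  solutions, flows, integrals and parameter derivatives all become holomorphic in this way.\<close>

lemma holomorphic_limit_rate:
  assumes "open S" and "\<And>n. f n holomorphic_on S" and "e \<longlonglongrightarrow> 0"
    and "\<And>n \<zeta>. \<zeta> \<in> S \<Longrightarrow> cmod (f n \<zeta> - g \<zeta>) \<le> e n"
  shows "g holomorphic_on S"
proof (rule holomorphic_uniform_sequence[OF assms(1,2)])
  fix x assume "x \<in> S"
  then obtain d where d: "0 < d" "cball x d \<subseteq> S" using assms(1) open_contains_cball by blast
  have "uniform_limit (cball x d) f g sequentially"
  proof (rule uniform_limitI)
    fix \<epsilon> :: real assume "0 < \<epsilon>"
    then have "eventually (\<lambda>n. e n < \<epsilon>) sequentially"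
      using assms(3) by (auto dest: order_tendstoD)
    then show "\<forall>\<^sub>F n in sequentially. \<forall>y\<in>cball x d. dist (f n y) (g y) < \<epsilon>"
      proof eventually_elim
      case (elim n)
      then show ?case using d assms(4)[of _ n] by (metis dist_norm le_less_trans subsetD)
    qed
  qed
  then show "\<exists>d>0. cball x d \<subseteq> S \<and> uniform_limit (cball x d) f g sequentially" using d by blast
qed

text \<open>Difference quotients in \<open>\<eta>\<close> are holomorphic in \<open>\<zeta>\<close>
  and converge with an error proportional to the step, uniformly in \<open>\<zeta>\<close>. The
  steps \<open>r / (n + 2)\<close> stay within half the radius, as the first-order Taylor estimate
  demands.\<close>

lemma holomorphic_param_deriv:
  assumes "open S" and "0 < r"
    and h1: "\<And>\<zeta>. \<zeta> \<in> S \<Longrightarrow> (\<lambda>\<eta>. Q \<eta> \<zeta>) holomorphic_on ball 0 r"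
    and h2: "\<And>\<eta>. \<eta> \<in> ball 0 r \<Longrightarrow> Q \<eta> holomorphic_on S"
    and M: "\<And>\<eta> \<zeta>. \<eta> \<in> ball 0 r \<Longrightarrow> \<zeta> \<in> S \<Longrightarrow> cmod (Q \<eta> \<zeta>) \<le> M"
  shows "(\<lambda>\<zeta>. deriv (\<lambda>\<eta>. Q \<eta> \<zeta>) 0) holomorphic_on S"
proof -
  define t where "t n = r / (real n + 2)" for n
  have t: "0 < t n" "t n \<le> r/2" for n using \<open>0 < r\<close> by (auto simp: t_def field_simps)
  have tlim: "t \<longlonglongrightarrow> 0" unfolding t_def by real_asymp
  show ?thesis
  proof (rule holomorphic_limit_rate[OF \<open>open S\<close>, of "\<lambda>n \<zeta>. (Q (of_real (t n)) \<zeta> - Q 0 \<zeta>) / of_real (t n)"])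
    show "(\<lambda>\<zeta>. (Q (of_real (t n)) \<zeta> - Q 0 \<zeta>) / of_real (t n)) holomorphic_on S" for n
      using t[of n] \<open>0 < r\<close> by (intro holomorphic_intros h2) auto
    show "(\<lambda>n. 8 * M / r\<^sup>2 * t n) \<longlonglongrightarrow> 0" using tendsto_mult_right_zero[OF tlim, of "8 * M / r\<^sup>2"] by simp
    fix n \<zeta> assume z: "\<zeta> \<in> S"
    have "cmod (Q (of_real (t n)) \<zeta> - Q 0 \<zeta> - of_real (t n) * deriv (\<lambda>\<eta>. Q \<eta> \<zeta>) 0)
        \<le> 8 * M * (cmod (of_real (t n)))\<^sup>2 / r\<^sup>2"
      by (rule Taylor_bound_1) (use t[of n] \<open>0 < r\<close> M z h1 in auto)
    then have *: "cmod (Q (of_real (t n)) \<zeta> - Q 0 \<zeta> - of_real (t n) * deriv (\<lambda>\<eta>. Q \<eta> \<zeta>) 0) / t n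
        \<le> 8 * M * (t n)\<^sup>2 / r\<^sup>2 / t n"
      using t[of n] by (intro divide_right_mono) auto
    have "cmod ((Q (of_real (t n)) \<zeta> - Q 0 \<zeta>) / of_real (t n) - deriv (\<lambda>\<eta>. Q \<eta> \<zeta>) 0)
       = cmod ((Q (of_real (t n)) \<zeta> - Q 0 \<zeta> - of_real (t n) * deriv (\<lambda>\<eta>. Q \<eta> \<zeta>) 0) / of_real (t n))"
      using t[of n] by (simp add: diff_divide_distrib)
    also have "\<dots> = cmod (Q (of_real (t n)) \<zeta> - Q 0 \<zeta> - of_real (t n) * deriv (\<lambda>\<eta>. Q \<eta> \<zeta>) 0) / t n"
      using t[of n] by (simp add: norm_divide)
    also note *
    also have "8 * M * (t n)\<^sup>2 / r\<^sup>2 / t n = 8 * M / r\<^sup>2 * t n"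
      using t[of n] by (simp add: power2_eq_square)
    finally show "cmod ((Q (of_real (t n)) \<zeta> - Q 0 \<zeta>) / of_real (t n) - deriv (\<lambda>\<eta>. Q \<eta> \<zeta>) 0)
      \<le> 8 * M / r\<^sup>2 * t n" .
  qed
qed

text \<open>The innermost derivative is peeled off, which replaces \<open>Q\<close> by its
  derivative on half the radius and \<open>M\<close> by Cauchy's bound \<open>M / (r/2)\<close>;
  therefore \<open>r\<close>, \<open>Q\<close> and \<open>M\<close> vary in the induction.\<close>

lemma holomorphic_param_higher_deriv:
  assumes "open S" and "0 < r"
    and "\<And>\<zeta>. \<zeta> \<in> S \<Longrightarrow> (\<lambda>\<eta>. Q \<eta> \<zeta>) holomorphic_on ball 0 r"
    and "\<And>\<eta>. \<eta> \<in> ball 0 r \<Longrightarrow> Q \<eta> holomorphic_on S"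
    and "\<And>\<eta> \<zeta>. \<eta> \<in> ball 0 r \<Longrightarrow> \<zeta> \<in> S \<Longrightarrow> cmod (Q \<eta> \<zeta>) \<le> M"
  shows "(\<lambda>\<zeta>. (deriv ^^ n) (\<lambda>\<eta>. Q \<eta> \<zeta>) 0) holomorphic_on S"
  using assms(2-)
proof (induction n arbitrary: r Q M)
  case 0
  then show ?case by simp
next
  case (Suc n)
  have sub: "ball \<eta> (r/2) \<subseteq> ball 0 r" if "\<eta> \<in> ball 0 (r/2)" for \<eta> :: complex
  proof
    fix x assume "x \<in> ball \<eta> (r/2)"
    then show "x \<in> ball 0 r" using that norm_triangle_ineq[of "x - \<eta>" \<eta>]
      by (simp add: dist_norm norm_minus_commute)
  qed
  have "(\<lambda>\<zeta>. (deriv ^^ n) (\<lambda>\<eta>. deriv (\<lambda>\<eta>. Q \<eta> \<zeta>) \<eta>) 0) holomorphic_on S"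
  proof (rule Suc.IH[where r = "r/2" and M = "M / (r/2)"])
    fix \<eta> :: complex assume \<eta>: "\<eta> \<in> ball 0 (r/2)"
    have eq: "deriv (\<lambda>\<eta>. Q \<eta> \<zeta>) \<eta> = deriv (\<lambda>y. Q (\<eta> + y) \<zeta>) 0" for \<zeta>
      by (subst deriv_shift_0) (simp add: o_def)
    show "(\<lambda>\<zeta>. deriv (\<lambda>\<eta>. Q \<eta> \<zeta>) \<eta>) holomorphic_on S"
      unfolding eq
    proof (rule holomorphic_param_deriv[OF \<open>open S\<close>, where r = "r/2" and M = M])
      have *: "\<eta> + y \<in> ball 0 r" if "y \<in> ball 0 (r/2)" for y
        using \<eta> that norm_triangle_ineq[of \<eta> y] by simp
      show "(\<lambda>y. Q (\<eta> + y) \<zeta>) holomorphic_on ball 0 (r/2)" if "\<zeta> \<in> S" for \<zeta>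
      proof -
        have "((\<lambda>\<eta>. Q \<eta> \<zeta>) \<circ> (\<lambda>y. \<eta> + y)) holomorphic_on ball 0 (r/2)"
          by (rule holomorphic_on_compose_gen[where t = "ball 0 r"])
            (use * Suc.prems(2)[OF that] in \<open>force intro!: holomorphic_intros simp del: image_add_ball\<close>)+
        then show ?thesis by (simp add: o_def)
      qed
      show "Q (\<eta> + y) holomorphic_on S" if "y \<in> ball 0 (r/2)" for y
        using Suc.prems(3) * that by auto
      show "cmod (Q (\<eta> + y) \<zeta>) \<le> M" if "y \<in> ball 0 (r/2)" "\<zeta> \<in> S" for y \<zeta>
        using Suc.prems(4) * that by auto
    qed (use Suc.prems in auto)
    fix \<zeta> assume "\<zeta> \<in> S"
    then show "cmod (deriv (\<lambda>\<eta>. Q \<eta> \<zeta>) \<eta>) \<le> M / (r/2)"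
      using sub[OF \<eta>] Suc.prems by (intro Cauchy_bound_deriv) (auto intro: holomorphic_on_subset)
  next
    fix \<zeta> assume "\<zeta> \<in> S"
    then show "(\<lambda>\<eta>. deriv (\<lambda>\<eta>. Q \<eta> \<zeta>) \<eta>) holomorphic_on ball 0 (r/2)"
      using Suc.prems(1) by (intro holomorphic_on_subset[OF holomorphic_deriv[OF Suc.prems(2)]]) auto
  qed (use Suc.prems in auto)
  then show ?case by (simp only: funpow_Suc_right o_def)
qed

lemma geometric_limit:
  fixes f :: "nat \<Rightarrow> complex"
  assumes "\<And>n. cmod (f (Suc n) - f n) \<le> C / 2 ^ n"
  shows "cmod (f n - lim f) \<le> 2 * C / 2 ^ n" and "f \<longlonglongrightarrow> lim f"
proof -
  have sg: "summable (\<lambda>n. C / 2 ^ n)"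
    using summable_mult[OF summable_geometric[of "1/2::real"], of C] by (simp add: power_one_over divide_simps)
  have s: "summable (\<lambda>n. f (Suc n) - f n)"
    by (rule summable_comparison_test'[OF sg, of 0]) (use assms in auto)
  then have "convergent (\<lambda>n. \<Sum>i<n. f (Suc i) - f i)" using summable_iff_convergent by blast
  then have "convergent (\<lambda>n. f n - f 0)" by (simp add: sum_lessThan_telescope)
  then have "convergent f" using convergent_diff_const_right_iff by blast
  then show lim: "f \<longlonglongrightarrow> lim f" by (simp add: convergent_LIMSEQ_iff)
  \<comment> \<open>The factor \<open>1 - 1 / 2 ^ k\<close> is the exact partial geometric sum; with
    it the induction on \<open>k\<close> closes.\<close>
  have *: "cmod (f (n + k) - f n) \<le> 2 * C / 2 ^ n * (1 - 1 / 2 ^ k)" for k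
  proof (induction k)
    case (Suc k)
    have "cmod (f (n + Suc k) - f n) \<le> C / 2 ^ (n + k) + 2 * C / 2 ^ n * (1 - 1 / 2 ^ k)"
      using Suc assms[of "n + k"] norm_triangle_mono[of "f (Suc (n + k)) - f (n + k)" _ "f (n + k) - f n"] by auto
    also have "\<dots> = 2 * C / 2 ^ n * (1 - 1 / 2 ^ Suc k)" by (simp add: field_simps power_add)
    finally show ?case .
  qed simp
  have C: "0 \<le> C" using order_trans[OF norm_ge_zero assms[of 0]] by simp
  have "cmod (f (n + k) - f n) \<le> 2 * C / 2 ^ n" for k
    by (rule order_trans[OF *]) (use C mult_left_mono[of "1 - 1 / 2 ^ k" 1 "2 * C / 2 ^ n"] in simp)
  moreover have "(\<lambda>k. cmod (f (n + k) - f n)) \<longlonglongrightarrow> cmod (lim f - f n)"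
    using LIMSEQ_ignore_initial_segment[OF lim, of n] by (intro tendsto_intros) (simp add: add.commute)
  ultimately show "cmod (f n - lim f) \<le> 2 * C / 2 ^ n"
    by (subst norm_minus_commute) (rule LIMSEQ_le_const2, auto)
qed

section \<open>Vectors and balls\<close>

lemma cvec_Re: "(\<And>p. Im (w p) = 0) \<Longrightarrow> cvec (\<lambda>p. Re (w p)) = w"
  by (auto simp: cvec_def complex_eq_iff fun_eq_iff)

locale dim =
  fixes D :: nat
  assumes D_pos: "1 \<le> D"
begin

lemma supnorm_less_iff: "supnorm D v < r \<longleftrightarrow> (\<forall>p<D. norm (v p) < r)"
  using D_pos unfolding supnorm_def by (subst Max_less_iff) (auto simp: lessThan_empty_iff)

lemma supnorm_le_iff: "supnorm D v \<le> r \<longleftrightarrow> (\<forall>p<D. norm (v p) \<le> r)"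
  using D_pos unfolding supnorm_def by (subst Max_le_iff) (auto simp: lessThan_empty_iff)

lemma norm_le_supnorm: "p < D \<Longrightarrow> norm (v p) \<le> supnorm D v"
  using supnorm_le_iff[of v "supnorm D v"] by simp

lemma supnorm_nonneg: "0 \<le> supnorm D v"
  using norm_le_supnorm[of 0 v] D_pos norm_ge_zero[of "v 0"] by linarith

lemma in_nball_iff: "z \<in> nball D c r \<longleftrightarrow> z \<in> nvecs D \<and> (\<forall>p<D. norm (z p - c p) < r)"
  by (simp add: nball_def supnorm_less_iff)

lemma nvecsD: "z \<in> nvecs D \<Longrightarrow> \<not> p < D \<Longrightarrow> z p = 0"
  by (simp add: nvecs_def)

lemma nball_nvecs: "z \<in> nball D c r \<Longrightarrow> z \<in> nvecs D"
  by (simp add: nball_def)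

lemma nball_shift:
  assumes "z \<in> nball D c r" and "w \<in> nvecs D" and "\<And>p. p < D \<Longrightarrow> norm (w p - z p) \<le> \<delta>" and "r + \<delta> \<le> \<rho>"
  shows "w \<in> nball D c \<rho>"
  unfolding in_nball_iff
proof (intro conjI allI impI)
  fix p assume p: "p < D"
  have "norm (w p - c p) \<le> norm (w p - z p) + norm (z p - c p)" by (rule norm_diff_triangle_ineq[of "w p" "z p" "z p" "c p", simplified])
  also have "\<dots> < \<rho>" using assms p by (fastforce simp: in_nball_iff)
  finally show "norm (w p - c p) < \<rho>" .
qed (use assms in auto)

lemma nball_mono: "r \<le> \<rho> \<Longrightarrow> z \<in> nball D c r \<Longrightarrow> z \<in> nball D c \<rho>"
  by (auto simp: nball_def)

lemma nball_centre: "c \<in> nvecs D \<Longrightarrow> 0 < r \<Longrightarrow> c \<in> nball D c r"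
  by (auto simp: in_nball_iff)

lemma nball_margin:
  assumes "z \<in> nball D c r"
  obtains \<delta> where "0 < \<delta>" and "z \<in> nball D c (r - \<delta>)"
    and "\<And>w. w \<in> nball D z \<delta> \<Longrightarrow> w \<in> nball D c r"
proof -
  define \<delta> where "\<delta> = (r - supnorm D (\<lambda>p. z p - c p)) / 2"
  have "supnorm D (\<lambda>p. z p - c p) < r" using assms by (simp add: nball_def)
  then have \<delta>: "0 < \<delta>" "supnorm D (\<lambda>p. z p - c p) < r - \<delta>" by (auto simp: \<delta>_def field_simps)
  then have z: "z \<in> nball D c (r - \<delta>)" using assms by (auto simp: nball_def)
  show ?thesis
  proof (rule that[OF \<delta>(1) z])
    fix w assume "w \<in> nball D z \<delta>"
    then show "w \<in> nball D c r"
      by (intro nball_shift[OF z, of w \<delta>]) (auto simp: in_nball_iff less_imp_le)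
  qed
qed

end

section \<open>Holomorphic families\<close>

definition pd :: "('a::real_normed_field nvec \<Rightarrow> 'a) \<Rightarrow> 'a nvec \<Rightarrow> nat \<Rightarrow> 'a" where
  "pd \<phi> z q = deriv (\<lambda>t. \<phi> (z(q := t))) (z q)"

lemma jacobian_eq_pd: "jacobian g z p q = pd (\<lambda>z. g z p) z q"
  by (simp add: jacobian_def pd_def)

lemma pd_shift: "pd \<phi> z q = deriv (\<lambda>\<eta>. \<phi> (\<lambda>p. z p + \<eta> * (if p = q then 1 else 0))) 0"
proof -
  have "z(q := z q + \<eta>) = (\<lambda>p. z p + \<eta> * (if p = q then 1 else 0))" for \<eta>
    by (auto simp: fun_eq_iff)
  then show ?thesis unfolding pd_def by (subst deriv_shift_0) (simp add: o_def)
qed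

context dim
begin

definition hcurve :: "complex set \<Rightarrow> complex nvec set \<Rightarrow> (complex \<Rightarrow> complex nvec) \<Rightarrow> bool" where
  "hcurve S U \<gamma> \<longleftrightarrow> (\<forall>\<zeta>\<in>S. \<gamma> \<zeta> \<in> U) \<and> (\<forall>p<D. (\<lambda>\<zeta>. \<gamma> \<zeta> p) holomorphic_on S)"

text \<open>Holomorphy of a family \<open>\<phi> \<tau> z\<close> is tested along holomorphic curves. This notion is stable under
  composition without further ado; together with the bound \<open>M\<close> it implies Frechet
  differentiability.\<close>

definition hfun :: "complex set \<Rightarrow> complex nvec set \<Rightarrow> real \<Rightarrow> (complex \<Rightarrow> complex nvec \<Rightarrow> complex) \<Rightarrow> bool" where
  "hfun T U M \<phi> \<longleftrightarrow> (\<forall>\<tau>\<in>T. \<forall>z\<in>U. cmod (\<phi> \<tau> z) \<le> M) \<and>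
     (\<forall>S \<eta> \<gamma>. open S \<longrightarrow> \<eta> holomorphic_on S \<longrightarrow> \<eta> ` S \<subseteq> T \<longrightarrow> hcurve S U \<gamma> \<longrightarrow>
        (\<lambda>\<zeta>. \<phi> (\<eta> \<zeta>) (\<gamma> \<zeta>)) holomorphic_on S)"

text \<open>A single field is the constant family over \<open>{0}\<close>. Otherwise the parameter
  is the step size, when Taylor coefficients in it are wanted, or the position on a complex line of
  fields, when two fields are compared.\<close>

definition hfam :: "complex set \<Rightarrow> complex nvec set \<Rightarrow> real \<Rightarrow> (complex \<Rightarrow> complex nvec \<Rightarrow> complex nvec) \<Rightarrow> bool" where
  "hfam T U M g \<longleftrightarrow> (\<forall>\<tau>\<in>T. \<forall>z\<in>U. g \<tau> z \<in> nvecs D) \<and> (\<forall>p<D. hfun T U M (\<lambda>\<tau> z. g \<tau> z p))"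

lemma hfun_bound: "hfun T U M \<phi> \<Longrightarrow> \<tau> \<in> T \<Longrightarrow> z \<in> U \<Longrightarrow> cmod (\<phi> \<tau> z) \<le> M"
  by (auto simp: hfun_def)

lemma hfun_hol:
  "hfun T U M \<phi> \<Longrightarrow> open S \<Longrightarrow> \<eta> holomorphic_on S \<Longrightarrow> \<eta> ` S \<subseteq> T \<Longrightarrow> hcurve S U \<gamma> \<Longrightarrow>
   (\<lambda>\<zeta>. \<phi> (\<eta> \<zeta>) (\<gamma> \<zeta>)) holomorphic_on S"
  by (auto simp: hfun_def)

lemma hfunI:
  assumes "\<And>\<tau> z. \<tau> \<in> T \<Longrightarrow> z \<in> U \<Longrightarrow> cmod (\<phi> \<tau> z) \<le> M"
    and "\<And>S \<eta> \<gamma>. open S \<Longrightarrow> \<eta> holomorphic_on S \<Longrightarrow> \<eta> ` S \<subseteq> T \<Longrightarrow> hcurve S U \<gamma> \<Longrightarrow>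
        (\<lambda>\<zeta>. \<phi> (\<eta> \<zeta>) (\<gamma> \<zeta>)) holomorphic_on S"
  shows "hfun T U M \<phi>"
  using assms by (simp add: hfun_def)

lemma hcurve_mono: "hcurve S U \<gamma> \<Longrightarrow> S' \<subseteq> S \<Longrightarrow> U \<subseteq> U' \<Longrightarrow> hcurve S' U' \<gamma>"
  unfolding hcurve_def using holomorphic_on_subset by blast

lemma hcurve_const: "z \<in> U \<Longrightarrow> hcurve S U (\<lambda>_. z)"
  by (auto simp: hcurve_def)

lemma hfun_mono: "hfun T U M \<phi> \<Longrightarrow> T' \<subseteq> T \<Longrightarrow> U' \<subseteq> U \<Longrightarrow> M \<le> M' \<Longrightarrow> hfun T' U' M' \<phi>"
  unfolding hfun_def using hcurve_mono by (smt (verit) order_trans subset_iff order_refl)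

lemma hfam_mono: "hfam T U M g \<Longrightarrow> T' \<subseteq> T \<Longrightarrow> U' \<subseteq> U \<Longrightarrow> M \<le> M' \<Longrightarrow> hfam T' U' M' g"
  unfolding hfam_def using hfun_mono by (meson subsetD)

lemma hfun_fixed: "hfun T U M \<phi> \<Longrightarrow> \<tau> \<in> T \<Longrightarrow> hfun T' U M (\<lambda>_. \<phi> \<tau>)"
  by (rule hfunI) (auto intro: hfun_bound hfun_hol)

lemma hfam_fixed: "hfam T U M g \<Longrightarrow> \<tau> \<in> T \<Longrightarrow> hfam T' U M (\<lambda>_. g \<tau>)"
  unfolding hfam_def using hfun_fixed[where \<phi> = "\<lambda>\<tau> z. g \<tau> z p" for p] by blast

lemma hfun_reparam:
  assumes "hfun T U M \<phi>" and "\<eta> holomorphic_on S" and "\<eta> ` S \<subseteq> T"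
  shows "hfun S U M (\<lambda>\<zeta>. \<phi> (\<eta> \<zeta>))"
proof (rule hfunI)
  fix S' \<eta>' \<gamma> assume *: "open S'" "\<eta>' holomorphic_on S'" "\<eta>' ` S' \<subseteq> S" "hcurve S' U \<gamma>"
  then have "(\<lambda>\<zeta>. \<eta> (\<eta>' \<zeta>)) holomorphic_on S'"
    using holomorphic_on_compose_gen[OF *(2) assms(2)] by (simp add: o_def)
  then show "(\<lambda>\<zeta>. \<phi> (\<eta> (\<eta>' \<zeta>)) (\<gamma> \<zeta>)) holomorphic_on S'"
    using hfun_hol[OF assms(1) *(1) _ _ *(4), of "\<lambda>\<zeta>. \<eta> (\<eta>' \<zeta>)"] *(3) assms(3) by blast
qed (use assms in \<open>auto intro: hfun_bound\<close>)

lemma hfam_reparam: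
  "hfam T U M g \<Longrightarrow> \<eta> holomorphic_on S \<Longrightarrow> \<eta> ` S \<subseteq> T \<Longrightarrow> hfam S U M (\<lambda>\<zeta>. g (\<eta> \<zeta>))"
  unfolding hfam_def using hfun_reparam[where \<phi> = "\<lambda>\<tau> z. g \<tau> z p" for p] by blast

lemma hfun_add: "hfun T U M \<phi> \<Longrightarrow> hfun T U N \<psi> \<Longrightarrow> hfun T U (M + N) (\<lambda>\<tau> z. \<phi> \<tau> z + \<psi> \<tau> z)"
  unfolding hfun_def by (auto intro!: holomorphic_intros intro: norm_triangle_mono)

lemma hfun_diff: "hfun T U M \<phi> \<Longrightarrow> hfun T U N \<psi> \<Longrightarrow> hfun T U (M + N) (\<lambda>\<tau> z. \<phi> \<tau> z - \<psi> \<tau> z)"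
  by (rule hfunI; (intro holomorphic_intros)?)
    (auto intro: hfun_hol order_trans[OF norm_triangle_ineq4 add_mono[OF hfun_bound hfun_bound]])

lemma hfun_scale:
  assumes "hfun T U M \<phi>" and "c holomorphic_on T" and "\<And>\<tau>. \<tau> \<in> T \<Longrightarrow> cmod (c \<tau>) \<le> C"
  shows "hfun T U (C * M) (\<lambda>\<tau> z. c \<tau> * \<phi> \<tau> z)"
proof (rule hfunI)
  fix S \<eta> \<gamma> assume *: "open S" "\<eta> holomorphic_on S" "\<eta> ` S \<subseteq> T" "hcurve S U \<gamma>"
  have "(\<lambda>\<zeta>. c (\<eta> \<zeta>)) holomorphic_on S"
    using holomorphic_on_compose_gen[OF *(2) assms(2) *(3)] by (simp add: o_def)
  then show "(\<lambda>\<zeta>. c (\<eta> \<zeta>) * \<phi> (\<eta> \<zeta>) (\<gamma> \<zeta>)) holomorphic_on S"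
    using hfun_hol[OF assms(1) *] by (intro holomorphic_intros)
next
  fix \<tau> z assume "\<tau> \<in> T" "z \<in> U"
  then have "cmod (c \<tau>) \<le> C" and "cmod (\<phi> \<tau> z) \<le> M" and "0 \<le> C"
    using assms(3)[of \<tau>] hfun_bound[OF assms(1), of \<tau> z] order_trans[OF norm_ge_zero] by blast+
  then show "cmod (c \<tau> * \<phi> \<tau> z) \<le> C * M"
    unfolding norm_mult by (intro mult_mono) auto
qed

lemma hfun_sum:
  assumes "finite A" and "\<And>i. i \<in> A \<Longrightarrow> hfun T U (M i) (\<phi> i)"
  shows "hfun T U (\<Sum>i\<in>A. M i) (\<lambda>\<tau> z. \<Sum>i\<in>A. \<phi> i \<tau> z)"
  using assms
proof (induction A rule: finite_induct)
  case empty
  then show ?case by (auto simp: hfun_def)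
next
  case (insert x F)
  then show ?case using hfun_add[of T U "M x" "\<phi> x"] by simp
qed

subsection \<open>Partial derivatives\<close>

text \<open>Discs on complex lines are where the Cauchy estimates in several variables are made;
  only one variable is involved, so the resulting constants do not contain \<open>D\<close>.\<close>

lemma line_hcurve:
  assumes "z \<in> nball D c \<rho>" and "u \<in> nvecs D" and "\<And>p. p < D \<Longrightarrow> cmod (u p) \<le> W" and "r * W \<le> \<delta>"
  shows "hcurve (ball 0 r) (nball D c (\<rho> + \<delta>)) (\<lambda>\<eta> p. z p + \<eta> * u p)"
  unfolding hcurve_def
proof (intro conjI ballI allI impI)
  fix \<eta> :: complex assume \<eta>: "\<eta> \<in> ball 0 r"
  show "(\<lambda>p. z p + \<eta> * u p) \<in> nball D c (\<rho> + \<delta>)"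
  proof (rule nball_shift[OF assms(1)])
    show "(\<lambda>p. z p + \<eta> * u p) \<in> nvecs D" using assms nball_nvecs[OF assms(1)] by (auto simp: nvecs_def)
    fix p assume p: "p < D"
    have "cmod (\<eta> * u p) \<le> r * W" unfolding norm_mult using \<eta> assms(3)[OF p] by (intro mult_mono) (auto intro: less_imp_le order_trans[OF norm_ge_zero])
    then show "cmod (z p + \<eta> * u p - z p) \<le> \<delta>" using assms(4) by simp
  qed simp
qed (auto intro!: holomorphic_intros)

definition dird :: "(complex nvec \<Rightarrow> complex) \<Rightarrow> complex nvec \<Rightarrow> complex nvec \<Rightarrow> complex" where
  "dird \<phi> z u = deriv (\<lambda>\<eta>. \<phi> (\<lambda>p. z p + \<eta> * u p)) 0"

lemma quadratic_deriv_zero: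
  assumes "0 < r" and "\<And>\<eta>. cmod \<eta> < r \<Longrightarrow> cmod (R \<eta>) \<le> C * (cmod \<eta>)\<^sup>2"
  shows "(R has_field_derivative 0) (at 0)"
proof -
  have R0: "R 0 = 0" using assms(2)[of 0] \<open>0 < r\<close> by simp
  have "((\<lambda>\<eta>. R \<eta> / \<eta>) \<longlongrightarrow> 0) (at 0)"
  proof (rule Lim_null_comparison)
    show "\<forall>\<^sub>F \<eta> in at 0. norm (R \<eta> / \<eta>) \<le> C * cmod \<eta>"
      unfolding eventually_at
    proof (intro exI[of _ r] conjI ballI impI)
      fix \<eta> :: complex assume *: "\<eta> \<noteq> 0 \<and> dist \<eta> 0 < r"
      then show "norm (R \<eta> / \<eta>) \<le> C * cmod \<eta>"
        using assms(2)[of \<eta>] by (simp add: norm_divide field_simps power2_eq_square)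
    qed (use \<open>0 < r\<close> in auto)
    show "((\<lambda>\<eta>. C * cmod \<eta>) \<longlongrightarrow> 0) (at 0)"
      by (intro tendsto_eq_intros) auto
  qed
  then show ?thesis using R0 by (simp add: has_field_derivative_iff)
qed

lemma holomorphic_line:
  assumes "hfun T (nball D c \<rho>) M (\<lambda>_. \<phi>)" and "T \<noteq> {}" and "z \<in> nball D c \<rho>" and "u \<in> nvecs D"
  obtains r where "0 < r" and "(\<lambda>\<eta>. \<phi> (\<lambda>p. z p + \<eta> * u p)) holomorphic_on ball 0 r"
proof -
  obtain \<delta> where \<delta>: "0 < \<delta>" "z \<in> nball D c (\<rho> - \<delta>)" using nball_margin[OF assms(3)] by metis
  define W where "W = supnorm D u + 1"
  have W: "0 < W" "\<And>p. p < D \<Longrightarrow> cmod (u p) \<le> W"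
    using supnorm_nonneg[of u] norm_le_supnorm[of _ u] by (auto simp: W_def add.commute intro: order_trans add_increasing)
  have "hcurve (ball 0 (\<delta> / W)) (nball D c (\<rho> - \<delta> + \<delta>)) (\<lambda>\<eta> p. z p + \<eta> * u p)"
    by (rule line_hcurve[OF \<delta>(2) assms(4) W(2)]) (use W in auto)
  moreover obtain \<tau> where "\<tau> \<in> T" using assms(2) by auto
  ultimately have "(\<lambda>\<eta>. \<phi> (\<lambda>p. z p + \<eta> * u p)) holomorphic_on ball 0 (\<delta> / W)"
    using hfun_hol[OF assms(1), of "ball 0 (\<delta> / W)" "\<lambda>_. \<tau>" "\<lambda>\<eta> p. z p + \<eta> * u p"] by (auto simp: add.commute)
  then show ?thesis using \<delta> W by (intro that[of "\<delta> / W"]) auto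
qed

lemma dird_has_derivative:
  assumes "hfun T (nball D c \<rho>) M (\<lambda>_. \<phi>)" and "T \<noteq> {}" and "z \<in> nball D c \<rho>" and "u \<in> nvecs D"
  shows "((\<lambda>\<eta>. \<phi> (\<lambda>p. z p + \<eta> * u p)) has_field_derivative dird \<phi> z u) (at 0)"
proof -
  obtain r where "0 < r" "(\<lambda>\<eta>. \<phi> (\<lambda>p. z p + \<eta> * u p)) holomorphic_on ball 0 r"
    using holomorphic_line[OF assms] .
  then show ?thesis unfolding dird_def by (intro holomorphic_derivI[of _ "ball 0 r"]) auto
qed

lemma dird_scale:
  assumes "hfun T (nball D c \<rho>) M (\<lambda>_. \<phi>)" and "T \<noteq> {}" and "z \<in> nball D c \<rho>" and "u \<in> nvecs D"
  shows "dird \<phi> z (\<lambda>p. k * u p) = k * dird \<phi> z u"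
proof -
  have "((\<lambda>\<eta>. \<phi> (\<lambda>p. z p + (k * \<eta>) * u p)) has_field_derivative dird \<phi> z u * k) (at 0)"
    by (rule DERIV_chain2[where f = "\<lambda>\<eta>. \<phi> (\<lambda>p. z p + \<eta> * u p)" and g = "\<lambda>\<eta>. k * \<eta>"])
      (use dird_has_derivative[OF assms] in \<open>auto intro!: derivative_eq_intros\<close>)
  then show ?thesis unfolding dird_def[of \<phi> z "\<lambda>p. k * u p"]
    by (intro DERIV_imp_deriv) (simp add: mult_ac)
qed

text \<open>Differentiating \<open>Q \<eta> \<zeta> = \<phi> (z + \<eta> u + \<zeta> v)\<close> along the diagonal: the \<open>\<zeta>\<close>-derivative
  at \<open>\<zeta> = 0\<close> depends continuously on \<open>\<eta>\<close>.\<close>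

lemma dird_add:
  assumes hf: "hfun T (nball D c \<rho>) M (\<lambda>_. \<phi>)" and T: "T \<noteq> {}" and z: "z \<in> nball D c \<rho>"
    and u: "u \<in> nvecs D" and v: "v \<in> nvecs D"
  shows "dird \<phi> z (\<lambda>p. u p + v p) = dird \<phi> z u + dird \<phi> z v"
proof -
  obtain \<tau> where \<tau>: "\<tau> \<in> T" using T by auto
  obtain \<delta> where \<delta>: "0 < \<delta>" "z \<in> nball D c (\<rho> - \<delta>)" using nball_margin[OF z] by metis
  define W where "W = supnorm D u + supnorm D v + 1"
  have W: "0 < W" "\<And>p. p < D \<Longrightarrow> cmod (u p) \<le> W" "\<And>p. p < D \<Longrightarrow> cmod (v p) \<le> W"
    using supnorm_nonneg[of u] supnorm_nonneg[of v] norm_le_supnorm[of _ u] norm_le_supnorm[of _ v]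
    by (auto simp: W_def add_increasing add_increasing2 add_pos_nonneg)+
  define r where "r = \<delta> / (2 * W)"
  have r: "0 < r" "r * W \<le> \<delta>/2" using \<delta> W by (auto simp: r_def)
  define Q where "Q \<eta> \<zeta> = \<phi> (\<lambda>p. z p + \<eta> * u p + \<zeta> * v p)" for \<eta> \<zeta>
  have mid: "(\<lambda>p. z p + \<eta> * w p) \<in> nball D c (\<rho> - \<delta>/2)"
    if "\<eta> \<in> ball 0 r" "w \<in> nvecs D" "\<And>p. p < D \<Longrightarrow> cmod (w p) \<le> W" for w \<eta>
    using line_hcurve[OF \<delta>(2) that(2,3) r(2)] that(1) by (simp add: hcurve_def)
  have c2: "hcurve (ball 0 r) (nball D c \<rho>) (\<lambda>\<zeta> p. z p + \<eta> * w p + \<zeta> * w' p)"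
    if "\<eta> \<in> ball 0 r" "w \<in> nvecs D" "\<And>p. p < D \<Longrightarrow> cmod (w p) \<le> W" "w' \<in> nvecs D" "\<And>p. p < D \<Longrightarrow> cmod (w' p) \<le> W" for \<eta> w w'
    using line_hcurve[OF mid[OF that(1-3)] that(4,5) r(2)] by simp
  have Q1: "(\<lambda>\<zeta>. Q \<eta> \<zeta>) holomorphic_on ball 0 r" if "\<eta> \<in> ball 0 r" for \<eta>
    unfolding Q_def using hfun_hol[OF hf _ _ _ c2[OF that u W(2) v W(3)], of "\<lambda>_. \<tau>"] \<tau> by auto
  have Q2: "(\<lambda>\<eta>. Q \<eta> \<zeta>) holomorphic_on ball 0 r" if "\<zeta> \<in> ball 0 r" for \<zeta>
    unfolding Q_def using hfun_hol[OF hf _ _ _ c2[OF that v W(3) u W(2)], of "\<lambda>_. \<tau>"] \<tau>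
    by (auto simp: add_ac)
  have QM: "cmod (Q \<eta> \<zeta>) \<le> M" if "\<eta> \<in> ball 0 r" "\<zeta> \<in> ball 0 r" for \<eta> \<zeta>
    unfolding Q_def using c2[OF that(1) u W(2) v W(3)] that(2) hfun_bound[OF hf \<tau>] by (auto simp: hcurve_def)
  define k where "k \<eta> = deriv (\<lambda>\<zeta>. Q \<eta> \<zeta>) 0" for \<eta>
  have "k holomorphic_on ball 0 r"
    unfolding k_def using holomorphic_param_deriv[of "ball 0 r" r "\<lambda>\<zeta> \<eta>. Q \<eta> \<zeta>" M] Q1 Q2 QM r by auto
  then have "isCont k 0"
    using r holomorphic_on_imp_continuous_on continuous_on_eq_continuous_at[of "ball 0 r" k] by auto
  then have d2: "((\<lambda>\<eta>. \<eta> * k \<eta>) has_field_derivative k 0) (at 0)"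
    by (simp add: has_field_derivative_iff isCont_def tendsto_cong[OF eventually_at_filter[THEN iffD2]])
      (subst tendsto_cong[where g = k], auto simp: eventually_at_filter)
  have d3: "((\<lambda>\<eta>. Q \<eta> \<eta> - Q \<eta> 0 - \<eta> * k \<eta>) has_field_derivative 0) (at 0)"
  proof (rule quadratic_deriv_zero[of "r/2" _ "8 * M / r\<^sup>2"])
    fix \<eta> :: complex assume \<eta>: "cmod \<eta> < r/2"
    have "cmod (Q \<eta> \<eta> - Q \<eta> 0 - \<eta> * deriv (Q \<eta>) 0) \<le> 8 * M * (cmod \<eta>)\<^sup>2 / r\<^sup>2"
      by (rule Taylor_bound_1) (use r \<eta> Q1 QM in auto)
    then show "cmod (Q \<eta> \<eta> - Q \<eta> 0 - \<eta> * k \<eta>) \<le> 8 * M / r\<^sup>2 * (cmod \<eta>)\<^sup>2" by (simp add: k_def)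
  qed (use r in auto)
  have d1: "((\<lambda>\<eta>. Q \<eta> 0) has_field_derivative dird \<phi> z u) (at 0)"
    unfolding Q_def using dird_has_derivative[OF hf T z u] by simp
  have "((\<lambda>\<eta>. Q \<eta> 0 + \<eta> * k \<eta> + (Q \<eta> \<eta> - Q \<eta> 0 - \<eta> * k \<eta>)) has_field_derivative dird \<phi> z u + k 0 + 0) (at 0)"
    by (intro DERIV_add d1 d2 d3)
  then have "deriv (\<lambda>\<eta>. Q \<eta> \<eta>) 0 = dird \<phi> z u + k 0" by (intro DERIV_imp_deriv) (simp add: algebra_simps)
  moreover have "k 0 = dird \<phi> z v" by (simp add: k_def Q_def dird_def)
  ultimately show ?thesis unfolding dird_def[of _ _ "\<lambda>p. u p + v p"] Q_def by (simp add: algebra_simps)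
qed

text \<open>The coordinates of \<open>u\<close> are switched on one after the other; each
  contributes a multiple of a unit vector, to which additivity and homogeneity of
  \<open>dird\<close> apply.\<close>

lemma dird_eq_pd:
  assumes "hfun T (nball D c \<rho>) M (\<lambda>_. \<phi>)" and "T \<noteq> {}" and "z \<in> nball D c \<rho>" and "u \<in> nvecs D"
  shows "dird \<phi> z u = (\<Sum>q<D. pd \<phi> z q * u q)"
proof -
  have "dird \<phi> z (\<lambda>p. if p < k then u p else 0) = (\<Sum>q<k. pd \<phi> z q * u q)" if "k \<le> D" for k
    using that
  proof (induction k)
    case 0
    then show ?case by (simp add: dird_def)
  next
    case (Suc k)
    define e :: "complex nvec" where "e = (\<lambda>p. if p = k then 1 else 0)"
    have e: "e \<in> nvecs D" using Suc by (auto simp: e_def nvecs_def)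
    have s: "(\<lambda>p. if p < Suc k then u p else 0) = (\<lambda>p. (if p < k then u p else 0) + u k * e p)"
      by (auto simp: fun_eq_iff e_def less_Suc_eq)
    have "dird \<phi> z e = pd \<phi> z k" by (simp add: dird_def pd_shift e_def)
    then show ?case
      using Suc dird_add[OF assms(1-3), of "\<lambda>p. if p < k then u p else 0" "\<lambda>p. u k * e p"] dird_scale[OF assms(1-3) e, of "u k"] e
      unfolding s by (auto simp: nvecs_def mult.commute)
  qed
  moreover have "(\<lambda>p. if p < D then u p else 0) = u" using assms(4) by (auto simp: fun_eq_iff nvecs_def)
  ultimately show ?thesis by (metis order_refl)
qed

lemma dird_bound:
  assumes hf: "hfun T (nball D c (\<rho> + \<delta>)) M (\<lambda>_. \<phi>)" and T: "T \<noteq> {}" and z: "z \<in> nball D c \<rho>" and u: "u \<in> nvecs D"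
    and W: "\<And>p. p < D \<Longrightarrow> cmod (u p) \<le> W" and "0 < W" and "0 < \<delta>"
  shows "cmod (dird \<phi> z u) \<le> M / \<delta> * W"
proof -
  obtain \<tau> where \<tau>: "\<tau> \<in> T" using T by auto
  have c: "hcurve (ball 0 (\<delta> / W)) (nball D c (\<rho> + \<delta>)) (\<lambda>\<eta> p. z p + \<eta> * u p)"
    by (rule line_hcurve[OF z u W]) (use \<open>0 < W\<close> in auto)
  have "cmod (dird \<phi> z u) \<le> M / (\<delta> / W)"
    unfolding dird_def
  proof (rule Cauchy_bound_deriv)
    show "(\<lambda>\<eta>. \<phi> (\<lambda>p. z p + \<eta> * u p)) holomorphic_on ball 0 (\<delta> / W)"
      using hfun_hol[OF hf _ _ _ c, of "\<lambda>_. \<tau>"] \<tau> by auto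
    show "cmod (\<phi> (\<lambda>p. z p + \<eta> * u p)) \<le> M" if "\<eta> \<in> ball 0 (\<delta> / W)" for \<eta>
      using c that hfun_bound[OF hf \<tau>] by (auto simp: hcurve_def)
  qed (use assms in auto)
  then show ?thesis by (simp add: field_simps)
qed

text \<open>The sum is a directional derivative, bounded by one Cauchy estimate on a disc in
  direction \<open>u\<close>. Estimating the partial derivatives one at a time would cost a factor
  \<open>D\<close>.\<close>

lemma pd_sum_bound:
  assumes hf: "hfun T (nball D c (\<rho> + \<delta>)) M (\<lambda>_. \<phi>)" and T: "T \<noteq> {}" and z: "z \<in> nball D c \<rho>" and u: "u \<in> nvecs D"
    and W: "\<And>p. p < D \<Longrightarrow> cmod (u p) \<le> W" and "0 \<le> W" and "0 < \<delta>"
  shows "cmod (\<Sum>q<D. pd \<phi> z q * u q) \<le> M / \<delta> * W"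
proof (cases "W = 0")
  case True
  then show ?thesis using W by simp
next
  case False
  then have "cmod (dird \<phi> z u) \<le> M / \<delta> * W" using assms by (intro dird_bound[OF hf T z u W]) auto
  then show ?thesis using dird_eq_pd[OF hf T nball_mono[OF _ z] u] \<open>0 < \<delta>\<close> by simp
qed

text \<open>The partial derivative is the parameter derivative at 0 on a disc of radius
  \<open>\<delta>\<close> in direction \<open>q\<close>. These discs fit into the larger ball along
  every curve in the smaller one, so holomorphy in the base point and the bound follow
  together.\<close>

lemma hfun_pd:
  assumes hf: "hfun T (nball D c (\<rho> + \<delta>)) M \<phi>" and "0 < \<delta>" and q: "q < D"
  shows "hfun T (nball D c \<rho>) (M / \<delta>) (\<lambda>\<tau> z. pd (\<phi> \<tau>) z q)"
proof (rule hfunI)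
  define e :: "complex nvec" where "e = (\<lambda>p. if p = q then 1 else 0)"
  have e: "e \<in> nvecs D" "\<And>p. p < D \<Longrightarrow> cmod (e p) \<le> 1" using q by (auto simp: e_def nvecs_def)
  have pd: "pd \<phi> z q = dird \<phi> z e" for \<phi> z by (simp add: dird_def pd_shift e_def)
  { fix \<tau> z assume \<tau>: "\<tau> \<in> T" and z: "z \<in> nball D c \<rho>"
    have "cmod (dird (\<phi> \<tau>) z e) \<le> M / \<delta> * 1"
      by (rule dird_bound[OF hfun_fixed[OF hf \<tau>, of "{0}"] _ z e]) (use \<open>0 < \<delta>\<close> in auto)
    then show "cmod (pd (\<phi> \<tau>) z q) \<le> M / \<delta>" by (simp add: pd) }
  fix S \<eta> \<gamma> assume *: "open S" "\<eta> holomorphic_on S" "\<eta> ` S \<subseteq> T" "hcurve S (nball D c \<rho>) \<gamma>"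
  have l: "hcurve (ball 0 \<delta>) (nball D c (\<rho> + \<delta>)) (\<lambda>\<xi> p. \<gamma> \<zeta> p + \<xi> * e p)" if "\<zeta> \<in> S" for \<zeta>
    by (rule line_hcurve[OF _ e]) (use * that in \<open>auto simp: hcurve_def\<close>)
  have "(\<lambda>\<zeta>. deriv (\<lambda>\<xi>. \<phi> (\<eta> \<zeta>) (\<lambda>p. \<gamma> \<zeta> p + \<xi> * e p)) 0) holomorphic_on S"
  proof (rule holomorphic_param_deriv[OF *(1) \<open>0 < \<delta>\<close>, where M = M])
    fix \<zeta> assume \<zeta>: "\<zeta> \<in> S"
    then have t: "\<eta> \<zeta> \<in> T" using * by auto
    show "(\<lambda>\<xi>. \<phi> (\<eta> \<zeta>) (\<lambda>p. \<gamma> \<zeta> p + \<xi> * e p)) holomorphic_on ball 0 \<delta>"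
      using hfun_hol[OF hf _ _ _ l[OF \<zeta>], of "\<lambda>_. \<eta> \<zeta>"] t by auto
  next
    fix \<xi> \<zeta> assume \<xi>: "\<xi> \<in> ball (0::complex) \<delta>" and \<zeta>: "\<zeta> \<in> S"
    show "cmod (\<phi> (\<eta> \<zeta>) (\<lambda>p. \<gamma> \<zeta> p + \<xi> * e p)) \<le> M"
      using l[OF \<zeta>] \<xi> \<zeta> * by (intro hfun_bound[OF hf]) (auto simp: hcurve_def)
  next
    fix \<xi> assume \<xi>: "\<xi> \<in> ball (0::complex) \<delta>"
    show "(\<lambda>\<zeta>. \<phi> (\<eta> \<zeta>) (\<lambda>p. \<gamma> \<zeta> p + \<xi> * e p)) holomorphic_on S"
      by (rule hfun_hol[OF hf *(1-3)]) (use l \<xi> * in \<open>auto simp: hcurve_def intro!: holomorphic_intros\<close>)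
  qed
  then show "(\<lambda>\<zeta>. pd (\<phi> (\<eta> \<zeta>)) (\<gamma> \<zeta>) q) holomorphic_on S" by (simp add: pd dird_def)
qed

text \<open>The ball is convex, so the segment from \<open>w\<close> to \<open>z\<close> lies in it,
  and the complex neighbourhood \<open>V\<close> of the parameter interval, of width
  \<open>\<delta> / W\<close>, is still mapped into the ball enlarged by \<open>\<delta>\<close>.
  There the one-variable Lipschitz estimate applies.\<close>

lemma hfun_Lipschitz:
  assumes hf: "hfun T (nball D c (\<rho> + \<delta>)) M (\<lambda>_. \<phi>)" and T: "T \<noteq> {}" and z: "z \<in> nball D c \<rho>" and w: "w \<in> nball D c \<rho>"
    and W: "\<And>p. p < D \<Longrightarrow> cmod (z p - w p) \<le> W" and "0 \<le> W" and "0 < \<delta>"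
  shows "cmod (\<phi> z - \<phi> w) \<le> M / \<delta> * W"
proof (cases "W = 0")
  case True
  then have "z = w" using W nball_nvecs[OF z] nball_nvecs[OF w] by (auto simp: fun_eq_iff nvecs_def) (metis not_le)
  then show ?thesis using True by simp
next
  case False
  with \<open>0 \<le> W\<close> have W0: "0 < W" by simp
  obtain \<tau> where \<tau>: "\<tau> \<in> T" using T by auto
  define u where "u p = z p - w p" for p
  have u: "u \<in> nvecs D" using nball_nvecs[OF z] nball_nvecs[OF w] by (auto simp: u_def nvecs_def)
  define S where "S = closed_segment (0::complex) 1"
  define V where "V = (\<Union>x\<in>S. ball x (\<delta> / W))"
  have seg: "(\<lambda>p. w p + x * u p) \<in> nball D c \<rho>" if xS: "x \<in> S" for x
  proof -
    obtain t where t: "0 \<le> t" "t \<le> 1" and "x = (1 - t) *\<^sub>R 0 + t *\<^sub>R 1"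
      using xS unfolding S_def in_segment by blast
    then have tx: "x = of_real t" by (simp add: scaleR_conv_of_real)
    show ?thesis unfolding in_nball_iff
    proof (intro conjI allI impI)
      show "(\<lambda>p. w p + x * u p) \<in> nvecs D" using u nball_nvecs[OF w] by (auto simp: nvecs_def)
      fix p assume p: "p < D"
      have eq: "w p + x * u p - c p = (1 - of_real t) * (w p - c p) + of_real t * (z p - c p)"
        by (simp add: tx u_def algebra_simps)
      have n1: "cmod (1 - of_real t) = 1 - t"
        using t by (metis abs_of_nonneg diff_ge_0_iff_ge norm_of_real of_real_1 of_real_diff)
      then have "cmod ((1 - of_real t) * (w p - c p) + of_real t * (z p - c p)) \<le> (1 - t) * cmod (w p - c p) + t * cmod (z p - c p)"
        using t by (intro order_trans[OF norm_triangle_ineq]) (simp add: norm_mult n1)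
      also have "\<dots> < \<rho>"
        using z w p t by (intro convex_bound_lt) (auto simp: in_nball_iff)
      finally show "cmod (w p + x * u p - c p) < \<rho>" unfolding eq .
    qed
  qed
  have cv: "hcurve V (nball D c (\<rho> + \<delta>)) (\<lambda>x p. w p + x * u p)"
    unfolding hcurve_def
  proof (intro conjI ballI allI impI)
    fix y assume "y \<in> V"
    then obtain x where x: "x \<in> S" "dist x y < \<delta> / W" by (auto simp: V_def)
    have "(\<lambda>p. (w p + x * u p) + (y - x) * u p) \<in> nball D c (\<rho> + \<delta>)"
      using line_hcurve[OF seg[OF x(1)] u, of W "\<delta> / W" \<delta>] W W0 x(2)
      by (auto simp: hcurve_def u_def dist_norm norm_minus_commute)
    then show "(\<lambda>p. w p + y * u p) \<in> nball D c (\<rho> + \<delta>)" by (simp add: algebra_simps)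
  qed (auto intro!: holomorphic_intros)
  have V: "open V" by (auto simp: V_def)
  have "cmod (\<phi> (\<lambda>p. w p + 1 * u p) - \<phi> (\<lambda>p. w p + 0 * u p)) \<le> M / (\<delta> / W) * cmod (1 - 0)"
  proof (rule holomorphic_Lipschitz[where T = V and S = S])
    show "(\<lambda>x. \<phi> (\<lambda>p. w p + x * u p)) holomorphic_on V"
      using hfun_hol[OF hf V _ _ cv, of "\<lambda>_. \<tau>"] \<tau> by auto
    show "cmod (\<phi> (\<lambda>p. w p + x * u p)) \<le> M" if "x \<in> V" for x
      using cv that hfun_bound[OF hf \<tau>] by (auto simp: hcurve_def)
  qed (use W0 \<open>0 < \<delta>\<close> V in \<open>auto simp: S_def V_def\<close>)
  then show ?thesis by (simp add: u_def)
qed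

end

section \<open>The unrolled step as a holomorphic map\<close>

context dim
begin

text \<open>Components beyond \<open>D\<close> vanish; giving them the bound 0 allows the stage
  computations to treat all component indices alike.\<close>

lemma hfam_component:
  assumes "hfam T U M g" and "0 \<le> M"
  shows "hfun T U (if p < D then M else 0) (\<lambda>\<tau> z. g \<tau> z p)"
proof (cases "p < D")
  case True
  then show ?thesis using assms by (auto simp: hfam_def)
next
  case False
  then have z: "g \<tau> z p = 0" if "\<tau> \<in> T" "z \<in> U" for \<tau> z
    using assms that nvecsD by (auto simp: hfam_def)
  show ?thesis
  proof (rule hfunI)
    fix S \<eta> \<gamma> assume *: "open S" "\<eta> holomorphic_on S" "\<eta> ` S \<subseteq> T" "hcurve S U \<gamma>"
    then have "g (\<eta> \<zeta>) (\<gamma> \<zeta>) p = 0" if "\<zeta> \<in> S" for \<zeta> using z that by (auto simp: hcurve_def)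
    then show "(\<lambda>\<zeta>. g (\<eta> \<zeta>) (\<gamma> \<zeta>) p) holomorphic_on S"
      using holomorphic_transform[of "\<lambda>_. 0" S] by auto
  qed (use z False in auto)
qed

lemma hfam_bound: "hfam T U M g \<Longrightarrow> \<tau> \<in> T \<Longrightarrow> z \<in> U \<Longrightarrow> p < D \<Longrightarrow> cmod (g \<tau> z p) \<le> M"
  unfolding hfam_def using hfun_bound[of T U M "\<lambda>\<tau> z. g \<tau> z p"] by auto

lemma hfam_nvecs: "hfam T U M g \<Longrightarrow> \<tau> \<in> T \<Longrightarrow> z \<in> U \<Longrightarrow> g \<tau> z \<in> nvecs D"
  by (auto simp: hfam_def)

end

text \<open>\<open>\<kappa>\<close> dominates the row sums of \<open>a\<close> as well as the
  weights \<open>b\<close>; through this one number the scheme enters all estimates, which are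
  uniform in \<open>L\<close>.\<close>

locale rk = dim +
  fixes sv :: implicit_solver and I :: nat and a :: "nat \<Rightarrow> nat \<Rightarrow> real" and b :: "nat \<Rightarrow> real"
    and L :: nat and \<kappa> :: real
  assumes kappa1: "1 \<le> \<kappa>"
    and kappa_a: "\<And>i. i < I \<Longrightarrow> (\<Sum>j<I. \<bar>a i j\<bar>) \<le> \<kappa>"
    and kappa_b: "(\<Sum>i<I. \<bar>b i\<bar>) \<le> \<kappa>"
    and consistent: "(\<Sum>i<I. b i) = 1"
begin

definition stage :: "complex \<Rightarrow> (complex nvec \<Rightarrow> complex nvec) \<Rightarrow> complex nvec \<Rightarrow> nat \<Rightarrow> nat \<Rightarrow> complex nvec" where
  "stage h g z l = rk_stages of_real sv I a D h g (jacobian g) z l"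

text \<open>The displacement of the step divided by \<open>h\<close>, written without a division so
  that it keeps its meaning at \<open>h = 0\<close>.\<close>

definition inc :: "complex \<Rightarrow> (complex nvec \<Rightarrow> complex nvec) \<Rightarrow> complex nvec \<Rightarrow> complex nvec" where
  "inc h g z p = (\<Sum>i<I. of_real (b i) * g (stage h g z L i) p)"

definition step :: "complex \<Rightarrow> (complex nvec \<Rightarrow> complex nvec) \<Rightarrow> complex nvec \<Rightarrow> complex nvec" where
  "step h g z p = z p + h * inc h g z p"

lemma unrolled_eq_step: "unrolled sv I a b L D h g = step (of_real h) g"
  by (simp add: unrolled_def rk_unrolled_def step_def inc_def stage_def fun_eq_iff)

text \<open>The affine map whose fixed point in \<open>w\<close> is the next Newton iterate;
  \<open>v\<close> holds the previous one.\<close>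

definition nmap :: "complex \<Rightarrow> (complex nvec \<Rightarrow> complex nvec) \<Rightarrow> complex nvec \<Rightarrow> (nat \<Rightarrow> complex nvec) \<Rightarrow>
    (nat \<Rightarrow> complex nvec) \<Rightarrow> nat \<Rightarrow> complex nvec" where
  "nmap h g z v w = (\<lambda>i p. z p + h * (\<Sum>j<I. of_real (a i j) *
      (g (v j) p + (\<Sum>q<D. jacobian g (v j) p q * (w j q - v j q)))))"

lemma stage_0: "stage h g z 0 i = z"
  by (simp add: stage_def)

lemma stage_FP: "sv = Fixed_Point \<Longrightarrow>
    stage h g z (Suc l) i p = z p + h * (\<Sum>j<I. of_real (a i j) * g (stage h g z l j) p)"
  unfolding stage_def by simp

lemma stage_NR: "sv = Newton_Raphson \<Longrightarrow> stage h g z (Suc l) = (THE w. w = nmap h g z (stage h g z l) w)"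
  unfolding stage_def nmap_def by (simp add: Let_def)

lemma weighted_bound:
  assumes "\<And>j. j < I \<Longrightarrow> cmod (x j) \<le> B" and "0 \<le> B" and "(\<Sum>j<I. \<bar>\<alpha> j\<bar>) \<le> \<kappa>"
  shows "cmod (\<Sum>j<I. of_real (\<alpha> j) * x j) \<le> \<kappa> * B"
proof -
  have "cmod (\<Sum>j<I. of_real (\<alpha> j) * x j) \<le> (\<Sum>j<I. \<bar>\<alpha> j\<bar> * B)"
    by (rule sum_norm_le) (use assms in \<open>auto simp: norm_mult intro!: mult_left_mono\<close>)
  also have "\<dots> = (\<Sum>j<I. \<bar>\<alpha> j\<bar>) * B" by (simp add: sum_distrib_right)
  also have "\<dots> \<le> \<kappa> * B" using assms by (intro mult_right_mono) auto
  finally show ?thesis .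
qed

lemma scaled_weighted_bound:
  assumes "\<And>j. j < I \<Longrightarrow> cmod (x j) \<le> B" and "0 \<le> B" and "(\<Sum>j<I. \<bar>\<alpha> j\<bar>) \<le> \<kappa>"
  shows "cmod (h * (\<Sum>j<I. of_real (\<alpha> j) * x j)) \<le> \<kappa> * cmod h * B"
proof -
  have "cmod (\<Sum>j<I. of_real (\<alpha> j) * x j) \<le> \<kappa> * B" by (rule weighted_bound[OF assms])
  then have "cmod h * cmod (\<Sum>j<I. of_real (\<alpha> j) * x j) \<le> cmod h * (\<kappa> * B)" by (rule mult_left_mono) simp
  then show ?thesis unfolding norm_mult by (simp add: mult_ac)
qed

end

text \<open>One Newton step as a fixed-point problem. By \<open>small\<close> the previous stages
  \<open>v\<close> are within \<open>\<delta> / 8\<close> of \<open>z\<close>, hence in a ball where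
  the Jacobian has norm at most \<open>M / \<delta>\<close>, and the factor 16 makes
  \<open>nmap\<close> contract by 1/16.\<close>

locale newton = rk +
  fixes c :: "complex nvec" and \<rho> \<delta> M :: real and h :: complex and g :: "complex nvec \<Rightarrow> complex nvec"
    and z :: "complex nvec" and v :: "nat \<Rightarrow> complex nvec"
  assumes delta: "0 < \<delta>" and M0: "0 \<le> M" and small: "16 * \<kappa> * cmod h * M \<le> \<delta>"
    and g: "hfam {0} (nball D c (\<rho> + 2 * \<delta>)) M (\<lambda>_. g)"
    and z: "z \<in> nball D c \<rho>"
    and v: "\<And>i. i < I \<Longrightarrow> v i \<in> nvecs D"
    and vz: "\<And>i p. i < I \<Longrightarrow> p < D \<Longrightarrow> cmod (v i p - z p) \<le> 2 * (\<kappa> * cmod h * M)"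
begin

definition e where "e = \<kappa> * cmod h * M"

lemma e: "0 \<le> e" "16 * e \<le> \<delta>"
  using kappa1 M0 small by (auto simp: e_def mult_ac)

lemma vball: "i < I \<Longrightarrow> v i \<in> nball D c (\<rho> + \<delta>)"
  by (rule nball_shift[OF z v vz]) (use e in \<open>auto simp: e_def[symmetric]\<close>)

lemma gp: "hfun {0} (nball D c (\<rho> + 2 * \<delta>)) (if p < D then M else 0) (\<lambda>_ z. g z p)"
  using hfam_component[OF g M0] .

lemma gv_bound: "j < I \<Longrightarrow> cmod (g (v j) p) \<le> M"
  using hfun_bound[OF gp[of p], of 0 "v j"] nball_mono[OF _ vball, of "\<rho> + 2 * \<delta>"] delta M0
  by (auto split: if_splits)

lemma jac_bound:
  assumes "j < I" "u \<in> nvecs D" "\<And>q. q < D \<Longrightarrow> cmod (u q) \<le> W" "0 \<le> W"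
  shows "cmod (\<Sum>q<D. jacobian g (v j) p q * u q) \<le> (if p < D then M / \<delta> * W else 0)"
proof -
  have "cmod (\<Sum>q<D. pd (\<lambda>z. g z p) (v j) q * u q) \<le> (if p < D then M else 0) / \<delta> * W"
    using gp[of p] assms delta
    by (intro pd_sum_bound[where T = "{0}" and c = c and \<rho> = "\<rho> + \<delta>"] vball) (simp_all add: add.assoc)
  then show ?thesis by (simp add: jacobian_eq_pd split: if_splits)
qed

text \<open>Displacements up to \<open>2 * e\<close> reproduce themselves: the field values are at
  most \<open>M\<close>, and the Jacobian term is at most \<open>M / \<delta> * (4 * e)\<close>,
  which is again at most \<open>M\<close>.\<close>

lemma nmap_near:
  assumes w: "\<And>j. j < I \<Longrightarrow> w j \<in> nvecs D" "\<And>j p. j < I \<Longrightarrow> p < D \<Longrightarrow> cmod (w j p - z p) \<le> 2 * e" and i: "i < I"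
  shows "nmap h g z v w i \<in> nvecs D" and "cmod (nmap h g z v w i p - z p) \<le> 2 * e"
proof -
  have d: "(\<lambda>q. w j q - v j q) \<in> nvecs D" if "j < I" for j using w(1)[OF that] v[OF that] by (auto simp: nvecs_def)
  have dq: "cmod (w j q - v j q) \<le> 4 * e" if "j < I" "q < D" for j q
    using norm_triangle_ineq4[of "w j q - z q" "v j q - z q"] w(2)[OF that] vz[OF that] by (simp add: e_def)
  have *: "cmod (\<Sum>q<D. jacobian g (v j) p q * (w j q - v j q)) \<le> (if p < D then M / \<delta> * (4 * e) else 0)"
    if "j < I" for j p by (rule jac_bound) (use that d dq e in auto)
  have z': "z \<in> nvecs D" using nball_nvecs[OF z] .
  show "nmap h g z v w i \<in> nvecs D"
    unfolding nvecs_def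
  proof safe
    fix p assume p: "D \<le> p"
    have "g (v j) p = 0" if "j < I" for j
      using hfam_nvecs[OF g, of 0 "v j"] nball_mono[OF _ vball[OF that], of "\<rho> + 2 * \<delta>"] delta p by (auto simp: nvecs_def)
    moreover have "(\<Sum>q<D. jacobian g (v j) p q * (w j q - v j q)) = 0" if "j < I" for j using *[OF that, of p] p by simp
    ultimately show "nmap h g z v w i p = 0" using z' p by (simp add: nmap_def nvecs_def)
  qed
  have "M / \<delta> * (4 * e) \<le> M" using e delta M0 mult_left_mono[of "4 * e" \<delta> M] by (simp add: field_simps)
  then have "cmod (\<Sum>q<D. jacobian g (v j) p q * (w j q - v j q)) \<le> M" if "j < I" for j
    using *[OF that, of p] M0 by (auto split: if_splits)
  then have "cmod (g (v j) p + (\<Sum>q<D. jacobian g (v j) p q * (w j q - v j q))) \<le> 2 * M" if "j < I" for j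
    using norm_triangle_mono[OF gv_bound[OF that, of p]] that by force
  then have "cmod (h * (\<Sum>j<I. of_real (a i j) * (g (v j) p + (\<Sum>q<D. jacobian g (v j) p q * (w j q - v j q))))) \<le> \<kappa> * cmod h * (2 * M)"
    by (rule scaled_weighted_bound) (use M0 kappa_a i in auto)
  then show "cmod (nmap h g z v w i p - z p) \<le> 2 * e" by (simp add: nmap_def e_def)
qed

lemma nmap_contract:
  assumes "\<And>j q. j < I \<Longrightarrow> q < D \<Longrightarrow> cmod (w j q - w' j q) \<le> W" "0 \<le> W" "i < I"
  shows "cmod (nmap h g z v w i p - nmap h g z v w' i p) \<le> W / 16"
proof -
  \<comment> \<open>The difference is cut off at \<open>D\<close> to become an element of
    \<open>nvecs D\<close>, as \<open>jac_bound\<close> demands of a direction; the sums do not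
    change.\<close>
  have eq: "(\<Sum>q<D. jacobian g (v j) p q * (w j q - v j q)) - (\<Sum>q<D. jacobian g (v j) p q * (w' j q - v j q))
      = (\<Sum>q<D. jacobian g (v j) p q * (\<lambda>q. if q < D then w j q - w' j q else 0) q)" for j
    by (simp flip: sum_subtractf add: algebra_simps)
  have "nmap h g z v w i p - nmap h g z v w' i p =
     h * (\<Sum>j<I. of_real (a i j) * (\<Sum>q<D. jacobian g (v j) p q * (\<lambda>q. if q < D then w j q - w' j q else 0) q))"
    unfolding nmap_def eq[symmetric] by (simp flip: right_diff_distrib sum_subtractf)
  also have "cmod \<dots> \<le> \<kappa> * cmod h * (M / \<delta> * W)"
  proof (rule scaled_weighted_bound)
    fix j assume j: "j < I"
    have "cmod (\<Sum>q<D. jacobian g (v j) p q * (\<lambda>q. if q < D then w j q - w' j q else 0) q) \<le> (if p < D then M / \<delta> * W else 0)"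
      by (rule jac_bound[OF j]) (use j assms in \<open>auto simp: nvecs_def\<close>)
    then show "cmod (\<Sum>q<D. jacobian g (v j) p q * (\<lambda>q. if q < D then w j q - w' j q else 0) q) \<le> M / \<delta> * W"
      by (rule order_trans) (use M0 delta assms in auto)
  qed (use M0 delta assms kappa_a in auto)
  also have "\<dots> = e * W / \<delta>" by (simp add: e_def)
  also have "\<dots> \<le> W / 16" using mult_right_mono[OF e(2) assms(2)] delta by (simp add: field_simps)
  finally show ?thesis .
qed

definition iter where "iter n = (nmap h g z v ^^ n) (\<lambda>_. z)"

lemma iter_near:
  "i < I \<Longrightarrow> iter n i \<in> nvecs D" "i < I \<Longrightarrow> p < D \<Longrightarrow> cmod (iter n i p - z p) \<le> 2 * e"
proof -
  have "(\<forall>i<I. iter n i \<in> nvecs D) \<and> (\<forall>i<I. \<forall>p. cmod (iter n i p - z p) \<le> 2 * e)"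
  proof (induction n)
    case 0
    then show ?case using e nball_nvecs[OF z] by (simp add: iter_def)
  next
    case (Suc n)
    then show ?case using nmap_near[of "iter n"] by (simp add: iter_def)
  qed
  then show "i < I \<Longrightarrow> iter n i \<in> nvecs D" "i < I \<Longrightarrow> p < D \<Longrightarrow> cmod (iter n i p - z p) \<le> 2 * e" by auto
qed

lemma iter_diff: "i < I \<Longrightarrow> cmod (iter (Suc n) i p - iter n i p) \<le> 2 * e / 2 ^ n"
proof (induction n arbitrary: i p)
  case 0
  then show ?case using nmap_near[of "\<lambda>_. z" i] e nball_nvecs[OF z] by (simp add: iter_def)
next
  case (Suc n)
  have "cmod (iter (Suc (Suc n)) i p - iter (Suc n) i p) \<le> (2 * e / 2 ^ n) / 16"
    using nmap_contract[of "iter (Suc n)" "iter n" "2 * e / 2 ^ n" i p] Suc e by (simp add: iter_def)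
  also have "\<dots> \<le> 2 * e / 2 ^ Suc n" using e by (simp add: field_simps)
  finally show ?case .
qed

definition sol where "sol i p = lim (\<lambda>n. iter n i p)"

lemma iter_sol: "i < I \<Longrightarrow> cmod (iter n i p - sol i p) \<le> 2 * (2 * e) / 2 ^ n"
  and iter_tendsto: "i < I \<Longrightarrow> (\<lambda>n. iter n i p) \<longlonglongrightarrow> sol i p"
  unfolding sol_def using geometric_limit[of "\<lambda>n. iter n i p" "2 * e", OF iter_diff] by blast+

lemma sol_fixed: "i < I \<Longrightarrow> nmap h g z v sol i p = sol i p"
proof -
  assume i: "i < I"
  have "(\<lambda>n. iter (Suc n) i p - nmap h g z v sol i p) \<longlonglongrightarrow> 0"
  proof (rule Lim_null_comparison)
    show "\<forall>\<^sub>F n in sequentially. norm (iter (Suc n) i p - nmap h g z v sol i p) \<le> (2 * (2 * e) / 2 ^ n) / 16"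
      using nmap_contract[of "iter n" sol "2 * (2 * e) / 2 ^ n" i p for n] iter_sol i e
      by (intro always_eventually) (simp add: iter_def)
    show "(\<lambda>n. 2 * (2 * e) / 2 ^ n / 16) \<longlonglongrightarrow> 0" by real_asymp
  qed
  then have "(\<lambda>n. iter (Suc n) i p) \<longlonglongrightarrow> nmap h g z v sol i p" using LIM_zero_iff by blast
  then show ?thesis using LIMSEQ_Suc[OF iter_tendsto[OF i, of p]] LIMSEQ_unique by blast
qed

lemma nmap_cong: "(\<And>j q. j < I \<Longrightarrow> q < D \<Longrightarrow> w j q = w' j q) \<Longrightarrow> nmap h g z v w = nmap h g z v w'"
  by (simp add: nmap_def)

text \<open>The definite description ranges over all stage and component indices, whereas
  \<open>nmap\<close> reads only those below \<open>I\<close> and \<open>D\<close>. Uniqueness is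
  settled on these, and the other entries are whatever \<open>nmap\<close> produces; hence the value
  is the image of \<open>sol\<close> rather than \<open>sol\<close>.\<close>

lemma the_sol: "(THE w. w = nmap h g z v w) = nmap h g z v sol"
proof (rule the_equality)
  show "nmap h g z v sol = nmap h g z v (nmap h g z v sol)"
    by (rule nmap_cong) (simp add: sol_fixed)
  fix w assume w: "w = nmap h g z v w"
  have wp: "nmap h g z v w i p = w i p" for i p using w by metis
  \<comment> \<open>A competing fixed point may be far from \<open>z\<close>. Since
    \<open>nmap\<close> is affine, the contraction is global and drives any finite initial distance
    to 0; the double sum is such a distance.\<close>
  have *: "cmod (w j q - sol j q) \<le> (\<Sum>j<I. \<Sum>q<D. cmod (w j q - sol j q)) / 16 ^ n" if "j < I" "q < D" for n j q
    using that
  proof (induction n arbitrary: j q)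
    case 0
    have "cmod (w j q - sol j q) \<le> (\<Sum>q<D. cmod (w j q - sol j q))" using 0 by (intro member_le_sum) auto
    also have "\<dots> \<le> (\<Sum>j<I. \<Sum>q<D. cmod (w j q - sol j q))"
      using 0 by (intro member_le_sum[where f = "\<lambda>j. \<Sum>q<D. cmod (w j q - sol j q)"]) (auto intro: sum_nonneg)
    finally show ?case by simp
  next
    case (Suc n)
    then show ?case
      using nmap_contract[of w sol "(\<Sum>j<I. \<Sum>q<D. cmod (w j q - sol j q)) / 16 ^ n" j q]
      by (simp add: wp sol_fixed sum_nonneg mult_ac)
  qed
  have "w j q = sol j q" if "j < I" "q < D" for j q
  proof -
    have "(\<lambda>n. (\<Sum>j<I. \<Sum>q<D. cmod (w j q - sol j q)) / 16 ^ n) \<longlonglongrightarrow> 0"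
      by (rule LIMSEQ_divide_realpow_zero) simp
    then have "cmod (w j q - sol j q) \<le> 0" using *[OF that] by (intro LIMSEQ_le_const) auto
    then show ?thesis by simp
  qed
  then show "w = nmap h g z v sol" using w nmap_cong by metis
qed

lemma sol_near:
  assumes "i < I" shows "nmap h g z v sol i \<in> nvecs D" and "p < D \<Longrightarrow> cmod (nmap h g z v sol i p - z p) \<le> 2 * e"
proof -
  have "sol i p = 0" if "D \<le> p" for p
  proof -
    have "iter n i p = 0" for n using iter_near(1)[OF assms, of n] that by (simp add: nvecs_def)
    then show ?thesis using iter_tendsto[OF assms, of p] LIMSEQ_unique[OF _ tendsto_const] by simp
  qed
  then show "nmap h g z v sol i \<in> nvecs D" using sol_fixed[OF assms] by (auto simp: nvecs_def)
  assume p: "p < D"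
  have "(\<lambda>n. cmod (iter n i p - z p)) \<longlonglongrightarrow> cmod (sol i p - z p)"
    by (intro tendsto_intros iter_tendsto assms)
  then show "cmod (nmap h g z v sol i p - z p) \<le> 2 * e"
    unfolding sol_fixed[OF assms] using iter_near(2)[OF assms p] by (intro LIMSEQ_le_const2) auto
qed

end

context rk
begin

text \<open>The bound is an invariant of the induction on \<open>l\<close>: a fixed-point iteration
  ends within \<open>\<kappa> * cmod h * M\<close> of \<open>z\<close>, a Newton iteration within
  twice this by \<open>sol_near\<close>. So it does not deteriorate with the number of
  iterations.\<close>

lemma stage_near:
  assumes "0 < \<delta>" and "0 \<le> M" and "16 * \<kappa> * cmod h * M \<le> \<delta>"
    and g: "hfam {0} (nball D c (\<rho> + 2 * \<delta>)) M (\<lambda>_. g)" and z: "z \<in> nball D c \<rho>" and "i < I"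
  shows "stage h g z l i \<in> nvecs D" and "p < D \<Longrightarrow> cmod (stage h g z l i p - z p) \<le> 2 * (\<kappa> * cmod h * M)"
proof -
  have e: "0 \<le> \<kappa> * cmod h * M" "16 * (\<kappa> * cmod h * M) \<le> \<delta>" using kappa1 assms(2,3) by auto
  have "\<forall>i<I. stage h g z l i \<in> nvecs D \<and> (\<forall>p<D. cmod (stage h g z l i p - z p) \<le> 2 * (\<kappa> * cmod h * M))"
  proof (induction l)
    case 0
    then show ?case using nball_nvecs[OF z] e by (simp add: stage_0)
  next
    case (Suc l)
    show ?case
    proof (intro allI impI)
      fix i assume i: "i < I"
      show "stage h g z (Suc l) i \<in> nvecs D \<and> (\<forall>p<D. cmod (stage h g z (Suc l) i p - z p) \<le> 2 * (\<kappa> * cmod h * M))"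
      proof (cases sv)
        case Fixed_Point
        have vb: "stage h g z l j \<in> nball D c (\<rho> + 2 * \<delta>)" if "j < I" for j
          by (rule nball_shift[OF z, of _ "2 * (\<kappa> * cmod h * M)"]) (use Suc that e in auto)
        have "cmod (h * (\<Sum>j<I. of_real (a i j) * g (stage h g z l j) p)) \<le> \<kappa> * cmod h * M" if "p < D" for p
          by (rule scaled_weighted_bound) (use hfam_bound[OF g _ vb that] assms kappa_a i in auto)
        moreover have "g (stage h g z l j) \<in> nvecs D" if "j < I" for j using hfam_nvecs[OF g _ vb[OF that]] by auto
        ultimately show ?thesis
          using Fixed_Point stage_FP[OF Fixed_Point] nball_nvecs[OF z] e by (force simp: nvecs_def)
      next
        case Newton_Raphson
        interpret newton D sv I a b L \<kappa> c \<rho> \<delta> M h g z "stage h g z l"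
          by unfold_locales (use assms Suc in auto)
        show ?thesis using sol_near[OF i] by (simp add: stage_NR[OF Newton_Raphson] the_sol e_def)
      qed
    qed
  qed
  then show "stage h g z l i \<in> nvecs D" and "p < D \<Longrightarrow> cmod (stage h g z l i p - z p) \<le> 2 * (\<kappa> * cmod h * M)"
    using \<open>i < I\<close> by auto
qed

lemma stage_in_nball:
  assumes "0 < \<delta>" and "0 \<le> M" and "16 * \<kappa> * cmod h * M \<le> \<delta>"
    and "hfam {0} (nball D c (\<rho> + 2 * \<delta>)) M (\<lambda>_. g)" and "z \<in> nball D c \<rho>" and "i < I"
  shows "stage h g z l i \<in> nball D c (\<rho> + \<delta>)"
proof -
  have e: "0 \<le> \<kappa> * cmod h * M" "16 * (\<kappa> * cmod h * M) \<le> \<delta>" using kappa1 assms(2,3) by auto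
  show ?thesis by (rule nball_shift[OF assms(5) stage_near[OF assms]]) (use e in auto)
qed

text \<open>A fixed-point stage is an explicit composition. A Newton stage is the limit of the
  holomorphic iterates \<open>it n\<close>, at a rate independent of \<open>\<zeta>\<close> because
  \<open>e\<close> is at most \<open>\<delta> / 16\<close> for every \<open>\<zeta>\<close>.\<close>

lemma stage_holomorphic:
  assumes S: "open S" and "0 < \<delta>" and "0 \<le> M" and small: "\<And>\<zeta>. \<zeta> \<in> S \<Longrightarrow> 16 * \<kappa> * cmod (h \<zeta>) * M \<le> \<delta>"
    and g: "hfam S (nball D c (\<rho> + 2 * \<delta>)) M g" and z: "hcurve S (nball D c \<rho>) z" and h: "h holomorphic_on S"
    and "i < I"
  shows "(\<lambda>\<zeta>. stage (h \<zeta>) (g \<zeta>) (z \<zeta>) l i p) holomorphic_on S"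
proof -
  have g0: "hfam {0} (nball D c (\<rho> + 2 * \<delta>)) M (\<lambda>_. g \<zeta>)" if "\<zeta> \<in> S" for \<zeta> using hfam_fixed[OF g that] .
  have z0: "z \<zeta> \<in> nball D c \<rho>" if "\<zeta> \<in> S" for \<zeta> using z that by (auto simp: hcurve_def)
  have zp: "(\<lambda>\<zeta>. z \<zeta> p) holomorphic_on S" for p
  proof (cases "p < D")
    case False
    then have "z \<zeta> p = 0" if "\<zeta> \<in> S" for \<zeta> using z0[OF that] by (auto simp: in_nball_iff nvecs_def)
    then show ?thesis using holomorphic_transform[of "\<lambda>_. 0" S] by auto
  qed (use z in \<open>auto simp: hcurve_def\<close>)
  have st: "stage (h \<zeta>) (g \<zeta>) (z \<zeta>) l j \<in> nball D c (\<rho> + \<delta>)" if "\<zeta> \<in> S" "j < I" for \<zeta> l j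
    using that assms g0 z0 by (intro stage_in_nball) auto
  have gp: "hfun S (nball D c (\<rho> + 2 * \<delta>)) (if p < D then M else 0) (\<lambda>\<zeta> y. g \<zeta> y p)" for p
    using hfam_component[OF g \<open>0 \<le> M\<close>] .
  have "\<forall>i<I. \<forall>p. (\<lambda>\<zeta>. stage (h \<zeta>) (g \<zeta>) (z \<zeta>) l i p) holomorphic_on S"
  proof (induction l)
    case 0
    then show ?case using zp by (simp add: stage_0)
  next
    case (Suc l)
    have hc: "hcurve S (nball D c (\<rho> + \<delta>)) (\<lambda>\<zeta>. stage (h \<zeta>) (g \<zeta>) (z \<zeta>) l j)" if "j < I" for j
      using Suc st that by (auto simp: hcurve_def)
    have hc': "hcurve S (nball D c (\<rho> + 2 * \<delta>)) (\<lambda>\<zeta>. stage (h \<zeta>) (g \<zeta>) (z \<zeta>) l j)" if "j < I" for j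
      by (rule hcurve_mono[OF hc[OF that] order_refl]) (use \<open>0 < \<delta>\<close> in \<open>auto intro: nball_mono[rotated]\<close>)
    have gs: "(\<lambda>\<zeta>. g \<zeta> (stage (h \<zeta>) (g \<zeta>) (z \<zeta>) l j) p) holomorphic_on S" if "j < I" for j p
      using hfun_hol[OF gp S holomorphic_on_ident _ hc'[OF that]] by auto
    show ?case
    proof (intro allI impI)
      fix i p assume i: "i < I"
      show "(\<lambda>\<zeta>. stage (h \<zeta>) (g \<zeta>) (z \<zeta>) (Suc l) i p) holomorphic_on S"
      proof (cases sv)
        case Fixed_Point
        show ?thesis unfolding stage_FP[OF Fixed_Point] by (intro holomorphic_intros h zp gs) auto
      next
        case Newton_Raphson
        have nw: "newton D I a b \<kappa> c \<rho> \<delta> M (h \<zeta>) (g \<zeta>) (z \<zeta>) (stage (h \<zeta>) (g \<zeta>) (z \<zeta>) l)" if "\<zeta> \<in> S" for \<zeta>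
          by unfold_locales (use that assms(2,3) small g0 z0
              stage_near[OF assms(2,3) small[OF that] g0[OF that] z0[OF that]] in auto)
        define it where "it n \<zeta> = newton.iter D I a (h \<zeta>) (g \<zeta>) (z \<zeta>) (stage (h \<zeta>) (g \<zeta>) (z \<zeta>) l) n" for n \<zeta>
        have it_Suc: "it (Suc n) \<zeta> = nmap (h \<zeta>) (g \<zeta>) (z \<zeta>) (stage (h \<zeta>) (g \<zeta>) (z \<zeta>) l) (it n \<zeta>)"
          and it_0: "it 0 \<zeta> = (\<lambda>_. z \<zeta>)" if "\<zeta> \<in> S" for n \<zeta>
          using newton.iter_def[OF nw[OF that]] by (auto simp: it_def)
        have jac: "(\<lambda>\<zeta>. jacobian (g \<zeta>) (stage (h \<zeta>) (g \<zeta>) (z \<zeta>) l j) p q) holomorphic_on S" if "j < I" "q < D" for j p q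
        proof -
          have "hfun S (nball D c (\<rho> + \<delta>)) ((if p < D then M else 0) / \<delta>) (\<lambda>\<zeta> y. pd (\<lambda>y. g \<zeta> y p) y q)"
            by (rule hfun_pd) (use gp[of p] \<open>0 < \<delta>\<close> that in \<open>auto simp: add.assoc\<close>)
          from hfun_hol[OF this S holomorphic_on_ident _ hc[OF that(1)]] show ?thesis by (auto simp: jacobian_eq_pd)
        qed
        have ith: "\<forall>i p. (\<lambda>\<zeta>. it n \<zeta> i p) holomorphic_on S" for n
        proof (induction n)
          case 0
          show ?case using holomorphic_transform[OF zp] it_0 by auto
        next
          case IH: (Suc n)
          show ?case
          proof (intro allI)
            fix i p
            have "(\<lambda>\<zeta>. nmap (h \<zeta>) (g \<zeta>) (z \<zeta>) (stage (h \<zeta>) (g \<zeta>) (z \<zeta>) l) (it n \<zeta>) i p) holomorphic_on S"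
              unfolding nmap_def using Suc IH by (intro holomorphic_intros h zp gs jac) auto
            then show "(\<lambda>\<zeta>. it (Suc n) \<zeta> i p) holomorphic_on S"
              by (rule holomorphic_transform) (simp add: it_Suc)
          qed
        qed
        show ?thesis
        proof (rule holomorphic_limit_rate[OF S, of "\<lambda>n \<zeta>. it n \<zeta> i p"])
          show "(\<lambda>\<zeta>. it n \<zeta> i p) holomorphic_on S" for n using ith by auto
          show "(\<lambda>n. 2 * (2 * (\<delta> / 16)) / 2 ^ n) \<longlonglongrightarrow> 0" by real_asymp
          fix n \<zeta> assume \<zeta>: "\<zeta> \<in> S"
          interpret newton D sv I a b L \<kappa> c \<rho> \<delta> M "h \<zeta>" "g \<zeta>" "z \<zeta>" "stage (h \<zeta>) (g \<zeta>) (z \<zeta>) l"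
            by (rule nw[OF \<zeta>])
          have "stage (h \<zeta>) (g \<zeta>) (z \<zeta>) (Suc l) i p = sol i p"
            by (simp add: stage_NR[OF Newton_Raphson] the_sol sol_fixed i)
          then have "cmod (it n \<zeta> i p - stage (h \<zeta>) (g \<zeta>) (z \<zeta>) (Suc l) i p) \<le> 2 * (2 * e) / 2 ^ n"
            using iter_sol[OF i, of n p] by (simp add: it_def)
          also have "\<dots> \<le> 2 * (2 * (\<delta> / 16)) / 2 ^ n" using e by (intro divide_right_mono) auto
          finally show "cmod (it n \<zeta> i p - stage (h \<zeta>) (g \<zeta>) (z \<zeta>) (Suc l) i p) \<le> 2 * (2 * (\<delta> / 16)) / 2 ^ n" .
        qed
      qed
    qed
  qed
  then show ?thesis using \<open>i < I\<close> by auto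
qed

end

section \<open>Comparing the steps of two vector fields\<close>

context rk
begin

lemma stage_zero: "stage 0 g z l i = z"
proof (cases l)
  case 0
  then show ?thesis by (simp add: stage_0)
next
  case (Suc k)
  show ?thesis unfolding Suc
  proof (cases sv)
    case Fixed_Point
    show "stage 0 g z (Suc k) i = z" using stage_FP[OF Fixed_Point] by (simp add: fun_eq_iff)
  next
    case Newton_Raphson
    show "stage 0 g z (Suc k) i = z" unfolding stage_NR[OF Newton_Raphson] nmap_def by simp
  qed
qed

text \<open>At \<open>h = 0\<close> all stages collapse to \<open>z\<close>, and consistency leaves
  \<open>g\<close> itself. That \<open>g\<close> is the leading term of \<open>inc\<close> is what
  later makes \<open>g - inc\<close> small.\<close>

lemma inc_0: "inc 0 g z p = g z p"
  unfolding inc_def stage_zero by (simp flip: sum_distrib_right of_real_sum add: consistent)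

context
  fixes c :: "complex nvec" and \<rho> \<delta> M :: real
  assumes delta: "0 < \<delta>" and M0: "0 \<le> M"
begin

lemma Lip: "hfam {0} (nball D c (\<rho> + 2 * \<delta>)) M (\<lambda>_. g) \<Longrightarrow> y \<in> nball D c (\<rho> + \<delta>) \<Longrightarrow> w \<in> nball D c (\<rho> + \<delta>) \<Longrightarrow>
   (\<And>q. q < D \<Longrightarrow> cmod (y q - w q) \<le> W) \<Longrightarrow> 0 \<le> W \<Longrightarrow> p < D \<Longrightarrow> cmod (g y p - g w p) \<le> M / \<delta> * W"
  using hfun_Lipschitz[of "{0}" c "\<rho> + \<delta>" \<delta> M "\<lambda>z. g z p" y w W] delta
  by (auto simp: hfam_def add.assoc)

text \<open>In the last bound one \<open>\<kappa>\<close> comes from the distance of the stages to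
  \<open>z\<close>, the other from the weights. Consistency lets \<open>g z\<close> be subtracted
  inside the weighted sum.\<close>

lemma inc_bound:
  assumes "16 * \<kappa> * cmod h * M \<le> \<delta>" and g: "hfam {0} (nball D c (\<rho> + 2 * \<delta>)) M (\<lambda>_. g)" and z: "z \<in> nball D c \<rho>"
  shows "inc h g z \<in> nvecs D" and "p < D \<Longrightarrow> cmod (inc h g z p) \<le> \<kappa> * M"
    and "p < D \<Longrightarrow> cmod (inc h g z p - g z p) \<le> 2 * \<kappa>\<^sup>2 * cmod h * M\<^sup>2 / \<delta>"
proof -
  have s: "stage h g z l i \<in> nball D c (\<rho> + \<delta>)" if "i < I" for l i
    by (rule stage_in_nball[OF delta M0 assms that])
  have s2: "stage h g z l i \<in> nball D c (\<rho> + 2 * \<delta>)" if "i < I" for l i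
    using nball_mono[OF _ s[OF that]] delta by auto
  show "inc h g z \<in> nvecs D"
    using hfam_nvecs[OF g _ s2] by (simp add: inc_def nvecs_def)
  assume p: "p < D"
  show "cmod (inc h g z p) \<le> \<kappa> * M"
    unfolding inc_def by (rule weighted_bound) (use hfam_bound[OF g _ s2 p] M0 kappa_b in auto)
  have z': "z \<in> nball D c (\<rho> + \<delta>)" using nball_mono[OF _ z] delta by auto
  have "inc h g z p - g z p = (\<Sum>i<I. of_real (b i) * (g (stage h g z L i) p - g z p))"
    using consistent by (simp add: inc_def right_diff_distrib sum_subtractf flip: sum_distrib_right of_real_sum)
  also have "cmod \<dots> \<le> \<kappa> * (M / \<delta> * (2 * (\<kappa> * cmod h * M)))"
  proof (rule weighted_bound)
    fix j assume j: "j < I"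
    show "cmod (g (stage h g z L j) p - g z p) \<le> M / \<delta> * (2 * (\<kappa> * cmod h * M))"
      by (rule Lip[OF g s[OF j] z' stage_near(2)[OF delta M0 assms j]]) (use M0 kappa1 p in auto)
  qed (use M0 delta kappa1 kappa_b in auto)
  also have "\<dots> = 2 * \<kappa>\<^sup>2 * cmod h * M\<^sup>2 / \<delta>" by (simp add: power2_eq_square)
  finally show "cmod (inc h g z p - g z p) \<le> 2 * \<kappa>\<^sup>2 * cmod h * M\<^sup>2 / \<delta>" .
qed

lemma inc_holomorphic:
  assumes S: "open S" and "\<And>\<zeta>. \<zeta> \<in> S \<Longrightarrow> 16 * \<kappa> * cmod (h \<zeta>) * M \<le> \<delta>"
    and g: "hfam S (nball D c (\<rho> + 2 * \<delta>)) M g" and z: "hcurve S (nball D c \<rho>) z" and "h holomorphic_on S"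
    and p: "p < D"
  shows "(\<lambda>\<zeta>. inc (h \<zeta>) (g \<zeta>) (z \<zeta>) p) holomorphic_on S"
proof -
  have "hcurve S (nball D c (\<rho> + 2 * \<delta>)) (\<lambda>\<zeta>. stage (h \<zeta>) (g \<zeta>) (z \<zeta>) L i)" if "i < I" for i
    unfolding hcurve_def
  proof (intro conjI ballI allI impI)
    fix \<zeta> assume "\<zeta> \<in> S"
    then have "stage (h \<zeta>) (g \<zeta>) (z \<zeta>) L i \<in> nball D c (\<rho> + \<delta>)"
      using assms that hfam_fixed[OF g] by (intro stage_in_nball[OF delta M0]) (auto simp: hcurve_def)
    then show "stage (h \<zeta>) (g \<zeta>) (z \<zeta>) L i \<in> nball D c (\<rho> + 2 * \<delta>)" using nball_mono[of "\<rho> + \<delta>" "\<rho> + 2 * \<delta>"] delta by auto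
  qed (use assms that in \<open>auto intro!: stage_holomorphic[OF S delta M0]\<close>)
  then have "(\<lambda>\<zeta>. g \<zeta> (stage (h \<zeta>) (g \<zeta>) (z \<zeta>) L i) p) holomorphic_on S" if "i < I" for i
    using that hfun_hol[of S _ M "\<lambda>\<tau> z. g \<tau> z p", OF _ S holomorphic_on_ident] g p by (auto simp: hfam_def)
  then show ?thesis unfolding inc_def by (intro holomorphic_intros) auto
qed

lemma inc_hfam:
  assumes "\<And>\<zeta>. \<zeta> \<in> T \<Longrightarrow> 16 * \<kappa> * cmod (h \<zeta>) * M \<le> \<delta>"
    and g: "hfam T (nball D c (\<rho> + 2 * \<delta>)) M g" and "h holomorphic_on T"
  shows "hfam T (nball D c \<rho>) (\<kappa> * M) (\<lambda>\<tau>. inc (h \<tau>) (g \<tau>))"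
  unfolding hfam_def
proof (intro conjI ballI allI impI)
  fix p assume p: "p < D"
  show "hfun T (nball D c \<rho>) (\<kappa> * M) (\<lambda>\<tau> z. inc (h \<tau>) (g \<tau>) z p)"
  proof (rule hfunI)
    fix S \<eta> \<gamma> assume *: "open S" "\<eta> holomorphic_on S" "\<eta> ` S \<subseteq> T" "hcurve S (nball D c \<rho>) \<gamma>"
    have "(\<lambda>\<zeta>. h (\<eta> \<zeta>)) holomorphic_on S"
      using holomorphic_on_compose_gen[OF *(2) assms(3) *(3)] by (simp add: o_def)
    then show "(\<lambda>\<zeta>. inc (h (\<eta> \<zeta>)) (g (\<eta> \<zeta>)) (\<gamma> \<zeta>) p) holomorphic_on S"
      using assms * p by (intro inc_holomorphic hfam_reparam[OF g]) auto
  qed (use assms p hfam_fixed[OF g] in \<open>auto intro!: inc_bound(2)\<close>)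
qed (use assms hfam_fixed[OF g] in \<open>auto intro!: inc_bound(1)\<close>)

lemma step_in_nball:
  assumes "16 * \<kappa> * cmod h * M \<le> \<delta>" and "hfam {0} (nball D c (\<rho> + 2 * \<delta>)) M (\<lambda>_. g)" and z: "z \<in> nball D c \<rho>"
  shows "step h g z \<in> nvecs D" and "p < D \<Longrightarrow> cmod (step h g z p - z p) \<le> \<kappa> * cmod h * M"
  using inc_bound(1)[OF assms] inc_bound(2)[OF assms, of p] nball_nvecs[OF z]
    mult_left_mono[OF inc_bound(2)[OF assms, of p], of "cmod h"]
  by (auto simp: step_def nvecs_def norm_mult mult_ac)

end

context
  fixes c :: "complex nvec" and \<rho> \<delta> M :: real and s :: nat
  assumes delta: "0 < \<delta>" and M0: "0 \<le> M" and s1: "1 \<le> s"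
begin

text \<open>The intermediate points drift by at most \<open>\<delta> / 16\<close> in total, so one
  collar of width \<open>\<delta>\<close> serves all \<open>s\<close> steps, and the remaining
  \<open>2 * \<delta>\<close> serve the stages of each step.\<close>

lemma step_iter_near:
  assumes small: "16 * \<kappa> * s * cmod h * M \<le> \<delta>" and g: "hfam {0} (nball D c (\<rho> + 3 * \<delta>)) M (\<lambda>_. g)" and z: "z \<in> nball D c \<rho>"
    and "i \<le> s"
  shows "(step h g ^^ i) z \<in> nball D c (\<rho> + \<delta>)" and "p < D \<Longrightarrow> cmod ((step h g ^^ i) z p - z p) \<le> real i * (\<kappa> * cmod h * M)"
    and "p < D \<Longrightarrow> cmod ((step h g ^^ i) z p - z p - of_nat i * h * g z p) \<le> real i * (3 * s * \<kappa>\<^sup>2 * (cmod h)\<^sup>2 * M\<^sup>2 / \<delta>)"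
proof -
  have g': "hfam {0} (nball D c ((\<rho> + \<delta>) + 2 * \<delta>)) M (\<lambda>_. g)" using g by (simp add: add_ac)
  have e: "0 \<le> \<kappa> * cmod h * M" using kappa1 M0 by simp
  have es: "16 * (s * (\<kappa> * cmod h * M)) \<le> \<delta>" using small by (simp add: mult_ac)
  have small1: "16 * \<kappa> * cmod h * M \<le> \<delta>"
    using es mult_right_mono[of 1 "real s" "\<kappa> * cmod h * M"] e s1 by (simp add: mult_ac)
  have iss: "real i * (\<kappa> * cmod h * M) \<le> s * (\<kappa> * cmod h * M)" if "i \<le> s" for i
    using that e by (intro mult_right_mono) auto
  have z1: "z \<in> nball D c ((\<rho> + \<delta>) + \<delta>)" using nball_mono[OF _ z] delta by auto
  have "i \<le> s \<longrightarrow> (step h g ^^ i) z \<in> nball D c (\<rho> + \<delta>) \<and> (\<forall>p<D. cmod ((step h g ^^ i) z p - z p) \<le> real i * (\<kappa> * cmod h * M)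
     \<and> cmod ((step h g ^^ i) z p - z p - of_nat i * h * g z p) \<le> real i * (3 * s * \<kappa>\<^sup>2 * (cmod h)\<^sup>2 * M\<^sup>2 / \<delta>))" for i
  proof (induction i)
    case 0
    then show ?case using nball_mono[OF _ z] delta by auto
  next
    case (Suc i)
    show ?case
    proof (intro impI)
      assume i: "Suc i \<le> s"
      define y where "y = (step h g ^^ i) z"
      have y: "y \<in> nball D c (\<rho> + \<delta>)" and yz: "\<And>p. p < D \<Longrightarrow> cmod (y p - z p) \<le> real i * (\<kappa> * cmod h * M)"
        and yh: "\<And>p. p < D \<Longrightarrow> cmod (y p - z p - of_nat i * h * g z p) \<le> real i * (3 * s * \<kappa>\<^sup>2 * (cmod h)\<^sup>2 * M\<^sup>2 / \<delta>)"
        using Suc i by (auto simp: y_def)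
      have eq: "(step h g ^^ Suc i) z = step h g y" by (simp add: y_def)
      note st = step_in_nball[OF delta M0 small1 g' y]
      have 1: "cmod (step h g y p - z p) \<le> real (Suc i) * (\<kappa> * cmod h * M)" if p: "p < D" for p
        using norm_triangle_ineq[of "step h g y p - y p" "y p - z p"] st(2)[OF p] yz[OF p] by (simp add: algebra_simps)
      have 2: "step h g y \<in> nball D c (\<rho> + \<delta>)"
        by (rule nball_shift[OF z st(1) 1]) (use iss[OF i] es delta e in auto)
      have 3: "cmod (step h g y p - z p - of_nat (Suc i) * h * g z p) \<le> real (Suc i) * (3 * s * \<kappa>\<^sup>2 * (cmod h)\<^sup>2 * M\<^sup>2 / \<delta>)"
        if p: "p < D" for p
      proof -
        have y1: "y \<in> nball D c ((\<rho> + \<delta>) + \<delta>)" using nball_mono[OF _ y] delta by auto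
        have "cmod (g y p - g z p) \<le> M / \<delta> * (real i * (\<kappa> * cmod h * M))"
          by (rule Lip[OF delta M0 g' y1 z1 yz]) (use e p in auto)
        also have "\<dots> \<le> M / \<delta> * (s * (\<kappa> * cmod h * M))"
          using iss[of i] i M0 delta by (intro mult_left_mono) auto
        also have "\<dots> = s * \<kappa> * (cmod h * M\<^sup>2 / \<delta>)" by (simp add: power2_eq_square)
        also have "\<dots> \<le> s * \<kappa>\<^sup>2 * (cmod h * M\<^sup>2 / \<delta>)"
          using kappa1 delta by (intro mult_right_mono mult_left_mono) (auto simp: power2_eq_square)
        finally have gg: "cmod (g y p - g z p) \<le> s * \<kappa>\<^sup>2 * (cmod h * M\<^sup>2 / \<delta>)" .
        have "cmod (inc h g y p - g y p) \<le> 2 * \<kappa>\<^sup>2 * cmod h * M\<^sup>2 / \<delta>"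
          by (rule inc_bound(3)[OF delta M0 small1 g' y p])
        also have "\<dots> = (2 * 1) * \<kappa>\<^sup>2 * (cmod h * M\<^sup>2 / \<delta>)" by simp
        \<comment> \<open>The constant 2 of a single step is enlarged to \<open>2 * s\<close> to
          match the error \<open>s\<close> that comes from the drift of the base point; together
          they make \<open>3 * s\<close>.\<close>
        also have "\<dots> \<le> (2 * s) * \<kappa>\<^sup>2 * (cmod h * M\<^sup>2 / \<delta>)"
          using s1 delta by (intro mult_right_mono) auto
        finally have i1: "cmod (inc h g y p - g y p) \<le> (2 * s) * \<kappa>\<^sup>2 * (cmod h * M\<^sup>2 / \<delta>)" .
        have "cmod ((inc h g y p - g y p) + (g y p - g z p)) \<le> (2 * s) * \<kappa>\<^sup>2 * (cmod h * M\<^sup>2 / \<delta>) + s * \<kappa>\<^sup>2 * (cmod h * M\<^sup>2 / \<delta>)"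
          by (rule norm_triangle_mono[OF i1 gg])
        also have "(2 * s) * \<kappa>\<^sup>2 * X + s * \<kappa>\<^sup>2 * X = 3 * s * \<kappa>\<^sup>2 * X" for X :: real
          by (simp add: algebra_simps)
        finally have "cmod (inc h g y p - g z p) \<le> 3 * s * \<kappa>\<^sup>2 * (cmod h * M\<^sup>2 / \<delta>)" by simp
        then have "cmod (h * (inc h g y p - g z p)) \<le> cmod h * (3 * s * \<kappa>\<^sup>2 * (cmod h * M\<^sup>2 / \<delta>))"
          unfolding norm_mult by (rule mult_left_mono) auto
        also have "\<dots> = 3 * s * \<kappa>\<^sup>2 * (cmod h)\<^sup>2 * M\<^sup>2 / \<delta>" by (simp add: power2_eq_square)
        finally have hb: "cmod (h * (inc h g y p - g z p)) \<le> 3 * s * \<kappa>\<^sup>2 * (cmod h)\<^sup>2 * M\<^sup>2 / \<delta>" .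
        have eq: "step h g y p - z p - of_nat (Suc i) * h * g z p = h * (inc h g y p - g z p) + (y p - z p - of_nat i * h * g z p)"
          by (simp add: step_def algebra_simps)
        have suc: "real (Suc i) * X = X + real i * X" for X by (simp add: algebra_simps)
        show ?thesis unfolding eq suc by (rule norm_triangle_mono[OF hb yh[OF p]])
      qed
      show "(step h g ^^ Suc i) z \<in> nball D c (\<rho> + \<delta>) \<and> (\<forall>p<D. cmod ((step h g ^^ Suc i) z p - z p) \<le> real (Suc i) * (\<kappa> * cmod h * M)
     \<and> cmod ((step h g ^^ Suc i) z p - z p - of_nat (Suc i) * h * g z p) \<le> real (Suc i) * (3 * s * \<kappa>\<^sup>2 * (cmod h)\<^sup>2 * M\<^sup>2 / \<delta>))"
        unfolding eq using 1 2 3 by blast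
    qed
  qed
  then show "(step h g ^^ i) z \<in> nball D c (\<rho> + \<delta>)" and "p < D \<Longrightarrow> cmod ((step h g ^^ i) z p - z p) \<le> real i * (\<kappa> * cmod h * M)"
    and "p < D \<Longrightarrow> cmod ((step h g ^^ i) z p - z p - of_nat i * h * g z p) \<le> real i * (3 * s * \<kappa>\<^sup>2 * (cmod h)\<^sup>2 * M\<^sup>2 / \<delta>)"
    using \<open>i \<le> s\<close> by blast+
qed

lemma step_iter_holomorphic:
  assumes S: "open S" and small: "16 * \<kappa> * s * cmod h * M \<le> \<delta>"
    and g: "hfam S (nball D c (\<rho> + 3 * \<delta>)) M g" and z: "z \<in> nball D c \<rho>" and "i \<le> s" and p: "p < D"
  shows "(\<lambda>\<tau>. (step h (g \<tau>) ^^ i) z p) holomorphic_on S"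
proof -
  have e: "0 \<le> \<kappa> * cmod h * M" using kappa1 M0 by simp
  have small1: "16 * \<kappa> * cmod h * M \<le> \<delta>"
    using small mult_right_mono[of 1 "real s" "\<kappa> * cmod h * M"] e s1 by (simp add: mult_ac)
  have g': "hfam S (nball D c ((\<rho> + \<delta>) + 2 * \<delta>)) M g" using g by (simp add: add_ac)
  have "\<forall>p<D. (\<lambda>\<tau>. (step h (g \<tau>) ^^ i) z p) holomorphic_on S" using \<open>i \<le> s\<close>
  proof (induction i)
    case (Suc i)
    have hc: "hcurve S (nball D c (\<rho> + \<delta>)) (\<lambda>\<tau>. (step h (g \<tau>) ^^ i) z)"
      using Suc by (auto simp: hcurve_def intro!: step_iter_near(1)[OF small hfam_fixed[OF g] z])
    have "(\<lambda>\<tau>. inc h (g \<tau>) ((step h (g \<tau>) ^^ i) z) p) holomorphic_on S" if "p < D" for p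
      by (rule inc_holomorphic[OF delta M0 S _ g' hc]) (use small1 that in auto)
    moreover have "(step h (g \<tau>) ^^ Suc i) z p = (step h (g \<tau>) ^^ i) z p + h * inc h (g \<tau>) ((step h (g \<tau>) ^^ i) z) p" for \<tau> p
      unfolding funpow.simps o_apply by (rule step_def)
    ultimately show ?case using Suc by (simp only:) (intro allI impI holomorphic_intros; simp)
  qed auto
  then show ?thesis using p by auto
qed

end

text \<open>Embedding \<open>g1\<close>, \<open>g2\<close> into the complex line \<open>g2 + \<tau> (g1 - g2)\<close> turns the bound on
  the remainder for a single field into a Lipschitz bound, by Cauchy's inequality in \<open>\<tau>\<close>.\<close>

lemma step_iter_compare:
  assumes delta: "0 < \<delta>" and M0: "0 < M" and s1: "1 \<le> s" and eps: "0 < \<epsilon>"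
    and small: "32 * \<kappa> * s * cmod h * M \<le> \<delta>"
    and g1: "hfam {0} (nball D c (\<rho> + 3 * \<delta>)) M (\<lambda>_. g1)" and g2: "hfam {0} (nball D c (\<rho> + 3 * \<delta>)) M (\<lambda>_. g2)"
    and g12: "\<And>y p. y \<in> nball D c (\<rho> + 3 * \<delta>) \<Longrightarrow> p < D \<Longrightarrow> cmod (g1 y p - g2 y p) \<le> \<epsilon>"
    and z: "z \<in> nball D c \<rho>" and p: "p < D"
  shows "cmod ((step h g1 ^^ s) z p - (step h g2 ^^ s) z p - of_nat s * h * (g1 z p - g2 z p))
     \<le> 24 * s\<^sup>2 * \<kappa>\<^sup>2 * (cmod h)\<^sup>2 * M / \<delta> * \<epsilon>"
proof -
  have M': "0 \<le> M" using M0 by simp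
  have "0 \<le> \<kappa> * s * cmod h * M" using kappa1 M0 by simp
  then have small1: "16 * \<kappa> * s * cmod h * M \<le> \<delta>" using small by linarith
  define P where "P g = (step h g ^^ s) z p - z p - of_nat s * h * g z p" for g
  have z3: "z \<in> nball D c (\<rho> + 3 * \<delta>)" using nball_mono[OF _ z] delta by auto
  have goal: "(step h g1 ^^ s) z p - (step h g2 ^^ s) z p - of_nat s * h * (g1 z p - g2 z p) = P g1 - P g2"
    by (simp add: P_def algebra_simps)
  define B where "B = 3 * s\<^sup>2 * \<kappa>\<^sup>2 * (cmod h)\<^sup>2 * M / \<delta>"
  have B: "0 \<le> B" using M0 delta by (simp add: B_def)
  have "cmod (P g1 - P g2) \<le> 8 * B * \<epsilon>"
  \<comment> \<open>The interval from 0 to 1 needs a collar of width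
    \<open>M / \<epsilon> / 2\<close> inside the disc of radius \<open>M / \<epsilon>\<close>, which
    it has if \<open>M / \<epsilon> \<ge> 2\<close>. Otherwise \<open>\<epsilon>\<close> exceeds
    \<open>M / 2\<close>, and the bounds for the two fields taken separately suffice.\<close>
  proof (cases "M / \<epsilon> < 2")
    case True
    have "cmod (P g1) \<le> B * M" "cmod (P g2) \<le> B * M"
      using step_iter_near(3)[OF delta M' s1 small1 g1 z order_refl p] step_iter_near(3)[OF delta M' s1 small1 g2 z order_refl p]
      by (simp_all add: P_def B_def power2_eq_square mult_ac)
    then have "cmod (P g1 - P g2) \<le> 2 * (B * M)" using norm_triangle_ineq4[of "P g1" "P g2"] by linarith
    also have "\<dots> \<le> 2 * (B * (2 * \<epsilon>))" using True eps B by (intro mult_left_mono) (auto simp: field_simps)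
    also have "\<dots> \<le> 8 * B * \<epsilon>" using eps B by simp
    finally show ?thesis .
  next
    case False
    \<comment> \<open>On this disc the line of fields is bounded by
      \<open>M + M / \<epsilon> * \<epsilon> = 2 * M\<close>; hence 32 in place of 16 in
      \<open>small\<close>. The remainder is quadratic in this bound and becomes
      \<open>4 * B * M\<close>; the collar \<open>M / \<epsilon> / 2\<close> then gives
      \<open>8 * B * \<epsilon>\<close>.\<close>
    define T where "T = ball (0::complex) (M / \<epsilon>)"
    define G where "G \<tau> y = (\<lambda>q. g2 y q + \<tau> * (g1 y q - g2 y q))" for \<tau> y
    have G: "hfam T (nball D c (\<rho> + 3 * \<delta>)) (2 * M) G"
      unfolding hfam_def
    proof (intro conjI ballI allI impI)
      fix \<tau> y assume "\<tau> \<in> T" "y \<in> nball D c (\<rho> + 3 * \<delta>)"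
      then show "G \<tau> y \<in> nvecs D" using hfam_nvecs[OF g1, of 0 y] hfam_nvecs[OF g2, of 0 y] by (auto simp: G_def nvecs_def)
    next
      fix q assume q: "q < D"
      have "hfun {0} (nball D c (\<rho> + 3 * \<delta>)) M (\<lambda>_ y. g1 y q)" "hfun {0} (nball D c (\<rho> + 3 * \<delta>)) M (\<lambda>_ y. g2 y q)"
        using g1 g2 q by (auto simp: hfam_def)
      then have h2: "hfun T (nball D c (\<rho> + 3 * \<delta>)) M (\<lambda>_ y. g2 y q)" and d: "hfun T (nball D c (\<rho> + 3 * \<delta>)) (M + M) (\<lambda>_ y. g1 y q - g2 y q)"
        using hfun_fixed[of "{0}" _ M "\<lambda>_ y. g2 y q" 0 T]
          hfun_fixed[OF hfun_diff[of "{0}" _ M "\<lambda>_ y. g1 y q" M "\<lambda>_ y. g2 y q"], where \<tau> = 0 and T' = T] by auto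
      have "hfun T (nball D c (\<rho> + 3 * \<delta>)) \<epsilon> (\<lambda>_ y. g1 y q - g2 y q)"
        using d g12 q by (auto simp: hfun_def)
      from hfun_scale[OF this holomorphic_on_ident, of "M / \<epsilon>"]
      have "hfun T (nball D c (\<rho> + 3 * \<delta>)) M (\<lambda>\<tau> y. \<tau> * (g1 y q - g2 y q))"
        using eps by (simp add: T_def less_imp_le)
      from hfun_add[OF h2 this] show "hfun T (nball D c (\<rho> + 3 * \<delta>)) (2 * M) (\<lambda>\<tau> z. G \<tau> z q)"
        by (simp add: G_def)
    qed
    have M2: "0 \<le> 2 * M" using M0 by simp
    have small2: "16 * \<kappa> * s * cmod h * (2 * M) \<le> \<delta>" using small by simp
    have PT: "cmod (P (G \<tau>)) \<le> 4 * B * M" if "\<tau> \<in> T" for \<tau>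
      using step_iter_near(3)[OF delta M2 s1 small2 hfam_fixed[OF G that] z order_refl p]
      by (simp add: P_def B_def power2_eq_square mult_ac)
    have "(\<lambda>\<tau>. P (G \<tau>)) holomorphic_on T"
      unfolding P_def
      by (intro holomorphic_intros step_iter_holomorphic[OF delta M2 s1 _ small2 G z order_refl p])
        (auto simp: T_def G_def intro!: holomorphic_intros)
    then have "cmod (P (G 1) - P (G 0)) \<le> 4 * B * M / (M / \<epsilon> / 2) * cmod (1 - 0)"
    proof (rule holomorphic_Lipschitz[where S = "closed_segment 0 1"])
      fix x :: complex assume "x \<in> closed_segment 0 1"
      then have x: "cmod x \<le> 1" using segment_bound(1)[of x 0 1] by simp
      show "ball x (M / \<epsilon> / 2) \<subseteq> T"
      proof
        fix y assume "y \<in> ball x (M / \<epsilon> / 2)"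
        then have "cmod y < M / \<epsilon> / 2 + 1"
          using x norm_triangle_ineq[of "y - x" x] by (simp add: dist_norm norm_minus_commute)
        then show "y \<in> T" using False by (simp add: T_def)
      qed
    qed (use PT M0 eps in \<open>auto simp: T_def\<close>)
    also have "\<dots> = 8 * B * \<epsilon>" using M0 eps by (simp add: field_simps)
    finally have "cmod (P (G 1) - P (G 0)) \<le> 8 * B * \<epsilon>" .
    moreover have "G 1 = g1" "G 0 = g2" by (auto simp: G_def fun_eq_iff)
    ultimately show ?thesis by simp
  qed
  then show ?thesis unfolding goal B_def by (simp add: mult_ac)
qed

text \<open>The case \<open>s = 1\<close> of the preceding comparison, divided by \<open>h\<close>.
  At \<open>h = 0\<close> the increments are the fields and the left-hand side vanishes.\<close>

lemma inc_compare:
  assumes delta: "0 < \<delta>" and M0: "0 < M" and eps: "0 < \<epsilon>"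
    and small: "32 * \<kappa> * cmod h * M \<le> \<delta>"
    and g1: "hfam {0} (nball D c (\<rho> + 3 * \<delta>)) M (\<lambda>_. g1)" and g2: "hfam {0} (nball D c (\<rho> + 3 * \<delta>)) M (\<lambda>_. g2)"
    and g12: "\<And>y p. y \<in> nball D c (\<rho> + 3 * \<delta>) \<Longrightarrow> p < D \<Longrightarrow> cmod (g1 y p - g2 y p) \<le> \<epsilon>"
    and z: "z \<in> nball D c \<rho>" and p: "p < D"
  shows "cmod (inc h g1 z p - inc h g2 z p - (g1 z p - g2 z p)) \<le> 24 * \<kappa>\<^sup>2 * cmod h * M / \<delta> * \<epsilon>"
proof (cases "h = 0")
  case False
  have "cmod ((step h g1 ^^ 1) z p - (step h g2 ^^ 1) z p - of_nat 1 * h * (g1 z p - g2 z p))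
     \<le> 24 * (real 1)\<^sup>2 * \<kappa>\<^sup>2 * (cmod h)\<^sup>2 * M / \<delta> * \<epsilon>"
    by (rule step_iter_compare) (use assms in auto)
  also have "(step h g1 ^^ 1) z p - (step h g2 ^^ 1) z p - of_nat 1 * h * (g1 z p - g2 z p) = h * (inc h g1 z p - inc h g2 z p - (g1 z p - g2 z p))"
    by (simp add: step_def algebra_simps)
  finally have "cmod h * cmod (inc h g1 z p - inc h g2 z p - (g1 z p - g2 z p)) \<le> cmod h * (24 * \<kappa>\<^sup>2 * cmod h * M / \<delta> * \<epsilon>)"
    by (simp add: norm_mult power2_eq_square mult_ac)
  then show ?thesis by (rule mult_left_le_imp_le) (use False in simp)
qed (use assms in \<open>simp add: inc_0\<close>)

end

section \<open>The complex flow\<close>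

text \<open>The integral along the ray from 0 to \<open>h\<close>, rescaled to the unit interval, is
  the primitive of \<open>k\<close> that vanishes at 0. A fixed interval of integration keeps the
  dependence on parameters simple.\<close>

lemma ray_primitive:
  fixes k :: "complex \<Rightarrow> complex"
  assumes k: "k holomorphic_on ball 0 r" and h: "h \<in> ball 0 r"
  shows "((\<lambda>h. h * integral {0..1} (\<lambda>t. k (of_real t * h))) has_field_derivative k h) (at h)"
proof -
  obtain K where K: "\<And>x. x \<in> ball 0 r \<Longrightarrow> (K has_field_derivative k x) (at x)"
    using holomorphic_convex_primitive'[OF convex_ball open_ball k] by (metis at_within_open open_ball)
  have eq: "K y - K 0 = y * integral {0..1} (\<lambda>t. k (of_real t * y))" if y: "y \<in> ball 0 r" for y
  proof -
    have "((\<lambda>t. y * k (of_real t * y)) has_integral K (of_real 1 * y) - K (of_real 0 * y)) {0..1}"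
    proof (rule fundamental_theorem_of_calculus)
      fix t :: real assume t: "t \<in> {0..1}"
      have "cmod (of_real t * y) < r" using t y mult_left_le_one_le[of "cmod y" t] by (auto simp: norm_mult)
      then have "(K has_field_derivative k (of_real t * y)) (at (of_real t * y))" by (intro K) simp
      then have "((\<lambda>u. K (u * y)) has_field_derivative y * k (of_real t * y)) (at (of_real t))"
        by (rule DERIV_chain2[where g = "\<lambda>u. u * y", THEN DERIV_cong]) (auto intro!: derivative_eq_intros)
      then show "((\<lambda>t. K (of_real t * y)) has_vector_derivative y * k (of_real t * y)) (at t within {0..1})"
        using has_vector_derivative_real_field has_vector_derivative_at_within by blast
    qed auto
    from integral_unique[OF this] show ?thesis by simp
  qed
  have "((\<lambda>y. K y - K 0) has_field_derivative k h) (at h)"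
    using K[OF h] by (auto intro!: derivative_eq_intros)
  then show ?thesis
    by (rule has_field_derivative_transform_within_open[where S = "ball 0 r"]) (use h eq in auto)
qed

lemma Riemann_sum_error:
  fixes f :: "real \<Rightarrow> complex"
  assumes L: "\<And>s t. s \<in> {0..1} \<Longrightarrow> t \<in> {0..1} \<Longrightarrow> cmod (f s - f t) \<le> B * \<bar>s - t\<bar>"
    and B: "0 \<le> B" and N: "0 < N"
  shows "cmod ((\<Sum>i<N. f (real i / real N)) / of_nat N - integral {0..1} f) \<le> B / real N"
proof -
  have cont: "continuous_on {0..1} f"
    by (rule lipschitz_on_continuous_on[of B]) (use L B in \<open>auto simp: lipschitz_on_def dist_norm\<close>)
  have "k \<le> N \<longrightarrow> cmod ((\<Sum>i<k. f (real i / real N)) / of_nat N - integral {0..real k / real N} f) \<le> real k * (B / real N / real N)" for k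
  proof (induction k)
    case (Suc k)
    show ?case
    proof
      assume k: "Suc k \<le> N"
      let ?u = "real k / real N" and ?v = "real (Suc k) / real N"
      have uv: "0 \<le> ?u" "?u \<le> ?v" "?v \<le> 1" "?v - ?u = 1 / real N" using k N by (auto simp: field_simps)
      have ci: "continuous_on {?u..?v} f" using cont by (rule continuous_on_subset) (use uv in auto)
      have ci2: "continuous_on {0..?v} f" using cont by (rule continuous_on_subset) (use uv in auto)
      have "integral {0..?u} f + integral {?u..?v} f = integral {0..?v} f"
        by (rule Henstock_Kurzweil_Integration.integral_combine) (use uv ci2 in \<open>auto intro: integrable_continuous_real\<close>)
      moreover have "cmod (integral {?u..?v} (\<lambda>t. f ?u - f t)) \<le> (B / real N) * (?v - ?u)"
      proof (rule integral_bound)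
        fix t assume t: "t \<in> {?u..?v}"
        then have "t \<in> {0..1}" using uv order_trans[OF uv(1), of t] t by auto
        then have "cmod (f ?u - f t) \<le> B * \<bar>?u - t\<bar>" using uv by (intro L) auto
        also have "\<dots> \<le> B * (1 / real N)" using t uv B by (intro mult_left_mono) auto
        finally show "cmod (f ?u - f t) \<le> B / real N" by simp
      qed (use uv ci in \<open>auto intro!: continuous_intros\<close>)
      moreover have "integral {?u..?v} (\<lambda>t. f ?u - f t) = f ?u / of_nat N - integral {?u..?v} f"
        using ci uv by (subst Henstock_Kurzweil_Integration.integral_diff)
          (auto intro: integrable_continuous_real simp: scaleR_conv_of_real divide_simps)
      ultimately have i1: "cmod (f ?u / of_nat N - integral {?u..?v} f) \<le> B / real N / real N"
        and i2: "integral {0..?v} f = integral {0..?u} f + integral {?u..?v} f"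
        using uv(4) by simp_all
      have eq: "(\<Sum>i<Suc k. f (real i / real N)) / of_nat N - integral {0..?v} f
          = (f ?u / of_nat N - integral {?u..?v} f) + ((\<Sum>i<k. f (real i / real N)) / of_nat N - integral {0..?u} f)"
        unfolding i2 by (simp add: add_divide_distrib)
      have suc: "real (Suc k) * X = X + real k * X" for X by (simp add: algebra_simps)
      have k': "k \<le> N" using k by simp
      show "cmod ((\<Sum>i<Suc k. f (real i / real N)) / of_nat N - integral {0..?v} f) \<le> real (Suc k) * (B / real N / real N)"
        unfolding eq suc by (rule norm_triangle_mono[OF i1 Suc[rule_format, OF k']])
    qed
  qed (use B in auto)
  from this[of N] show ?thesis using N by simp
qed

text \<open>Left Riemann sums are finite sums of holomorphic functions, and the Lipschitz condition
  in \<open>t\<close> gives \<open>N\<close> of their terms the error \<open>B / N\<close>,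
  uniformly in \<open>\<zeta>\<close>.\<close>

lemma holomorphic_integral_Lipschitz:
  assumes "open S" and "\<And>t. t \<in> {0..1} \<Longrightarrow> Q t holomorphic_on S" and "0 \<le> B"
    and "\<And>\<zeta> s t. \<zeta> \<in> S \<Longrightarrow> s \<in> {0..1} \<Longrightarrow> t \<in> {0..1} \<Longrightarrow> cmod (Q s \<zeta> - Q t \<zeta>) \<le> B * \<bar>s - t\<bar>"
  shows "(\<lambda>\<zeta>. integral {0..1} (\<lambda>t. Q t \<zeta>)) holomorphic_on S"
proof (rule holomorphic_limit_rate[OF \<open>open S\<close>, of "\<lambda>n \<zeta>. (\<Sum>i<Suc n. Q (real i / real (Suc n)) \<zeta>) / of_nat (Suc n)"])
  show "(\<lambda>\<zeta>. (\<Sum>i<Suc n. Q (real i / real (Suc n)) \<zeta>) / of_nat (Suc n)) holomorphic_on S" for n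
    by (intro holomorphic_intros assms(2)) (auto simp del: of_nat_Suc)
  show "(\<lambda>n. B / real (Suc n)) \<longlonglongrightarrow> 0" by real_asymp
  show "cmod ((\<Sum>i<Suc n. Q (real i / real (Suc n)) \<zeta>) / of_nat (Suc n) - integral {0..1} (\<lambda>t. Q t \<zeta>)) \<le> B / real (Suc n)"
    if "\<zeta> \<in> S" for n \<zeta>
    by (rule Riemann_sum_error) (use assms that in auto)
qed

section \<open>Picard iteration in complex time\<close>

text \<open>Each iterate integrates the field along the segment from 0 to \<open>h\<close>,
  parametrized over the unit interval, so that \<open>h\<close> may be complex.\<close>

primrec pic :: "(complex nvec \<Rightarrow> complex nvec) \<Rightarrow> nat \<Rightarrow> complex \<Rightarrow> complex nvec \<Rightarrow> complex nvec" where
  "pic F 0 h z = z"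
| "pic F (Suc n) h z = (\<lambda>p. z p + h * integral {0..1} (\<lambda>t. F (pic F n (of_real t * h) z) p))"

definition flowc :: "(complex nvec \<Rightarrow> complex nvec) \<Rightarrow> complex \<Rightarrow> complex nvec \<Rightarrow> complex nvec" where
  "flowc F h z p = lim (\<lambda>n. pic F n h z p)"

text \<open>The counterpart of \<open>inc\<close> for the exact flow, which is
  \<open>z + h * avg F h z\<close>; at \<open>h = 0\<close> it reduces to
  \<open>F z\<close>.\<close>

definition avg :: "(complex nvec \<Rightarrow> complex nvec) \<Rightarrow> complex \<Rightarrow> complex nvec \<Rightarrow> complex nvec" where
  "avg F h z p = integral {0..1} (\<lambda>t. F (flowc F (of_real t * h) z) p)"

text \<open>Curves that start within radius \<open>\<rho>\<close> have one collar
  \<open>\<delta>\<close> for their motion, of which \<open>small\<close> lets them use a quarter,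
  and a second one for the Lipschitz constant \<open>M / \<delta>\<close> of \<open>F\<close>. The
  same condition makes the Picard step contract by 1/4.\<close>

locale picard = dim +
  fixes c :: "complex nvec" and \<rho> \<delta> M r :: real and F :: "complex nvec \<Rightarrow> complex nvec"
  assumes delta: "0 < \<delta>" and M0: "0 \<le> M" and r0: "0 < r" and small: "4 * r * M \<le> \<delta>"
    and F: "hfam {0} (nball D c (\<rho> + 2 * \<delta>)) M (\<lambda>_. F)"
begin

text \<open>Invariants that the Picard step and pointwise limits preserve. They hold for the
  iterates, for the flow and for constant curves, so the integral estimates below are proved once
  for all of these.\<close>

definition good :: "(complex \<Rightarrow> complex nvec \<Rightarrow> complex nvec) \<Rightarrow> bool" where
  "good u \<longleftrightarrow>
    (\<forall>h\<in>ball 0 r. \<forall>z\<in>nball D c \<rho>. u h z \<in> nvecs D \<and> (\<forall>p<D. cmod (u h z p - z p) \<le> cmod h * M)) \<and>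
    (\<forall>h\<in>ball 0 r. \<forall>h'\<in>ball 0 r. \<forall>z\<in>nball D c \<rho>. \<forall>p<D. cmod (u h z p - u h' z p) \<le> M * cmod (h - h')) \<and>
    (\<forall>S \<eta> \<gamma>. open S \<longrightarrow> \<eta> holomorphic_on S \<longrightarrow> \<eta> ` S \<subseteq> ball 0 r \<longrightarrow> hcurve S (nball D c \<rho>) \<gamma> \<longrightarrow>
        (\<forall>p<D. (\<lambda>\<zeta>. u (\<eta> \<zeta>) (\<gamma> \<zeta>) p) holomorphic_on S))"

lemma FLip: "y \<in> nball D c (\<rho> + \<delta>) \<Longrightarrow> w \<in> nball D c (\<rho> + \<delta>) \<Longrightarrow>
   (\<And>q. q < D \<Longrightarrow> cmod (y q - w q) \<le> W) \<Longrightarrow> 0 \<le> W \<Longrightarrow> p < D \<Longrightarrow> cmod (F y p - F w p) \<le> M / \<delta> * W"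
proof -
  assume *: "y \<in> nball D c (\<rho> + \<delta>)" "w \<in> nball D c (\<rho> + \<delta>)" "\<And>q. q < D \<Longrightarrow> cmod (y q - w q) \<le> W" "0 \<le> W" "p < D"
  have "hfun {0} (nball D c (\<rho> + \<delta> + \<delta>)) M (\<lambda>_ z. F z p)"
    using F \<open>p < D\<close> by (simp add: hfam_def add.assoc)
  then show ?thesis by (rule hfun_Lipschitz) (use * delta in simp_all)
qed

lemma rM: "(h::complex) \<in> ball 0 r \<Longrightarrow> 4 * (cmod h * M) \<le> \<delta>"
  using small M0 mult_right_mono[of "cmod h" r M] by (simp add: mult.assoc)

lemma ray: "t \<in> {0..1} \<Longrightarrow> (h::complex) \<in> ball 0 r \<Longrightarrow> of_real t * h \<in> ball 0 r"
  using mult_left_le_one_le[of "cmod h" t] by (auto simp: norm_mult)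

lemma goodD:
  assumes "good u" and "h \<in> ball 0 r" and "z \<in> nball D c \<rho>"
  shows "u h z \<in> nvecs D" and "p < D \<Longrightarrow> cmod (u h z p - z p) \<le> cmod h * M" and "u h z \<in> nball D c (\<rho> + \<delta>)"
    and "h' \<in> ball 0 r \<Longrightarrow> p < D \<Longrightarrow> cmod (u h z p - u h' z p) \<le> M * cmod (h - h')"
    and "F (u h z) \<in> nvecs D" and "p < D \<Longrightarrow> cmod (F (u h z) p) \<le> M"
    and "p < D \<Longrightarrow> cmod (F (u h z) p - F z p) \<le> M / \<delta> * (cmod h * M)"
proof -
  have *: "u h z \<in> nvecs D" "\<And>p. p < D \<Longrightarrow> cmod (u h z p - z p) \<le> cmod h * M" using assms by (auto simp: good_def)
  then show "u h z \<in> nvecs D" and "p < D \<Longrightarrow> cmod (u h z p - z p) \<le> cmod h * M" by auto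
  show u: "u h z \<in> nball D c (\<rho> + \<delta>)"
    by (rule nball_shift[OF assms(3) *]) (use rM[OF assms(2)] delta in auto)
  show "h' \<in> ball 0 r \<Longrightarrow> p < D \<Longrightarrow> cmod (u h z p - u h' z p) \<le> M * cmod (h - h')"
    using assms by (auto simp: good_def)
  have "u h z \<in> nball D c (\<rho> + 2 * \<delta>)" using nball_mono[OF _ u] delta by auto
  then show "F (u h z) \<in> nvecs D" and "p < D \<Longrightarrow> cmod (F (u h z) p) \<le> M"
    using hfam_nvecs[OF F] hfam_bound[OF F] by auto
  show "p < D \<Longrightarrow> cmod (F (u h z) p - F z p) \<le> M / \<delta> * (cmod h * M)"
    by (rule FLip[OF u _ *(2)]) (use nball_mono[OF _ assms(3)] delta M0 in auto)
qed

lemma good_F_hol: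
  assumes u: "good u" and S: "open S" and \<eta>: "\<eta> holomorphic_on S" "\<eta> ` S \<subseteq> ball 0 r" and \<gamma>: "hcurve S (nball D c \<rho>) \<gamma>" and p: "p < D"
  shows "(\<lambda>\<zeta>. F (u (\<eta> \<zeta>) (\<gamma> \<zeta>)) p) holomorphic_on S"
proof -
  have "hcurve S (nball D c (\<rho> + 2 * \<delta>)) (\<lambda>\<zeta>. u (\<eta> \<zeta>) (\<gamma> \<zeta>))"
    unfolding hcurve_def
  proof (intro conjI ballI allI impI)
    fix \<zeta> assume "\<zeta> \<in> S"
    then have "u (\<eta> \<zeta>) (\<gamma> \<zeta>) \<in> nball D c (\<rho> + \<delta>)"
      using \<eta>(2) \<gamma> by (intro goodD(3)[OF u]) (auto simp: hcurve_def)
    then show "u (\<eta> \<zeta>) (\<gamma> \<zeta>) \<in> nball D c (\<rho> + 2 * \<delta>)"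
      by (rule nball_mono[rotated]) (use delta in auto)
  qed (use assms in \<open>auto simp: good_def\<close>)
  then show ?thesis
    using hfun_hol[of "{0}" _ M "\<lambda>_ z. F z p" S "\<lambda>_. 0"] F S p by (auto simp: hfam_def)
qed

lemma good_F_disc: "good u \<Longrightarrow> z \<in> nball D c \<rho> \<Longrightarrow> p < D \<Longrightarrow> (\<lambda>h. F (u h z) p) holomorphic_on ball 0 r"
  by (rule good_F_hol[where \<eta> = "\<lambda>h. h" and \<gamma> = "\<lambda>_. z"]) (auto intro: hcurve_const)

lemma good_F_Lip:
  assumes u: "good u" and "z \<in> nball D c \<rho>" and h: "h \<in> ball 0 r" and "p < D" and st: "s \<in> {0..1}" "t \<in> {0..1}"
  shows "cmod (F (u (of_real s * h) z) p - F (u (of_real t * h) z) p) \<le> M / \<delta> * (M * r) * \<bar>s - t\<bar>"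
proof -
  have "cmod (u (of_real s * h) z q - u (of_real t * h) z q) \<le> M * r * \<bar>s - t\<bar>" if "q < D" for q
  proof -
    have "cmod (u (of_real s * h) z q - u (of_real t * h) z q) \<le> M * cmod (of_real s * h - of_real t * h)"
      using assms ray that by (intro goodD(4)) auto
    also have "cmod (of_real s * h - of_real t * h) = \<bar>s - t\<bar> * cmod h"
      by (simp flip: left_diff_distrib of_real_diff add: norm_mult)
    also have "M * (\<bar>s - t\<bar> * cmod h) \<le> M * (\<bar>s - t\<bar> * r)" using h M0 by (intro mult_left_mono) auto
    finally show ?thesis by (simp add: mult_ac)
  qed
  from FLip[OF goodD(3)[OF u ray] goodD(3)[OF u ray] this] show ?thesis
    using assms M0 r0 by (simp add: mult_ac)
qed

lemma good_F_cont:
  assumes "good u" and "z \<in> nball D c \<rho>" and "h \<in> ball 0 r"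
  shows "continuous_on {0..1} (\<lambda>t. F (u (of_real t * h) z) p)"
proof (cases "p < D")
  case True
  show ?thesis
    by (rule lipschitz_on_continuous_on[of "M / \<delta> * (M * r)"])
      (use good_F_Lip[OF assms True] M0 delta r0 in \<open>auto simp: lipschitz_on_def dist_norm\<close>)
next
  case False
  have z0: "F (u (of_real t * h) z) p = 0" if "t \<in> {0..1}" for t
    using goodD(5)[OF assms(1) ray[OF that assms(3)] assms(2)] False by (simp add: nvecs_def)
  show ?thesis by (rule continuous_on_eq[of "{0..1}" "\<lambda>_. 0"]) (use z0 in auto)
qed

lemma good_integral_bound:
  assumes "good u" and "z \<in> nball D c \<rho>" and "h \<in> ball 0 r"
  shows "p < D \<Longrightarrow> cmod (integral {0..1} (\<lambda>t. F (u (of_real t * h) z) p)) \<le> M"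
    and "\<not> p < D \<Longrightarrow> integral {0..1} (\<lambda>t. F (u (of_real t * h) z) p) = 0"
proof -
  assume "p < D"
  have "cmod (integral {0..1} (\<lambda>t. F (u (of_real t * h) z) p)) \<le> M * (1 - 0)"
    by (rule integral_bound) (use good_F_cont[OF assms] goodD(6)[OF assms(1) ray assms(2)] assms \<open>p < D\<close> in auto)
  then show "cmod (integral {0..1} (\<lambda>t. F (u (of_real t * h) z) p)) \<le> M" by simp
next
  assume "\<not> p < D"
  then have "F (u (of_real t * h) z) p = 0" if "t \<in> {0..1}" for t
    using goodD(5)[OF assms(1) ray[OF that assms(3)] assms(2)] by (simp add: nvecs_def)
  then have "integral {0..1} (\<lambda>t. F (u (of_real t * h) z) p) = integral {0..1} (\<lambda>t::real. 0)"
    by (intro Henstock_Kurzweil_Integration.integral_cong) auto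
  then show "integral {0..1} (\<lambda>t. F (u (of_real t * h) z) p) = 0" by simp
qed

lemma good_integral_diff:
  assumes "good u" "good u'" and "z \<in> nball D c \<rho>" and h: "h \<in> ball 0 r" and "p < D" and "0 \<le> W"
    and W: "\<And>t q. t \<in> {0..1} \<Longrightarrow> q < D \<Longrightarrow> cmod (u (of_real t * h) z q - u' (of_real t * h) z q) \<le> W"
  shows "cmod (integral {0..1} (\<lambda>t. F (u (of_real t * h) z) p) - integral {0..1} (\<lambda>t. F (u' (of_real t * h) z) p)) \<le> M / \<delta> * W"
proof -
  note c = good_F_cont[OF assms(1,3,4), of p] good_F_cont[OF assms(2,3,4), of p]
  have "cmod (integral {0..1} (\<lambda>t. F (u (of_real t * h) z) p - F (u' (of_real t * h) z) p)) \<le> M / \<delta> * W * (1 - 0)"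
  proof (rule integral_bound)
    fix t :: real assume t: "t \<in> {0..1}"
    show "cmod (F (u (of_real t * h) z) p - F (u' (of_real t * h) z) p) \<le> M / \<delta> * W"
      by (rule FLip[OF goodD(3)[OF assms(1) ray[OF t h]] goodD(3)[OF assms(2) ray[OF t h]]])
        (use assms t in auto)
  qed (use c in \<open>auto intro!: continuous_intros\<close>)
  then show ?thesis
    using Henstock_Kurzweil_Integration.integral_diff[OF integrable_continuous_real[OF c(1)] integrable_continuous_real[OF c(2)]] by simp
qed

lemma good_integral_hol:
  assumes u: "good u" and S: "open S" and \<eta>: "\<eta> holomorphic_on S" "\<eta> ` S \<subseteq> ball 0 r" and \<gamma>: "hcurve S (nball D c \<rho>) \<gamma>" and p: "p < D"
  shows "(\<lambda>\<zeta>. integral {0..1} (\<lambda>t. F (u (of_real t * \<eta> \<zeta>) (\<gamma> \<zeta>)) p)) holomorphic_on S"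
proof (rule holomorphic_integral_Lipschitz[OF S, where B = "M / \<delta> * (M * r)"])
  fix t :: real assume t: "t \<in> {0..1}"
  show "(\<lambda>\<zeta>. F (u (of_real t * \<eta> \<zeta>) (\<gamma> \<zeta>)) p) holomorphic_on S"
  proof (rule good_F_hol[OF u S _ _ \<gamma> p])
    show "(\<lambda>\<zeta>. of_real t * \<eta> \<zeta>) ` S \<subseteq> ball 0 r" using \<eta>(2) ray[OF t] by blast
  qed (intro holomorphic_intros \<eta>)
next
  fix \<zeta> and s t :: real assume "\<zeta> \<in> S" "s \<in> {0..1}" "t \<in> {0..1}"
  then show "cmod (F (u (of_real s * \<eta> \<zeta>) (\<gamma> \<zeta>)) p - F (u (of_real t * \<eta> \<zeta>) (\<gamma> \<zeta>)) p) \<le> M / \<delta> * (M * r) * \<bar>s - t\<bar>"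
    using \<eta> \<gamma> p by (intro good_F_Lip[OF u]) (auto simp: hcurve_def)
qed (use M0 delta r0 in auto)

text \<open>For an iterate this bounds the speed of the next one; for the limit it becomes the
  differential equation of the flow.\<close>

lemma good_integral_deriv:
  assumes "good u" and "z \<in> nball D c \<rho>" and "p < D" and "h \<in> ball 0 r"
  shows "((\<lambda>h. z p + h * integral {0..1} (\<lambda>t. F (u (of_real t * h) z) p)) has_field_derivative F (u h z) p) (at h)"
  using DERIV_add[OF DERIV_const[of "z p"] ray_primitive[OF good_F_disc[OF assms(1-3)] assms(4)]] by simp

lemma good_pic: "good (pic F n)"
proof (induction n)
  case 0
  then show ?case using M0 by (auto simp: good_def hcurve_def dest: nball_nvecs)
next
  case (Suc n)
  show ?case unfolding good_def
  proof (intro conjI ballI allI impI)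
    fix h z assume h: "h \<in> ball (0::complex) r" and z: "z \<in> nball D c \<rho>"
    show "pic F (Suc n) h z \<in> nvecs D"
      using good_integral_bound(2)[OF Suc z h] nball_nvecs[OF z] by (auto simp: nvecs_def)
    fix p assume p: "p < D"
    show "cmod (pic F (Suc n) h z p - z p) \<le> cmod h * M"
      using mult_left_mono[OF good_integral_bound(1)[OF Suc z h p], of "cmod h"] by (simp add: norm_mult)
    fix h' assume h': "h' \<in> ball (0::complex) r"
    show "cmod (pic F (Suc n) h z p - pic F (Suc n) h' z p) \<le> M * cmod (h - h')"
    proof (rule field_differentiable_bound[where S = "ball 0 r"])
      fix y assume y: "y \<in> ball (0::complex) r"
      show "((\<lambda>h. pic F (Suc n) h z p) has_field_derivative F (pic F n y z) p) (at y within ball 0 r)"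
        using good_integral_deriv[OF Suc z p y] by (simp add: has_field_derivative_at_within)
      show "cmod (F (pic F n y z) p) \<le> M" by (rule goodD(6)[OF Suc y z p])
    qed (use h h' in auto)
  next
    fix S \<eta> \<gamma> p assume *: "open S" "\<eta> holomorphic_on S" "\<eta> ` S \<subseteq> ball 0 r" "hcurve S (nball D c \<rho>) \<gamma>" "p < D"
    then show "(\<lambda>\<zeta>. pic F (Suc n) (\<eta> \<zeta>) (\<gamma> \<zeta>) p) holomorphic_on S"
      using good_integral_hol[OF Suc *] by (auto intro!: holomorphic_intros simp: hcurve_def)
  qed
qed

lemma pic_diff:
  assumes "z \<in> nball D c \<rho>" and "p < D"
  shows "h \<in> ball 0 r \<Longrightarrow> cmod (pic F (Suc n) h z p - pic F n h z p) \<le> \<delta> / 4 / 2 ^ n"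
  using assms(2)
proof (induction n arbitrary: h p)
  case 0
  then show ?case using goodD(2)[OF good_pic[of "Suc 0"] _ assms(1), of h p] rM[of h] by simp
next
  case (Suc n)
  have "cmod (integral {0..1} (\<lambda>t. F (pic F (Suc n) (of_real t * h) z) p) - integral {0..1} (\<lambda>t. F (pic F n (of_real t * h) z) p)) \<le> M / \<delta> * (\<delta> / 4 / 2 ^ n)"
    by (rule good_integral_diff[OF good_pic good_pic assms(1)]) (use Suc ray delta in \<open>auto simp del: pic.simps\<close>)
  then have "cmod h * cmod (integral {0..1} (\<lambda>t. F (pic F (Suc n) (of_real t * h) z) p) - integral {0..1} (\<lambda>t. F (pic F n (of_real t * h) z) p)) \<le> cmod h * (M / \<delta> * (\<delta> / 4 / 2 ^ n))"
    by (rule mult_left_mono) simp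
  also have "\<dots> = (cmod h * M) / 4 / 2 ^ n" using delta by simp
  also have "\<dots> \<le> \<delta> / 8 / 2 ^ n"
  proof (rule divide_right_mono)
    show "cmod h * M / 4 \<le> \<delta> / 8" using rM[OF Suc.prems(1)] mult_nonneg_nonneg[OF norm_ge_zero[of h] M0] by linarith
  qed simp
  also have "\<dots> = \<delta> / 4 / 2 ^ Suc n" by simp
  finally show ?case by (simp add: norm_mult flip: right_diff_distrib)
qed

lemma pic_flowc:
  assumes "z \<in> nball D c \<rho>" and "h \<in> ball 0 r"
  shows "p < D \<Longrightarrow> cmod (pic F n h z p - flowc F h z p) \<le> 2 * (\<delta> / 4) / 2 ^ n"
    and "p < D \<Longrightarrow> (\<lambda>n. pic F n h z p) \<longlonglongrightarrow> flowc F h z p"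
    and "\<not> p < D \<Longrightarrow> flowc F h z p = 0"
proof -
  { assume p: "p < D"
    note g = geometric_limit[of "\<lambda>n. pic F n h z p" "\<delta> / 4", OF pic_diff[OF assms(1) p assms(2)]]
    show "cmod (pic F n h z p - flowc F h z p) \<le> 2 * (\<delta> / 4) / 2 ^ n" unfolding flowc_def by (rule g(1))
    show "(\<lambda>n. pic F n h z p) \<longlonglongrightarrow> flowc F h z p" unfolding flowc_def by (rule g(2)) }
  show "\<not> p < D \<Longrightarrow> flowc F h z p = 0"
    unfolding flowc_def using goodD(1)[OF good_pic assms(2,1)] by (simp add: nvecs_def)
qed

lemma good_flowc: "good (flowc F)"
  unfolding good_def
proof (intro conjI ballI allI impI)
  fix h z assume h: "h \<in> ball (0::complex) r" and z: "z \<in> nball D c \<rho>"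
  note pf = pic_flowc[OF z]
  show "flowc F h z \<in> nvecs D" using pf(3)[OF h] by (auto simp: nvecs_def)
  fix p assume p: "p < D"
  have "(\<lambda>n. cmod (pic F n h z p - z p)) \<longlonglongrightarrow> cmod (flowc F h z p - z p)" by (intro tendsto_intros pf h p)
  then show "cmod (flowc F h z p - z p) \<le> cmod h * M"
    using goodD(2)[OF good_pic h z p] by (intro LIMSEQ_le_const2) auto
  fix h' assume h': "h' \<in> ball (0::complex) r"
  have "(\<lambda>n. cmod (pic F n h z p - pic F n h' z p)) \<longlonglongrightarrow> cmod (flowc F h z p - flowc F h' z p)"
    by (intro tendsto_intros pf h h' p)
  then show "cmod (flowc F h z p - flowc F h' z p) \<le> M * cmod (h - h')"
    using goodD(4)[OF good_pic h z h' p] by (intro LIMSEQ_le_const2) auto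
next
  fix S \<eta> \<gamma> p assume *: "open S" "\<eta> holomorphic_on S" "\<eta> ` S \<subseteq> ball 0 r" "hcurve S (nball D c \<rho>) \<gamma>" "p < D"
  show "(\<lambda>\<zeta>. flowc F (\<eta> \<zeta>) (\<gamma> \<zeta>) p) holomorphic_on S"
  proof (rule holomorphic_limit_rate[OF *(1)])
    show "(\<lambda>\<zeta>. pic F n (\<eta> \<zeta>) (\<gamma> \<zeta>) p) holomorphic_on S" for n using good_pic * by (auto simp: good_def)
    show "(\<lambda>n. 2 * (\<delta> / 4) / 2 ^ n) \<longlonglongrightarrow> 0" by (rule LIMSEQ_divide_realpow_zero) simp
    show "cmod (pic F n (\<eta> \<zeta>) (\<gamma> \<zeta>) p - flowc F (\<eta> \<zeta>) (\<gamma> \<zeta>) p) \<le> 2 * (\<delta> / 4) / 2 ^ n" if "\<zeta> \<in> S" for n \<zeta>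
      by (rule pic_flowc(1)) (use * that in \<open>auto simp: hcurve_def\<close>)
  qed
qed

text \<open>Both sides of the Picard recursion pass to the limit; the integrals converge because
  \<open>F\<close> is Lipschitz and the iterates converge uniformly along the ray.\<close>

lemma flowc_eq_avg:
  assumes z: "z \<in> nball D c \<rho>" and h: "h \<in> ball 0 r"
  shows "flowc F h z p = z p + h * avg F h z p"
proof (cases "p < D")
  case p: True
  have "(\<lambda>n. integral {0..1} (\<lambda>t. F (pic F n (of_real t * h) z) p) - avg F h z p) \<longlonglongrightarrow> 0"
  proof (rule Lim_null_comparison)
    have "cmod (integral {0..1} (\<lambda>t. F (pic F n (of_real t * h) z) p) - avg F h z p) \<le> M / \<delta> * (2 * (\<delta> / 4) / 2 ^ n)" for n
      unfolding avg_def
      by (rule good_integral_diff[OF good_pic good_flowc z h p]) (use pic_flowc(1)[OF z ray[OF _ h]] delta in auto)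
    then show "\<forall>\<^sub>F n in sequentially. norm (integral {0..1} (\<lambda>t. F (pic F n (of_real t * h) z) p) - avg F h z p) \<le> M / \<delta> * (2 * (\<delta> / 4)) / 2 ^ n"
      by (intro always_eventually) simp
    show "(\<lambda>n. M / \<delta> * (2 * (\<delta> / 4)) / 2 ^ n) \<longlonglongrightarrow> 0" by (rule LIMSEQ_divide_realpow_zero) simp
  qed
  then have "(\<lambda>n. integral {0..1} (\<lambda>t. F (pic F n (of_real t * h) z) p)) \<longlonglongrightarrow> avg F h z p" using LIM_zero_iff by blast
  then have "(\<lambda>n. pic F (Suc n) h z p) \<longlonglongrightarrow> z p + h * avg F h z p" by (auto intro!: tendsto_intros)
  then show ?thesis using LIMSEQ_Suc[OF pic_flowc(2)[OF z h p]] LIMSEQ_unique by blast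
next
  case False
  then show ?thesis
    using pic_flowc(3)[OF z h] good_integral_bound(2)[OF good_flowc z h] nball_nvecs[OF z] by (simp add: avg_def nvecs_def)
qed

lemma flowc_deriv:
  assumes "z \<in> nball D c \<rho>" and "h \<in> ball 0 r" and "p < D"
  shows "((\<lambda>h. flowc F h z p) has_field_derivative F (flowc F h z) p) (at h)"
proof -
  have "((\<lambda>h. z p + h * avg F h z p) has_field_derivative F (flowc F h z) p) (at h)"
    unfolding avg_def by (rule good_integral_deriv[OF good_flowc assms(1,3,2)])
  then show ?thesis
    by (rule has_field_derivative_transform_within_open[where S = "ball 0 r"]) (use assms(2) in \<open>simp_all add: flowc_eq_avg[OF assms(1)]\<close>)
qed

lemma avg_hfam: "hfam (ball 0 r) (nball D c \<rho>) M (avg F)"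
  unfolding hfam_def
proof (intro conjI ballI allI impI)
  fix h z assume "h \<in> ball (0::complex) r" and "z \<in> nball D c \<rho>"
  then show "avg F h z \<in> nvecs D" using good_integral_bound(2)[OF good_flowc] by (auto simp: nvecs_def avg_def)
next
  fix p assume "p < D"
  then show "hfun (ball 0 r) (nball D c \<rho>) M (\<lambda>h z. avg F h z p)"
    unfolding avg_def by (intro hfunI good_integral_bound(1)[OF good_flowc] good_integral_hol[OF good_flowc])
qed

lemma avg_near:
  assumes z: "z \<in> nball D c \<rho>" and h: "h \<in> ball 0 r" and p: "p < D"
  shows "cmod (avg F h z p - F z p) \<le> M\<^sup>2 / \<delta> * cmod h"
proof -
  \<comment> \<open>Constant curves serve as the second family in the comparison of integrals, so
    that the second integral is \<open>F z\<close>.\<close>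
  have gid: "good (\<lambda>h z. z)" using M0 by (auto simp: good_def hcurve_def dest: nball_nvecs)
  have "cmod (integral {0..1} (\<lambda>t. F (flowc F (of_real t * h) z) p) - integral {0..1} (\<lambda>t::real. F z p)) \<le> M / \<delta> * (cmod h * M)"
  proof (rule good_integral_diff[OF good_flowc gid z h p])
    fix t :: real and q assume t: "t \<in> {0..1}" and q: "q < D"
    have "cmod (flowc F (of_real t * h) z q - z q) \<le> cmod (of_real t * h) * M"
      by (rule goodD(2)[OF good_flowc ray[OF t h] z q])
    also have "\<dots> \<le> cmod h * M" using t M0 by (intro mult_right_mono) (auto simp: norm_mult mult_left_le_one_le)
    finally show "cmod (flowc F (of_real t * h) z q - z q) \<le> cmod h * M" .
  qed (use M0 in auto)
  then show ?thesis by (simp add: avg_def power2_eq_square mult_ac)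
qed

end

section \<open>Uniqueness of solutions\<close>

lemma vector_derivative_bound:
  fixes f :: "real \<Rightarrow> 'b::real_normed_vector"
  assumes "convex S" and "\<And>x. x \<in> S \<Longrightarrow> (f has_vector_derivative f' x) (at x within S)"
    and "\<And>x. x \<in> S \<Longrightarrow> norm (f' x) \<le> B" and "x \<in> S" and "y \<in> S"
  shows "norm (f x - f y) \<le> B * \<bar>x - y\<bar>"
proof -
  have "norm (f x - f y) \<le> B * norm (x - y)"
  proof (rule differentiable_bound[OF assms(1), where f' = "\<lambda>x h. h *\<^sub>R f' x"])
    fix z assume z: "z \<in> S"
    show "(f has_derivative (\<lambda>h. h *\<^sub>R f' z)) (at z within S)"
      using assms(2)[OF z] by (simp add: has_vector_derivative_def)
    show "onorm (\<lambda>h. h *\<^sub>R f' z) \<le> B"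
    proof (rule onorm_le)
      fix x :: real
      show "norm (x *\<^sub>R f' z) \<le> B * norm x"
        using mult_left_mono[OF assms(3)[OF z], of "\<bar>x\<bar>"] by (simp add: mult.commute)
    qed
  qed (use assms in auto)
  then show ?thesis by simp
qed

definition solution_on :: "real set \<Rightarrow> ('a::real_normed_vector nvec \<Rightarrow> 'a nvec) \<Rightarrow> (real \<Rightarrow> 'a nvec) \<Rightarrow> bool" where
  "solution_on S g u \<longleftrightarrow> (\<forall>\<tau>\<in>S. \<forall>p. ((\<lambda>\<sigma>. u \<sigma> p) has_vector_derivative g (u \<tau>) p) (at \<tau> within S))"

text \<open>The description in \<open>flow\<close> selects an endpoint, not a curve; hence
  competitors are compared at time \<open>t\<close> alone.\<close>

lemma flow_eqI:
  assumes "u 0 = z" and "\<And>\<tau>. \<tau> \<in> closed_segment 0 t \<Longrightarrow> u \<tau> \<in> U" and "solution_on (closed_segment 0 t) g u"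
    and "\<And>v. v 0 = z \<Longrightarrow> (\<And>\<tau>. \<tau> \<in> closed_segment 0 t \<Longrightarrow> v \<tau> \<in> U) \<Longrightarrow> solution_on (closed_segment 0 t) g v \<Longrightarrow> v t = u t"
  shows "flow U g t z = u t"
  unfolding flow_def
proof (rule the_equality)
  show "\<exists>v. v 0 = z \<and> v t = u t \<and> (\<forall>\<tau>\<in>closed_segment 0 t. v \<tau> \<in> U \<and>
     (\<forall>p. ((\<lambda>\<sigma>. v \<sigma> p) has_vector_derivative g (v \<tau>) p) (at \<tau> within closed_segment 0 t)))"
    by (rule exI[of _ u]) (use assms(1-3) in \<open>auto simp: solution_on_def\<close>)
qed (use assms(4) in \<open>auto simp: solution_on_def\<close>)

context picard
begin

text \<open>The time is so short that \<open>\<bar>t\<bar> * M / \<delta>\<close> is at most 1/4.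
  Feeding a bound on the distance of two solutions into the mean value inequality therefore divides
  it by 4; the diameter of the ball is the first bound.\<close>

lemma solution_unique:
  assumes "t \<in> S" and S: "S = closed_segment 0 t" and t: "\<bar>t\<bar> < r"
    and u: "\<And>\<tau>. \<tau> \<in> S \<Longrightarrow> u \<tau> \<in> nball D c (\<rho> + \<delta>)" "solution_on S F u"
    and v: "\<And>\<tau>. \<tau> \<in> S \<Longrightarrow> v \<tau> \<in> nball D c (\<rho> + \<delta>)" "solution_on S F v"
    and "u 0 = v 0"
  shows "u t = v t"
proof
  fix p
  have conv: "convex S" and "0 \<in> S" by (auto simp: S)
  have tM: "4 * (\<bar>\<tau>\<bar> * M) \<le> \<delta>" if "\<tau> \<in> S" for \<tau>
  proof -
    have "\<bar>\<tau>\<bar> \<le> \<bar>t\<bar>" using that segment_bound(1)[of \<tau> 0 t] by (simp add: S)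
    then show ?thesis using t rM[of "of_real \<tau>"] by simp
  qed
  have "\<forall>\<tau>\<in>S. \<forall>p<D. cmod (u \<tau> p - v \<tau> p) \<le> 2 * \<bar>\<rho> + \<delta>\<bar> / 4 ^ n" for n
  proof (induction n)
    case 0
    show ?case
    proof (intro ballI allI impI)
      fix \<tau> p assume "\<tau> \<in> S" "p < D"
      then have "cmod (u \<tau> p - c p) < \<rho> + \<delta>" "cmod (v \<tau> p - c p) < \<rho> + \<delta>" using u(1) v(1) by (auto simp: in_nball_iff)
      then show "cmod (u \<tau> p - v \<tau> p) \<le> 2 * \<bar>\<rho> + \<delta>\<bar> / 4 ^ 0"
        using norm_triangle_ineq4[of "u \<tau> p - c p" "v \<tau> p - c p"] abs_ge_self[of "\<rho> + \<delta>"] by auto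
    qed
  next
    case (Suc n)
    show ?case
    proof (intro ballI allI impI)
      fix \<tau> p assume \<tau>: "\<tau> \<in> S" and p: "p < D"
      let ?W = "2 * \<bar>\<rho> + \<delta>\<bar> / 4 ^ n"
      have "cmod ((u \<tau> p - v \<tau> p) - (u 0 p - v 0 p)) \<le> M / \<delta> * ?W * \<bar>\<tau> - 0\<bar>"
      proof (rule vector_derivative_bound[OF conv _ _ \<tau> \<open>0 \<in> S\<close>])
        fix x assume x: "x \<in> S"
        show "((\<lambda>x. u x p - v x p) has_vector_derivative F (u x) p - F (v x) p) (at x within S)"
          using u(2) v(2) x by (auto simp: solution_on_def intro!: has_vector_derivative_diff)
        show "cmod (F (u x) p - F (v x) p) \<le> M / \<delta> * ?W"
          by (rule FLip[OF u(1)[OF x] v(1)[OF x]]) (use Suc x p in auto)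
      qed
      also have "\<dots> = (\<bar>\<tau>\<bar> * M) / \<delta> * ?W" by simp
      also have "\<dots> \<le> 1 / 4 * ?W"
        using tM[OF \<tau>] delta by (intro mult_right_mono) (auto simp: field_simps)
      finally show "cmod (u \<tau> p - v \<tau> p) \<le> 2 * \<bar>\<rho> + \<delta>\<bar> / 4 ^ Suc n" using assms(8) by simp
    qed
  qed
  then have *: "cmod (u t p - v t p) \<le> 2 * \<bar>\<rho> + \<delta>\<bar> / 4 ^ n" if "p < D" for n using that \<open>t \<in> S\<close> by blast
  show "u t p = v t p"
  proof (cases "p < D")
    case True
    have "(\<lambda>n. 2 * \<bar>\<rho> + \<delta>\<bar> / 4 ^ n) \<longlonglongrightarrow> 0" by (rule LIMSEQ_divide_realpow_zero) simp
    then have "cmod (u t p - v t p) \<le> 0" by (rule LIMSEQ_le_const) (use *[OF True] in auto)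
    then show ?thesis by simp
  next
    case False
    then show ?thesis using nball_nvecs[OF u(1)] nball_nvecs[OF v(1)] \<open>t \<in> S\<close> by (auto simp: nvecs_def)
  qed
qed

lemma flowc_0: "z \<in> nball D c \<rho> \<Longrightarrow> flowc F 0 z = z"
  using flowc_eq_avg[of z 0] r0 by (auto simp: fun_eq_iff)

lemma flowc_solution:
  assumes z: "z \<in> nball D c \<rho>" and t: "\<And>\<tau>. \<tau> \<in> S \<Longrightarrow> \<bar>t0 + \<tau>\<bar> < r"
  shows "solution_on S F (\<lambda>\<tau>. flowc F (of_real (t0 + \<tau>)) z)"
  unfolding solution_on_def
proof (intro ballI allI)
  fix \<tau> p assume \<tau>: "\<tau> \<in> S"
  then have h: "complex_of_real (t0 + \<tau>) \<in> ball 0 r" using t by (simp del: of_real_add)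
  show "((\<lambda>\<sigma>. flowc F (of_real (t0 + \<sigma>)) z p) has_vector_derivative F (flowc F (of_real (t0 + \<tau>)) z) p) (at \<tau> within S)"
  proof (cases "p < D")
    case True
    have "((\<lambda>y. flowc F (of_real t0 + y) z p) has_field_derivative F (flowc F (of_real (t0 + \<tau>)) z) p * 1) (at (of_real \<tau>))"
      by (rule DERIV_chain2[where f = "\<lambda>h. flowc F h z p" and g = "\<lambda>y. of_real t0 + y"])
        (use flowc_deriv[OF z h True] in \<open>auto intro!: derivative_eq_intros\<close>)
    then show ?thesis
      using has_vector_derivative_real_field has_vector_derivative_at_within by fastforce
  next
    case False
    have z0: "flowc F (of_real (t0 + \<sigma>)) z p = 0" if "\<sigma> \<in> S" for \<sigma>
      using goodD(1)[OF good_flowc _ z, of "of_real (t0 + \<sigma>)"] t[OF that] False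
      by (simp add: nvecs_def del: of_real_add)
    have "((\<lambda>\<sigma>. 0) has_vector_derivative (0::complex)) (at \<tau> within S)" by simp
    then have "((\<lambda>\<sigma>. flowc F (of_real (t0 + \<sigma>)) z p) has_vector_derivative 0) (at \<tau> within S)"
      by (rule has_vector_derivative_transform[OF \<tau>, rotated]) (use z0 in auto)
    moreover have "F (flowc F (of_real (t0 + \<tau>)) z) p = 0"
      using goodD(5)[OF good_flowc h z] False by (simp add: nvecs_def)
    ultimately show ?thesis by simp
  qed
qed

lemma seg_r: "\<bar>t\<bar> < r \<Longrightarrow> \<tau> \<in> closed_segment 0 t \<Longrightarrow> \<bar>\<tau>\<bar> < r"
  using segment_bound(1)[of \<tau> 0 t] by simp

lemma flow_eq_flowc:
  assumes z: "z \<in> nball D c \<rho>" and t: "\<bar>t\<bar> < r"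
  shows "flow (nball D c (\<rho> + 2 * \<delta>)) F t z = flowc F (of_real t) z"
proof (rule flow_eqI[where u = "\<lambda>\<tau>. flowc F (of_real \<tau>) z"])
  let ?S = "closed_segment 0 t"
  have in1: "flowc F (of_real \<tau>) z \<in> nball D c (\<rho> + \<delta>)" if "\<tau> \<in> ?S" for \<tau>
    using seg_r[OF t that] by (intro goodD(3)[OF good_flowc _ z]) simp
  show "flowc F (of_real 0) z = z" using flowc_0[OF z] by simp
  show "flowc F (of_real \<tau>) z \<in> nball D c (\<rho> + 2 * \<delta>)" if "\<tau> \<in> ?S" for \<tau>
    using nball_mono[OF _ in1[OF that]] delta by auto
  have sol: "solution_on ?S F (\<lambda>\<tau>. flowc F (of_real \<tau>) z)"
    using flowc_solution[OF z, of ?S 0] seg_r[OF t] by simp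
  then show "solution_on ?S F (\<lambda>\<tau>. flowc F (of_real \<tau>) z)" .
  fix v assume v: "v 0 = z" "\<And>\<tau>. \<tau> \<in> ?S \<Longrightarrow> v \<tau> \<in> nball D c (\<rho> + 2 * \<delta>)" "solution_on ?S F v"
  \<comment> \<open>A competitor is only known to remain in the large ball, where \<open>F\<close>
    is bounded but its Lipschitz constant is not. The bound on its speed confines it to the smaller
    ball, where uniqueness applies.\<close>
  have "v \<tau> \<in> nball D c (\<rho> + \<delta>)" if \<tau>: "\<tau> \<in> ?S" for \<tau>
  proof (rule nball_shift[OF z])
    fix p assume p: "p < D"
    have "cmod (v \<tau> p - v 0 p) \<le> M * \<bar>\<tau> - 0\<bar>"
      by (rule vector_derivative_bound[where S = ?S and f' = "\<lambda>x. F (v x) p"])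
        (use v \<tau> hfam_bound[OF F _ v(2) p] in \<open>auto simp: solution_on_def\<close>)
    also have "\<dots> \<le> \<delta>" using rM[of "of_real \<tau>"] seg_r[OF t \<tau>] M0 delta by (simp add: mult.commute)
    finally show "cmod (v \<tau> p - z p) \<le> \<delta>" using v by simp
  qed (use v(2)[OF \<tau>] nball_nvecs in auto)
  then show "v t = flowc F (of_real t) z"
    using v sol in1 flowc_0[OF z]
    by (intro solution_unique[OF _ refl t, of v "\<lambda>\<tau>. flowc F (of_real \<tau>) z"]) auto
qed

text \<open>Uniqueness, applied to the solution restarted at time \<open>t\<close>. Starting within
  radius \<open>\<rho> - \<delta>\<close> keeps the point of restart within radius
  \<open>\<rho>\<close>.\<close>

lemma flowc_add:
  assumes z: "z \<in> nball D c (\<rho> - \<delta>)" and h: "0 \<le> h" and t: "0 \<le> t" "h + t < r"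
  shows "flowc F (of_real (t + h)) z = flowc F (of_real h) (flowc F (of_real t) z)"
proof -
  let ?S = "closed_segment 0 h"
  have S: "0 \<le> \<tau>" "\<tau> \<le> h" if "\<tau> \<in> ?S" for \<tau>
    using that h by (auto simp: closed_segment_eq_real_ivl)
  have z': "z \<in> nball D c \<rho>" using nball_mono[OF _ z] delta by auto
  have tr: "complex_of_real \<tau> \<in> ball 0 r" if "0 \<le> \<tau>" "\<tau> \<le> t + h" for \<tau> using that assms by simp
  define y where "y = flowc F (of_real t) z"
  have y: "y \<in> nball D c \<rho>"
    unfolding y_def
    by (rule nball_shift[OF z goodD(1,2)[OF good_flowc tr z']]) (use rM[OF tr[of t]] M0 delta assms in \<open>auto simp: mult_ac intro: order_trans[rotated]\<close>)
  have "(\<lambda>\<tau>. flowc F (of_real (t + \<tau>)) z) h = (\<lambda>\<tau>. flowc F (of_real (0 + \<tau>)) y) h"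
  proof (rule solution_unique[OF _ refl, where u = "\<lambda>\<tau>. flowc F (of_real (t + \<tau>)) z" and v = "\<lambda>\<tau>. flowc F (of_real (0 + \<tau>)) y"])
    show "solution_on ?S F (\<lambda>\<tau>. flowc F (of_real (t + \<tau>)) z)"
      by (rule flowc_solution[OF z']) (use S assms in fastforce)
    show "solution_on ?S F (\<lambda>\<tau>. flowc F (of_real (0 + \<tau>)) y)"
      by (rule flowc_solution[OF y]) (use S assms in fastforce)
    show "flowc F (of_real (t + 0)) z = flowc F (of_real (0 + 0)) y" using flowc_0[OF y] by (simp add: y_def)
    fix \<tau> assume \<tau>: "\<tau> \<in> ?S"
    show "flowc F (of_real (t + \<tau>)) z \<in> nball D c (\<rho> + \<delta>)"
      by (rule goodD(3)[OF good_flowc tr z']) (use S[OF \<tau>] t in auto)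
    show "flowc F (of_real (0 + \<tau>)) y \<in> nball D c (\<rho> + \<delta>)"
      by (rule goodD(3)[OF good_flowc tr y]) (use S[OF \<tau>] t in auto)
  qed (use assms in auto)
  then show ?thesis by (simp add: y_def)
qed

subsection \<open>Real vector fields\<close>

context
  fixes f :: "real nvec \<Rightarrow> real nvec"
  assumes f: "\<And>y. cvec y \<in> nball D c (\<rho> + 2 * \<delta>) \<Longrightarrow> F (cvec y) = cvec (f y)"
begin

text \<open>On real points \<open>F\<close> agrees with the real field \<open>f\<close>, so at real
  times the integrand of every iterate has no imaginary part.\<close>

lemma pic_real:
  assumes z: "cvec z \<in> nball D c \<rho>"
  shows "\<bar>h\<bar> < r \<Longrightarrow> Im (pic F n (of_real h) (cvec z) p) = 0"
proof (induction n arbitrary: h p)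
  case 0
  then show ?case by (simp add: cvec_def)
next
  case (Suc n)
  let ?f = "\<lambda>t::real. F (pic F n (of_real t * of_real h) (cvec z)) p"
  have h: "complex_of_real h \<in> ball 0 r" using Suc.prems by simp
  have 0: "Im (?f t) = 0" if t: "t \<in> {0..1}" for t
  proof -
    have th: "\<bar>t * h\<bar> < r" using ray[OF t h] by (simp add: norm_mult abs_mult)
    let ?w = "pic F n (of_real (t * h)) (cvec z)"
    have w: "cvec (\<lambda>p. Re (?w p)) = ?w" by (rule cvec_Re) (rule Suc.IH[OF th])
    have "?w \<in> nball D c (\<rho> + \<delta>)" 
      by (rule goodD(3)[OF good_pic _ z]) (use th in \<open>simp del: of_real_mult\<close>)
    then have "?w \<in> nball D c (\<rho> + 2 * \<delta>)" by (rule nball_mono[rotated]) (use delta in auto)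
    then have "F ?w = cvec (f (\<lambda>p. Re (?w p)))" using f[of "\<lambda>p. Re (?w p)"] w by simp
    then show ?thesis by (simp add: cvec_def)
  qed
  have "Im (integral {0..1} ?f) = integral {0..1} (Im \<circ> ?f)"
    by (rule integral_linear[symmetric])
      (auto intro!: integrable_continuous_real good_F_cont[OF good_pic z h] bounded_linear_Im)
  also have "\<dots> = integral {0..1} (\<lambda>t::real. 0::real)"
    by (rule Henstock_Kurzweil_Integration.integral_cong) (use 0 in auto)
  finally show ?case by (simp add: cvec_def)
qed

lemma flowc_real:
  assumes z: "cvec z \<in> nball D c \<rho>" and h: "\<bar>h\<bar> < r"
  shows "Im (flowc F (of_real h) (cvec z) p) = 0"
proof (cases "p < D")
  case True
  have h': "complex_of_real h \<in> ball 0 r" using h by simp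
  have "(\<lambda>n. Im (pic F n (of_real h) (cvec z) p)) \<longlonglongrightarrow> Im (flowc F (of_real h) (cvec z) p)"
    by (intro tendsto_intros pic_flowc(2)[OF z h' True])
  then show ?thesis using LIMSEQ_unique[OF _ tendsto_const] by (simp add: pic_real[OF z h])
qed (use pic_flowc(3)[OF z, of "of_real h"] h in auto)

text \<open>The domain of the real flow is all of \<open>nvecs D\<close>, and nothing bounds
  \<open>f\<close> outside the ball. A first-exit argument confines the solution: until it has moved
  by \<open>\<delta> / 2\<close> its speed is at most \<open>M\<close>, and the time allows a motion
  of at most \<open>\<delta> / 4\<close>. Writing times as \<open>s * t\<close> with
  \<open>s\<close> in the unit interval covers both signs of \<open>t\<close>.\<close>

lemma real_solution_stays:
  assumes z: "cvec z \<in> nball D c \<rho>" and t: "\<bar>t\<bar> < r"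
    and v: "v 0 = z" "\<And>\<tau>. \<tau> \<in> closed_segment 0 t \<Longrightarrow> v \<tau> \<in> nvecs D" "solution_on (closed_segment 0 t) f v"
    and \<tau>: "\<tau> \<in> closed_segment 0 t"
  shows "cvec (v \<tau>) \<in> nball D c (\<rho> + \<delta>)"
proof -
  let ?S = "closed_segment 0 t"
  have seg: "s * t \<in> ?S" if "s \<in> {0..1}" for s
    using that by (auto simp: in_segment intro!: exI[of _ s])
  have cont: "continuous_on {0..1} (\<lambda>s. v (s * t) p)" for p
  proof (rule continuous_on_compose2[where f = "\<lambda>s. s * t" and g = "\<lambda>\<tau>. v \<tau> p" and t = ?S])
    show "continuous_on ?S (\<lambda>\<tau>. v \<tau> p)"
      using v(3) has_vector_derivative_continuous continuous_on_eq_continuous_within by (metis solution_on_def)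
  qed (use seg in \<open>auto intro!: continuous_intros\<close>)
  \<comment> \<open>The parameters at which some component has moved by \<open>\<delta> / 2\<close>.
    As a finite union of compact sets, \<open>A\<close> has a least element if it is nonempty: the
    exit time.\<close>
  define A where "A = (\<Union>p\<in>{..<D}. {s\<in>{0..1}. \<delta> / 2 \<le> \<bar>v (s * t) p - z p\<bar>})"
  have near: "cvec (v (s * t)) \<in> nball D c (\<rho> + \<delta>)" if "s \<in> {0..1}" "s \<notin> A" for s
  proof (rule nball_shift[OF z])
    show "cvec (v (s * t)) \<in> nvecs D" using v(2)[OF seg[OF that(1)]] by (auto simp: nvecs_def cvec_def)
    show "cmod (cvec (v (s * t)) p - cvec z p) \<le> \<delta>" if p: "p < D" for p
    proof -
      have "\<bar>v (s * t) p - z p\<bar> < \<delta> / 2" using \<open>s \<notin> A\<close> \<open>s \<in> {0..1}\<close> p unfolding A_def by (auto simp: not_le)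
      then show ?thesis using delta by (simp add: cvec_def flip: of_real_diff)
    qed
  qed simp
  have "A = {}"
  proof (rule ccontr)
    assume "A \<noteq> {}"
    have "compact A"
      unfolding A_def
    proof (intro compact_UN ballI)
      fix p
      have "closed {s\<in>{0..1::real}. \<delta> / 2 \<le> \<bar>v (s * t) p - z p\<bar>}"
        by (intro continuous_on_closed_Collect_le continuous_intros cont closed_atLeastAtMost)
      then show "compact {s\<in>{0..1::real}. \<delta> / 2 \<le> \<bar>v (s * t) p - z p\<bar>}"
        unfolding compact_eq_bounded_closed
        by (intro conjI bounded_subset[OF bounded_closed_interval[of 0 "1::real"]]) auto
    qed simp
    then obtain s0 where s0: "s0 \<in> A" "\<And>s. s \<in> A \<Longrightarrow> s0 \<le> s" using \<open>A \<noteq> {}\<close> compact_attains_inf by metis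
    then obtain p where p: "p < D" "s0 \<in> {0..1}" "\<delta> / 2 \<le> \<bar>v (s0 * t) p - z p\<bar>" by (auto simp: A_def)
    have pos: "0 < s0" using p v(1) delta by (cases "s0 = 0") auto
    have "norm (v (s0 * t) p - v (0 * t) p) \<le> \<bar>t\<bar> * M * s0 - \<bar>t\<bar> * M * 0"
    proof (rule differentiable_bound_general[OF pos, where f' = "\<lambda>s. t * f (v (s * t)) p" and \<phi>' = "\<lambda>s. \<bar>t\<bar> * M"])
      show "continuous_on {0..s0} (\<lambda>s. v (s * t) p)"
        using cont by (rule continuous_on_subset) (use p in auto)
      fix s assume s: "0 < s" "s < s0"
      then have s1: "s \<in> {0..1}" "s \<notin> A" using p s0(2)[of s] by auto
      have "((\<lambda>\<tau>. v \<tau> p) has_field_derivative f (v (s * t)) p) (at (s * t) within ?S)"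
        using v(3) seg[OF s1(1)] by (auto simp: solution_on_def has_real_derivative_iff_has_vector_derivative)
      then have "((\<lambda>\<tau>. v \<tau> p) has_field_derivative f (v (s * t)) p) (at (s * t) within (\<lambda>s. s * t) ` {0..1})"
        by (rule DERIV_subset) (use seg in auto)
      then have "((\<lambda>\<tau>. v \<tau> p) \<circ> (\<lambda>s. s * t) has_field_derivative f (v (s * t)) p * t) (at s within {0..1})"
        by (rule DERIV_image_chain) (auto intro!: derivative_eq_intros)
      moreover have "at s within {0..1} = at s" using s p by (intro at_within_Icc_at) auto
      ultimately show "((\<lambda>s. v (s * t) p) has_vector_derivative t * f (v (s * t)) p) (at s)"
        by (simp add: has_real_derivative_iff_has_vector_derivative o_def mult.commute)
      have "cvec (v (s * t)) \<in> nball D c (\<rho> + 2 * \<delta>)"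
        by (rule nball_mono[OF _ near[OF s1]]) (use delta in auto)
      from hfam_bound[OF F _ this p(1)] f[OF this] have "\<bar>f (v (s * t)) p\<bar> \<le> M" by (simp add: cvec_def)
      then show "norm (t * f (v (s * t)) p) \<le> \<bar>t\<bar> * M" by (simp add: abs_mult mult_left_mono)
    qed (auto intro!: derivative_eq_intros continuous_intros simp: has_real_derivative_iff_has_vector_derivative[symmetric])
    also have "\<dots> \<le> \<bar>t\<bar> * M" using p M0 mult_left_mono[of s0 1 "\<bar>t\<bar> * M"] by simp
    also have "\<dots> \<le> \<delta> / 4" using rM[of "of_real t"] t by simp
    finally show False using p v(1) delta by simp
  qed
  moreover obtain s where "s \<in> {0..1}" "\<tau> = s * t" using \<tau> by (auto simp: in_segment)
  ultimately show ?thesis using near by auto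
qed

text \<open>A competing real solution is first confined to the ball and then complexified, which
  brings it under the uniqueness result for complex solutions.\<close>

lemma real_flow_eq_flowc:
  assumes z: "cvec z \<in> nball D c \<rho>" and t: "\<bar>t\<bar> < r"
  shows "cvec (flow (nvecs D) f t z) = flowc F (of_real t) (cvec z)"
proof -
  let ?S = "closed_segment 0 t"
  define w where "w \<tau> p = Re (flowc F (of_real \<tau>) (cvec z) p)" for \<tau> p
  have w: "cvec (w \<tau>) = flowc F (of_real \<tau>) (cvec z)" if "\<bar>\<tau>\<bar> < r" for \<tau>
    unfolding w_def by (rule cvec_Re) (rule flowc_real[OF z that])
  have in1: "flowc F (of_real \<tau>) (cvec z) \<in> nball D c (\<rho> + \<delta>)" if "\<tau> \<in> ?S" for \<tau>
    using seg_r[OF t that] by (intro goodD(3)[OF good_flowc _ z]) simp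
  have sol: "solution_on ?S F (\<lambda>\<tau>. flowc F (of_real \<tau>) (cvec z))"
    using flowc_solution[OF z, of ?S 0] seg_r[OF t] by simp
  have fw: "F (flowc F (of_real \<tau>) (cvec z)) = cvec (f (w \<tau>))" if "\<tau> \<in> ?S" for \<tau>
    using f[of "w \<tau>"] w[OF seg_r[OF t that]] nball_mono[OF _ in1[OF that], of "\<rho> + 2 * \<delta>"] delta by auto
  have "flow (nvecs D) f t z = w t"
  proof (rule flow_eqI)
    show "w 0 = z" using flowc_0[OF z] by (simp add: w_def fun_eq_iff) (simp add: cvec_def)
    show "w \<tau> \<in> nvecs D" if "\<tau> \<in> ?S" for \<tau> using nball_nvecs[OF in1[OF that]] by (auto simp: w_def nvecs_def)
    show "solution_on ?S f w"
      unfolding solution_on_def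
    proof (intro ballI allI)
      fix \<tau> p assume \<tau>: "\<tau> \<in> ?S"
      have "((\<lambda>\<sigma>. flowc F (of_real \<sigma>) (cvec z) p) has_vector_derivative cvec (f (w \<tau>)) p) (at \<tau> within ?S)"
        using sol \<tau> fw[OF \<tau>] by (auto simp: solution_on_def)
      from bounded_linear.has_vector_derivative[OF bounded_linear_Re this]
      show "((\<lambda>\<sigma>. w \<sigma> p) has_vector_derivative f (w \<tau>) p) (at \<tau> within ?S)" by (simp add: w_def cvec_def)
    qed
    fix v assume v: "v 0 = z" "\<And>\<tau>. \<tau> \<in> ?S \<Longrightarrow> v \<tau> \<in> nvecs D" "solution_on ?S f v"
    have st: "cvec (v \<tau>) \<in> nball D c (\<rho> + \<delta>)" if "\<tau> \<in> ?S" for \<tau>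
      by (rule real_solution_stays[where v = v, OF z t]) (use v that in auto)
    have "(\<lambda>\<tau>. cvec (v \<tau>)) t = (\<lambda>\<tau>. flowc F (of_real \<tau>) (cvec z)) t"
    proof (rule solution_unique[OF _ refl t, where u = "\<lambda>\<tau>. cvec (v \<tau>)" and v = "\<lambda>\<tau>. flowc F (of_real \<tau>) (cvec z)"])
      show "solution_on ?S F (\<lambda>\<tau>. cvec (v \<tau>))"
        unfolding solution_on_def
      proof (intro ballI allI)
        fix \<tau> p assume \<tau>: "\<tau> \<in> ?S"
        have "F (cvec (v \<tau>)) = cvec (f (v \<tau>))"
          using f nball_mono[OF _ st[OF \<tau>], of "\<rho> + 2 * \<delta>"] delta by auto
        then show "((\<lambda>\<sigma>. cvec (v \<sigma>) p) has_vector_derivative F (cvec (v \<tau>)) p) (at \<tau> within ?S)"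
          using v(3) \<tau> by (auto simp: solution_on_def cvec_def has_real_derivative_iff_has_vector_derivative
              intro!: has_vector_derivative_of_real)
      qed
    qed (use st in1 sol v(1) flowc_0[OF z] in auto)
    then have "cvec (v t) = cvec (w t)" using w[OF t] by simp
    then show "v t = w t" by (auto simp: cvec_def fun_eq_iff)
  qed
  then show ?thesis using w[OF t] by simp
qed

end

end

section \<open>Approximate modified vector fields\<close>

context dim
begin

text \<open>The closure rules deliver holomorphy together with a crude constant; a separate
  pointwise estimate then replaces that constant.\<close>

lemma hfam_bound_improve:
  assumes "hfam T U M g" and "\<And>\<tau> z p. \<tau> \<in> T \<Longrightarrow> z \<in> U \<Longrightarrow> p < D \<Longrightarrow> cmod (g \<tau> z p) \<le> M'"
  shows "hfam T U M' g"
  using assms by (auto simp: hfam_def hfun_def)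

lemma hfam_add: "hfam T U M g \<Longrightarrow> hfam T U N g' \<Longrightarrow> hfam T U (M + N) (\<lambda>\<tau> z p. g \<tau> z p + g' \<tau> z p)"
  unfolding hfam_def by (intro conjI ballI allI impI hfun_add) (auto simp: nvecs_def)

lemma hfam_diff: "hfam T U M g \<Longrightarrow> hfam T U N g' \<Longrightarrow> hfam T U (M + N) (\<lambda>\<tau> z p. g \<tau> z p - g' \<tau> z p)"
  unfolding hfam_def by (intro conjI ballI allI impI hfun_diff) (auto simp: nvecs_def)

end

text \<open>Cauchy's inequality on the disc of radius \<open>t\<close> bounds the
  \<open>k\<close>-th derivative of the difference by a multiple of \<open>t ^ (Suc n - k)\<close>,
  which tends to 0 with \<open>t\<close>.\<close>

lemma higher_deriv_agree:
  assumes "f holomorphic_on ball 0 r" and "g holomorphic_on ball 0 r" and "0 < r"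
    and d: "\<And>h. h \<in> ball 0 r \<Longrightarrow> cmod (f h - g h) \<le> C * cmod h ^ Suc n" and k: "k \<le> n"
  shows "(deriv ^^ k) f 0 = (deriv ^^ k) g 0"
proof -
  let ?D = "(deriv ^^ k) (\<lambda>h. f h - g h) 0"
  have C: "0 \<le> C"
  proof (rule ccontr)
    assume "\<not> 0 \<le> C"
    moreover have "0 < (r / 2) ^ Suc n" using \<open>0 < r\<close> by simp
    ultimately have "C * (r / 2) ^ Suc n < 0" by (simp add: mult_neg_pos del: power_Suc)
    moreover have "0 \<le> C * cmod (of_real (r / 2)) ^ Suc n"
      by (rule order_trans[OF norm_ge_zero d]) (use \<open>0 < r\<close> in simp)
    ultimately show False using \<open>0 < r\<close> by (simp del: power_Suc)
  qed
  have *: "cmod ?D \<le> fact k * C * t" if t: "0 < t" "t < min r 1" for t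
  proof -
    have "cmod ?D \<le> fact k * (C * t ^ Suc n) / t ^ k"
    proof (rule Cauchy_bound_ball)
      show "(\<lambda>h. f h - g h) holomorphic_on ball 0 t"
        by (intro holomorphic_intros holomorphic_on_subset[OF assms(1)] holomorphic_on_subset[OF assms(2)]) (use t in auto)
      fix z assume "z \<in> ball (0::complex) t"
      then show "cmod (f z - g z) \<le> C * t ^ Suc n"
        by (intro order_trans[OF d mult_left_mono[OF power_mono]]) (use t C in auto)
    qed (use t in auto)
    also have "\<dots> = fact k * C * (t ^ Suc n / t ^ k)" by simp
    also have "t ^ Suc n / t ^ k = t * t ^ (n - k)" using t k by (simp add: power_diff)
    also have "fact k * C * (t * t ^ (n - k)) \<le> fact k * C * (t * 1)"
      using t C by (intro mult_left_mono power_le_one) auto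
    finally show ?thesis by simp
  qed
  have "cmod ?D \<le> 0"
  proof (rule tendsto_lowerbound)
    show "((\<lambda>t. fact k * C * t) \<longlongrightarrow> 0) (at_right 0)" by (intro tendsto_eq_intros) auto
    show "\<forall>\<^sub>F t in at_right 0. cmod ?D \<le> fact k * C * t"
      using eventually_at_right_real[of 0 "min r 1"] \<open>0 < r\<close> by (auto elim!: eventually_mono intro: *)
  qed simp
  then have "?D = 0" by simp
  moreover have "?D = (deriv ^^ k) f 0 - (deriv ^^ k) g 0"
    by (rule higher_deriv_diff[where S = "ball 0 r"]) (use assms in auto)
  ultimately show ?thesis by simp
qed

context rk
begin

primrec giter :: "(complex nvec \<Rightarrow> complex nvec) \<Rightarrow> nat \<Rightarrow> complex \<Rightarrow> complex nvec \<Rightarrow> complex nvec" where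
  "giter F 0 h = F"
| "giter F (Suc j) h = (\<lambda>z p. giter F j h z p - inc h (giter F j h) z p + avg F h z p)"

end

text \<open>\<open>giter F\<close> iterates a map whose fixed points \<open>g\<close> satisfy \<open>step h g = flowc F h\<close>. Every iteration
  costs \<open>3 * \<delta>\<close> of the radius and is a contraction by \<open>\<theta> * \<bar>h\<bar> \<le> 1/4\<close>.\<close>

locale modified_field = rk +
  fixes c :: "complex nvec" and \<rho> \<delta> M r :: real and F :: "complex nvec \<Rightarrow> complex nvec"
  assumes delta: "0 < \<delta>" and M0: "0 < M" and r0: "0 < r" and small: "192 * r * \<kappa>\<^sup>2 * M \<le> \<delta>"
    and F: "hfam {0} (nball D c \<rho>) M (\<lambda>_. F)"
begin

text \<open>The constant \<open>24 * \<kappa>\<^sup>2 * (2 * M) / \<delta>\<close> of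
  \<open>inc_compare\<close> for fields bounded by \<open>2 * M\<close>. The 192 in the locale is
  \<open>4 * 48\<close>, which makes \<open>\<theta> * cmod h\<close> at most 1/4.\<close>

definition \<theta> where "\<theta> = 48 * \<kappa>\<^sup>2 * M / \<delta>"

abbreviation V where "V j \<equiv> nball D c (\<rho> - 3 * \<delta> * real j)"

lemma kappa_sq: "\<kappa> \<le> \<kappa>\<^sup>2" "1 \<le> \<kappa>\<^sup>2"
  using kappa1 self_le_power[of \<kappa> 2] one_le_power[of \<kappa> 2] by auto

lemma h_small:
  assumes "h \<in> ball (0::complex) r"
  shows "64 * \<kappa> * cmod h * M \<le> \<delta>" and "\<theta> * cmod h \<le> 1 / 4"
    and "16 * \<kappa> * cmod h * M \<le> \<delta>" and "16 * \<kappa> * cmod h * (2 * M) \<le> \<delta>" and "32 * \<kappa> * cmod h * (2 * M) \<le> \<delta>"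
proof -
  have "\<kappa> * (cmod h * M) \<le> \<kappa>\<^sup>2 * (r * M)" using assms kappa_sq M0 kappa1 r0 by (intro mult_mono) auto
  moreover have "0 \<le> \<kappa> * (cmod h * M)" using kappa1 M0 by simp
  ultimately show "64 * \<kappa> * cmod h * M \<le> \<delta>" "16 * \<kappa> * cmod h * M \<le> \<delta>"
    "16 * \<kappa> * cmod h * (2 * M) \<le> \<delta>" "32 * \<kappa> * cmod h * (2 * M) \<le> \<delta>"
    using small by (simp_all add: mult_ac)
  have "\<kappa>\<^sup>2 * (cmod h * M) \<le> \<kappa>\<^sup>2 * (r * M)" using assms M0 by (intro mult_left_mono mult_right_mono) auto
  then have "192 * (\<kappa>\<^sup>2 * (cmod h * M)) \<le> \<delta>" using small by (simp add: mult_ac)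
  then show "\<theta> * cmod h \<le> 1 / 4" using delta by (simp add: \<theta>_def field_simps)
qed

lemma r_small: "4 * r * M \<le> \<delta>"
proof -
  have "4 * r * M * 1 \<le> 192 * r * M * \<kappa>\<^sup>2" using kappa_sq(2) r0 M0 by (intro mult_mono) auto
  then show ?thesis using small by (simp add: mult_ac)
qed

sublocale pic: picard D c "\<rho> - 2 * \<delta>" \<delta> M r F
  by unfold_locales (use delta M0 r0 r_small F in auto)

lemma theta_pos: "0 < \<theta>" using kappa1 M0 delta by (simp add: \<theta>_def)

lemma V_Suc: "\<rho> - 3 * \<delta> * real (Suc j) + 3 * \<delta> = \<rho> - 3 * \<delta> * real j"
  by (simp add: algebra_simps)

lemma V_mono: "i \<le> j \<Longrightarrow> z \<in> V j \<Longrightarrow> z \<in> V i"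
  by (rule nball_mono[of "\<rho> - 3 * \<delta> * real j"]) (use delta in auto)

lemma V_pic: "z \<in> V (Suc j) \<Longrightarrow> z \<in> nball D c (\<rho> - 2 * \<delta>)"
  by (rule nball_mono[of "\<rho> - 3 * \<delta> * real (Suc j)"]) (use delta in \<open>auto simp: algebra_simps\<close>)

lemma avg_V: "hfam (ball 0 r) (V (Suc j)) M (avg F)"
  using V_pic by (intro hfam_mono[OF pic.avg_hfam]) auto

lemma inc_V:
  assumes "hfam (ball 0 r) (V j) (2 * M) g"
  shows "hfam (ball 0 r) (V (Suc j)) (\<kappa> * (2 * M)) (\<lambda>h. inc h (g h))"
proof (rule inc_hfam[OF delta])
  show "hfam (ball 0 r) (nball D c (\<rho> - 3 * \<delta> * real (Suc j) + 2 * \<delta>)) (2 * M) g"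
    by (rule hfam_mono[OF assms]) (use delta in \<open>auto simp: algebra_simps intro: nball_mono[rotated]\<close>)
  show "16 * \<kappa> * cmod \<zeta> * (2 * M) \<le> \<delta>" if "\<zeta> \<in> ball 0 r" for \<zeta>
    by (rule h_small(4)[OF that])
qed (use M0 in auto)

lemma inc_compare_V:
  assumes "hfam (ball 0 r) (V j) (2 * M) g" "hfam (ball 0 r) (V j) (2 * M) g'" "h \<in> ball 0 r"
    and "\<And>y p. y \<in> V j \<Longrightarrow> p < D \<Longrightarrow> cmod (g h y p - g' h y p) \<le> \<epsilon>" "0 < \<epsilon>" "z \<in> V (Suc j)" "p < D"
  shows "cmod (inc h (g h) z p - inc h (g' h) z p - (g h z p - g' h z p)) \<le> \<theta> * cmod h * \<epsilon>"
proof -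
  have "hfam {0} (nball D c (\<rho> - 3 * \<delta> * real (Suc j) + 3 * \<delta>)) (2 * M) (\<lambda>_. g h)"
    and "hfam {0} (nball D c (\<rho> - 3 * \<delta> * real (Suc j) + 3 * \<delta>)) (2 * M) (\<lambda>_. g' h)"
    unfolding V_Suc by (rule hfam_fixed[OF assms(1,3)] hfam_fixed[OF assms(2,3)])+
  moreover have "0 < 2 * M" using M0 by simp
  ultimately have "cmod (inc h (g h) z p - inc h (g' h) z p - (g h z p - g' h z p)) \<le> 24 * \<kappa>\<^sup>2 * cmod h * (2 * M) / \<delta> * \<epsilon>"
    using assms(4,5,6,7) by (intro inc_compare[OF delta _ _ h_small(5)[OF assms(3)]]) (simp_all only: V_Suc)
  then show ?thesis by (simp add: \<theta>_def mult_ac)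
qed

text \<open>The claims support each other: a bound below \<open>2 * M\<close> admits the contraction
  estimate, and its increments, dominated by \<open>M / 2 ^ Suc j\<close>, keep the next iterate
  bounded; \<open>2 - 1 / 2 ^ j\<close> is the partial sum so far. The first increment comes from
  the first-order bounds of \<open>inc\<close> and \<open>avg\<close> against
  \<open>F\<close>.\<close>

lemma giter_props:
  "hfam (ball 0 r) (V j) (M * (2 - 1 / 2 ^ j)) (giter F j)"
  "z \<in> V j \<Longrightarrow> p < D \<Longrightarrow> giter F j 0 z p = F z p"
  "h \<in> ball 0 r \<Longrightarrow> z \<in> V (Suc j) \<Longrightarrow> p < D \<Longrightarrow> cmod (giter F (Suc j) h z p - giter F j h z p) \<le> M * (\<theta> * cmod h) ^ Suc j"
proof -
  have avg0: "avg F 0 z p = F z p" if "z \<in> V (Suc j)" "p < D" for z p j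
    using pic.avg_near[OF V_pic[OF that(1)] _ that(2), of 0] r0 by simp
  have "hfam (ball 0 r) (V j) (M * (2 - 1 / 2 ^ j)) (giter F j) \<and> (\<forall>z\<in>V j. \<forall>p<D. giter F j 0 z p = F z p) \<and>
    (\<forall>h\<in>ball 0 r. \<forall>z\<in>V (Suc j). \<forall>p<D. cmod (giter F (Suc j) h z p - giter F j h z p) \<le> M * (\<theta> * cmod h) ^ Suc j)"
  proof (induction j)
    case 0
    have F0: "hfam (ball 0 r) (V 0) M (\<lambda>_. F)" using hfam_fixed[OF F, of 0] by simp
    have "cmod (giter F (Suc 0) h z p - giter F 0 h z p) \<le> M * (\<theta> * cmod h) ^ Suc 0"
      if h: "h \<in> ball 0 r" and z: "z \<in> V (Suc 0)" and p: "p < D" for h z p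
    proof -
      have "cmod (inc h F z p - F z p) \<le> 2 * \<kappa>\<^sup>2 * cmod h * M\<^sup>2 / \<delta>"
      proof (rule inc_bound(3)[where c = c and \<rho> = "\<rho> - 3 * \<delta>"])
        show "hfam {0} (nball D c (\<rho> - 3 * \<delta> + 2 * \<delta>)) M (\<lambda>_. F)"
          by (rule hfam_mono[OF F]) (use delta in \<open>auto intro: nball_mono[rotated]\<close>)
        show "16 * \<kappa> * cmod h * M \<le> \<delta>" by (rule h_small(3)[OF h])
      qed (use delta M0 z p in auto)
      moreover have "cmod (avg F h z p - F z p) \<le> M\<^sup>2 / \<delta> * cmod h" by (rule pic.avg_near[OF V_pic[OF z] h p])
      moreover have "giter F (Suc 0) h z p - giter F 0 h z p = (avg F h z p - F z p) - (inc h F z p - F z p)" by simp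
      ultimately have "cmod (giter F (Suc 0) h z p - giter F 0 h z p) \<le> M\<^sup>2 / \<delta> * cmod h + 2 * \<kappa>\<^sup>2 * cmod h * M\<^sup>2 / \<delta>"
        using norm_triangle_ineq4[of "avg F h z p - F z p" "inc h F z p - F z p"] by (simp only:)
      also have "\<dots> = (1 + 2 * \<kappa>\<^sup>2) * (M\<^sup>2 / \<delta> * cmod h)" by (simp add: algebra_simps)
      also have "\<dots> \<le> (48 * \<kappa>\<^sup>2) * (M\<^sup>2 / \<delta> * cmod h)" using kappa_sq(2) delta by (intro mult_right_mono) auto
      also have "\<dots> = M * (\<theta> * cmod h) ^ Suc 0" by (simp add: \<theta>_def power2_eq_square)
      finally show ?thesis .
    qed
    then show ?case using F0 by simp
  next
    case (Suc j)
    note B = Suc[THEN conjunct1] and A = Suc[THEN conjunct2, THEN conjunct2, rule_format]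
    have B2: "hfam (ball 0 r) (V j) (2 * M) (giter F j)"
      by (rule hfam_mono[OF B]) (use M0 in \<open>auto simp: algebra_simps\<close>)
    have B3: "hfam (ball 0 r) (V (Suc j)) (2 * M) (giter F j)"
      by (rule hfam_mono[OF B2]) (use V_mono[of j "Suc j"] in auto)
    \<comment> \<open>A crude bound containing \<open>\<kappa>\<close>, good for holomorphy only;
      \<open>bd\<close> restores the one that the next contraction needs.\<close>
    have C: "hfam (ball 0 r) (V (Suc j)) (2 * M + \<kappa> * (2 * M) + M) (giter F (Suc j))"
      unfolding giter.simps by (intro hfam_add hfam_diff B3 inc_V B2 avg_V)
    have bd: "cmod (giter F (Suc j) h z p) \<le> M * (2 - 1 / 2 ^ Suc j)" if "h \<in> ball 0 r" "z \<in> V (Suc j)" "p < D" for h z p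
    proof -
      have "(\<theta> * cmod h) ^ Suc j \<le> (1 / 4) ^ Suc j"
        using h_small(2)[OF that(1)] theta_pos by (intro power_mono) auto
      also have "\<dots> \<le> (1 / 2) ^ Suc j" by (intro power_mono) auto
      finally have "M * (\<theta> * cmod h) ^ Suc j \<le> M * (1 / 2) ^ Suc j" using M0 by (intro mult_left_mono) auto
      then have "cmod (giter F (Suc j) h z p - giter F j h z p) \<le> M * (1 / 2) ^ Suc j" using A[OF that] by linarith
      moreover have "cmod (giter F j h z p) \<le> M * (2 - 1 / 2 ^ j)"
        using hfam_bound[OF B that(1) V_mono[OF _ that(2)] that(3)] by simp
      ultimately have "cmod (giter F (Suc j) h z p) \<le> M * (1 / 2) ^ Suc j + M * (2 - 1 / 2 ^ j)"
        using norm_triangle_mono[of "giter F (Suc j) h z p - giter F j h z p" _ "giter F j h z p"]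
        by (simp only: diff_add_cancel)
      also have "\<dots> = M * (2 - 1 / 2 ^ Suc j)" by (simp add: field_simps power_one_over)
      finally show ?thesis .
    qed
    have B': "hfam (ball 0 r) (V (Suc j)) (M * (2 - 1 / 2 ^ Suc j)) (giter F (Suc j))"
      by (rule hfam_bound_improve[OF C bd])
    have B'2: "hfam (ball 0 r) (V (Suc j)) (2 * M) (giter F (Suc j))"
      by (rule hfam_mono[OF B']) (use M0 in \<open>auto simp: algebra_simps\<close>)
    have Z': "giter F (Suc j) 0 z p = F z p" if "z \<in> V (Suc j)" "p < D" for z p
      using that avg0 by (simp add: inc_0)
    have A': "cmod (giter F (Suc (Suc j)) h z p - giter F (Suc j) h z p) \<le> M * (\<theta> * cmod h) ^ Suc (Suc j)"
      if h: "h \<in> ball 0 r" and z: "z \<in> V (Suc (Suc j))" and p: "p < D" for h z p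
    \<comment> \<open>\<open>inc_compare_V\<close> takes a positive distance of the fields, but at
      \<open>h = 0\<close> the available bound is 0; there both iterates coincide with
      \<open>F\<close>.\<close>
    proof (cases "h = 0")
      case True
      have "giter F (Suc (Suc j)) 0 z p = F z p" using avg0[OF z p] by (simp add: inc_0)
      then show ?thesis using True Z'[OF V_mono[OF _ z] p] by simp
    next
      case False
      have "cmod (inc h (giter F (Suc j) h) z p - inc h (giter F j h) z p - (giter F (Suc j) h z p - giter F j h z p))
          \<le> \<theta> * cmod h * (M * (\<theta> * cmod h) ^ Suc j)"
        by (rule inc_compare_V[OF B'2 B3 h A[OF h] _ z p]) (use M0 theta_pos False in simp_all)
      also have "\<dots> = M * (\<theta> * cmod h) ^ Suc (Suc j)" by (simp add: mult_ac)
      also have "cmod (inc h (giter F (Suc j) h) z p - inc h (giter F j h) z p - (giter F (Suc j) h z p - giter F j h z p))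
         = cmod (giter F (Suc (Suc j)) h z p - giter F (Suc j) h z p)"
        by (subst norm_minus_commute) (simp add: algebra_simps)
      finally show ?thesis .
    qed
    show ?case by (intro conjI ballI allI impI B' Z' A')
  qed
  then show "hfam (ball 0 r) (V j) (M * (2 - 1 / 2 ^ j)) (giter F j)"
    "z \<in> V j \<Longrightarrow> p < D \<Longrightarrow> giter F j 0 z p = F z p"
    "h \<in> ball 0 r \<Longrightarrow> z \<in> V (Suc j) \<Longrightarrow> p < D \<Longrightarrow> cmod (giter F (Suc j) h z p - giter F j h z p) \<le> M * (\<theta> * cmod h) ^ Suc j"
    by blast+
qed

lemma giter_hfam: "hfam (ball 0 r) (V j) (2 * M) (giter F j)"
  by (rule hfam_mono[OF giter_props(1)]) (use M0 in \<open>auto simp: algebra_simps\<close>)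

lemma giter_hol: "z \<in> V j \<Longrightarrow> p < D \<Longrightarrow> (\<lambda>h. giter F j h z p) holomorphic_on ball 0 r"
  using giter_hfam[of j] hfun_hol[of "ball 0 r" "V j" "2 * M" "\<lambda>h z. giter F j h z p" "ball 0 r" "\<lambda>h. h" "\<lambda>_. z"]
  by (auto simp: hfam_def hcurve_const)

text \<open>The recursion of \<open>giter\<close> solved for \<open>inc\<close>: the defect of an
  iterate as a modified field is \<open>h\<close> times the negative of its next change.\<close>

lemma step_giter:
  assumes "z \<in> V (Suc j)" and "h \<in> ball 0 r"
  shows "step h (giter F j h) z p = flowc F h z p + h * (giter F j h z p - giter F (Suc j) h z p)"
  using pic.flowc_eq_avg[OF V_pic[OF assms(1)] assms(2), of p] by (simp add: step_def algebra_simps)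

text \<open>The change from iterate \<open>j\<close> to the next is of order \<open>Suc j\<close> in
  \<open>h\<close>, so for \<open>k \<le> j\<close> the coefficient of order \<open>k\<close> is
  already final.\<close>

lemma giter_coeff:
  assumes z: "z \<in> V K" and p: "p < D" and "k \<le> j" "j \<le> K"
  shows "(deriv ^^ k) (\<lambda>h. giter F j h z p) 0 = (deriv ^^ k) (\<lambda>h. giter F k h z p) 0"
  using assms(3,4)
proof (induction j rule: dec_induct)
  case (step j)
  have "(deriv ^^ k) (\<lambda>h. giter F (Suc j) h z p) 0 = (deriv ^^ k) (\<lambda>h. giter F j h z p) 0"
  proof (rule higher_deriv_agree[where n = j and C = "M * \<theta> ^ Suc j"])
    show "(\<lambda>h. giter F (Suc j) h z p) holomorphic_on ball 0 r" "(\<lambda>h. giter F j h z p) holomorphic_on ball 0 r"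
      using step p by (intro giter_hol V_mono[OF _ z]; simp)+
    show "cmod (giter F (Suc j) h z p - giter F j h z p) \<le> M * \<theta> ^ Suc j * cmod h ^ Suc j" if "h \<in> ball 0 r" for h
      using giter_props(3)[OF that V_mono[OF _ z] p, of j] step by (simp add: power_mult_distrib mult_ac)
  qed (use r0 step in auto)
  then show ?case using step by simp
qed simp

end

section \<open>Frechet differentiability\<close>

context dim
begin

text \<open>The first-order Taylor estimate on the complex line from \<open>z\<close> to
  \<open>w\<close>, on a disc of radius \<open>d / W\<close> and evaluated at 1, leaves a remainder
  quadratic in \<open>W\<close>; its linear term is the directional derivative.\<close>

lemma hfun_Frechet:
  assumes hf: "hfun T (nball D c \<rho>) M (\<lambda>_. \<phi>)" and T: "T \<noteq> {}" and z: "z \<in> nball D c \<rho>"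
  shows "\<exists>C. \<forall>\<epsilon>>0. \<exists>\<delta>>0. \<forall>w\<in>nvecs D. supnorm D (\<lambda>q. w q - z q) < \<delta> \<longrightarrow>
          norm (\<phi> w - \<phi> z - (\<Sum>q<D. C q * (w q - z q))) \<le> \<epsilon> * supnorm D (\<lambda>q. w q - z q)"
proof (rule exI[of _ "pd \<phi> z"], intro allI impI)
  fix \<epsilon> :: real assume \<epsilon>: "0 < \<epsilon>"
  obtain \<tau> where \<tau>: "\<tau> \<in> T" using T by auto
  obtain d where d: "0 < d" "z \<in> nball D c (\<rho> - d)" using nball_margin[OF z] by metis
  have M0: "0 \<le> M" using hfun_bound[OF hf \<tau> z] norm_ge_zero order_trans by blast
  \<comment> \<open>\<open>d / 2\<close> puts the parameter 1 within half the radius of the disc.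
    The second entry makes \<open>8 * M / d\<^sup>2 * W\<close> at most \<open>\<epsilon>\<close>;
    the summand 1 covers \<open>M = 0\<close>.\<close>
  define d' where "d' = min (d / 2) (\<epsilon> * d\<^sup>2 / (8 * M + 1))"
  have d': "0 < d'" "d' \<le> d / 2" using d \<epsilon> M0 unfolding d'_def by (simp, intro min.cobounded1)
  show "\<exists>\<delta>>0. \<forall>w\<in>nvecs D. supnorm D (\<lambda>q. w q - z q) < \<delta> \<longrightarrow>
      norm (\<phi> w - \<phi> z - (\<Sum>q<D. pd \<phi> z q * (w q - z q))) \<le> \<epsilon> * supnorm D (\<lambda>q. w q - z q)"
  proof (intro exI[of _ d'] conjI d' ballI impI)
    fix w assume w: "w \<in> nvecs D" and wd: "supnorm D (\<lambda>q. w q - z q) < d'"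
    define W where "W = supnorm D (\<lambda>q. w q - z q)"
    have W: "0 \<le> W" "W < d'" "\<And>p. p < D \<Longrightarrow> cmod (w p - z p) \<le> W"
      using wd supnorm_nonneg norm_le_supnorm[of _ "\<lambda>q. w q - z q"] by (auto simp: W_def)
    define u where "u p = w p - z p" for p
    have u: "u \<in> nvecs D" using w nball_nvecs[OF z] by (auto simp: u_def nvecs_def)
    show "norm (\<phi> w - \<phi> z - (\<Sum>q<D. pd \<phi> z q * (w q - z q))) \<le> \<epsilon> * supnorm D (\<lambda>q. w q - z q)"
    proof (cases "W = 0")
      case True
      then have "w = z" using W(3) w nball_nvecs[OF z] by (auto simp: fun_eq_iff nvecs_def) (metis not_le)
      then show ?thesis using supnorm_nonneg[of "\<lambda>q. w q - z q"] \<epsilon> by simp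
    next
      case False
      then have W0: "0 < W" using W by simp
      have cv: "hcurve (ball 0 (d / W)) (nball D c (\<rho> - d + d)) (\<lambda>\<eta> p. z p + \<eta> * u p)"
        by (rule line_hcurve[OF d(2) u]) (use W W0 in \<open>auto simp: u_def\<close>)
      have "cmod (\<phi> (\<lambda>p. z p + 1 * u p) - \<phi> (\<lambda>p. z p + 0 * u p) - 1 * deriv (\<lambda>\<eta>. \<phi> (\<lambda>p. z p + \<eta> * u p)) 0)
          \<le> 8 * M * (cmod 1)\<^sup>2 / (d / W)\<^sup>2"
      proof (rule Taylor_bound_1)
        show "(\<lambda>\<eta>. \<phi> (\<lambda>p. z p + \<eta> * u p)) holomorphic_on ball 0 (d / W)"
          using hfun_hol[OF hf _ _ _ cv[simplified], of "\<lambda>_. \<tau>"] \<tau> by auto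
        show "cmod (\<phi> (\<lambda>p. z p + \<eta> * u p)) \<le> M" if "\<eta> \<in> ball 0 (d / W)" for \<eta>
          using cv that hfun_bound[OF hf \<tau>] by (auto simp: hcurve_def)
        show "cmod 1 \<le> d / W / 2" using W W0 d' by (simp add: field_simps)
      qed (use d W0 in auto)
      also have "\<dots> = (8 * M / d\<^sup>2 * W) * W" by (simp add: power2_eq_square)
      also have "\<dots> \<le> \<epsilon> * W"
      proof (rule mult_right_mono)
        have "8 * M * W \<le> (8 * M + 1) * d'" using W M0 by (intro mult_mono) auto
        also have "\<dots> \<le> (8 * M + 1) * (\<epsilon> * d\<^sup>2 / (8 * M + 1))" using M0 by (intro mult_left_mono) (auto simp: d'_def)
        also have "\<dots> = \<epsilon> * d\<^sup>2" using M0 by (simp add: add_nonneg_eq_0_iff)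
        finally show "8 * M / d\<^sup>2 * W \<le> \<epsilon>" using d by (simp add: field_simps)
      qed (use W in auto)
      finally have "cmod (\<phi> w - \<phi> z - dird \<phi> z u) \<le> \<epsilon> * W" by (simp add: dird_def u_def)
      then show ?thesis using dird_eq_pd[OF hf T z u] by (simp add: u_def W_def)
    qed
  qed
qed

text \<open>The chain rule at a single point: a holomorphic curve moves at most linearly in the
  parameter, so the Frechet remainder along it vanishes faster than linearly.\<close>

lemma Frechet_curve:
  assumes der: "\<forall>\<epsilon>>0. \<exists>\<delta>>0. \<forall>w\<in>nvecs D. supnorm D (\<lambda>q. w q - \<gamma> \<zeta>0 q) < \<delta> \<longrightarrow>
          norm (\<phi> w - \<phi> (\<gamma> \<zeta>0) - (\<Sum>q<D. C q * (w q - \<gamma> \<zeta>0 q))) \<le> \<epsilon> * supnorm D (\<lambda>q. w q - \<gamma> \<zeta>0 q)"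
    and S: "open S" "\<zeta>0 \<in> S" and \<gamma>: "hcurve S U \<gamma>" and U: "U \<subseteq> nvecs D"
  shows "(\<lambda>\<zeta>. \<phi> (\<gamma> \<zeta>)) field_differentiable (at \<zeta>0)"
proof -
  let ?d = "\<lambda>q. deriv (\<lambda>\<zeta>. \<gamma> \<zeta> q) \<zeta>0"
  let ?N = "\<lambda>\<zeta>. supnorm D (\<lambda>q. \<gamma> \<zeta> q - \<gamma> \<zeta>0 q)"
  have dg: "((\<lambda>\<zeta>. \<gamma> \<zeta> q) has_field_derivative ?d q) (at \<zeta>0)" if "q < D" for q
    using \<gamma> S that by (intro holomorphic_derivI[OF _ S]) (auto simp: hcurve_def)
  define K where "K = (\<Sum>q<D. cmod (?d q) + 1) + 1"
  have K0: "0 < K" by (auto simp: K_def intro!: add_nonneg_pos sum_nonneg)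
  have ev: "\<forall>\<^sub>F \<zeta> in at \<zeta>0. ?N \<zeta> \<le> K * cmod (\<zeta> - \<zeta>0)"
  proof -
    have "\<forall>\<^sub>F \<zeta> in at \<zeta>0. \<forall>q\<in>{..<D}. cmod (\<gamma> \<zeta> q - \<gamma> \<zeta>0 q) \<le> K * cmod (\<zeta> - \<zeta>0)"
    proof (rule eventually_ball_finite)
      show "\<forall>q\<in>{..<D}. \<forall>\<^sub>F \<zeta> in at \<zeta>0. cmod (\<gamma> \<zeta> q - \<gamma> \<zeta>0 q) \<le> K * cmod (\<zeta> - \<zeta>0)"
      proof
        fix q assume "q \<in> {..<D}"
        then have q: "q < D" by simp
        have "cmod (?d q) + 1 \<le> (\<Sum>q<D. cmod (?d q) + 1)" using q by (intro member_le_sum) auto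
        then have "cmod (?d q) < K" by (simp add: K_def)
        moreover have "((\<lambda>\<zeta>. cmod ((\<gamma> \<zeta> q - \<gamma> \<zeta>0 q) / (\<zeta> - \<zeta>0))) \<longlongrightarrow> cmod (?d q)) (at \<zeta>0)"
          using dg[OF q] by (intro tendsto_norm) (simp add: has_field_derivative_iff)
        ultimately have "\<forall>\<^sub>F \<zeta> in at \<zeta>0. cmod ((\<gamma> \<zeta> q - \<gamma> \<zeta>0 q) / (\<zeta> - \<zeta>0)) < K"
          using order_tendstoD(2) by blast
        then show "\<forall>\<^sub>F \<zeta> in at \<zeta>0. cmod (\<gamma> \<zeta> q - \<gamma> \<zeta>0 q) \<le> K * cmod (\<zeta> - \<zeta>0)"
          using eventually_neq_at_within[of \<zeta>0]
          by eventually_elim (auto simp: norm_divide field_simps)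
      qed
    qed simp
    then show ?thesis by eventually_elim (simp add: supnorm_le_iff)
  qed
  let ?R = "\<lambda>\<zeta>. \<phi> (\<gamma> \<zeta>) - \<phi> (\<gamma> \<zeta>0) - (\<Sum>q<D. C q * (\<gamma> \<zeta> q - \<gamma> \<zeta>0 q))"
  have "((\<lambda>\<zeta>. ?R \<zeta> / (\<zeta> - \<zeta>0)) \<longlongrightarrow> 0) (at \<zeta>0)"
  proof (rule tendstoI)
    fix e :: real assume e: "0 < e"
    obtain d where d: "0 < d" "\<And>w. w \<in> nvecs D \<Longrightarrow> supnorm D (\<lambda>q. w q - \<gamma> \<zeta>0 q) < d \<Longrightarrow>
          norm (\<phi> w - \<phi> (\<gamma> \<zeta>0) - (\<Sum>q<D. C q * (w q - \<gamma> \<zeta>0 q))) \<le> (e / (2 * K)) * supnorm D (\<lambda>q. w q - \<gamma> \<zeta>0 q)"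
      using der[rule_format, of "e / (2 * K)"] e K0 by auto
    have "\<forall>\<^sub>F \<zeta> in at \<zeta>0. dist \<zeta> \<zeta>0 < d / K" using d(1) K0 by (auto simp: eventually_at intro!: exI[of _ "d / K"])
    moreover have "\<forall>\<^sub>F \<zeta> in at \<zeta>0. \<zeta> \<in> S" using S eventually_at_in_open' by blast
    ultimately show "\<forall>\<^sub>F \<zeta> in at \<zeta>0. dist (?R \<zeta> / (\<zeta> - \<zeta>0)) 0 < e"
      using ev eventually_neq_at_within[of \<zeta>0]
    proof eventually_elim
      case (elim \<zeta>)
      have "\<gamma> \<zeta> \<in> nvecs D" using elim(2) \<gamma> U by (auto simp: hcurve_def)
      moreover have "?N \<zeta> < d" using elim(1,3) K0 by (auto simp: dist_norm field_simps intro: le_less_trans)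
      ultimately have "cmod (?R \<zeta>) \<le> (e / (2 * K)) * ?N \<zeta>" by (rule d(2))
      also have "\<dots> \<le> (e / (2 * K)) * (K * cmod (\<zeta> - \<zeta>0))" using elim e K0 by (intro mult_left_mono) auto
      also have "\<dots> = e / 2 * cmod (\<zeta> - \<zeta>0)" using K0 by simp
      finally have "cmod (?R \<zeta>) / cmod (\<zeta> - \<zeta>0) \<le> e / 2" using elim by (simp add: divide_le_eq)
      then have "cmod (?R \<zeta>) / cmod (\<zeta> - \<zeta>0) < e" using e by linarith
      then show ?case by (simp add: norm_divide)
    qed
  qed
  then have R: "(?R has_field_derivative 0) (at \<zeta>0)" by (simp add: has_field_derivative_iff)
  have "((\<lambda>\<zeta>. ?R \<zeta> + (\<phi> (\<gamma> \<zeta>0) + (\<Sum>q<D. C q * (\<gamma> \<zeta> q - \<gamma> \<zeta>0 q)))) has_field_derivative 0 + (0 + (\<Sum>q<D. C q * (?d q - 0)))) (at \<zeta>0)"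
    by (intro DERIV_add R DERIV_const DERIV_sum DERIV_cmult DERIV_diff dg) auto
  then have "((\<lambda>\<zeta>. \<phi> (\<gamma> \<zeta>)) has_field_derivative 0 + (0 + (\<Sum>q<D. C q * (?d q - 0)))) (at \<zeta>0)" by simp
  then show ?thesis by (auto simp: field_differentiable_def)
qed

lemma holomorphic_field_hfam:
  assumes h: "holomorphic_field D U G" and U: "U' \<subseteq> U" "U \<subseteq> nvecs D"
    and M: "\<And>z p. z \<in> U' \<Longrightarrow> p < D \<Longrightarrow> cmod (G z p) \<le> M"
  shows "hfam T U' M (\<lambda>_. G)"
  unfolding hfam_def
proof (intro conjI ballI allI impI)
  fix z assume "z \<in> U'"
  then show "G z \<in> nvecs D" using h U by (auto simp: holomorphic_field_def)
next
  fix p assume p: "p < D"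
  show "hfun T U' M (\<lambda>_ z. G z p)"
  proof (rule hfunI)
    fix S \<eta> \<gamma> assume *: "open S" "hcurve S U' \<gamma>"
    have "(\<lambda>\<zeta>. G (\<gamma> \<zeta>) p) field_differentiable (at \<zeta>0)" if "\<zeta>0 \<in> S" for \<zeta>0
    proof -
      have "\<gamma> \<zeta>0 \<in> U" using * that U by (auto simp: hcurve_def)
      then obtain C where "\<forall>\<epsilon>>0. \<exists>\<delta>>0. \<forall>w\<in>nvecs D. supnorm D (\<lambda>q. w q - \<gamma> \<zeta>0 q) < \<delta> \<longrightarrow>
          norm (G w p - G (\<gamma> \<zeta>0) p - (\<Sum>q<D. C q * (w q - \<gamma> \<zeta>0 q))) \<le> \<epsilon> * supnorm D (\<lambda>q. w q - \<gamma> \<zeta>0 q)"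
        using h p unfolding holomorphic_field_def by blast
      from Frechet_curve[OF this *(1) that *(2)] U show ?thesis by blast
    qed
    then show "(\<lambda>\<zeta>. G (\<gamma> \<zeta>) p) holomorphic_on S"
      using *(1) by (simp add: holomorphic_on_def field_differentiable_at_within)
  qed (use M p in auto)
qed

text \<open>Differentiability at \<open>z\<close> with tolerance 1 already bounds the field near
  \<open>z\<close>. This supplies bounds for the coefficients of an arbitrary IMDE, of which only
  analyticity is known.\<close>

lemma holomorphic_field_locally_hfam:
  assumes h: "holomorphic_field D (nball D c \<rho>) G" and z: "z \<in> nball D c \<rho>"
  obtains \<delta> M where "0 < \<delta>" "0 < M" "\<And>w. w \<in> nball D z \<delta> \<Longrightarrow> w \<in> nball D c \<rho>" "hfam {0} (nball D z \<delta>) M (\<lambda>_. G)"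
proof -
  obtain d where d: "0 < d" "\<And>w. w \<in> nball D z d \<Longrightarrow> w \<in> nball D c \<rho>" using nball_margin[OF z] by metis
  have "\<exists>\<delta>>0. \<exists>B. \<forall>w\<in>nball D z \<delta>. cmod (G w p) \<le> B" if p: "p < D" for p
  proof -
    obtain C where "\<forall>\<epsilon>>0. \<exists>\<delta>>0. \<forall>w\<in>nvecs D. supnorm D (\<lambda>q. w q - z q) < \<delta> \<longrightarrow>
          norm (G w p - G z p - (\<Sum>q<D. C q * (w q - z q))) \<le> \<epsilon> * supnorm D (\<lambda>q. w q - z q)"
      using h z p unfolding holomorphic_field_def by blast
    then obtain \<delta> where \<delta>: "0 < \<delta>" "\<And>w. w \<in> nvecs D \<Longrightarrow> supnorm D (\<lambda>q. w q - z q) < \<delta> \<Longrightarrow>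
          norm (G w p - G z p - (\<Sum>q<D. C q * (w q - z q))) \<le> 1 * supnorm D (\<lambda>q. w q - z q)"
      using zero_less_one by blast
    have "cmod (G w p) \<le> cmod (G z p) + (\<Sum>q<D. cmod (C q) * \<delta>) + \<delta>" if w: "w \<in> nball D z \<delta>" for w
    proof -
      have 1: "cmod (G w p - G z p - (\<Sum>q<D. C q * (w q - z q))) \<le> \<delta>"
        using \<delta>(2)[of w] w by (auto simp: nball_def)
      have 2: "cmod (\<Sum>q<D. C q * (w q - z q)) \<le> (\<Sum>q<D. cmod (C q) * \<delta>)"
        by (rule sum_norm_le) (use w in \<open>auto simp: norm_mult in_nball_iff intro!: mult_left_mono intro: less_imp_le\<close>)
      have "G w p = (G w p - G z p - (\<Sum>q<D. C q * (w q - z q))) + (\<Sum>q<D. C q * (w q - z q)) + G z p" by simp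
      also have "cmod \<dots> \<le> \<delta> + (\<Sum>q<D. cmod (C q) * \<delta>) + cmod (G z p)"
        by (intro norm_triangle_mono 1 2 order_refl)
      finally show ?thesis by simp
    qed
    then show ?thesis using \<delta>(1) by blast
  qed
  then obtain \<delta> B where \<delta>: "\<And>p. p < D \<Longrightarrow> 0 < \<delta> p" "\<And>p w. p < D \<Longrightarrow> w \<in> nball D z (\<delta> p) \<Longrightarrow> cmod (G w p) \<le> B p" by metis
  define e where "e = min d (Min (\<delta> ` {..<D}))"
  have e: "0 < e" "e \<le> d" "\<And>p. p < D \<Longrightarrow> e \<le> \<delta> p"
    using \<delta>(1) d(1) D_pos by (auto simp: e_def min_le_iff_disj lessThan_empty_iff)
  show ?thesis
  proof (rule that[OF e(1), of "Max (insert 1 (B ` {..<D}))"])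
    show "w \<in> nball D c \<rho>" if "w \<in> nball D z e" for w using d(2)[OF nball_mono[OF e(2) that]] .
    then show "hfam {0} (nball D z e) (Max (insert 1 (B ` {..<D}))) (\<lambda>_. G)"
    proof (intro holomorphic_field_hfam[OF h])
      fix w p assume "w \<in> nball D z e" "p < D"
      then have "cmod (G w p) \<le> B p" using \<delta>(2) nball_mono[OF e(3)] by blast
      also have "\<dots> \<le> Max (insert 1 (B ` {..<D}))" using \<open>p < D\<close> by (intro Max_ge) auto
      finally show "cmod (G w p) \<le> Max (insert 1 (B ` {..<D}))" .
    qed (auto dest: nball_nvecs)
    show "0 < Max (insert 1 (B ` {..<D}))" by (rule less_le_trans[OF zero_less_one Max_ge]) auto
  qed
qed

end

section \<open>Reality\<close>

lemma deriv_real_on_reals: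
  assumes f: "(f has_field_derivative f') (at (complex_of_real x))" and "0 < e"
    and re: "\<And>t. \<bar>t - x\<bar> < e \<Longrightarrow> Im (f (of_real t)) = 0"
  shows "Im f' = 0" and "((\<lambda>t. Re (f (of_real t))) has_field_derivative Re f') (at x)"
proof -
  have v: "((\<lambda>t. f (of_real t)) has_vector_derivative f') (at x)"
    using f by (rule has_vector_derivative_real_field)
  then show "((\<lambda>t. Re (f (of_real t))) has_field_derivative Re f') (at x)"
    by (simp add: has_vector_derivative_complex_iff)
  have "((\<lambda>t. Im (f (of_real t))) has_field_derivative Im f') (at x)"
    using v by (simp add: has_vector_derivative_complex_iff)
  moreover have "((\<lambda>t. Im (f (of_real t))) has_field_derivative 0) (at x)"
  proof (rule has_field_derivative_transform_within_open[where S = "{x - e<..<x + e}" and f = "\<lambda>_. 0"])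
    show "0 = Im (f (of_real t))" if "t \<in> {x - e<..<x + e}" for t using re[of t] that by (simp add: abs_less_iff)
  qed (use \<open>0 < e\<close> in auto)
  ultimately show "Im f' = 0" by (rule DERIV_unique)
qed

lemma higher_deriv_real_on_reals:
  assumes "f holomorphic_on ball 0 r" and "\<And>t. \<bar>t\<bar> < r \<Longrightarrow> Im (f (of_real t)) = 0" and "\<bar>x\<bar> < r"
  shows "Im ((deriv ^^ k) f (of_real x)) = 0"
  using assms(3)
proof (induction k arbitrary: x)
  case (Suc k)
  have x: "complex_of_real x \<in> ball 0 r" using Suc.prems by simp
  have "((deriv ^^ k) f has_field_derivative (deriv ^^ Suc k) f (of_real x)) (at (of_real x))"
    using has_field_derivative_higher_deriv[OF assms(1) open_ball x] by simp
  then show ?case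
    by (rule deriv_real_on_reals[where e = "r - \<bar>x\<bar>"]) (use Suc in auto)
qed (use assms in auto)

definition realf :: "complex nvec set \<Rightarrow> (complex nvec \<Rightarrow> complex nvec) \<Rightarrow> bool" where
  "realf U g \<longleftrightarrow> (\<forall>y p. cvec y \<in> U \<longrightarrow> Im (g (cvec y) p) = 0)"

lemma realfD: "realf U g \<Longrightarrow> w \<in> U \<Longrightarrow> (\<And>p. Im (w p) = 0) \<Longrightarrow> Im (g w p) = 0"
  using cvec_Re[of w] unfolding realf_def by metis

context dim
begin

text \<open>The formal scheme differentiates real fields, the actual one their complex extensions;
  this identifies the two Jacobians.\<close>

lemma pd_real:
  assumes hf: "hfun T (nball D c \<rho>) M (\<lambda>_. \<phi>)" and T: "T \<noteq> {}" and y: "cvec y \<in> nball D c \<rho>" and q: "q < D"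
    and re: "\<And>y. cvec y \<in> nball D c \<rho> \<Longrightarrow> Im (\<phi> (cvec y)) = 0"
  shows "Im (pd \<phi> (cvec y) q) = 0" and "pd (\<lambda>y. Re (\<phi> (cvec y))) y q = Re (pd \<phi> (cvec y) q)"
proof -
  define e :: "complex nvec" where "e = (\<lambda>p. if p = q then 1 else 0)"
  have e: "e \<in> nvecs D" using q by (auto simp: e_def nvecs_def)
  have "((\<lambda>\<eta>. \<phi> (\<lambda>p. cvec y p + \<eta> * e p)) has_field_derivative pd \<phi> (cvec y) q) (at (of_real (y q) - of_real (y q)))"
    using dird_has_derivative[OF hf T y e] by (simp add: dird_def pd_shift e_def)
  then have "((\<lambda>t. \<phi> (\<lambda>p. cvec y p + (t - of_real (y q)) * e p)) has_field_derivative pd \<phi> (cvec y) q * 1) (at (of_real (y q)))"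
    by (rule DERIV_chain2[where f = "\<lambda>\<eta>. \<phi> (\<lambda>p. cvec y p + \<eta> * e p)"]) (auto intro!: derivative_eq_intros)
  moreover have "(\<lambda>p. cvec y p + (t - of_real (y q)) * e p) = (cvec y)(q := t)" for t
    by (auto simp: e_def cvec_def fun_eq_iff)
  ultimately have d: "((\<lambda>t. \<phi> ((cvec y)(q := t))) has_field_derivative pd \<phi> (cvec y) q) (at (of_real (y q)))" by simp
  obtain \<delta> where \<delta>: "0 < \<delta>" "cvec y \<in> nball D c (\<rho> - \<delta>)" using nball_margin[OF y] by metis
  have upd: "(cvec y)(q := of_real t) = cvec (y(q := t))" for t by (auto simp: cvec_def)
  have "cvec (y(q := t)) \<in> nball D c \<rho>" if "\<bar>t - y q\<bar> < \<delta>" for t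
    by (rule nball_shift[OF \<delta>(2)])
      (use nball_nvecs[OF y] that \<delta>(1) q in \<open>auto simp: nvecs_def cvec_def simp flip: of_real_diff\<close>)
  then have re': "Im (\<phi> ((cvec y)(q := of_real t))) = 0" if "\<bar>t - y q\<bar> < \<delta>" for t
    using re that by (simp add: upd)
  note dr = deriv_real_on_reals[OF d \<delta>(1) re']
  then show "Im (pd \<phi> (cvec y) q) = 0" by simp
  have "((\<lambda>t. Re (\<phi> (cvec (y(q := t))))) has_field_derivative Re (pd \<phi> (cvec y) q)) (at (y q))"
    using dr(2) by (simp add: upd)
  then show "pd (\<lambda>y. Re (\<phi> (cvec y))) y q = Re (pd \<phi> (cvec y) q)"
    unfolding pd_def[of "\<lambda>y. Re (\<phi> (cvec y))"] by (rule DERIV_imp_deriv)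
qed

end

context rk
begin

text \<open>In the Newton case the linear system has real data and its iterative solution starts at
  a real point, so every iterate and hence the limit is real.\<close>

lemma stage_real:
  assumes d: "0 < \<delta>" "0 \<le> M" "16 * \<kappa> * cmod (of_real h) * M \<le> \<delta>"
    and g: "hfam {0} (nball D c (\<rho> + 2 * \<delta>)) M (\<lambda>_. g)" and z: "cvec z \<in> nball D c \<rho>"
    and re: "realf (nball D c (\<rho> + 2 * \<delta>)) g" and "i < I"
  shows "Im (stage (of_real h) g (cvec z) l i p) = 0"
proof -
  have zr: "Im (cvec z p) = 0" for p by (simp add: cvec_def)
  have "\<forall>i<I. \<forall>p. Im (stage (of_real h) g (cvec z) l i p) = 0"
  proof (induction l)
    case 0
    then show ?case by (simp add: stage_0 zr)
  next
    case (Suc l)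
    have sb: "stage (of_real h) g (cvec z) l j \<in> nball D c (\<rho> + 2 * \<delta>)" if "j < I" for j
      using nball_mono[OF _ stage_in_nball[OF d g z that]] d(1) by auto
    have gr: "Im (g (stage (of_real h) g (cvec z) l j) p) = 0" if "j < I" for j p
      using realfD[OF re sb[OF that]] Suc that by blast
    show ?case
    proof (intro allI impI)
      fix i p assume i: "i < I"
      show "Im (stage (of_real h) g (cvec z) (Suc l) i p) = 0"
      proof (cases sv)
        case Fixed_Point
        show ?thesis using gr zr by (simp add: stage_FP[OF Fixed_Point])
      next
        case Newton_Raphson
        interpret newton D sv I a b L \<kappa> c \<rho> \<delta> M "of_real h" g "cvec z" "stage (of_real h) g (cvec z) l"
          by unfold_locales (use d g z stage_near[OF d g z] in auto)
        have jr: "Im (jacobian g (stage (of_real h) g (cvec z) l j) p q) = 0" if "j < I" "q < D" for j p q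
        proof -
          let ?y = "\<lambda>p. Re (stage (of_real h) g (cvec z) l j p)"
          have y: "cvec ?y = stage (of_real h) g (cvec z) l j" by (rule cvec_Re) (use Suc that in auto)
          have "Im (pd (\<lambda>z. g z p) (cvec ?y) q) = 0"
            by (rule pd_real(1)[OF gp]) (use that y sb re in \<open>auto simp: realf_def\<close>)
          then show ?thesis by (simp add: y jacobian_eq_pd)
        qed
        have "\<forall>i p. Im (iter n i p) = 0" for n
        proof (induction n)
          case 0
          then show ?case by (simp add: iter_def zr)
        next
          case IH: (Suc n)
          show ?case using IH Suc jr gr by (simp add: iter_def nmap_def zr)
        qed
        moreover have "(\<lambda>n. Im (iter n i p)) \<longlonglongrightarrow> Im (sol i p)" by (intro tendsto_intros iter_tendsto i)
        ultimately have "Im (sol i p) = 0" using LIMSEQ_unique[OF _ tendsto_const] by simp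
        then show ?thesis by (simp add: stage_NR[OF Newton_Raphson] the_sol sol_fixed i)
      qed
    qed
  qed
  then show ?thesis using \<open>i < I\<close> by blast
qed

lemma inc_real:
  assumes d: "0 < \<delta>" "0 \<le> M" "16 * \<kappa> * cmod (of_real h) * M \<le> \<delta>"
    and g: "hfam {0} (nball D c (\<rho> + 2 * \<delta>)) M (\<lambda>_. g)" and z: "cvec z \<in> nball D c \<rho>"
    and re: "realf (nball D c (\<rho> + 2 * \<delta>)) g"
  shows "Im (inc (of_real h) g (cvec z) p) = 0"
proof -
  have "stage (of_real h) g (cvec z) L i \<in> nball D c (\<rho> + 2 * \<delta>)" if "i < I" for i
    using nball_mono[OF _ stage_in_nball[OF d g z that]] d(1) by auto
  then have "Im (g (stage (of_real h) g (cvec z) L i) p) = 0" if "i < I" for i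
    using realfD[OF re] stage_real[OF d g z re that] that by blast
  then show ?thesis by (simp add: inc_def)
qed

end

context modified_field
begin

text \<open>For nonzero \<open>h\<close> the average is the displacement of a real solution divided
  by \<open>h\<close>; at \<open>h = 0\<close> it is the value of \<open>F\<close>.\<close>

lemma avg_real:
  assumes re: "realf (nball D c \<rho>) F" and z: "cvec z \<in> V (Suc j)" and h: "\<bar>h\<bar> < r"
  shows "Im (avg F (of_real h) (cvec z) p) = 0"
proof -
  have h': "complex_of_real h \<in> ball 0 r" using h by simp
  have f: "F (cvec y) = cvec (\<lambda>p. Re (F (cvec y) p))" if "cvec y \<in> nball D c (\<rho> - 2 * \<delta> + 2 * \<delta>)" for y
    using re that by (intro cvec_Re[symmetric]) (auto simp: realf_def)
  note z' = V_pic[OF z]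
  show ?thesis
  proof (cases "h = 0 \<or> \<not> p < D")
    case True
    then consider "p < D" "h = 0" | "\<not> p < D" by blast
    then show ?thesis
    proof cases
      case 1
      then have "avg F (of_real h) (cvec z) p = F (cvec z) p" using pic.avg_near[OF z' h', of p] by simp
      moreover have "cvec z \<in> nball D c \<rho>" by (rule nball_mono[OF _ z']) (use delta in auto)
      ultimately show ?thesis using re by (simp add: realf_def)
    next
      case 2
      then show ?thesis using hfam_nvecs[OF pic.avg_hfam h' z'] by (simp add: nvecs_def)
    qed
  next
    case False
    have "Im (flowc F (of_real h) (cvec z) p) = 0" by (rule pic.flowc_real[OF f z' h])
    then show ?thesis using pic.flowc_eq_avg[OF z' h', of p] False by (simp add: cvec_def)
  qed
qed

lemma giter_real:
  assumes re: "realf (nball D c \<rho>) F" and h: "\<bar>h\<bar> < r"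
  shows "realf (V j) (giter F j (of_real h))"
proof (induction j)
  case 0
  then show ?case using re by simp
next
  case (Suc j)
  have h': "complex_of_real h \<in> ball 0 r" using h by simp
  show ?case unfolding realf_def
  proof (intro allI impI)
    fix y p assume y: "cvec y \<in> V (Suc j)"
    have sub: "w \<in> V j" if "w \<in> nball D c (\<rho> - 3 * \<delta> * real (Suc j) + 2 * \<delta>)" for w
      by (rule nball_mono[OF _ that]) (use delta in \<open>auto simp: algebra_simps\<close>)
    have "hfam {0} (nball D c (\<rho> - 3 * \<delta> * real (Suc j) + 2 * \<delta>)) (2 * M) (\<lambda>_. giter F j (of_real h))"
      by (rule hfam_mono[OF hfam_fixed[OF giter_hfam h']]) (use sub in auto)
    then have "Im (inc (of_real h) (giter F j (of_real h)) (cvec y) p) = 0"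
      by (rule inc_real[OF delta _ h_small(4)[OF h'], rotated]) (use Suc sub y M0 in \<open>auto simp: realf_def\<close>)
    moreover have "Im (giter F j (of_real h) (cvec y) p) = 0" using Suc V_mono[OF _ y, of j] by (auto simp: realf_def)
    ultimately show "Im (giter F (Suc j) (of_real h) (cvec y) p) = 0" using avg_real[OF re y h] by simp
  qed
qed

end

section \<open>Formal and convergent power series\<close>

text \<open>Cauchy bounds the coefficients by \<open>M / r ^ k\<close>, so the tail is dominated by
  a geometric series of ratio at most 1/2, whose sum is at most twice its first term.\<close>

lemma Taylor_tail_bound:
  assumes f: "f holomorphic_on ball 0 r" and r: "0 < r" and M: "\<And>z. z \<in> ball 0 r \<Longrightarrow> cmod (f z) \<le> M"
    and h: "cmod h \<le> r / 2"
  shows "cmod (f h - (\<Sum>k<N. (deriv ^^ k) f 0 / fact k * h ^ k)) \<le> 2 * M * (cmod h / r) ^ N"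
proof -
  define x where "x = cmod h / r"
  have x: "0 \<le> x" "x \<le> 1 / 2" using h r by (auto simp: x_def field_simps)
  have M0: "0 \<le> M" using M[of 0] r norm_ge_zero order_trans by (metis centre_in_ball)
  have s: "(\<lambda>k. (deriv ^^ k) f 0 / fact k * h ^ k) sums f h"
    using holomorphic_power_series[OF f, of h] h r by simp
  have b: "cmod ((deriv ^^ k) f 0 / fact k * h ^ k) \<le> M * x ^ k" for k
  proof -
    have "cmod ((deriv ^^ k) f 0) \<le> fact k * M / r ^ k" by (rule Cauchy_bound_ball[OF f r M])
    then have "cmod ((deriv ^^ k) f 0) / fact k * cmod h ^ k \<le> M / r ^ k * cmod h ^ k"
      by (intro mult_right_mono) (auto simp: field_simps)
    then show ?thesis by (simp add: norm_mult norm_divide norm_power x_def power_divide)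
  qed
  have g: "(\<lambda>k. M * x ^ N * x ^ k) sums (M * x ^ N * (1 / (1 - x)))"
    using x by (intro sums_mult geometric_sums) auto
  have t: "(\<lambda>k. (deriv ^^ (k + N)) f 0 / fact (k + N) * h ^ (k + N)) sums (f h - (\<Sum>k<N. (deriv ^^ k) f 0 / fact k * h ^ k))"
    using sums_split_initial_segment[OF s, of N] .
  have "cmod (f h - (\<Sum>k<N. (deriv ^^ k) f 0 / fact k * h ^ k)) \<le> M * x ^ N * (1 / (1 - x))"
    unfolding sums_unique[OF t] sums_unique[OF g]
  proof (rule norm_suminf_le[OF _ sums_summable[OF g]])
    show "cmod ((deriv ^^ (k + N)) f 0 / fact (k + N) * h ^ (k + N)) \<le> M * x ^ N * x ^ k" for k
      using b[of "k + N"] by (simp only: power_add mult_ac)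
  qed
  also have "\<dots> \<le> M * x ^ N * 2" using x M0 by (intro mult_left_mono) (auto simp: field_simps)
  finally show ?thesis by (simp add: x_def mult_ac)
qed

text \<open>The formal side of the IMDE is real, the analytic side complex. This coefficientwise
  embedding is a ring homomorphism between them.\<close>

definition cfps :: "real fps \<Rightarrow> complex fps" where
  "cfps A = Abs_fps (\<lambda>n. of_real (fps_nth A n))"

lemma cfps_nth [simp]: "fps_nth (cfps A) n = of_real (fps_nth A n)"
  by (simp add: cfps_def)

lemma cfps_hom:
  "cfps (A + B) = cfps A + cfps B" "cfps (A - B) = cfps A - cfps B" "cfps (A * B) = cfps A * cfps B"
  "cfps (fps_const x) = fps_const (of_real x)" "cfps fps_X = fps_X" "cfps 0 = 0"
  by (auto simp: fps_eq_iff fps_mult_nth)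

lemma cfps_sum: "cfps (\<Sum>i\<in>A. f i) = (\<Sum>i\<in>A. cfps (f i))"
  by (induction A rule: infinite_finite_induct) (auto simp: cfps_hom)

text \<open>Taylor coefficients at 0 of a function that is real on real points are real; they form
  \<open>A\<close>.\<close>

lemma real_on_reals_expansion:
  assumes f: "f holomorphic_on ball 0 r" and r: "0 < r" and re: "\<And>t. \<bar>t\<bar> < r \<Longrightarrow> f (of_real t) = of_real (g t)"
  shows "\<exists>A. f has_fps_expansion cfps A \<and> g has_fps_expansion A"
proof -
  define P where "P = fps_expansion f 0"
  define A where "A = Abs_fps (\<lambda>n. Re (fps_nth P n))"
  have P: "f has_fps_expansion P"
    unfolding P_def by (rule has_fps_expansion_fps_expansion[of "ball 0 r"]) (use r f in auto)
  have "Im ((deriv ^^ n) f (of_real 0)) = 0" for n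
    by (rule higher_deriv_real_on_reals[OF f]) (use re r in auto)
  then have "Im (fps_nth P n) = 0" for n
    using Im_divide_of_real[of "(deriv ^^ n) f 0" "fact n"] by (simp add: fps_nth_fps_expansion[OF P])
  then have PA: "P = cfps A" by (auto simp: A_def fps_eq_iff complex_eq_iff)
  have "g has_fps_expansion A"
  proof (rule has_fps_expansionI)
    have "eventually (\<lambda>u::real. u \<in> ball 0 r) (nhds 0)" using r by (intro eventually_nhds_in_open) auto
    then show "\<forall>\<^sub>F u in nhds 0. (\<lambda>n. fps_nth A n * u ^ n) sums g u"
    proof eventually_elim
      case (elim u)
      have "(\<lambda>n. fps_nth P n * of_real u ^ n) sums f (of_real u)"
        by (rule has_fps_expansion_imp_sums_complex[OF P, where r = r]) (use f elim in auto)
      then have "(\<lambda>n. complex_of_real (fps_nth A n * u ^ n)) sums of_real (g u)"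
        using re[of u] elim by (simp add: PA)
      then show ?case by (simp only: sums_of_real_iff)
    qed
  qed
  then show ?thesis using P PA by auto
qed

text \<open>Here \<open>A\<close> is given, as by an IMDE, with its own radius of convergence. On a
  common disc the identity theorem carries the equality from the real interval to complex
  arguments.\<close>

lemma real_expansion_complexify:
  assumes f: "f holomorphic_on ball 0 r" and r: "0 < r" and re: "\<And>t. \<bar>t\<bar> < r \<Longrightarrow> f (of_real t) = of_real (g t)"
    and A: "g has_fps_expansion A"
  shows "f has_fps_expansion cfps A"
proof -
  have cr: "fps_conv_radius (cfps A) = fps_conv_radius A"
    by (subst (1 2) fps_conv_radius_norm[symmetric]) simp
  have pos: "0 < fps_conv_radius A" using A by (simp add: has_fps_expansion_def)
  obtain e where e: "0 < e" "ereal e < fps_conv_radius A" using pos ereal_dense2 by (metis ereal_less(2))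
  obtain d where d: "0 < d" "\<And>t. \<bar>t\<bar> < d \<Longrightarrow> eval_fps A t = g t"
    using A unfolding has_fps_expansion_def eventually_nhds_metric by (auto simp: dist_norm)
  define s where "s = min r (min e d)"
  have s: "0 < s" "s \<le> r" "s \<le> e" "s \<le> d" using r e d by (auto simp: s_def)
  let ?F = "eval_fps (cfps A)"
  have eqr: "?F (of_real t) = f (of_real t)" if t: "\<bar>t\<bar> < s" for t
  proof -
    have "(\<lambda>n. fps_nth A n * t ^ n) sums eval_fps A t"
      by (rule sums_eval_fps) (use t s in \<open>auto intro!: less_trans[OF _ e(2)]\<close>)
    then have "(\<lambda>n. of_real (fps_nth A n * t ^ n)) sums complex_of_real (eval_fps A t)" by (simp only: sums_of_real_iff)
    then have "?F (of_real t) = of_real (eval_fps A t)" by (simp add: eval_fps_def sums_iff)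
    then show ?thesis using re[of t] d(2)[of t] t s by simp
  qed
  have holF: "?F holomorphic_on ball 0 s"
    by (rule holomorphic_on_eval_fps) (use s cr in \<open>auto simp: in_eball_iff intro!: less_trans[OF _ e(2)]\<close>)
  have eq: "?F w - f w = 0" if "w \<in> ball 0 s" for w
  proof (rule analytic_continuation[where f = "\<lambda>w. ?F w - f w" and S = "ball 0 s" and U = "complex_of_real ` {-s<..<s}" and \<xi> = 0])
    show "(\<lambda>w. ?F w - f w) holomorphic_on ball 0 s"
      by (intro holomorphic_intros holF holomorphic_on_subset[OF f]) (use s in auto)
    show "0 islimpt complex_of_real ` {-s<..<s}"
      unfolding islimpt_approachable
    proof (intro allI impI)
      fix e :: real assume "0 < e"
      then show "\<exists>x'\<in>complex_of_real ` {- s<..<s}. x' \<noteq> 0 \<and> dist x' 0 < e"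
        using s by (intro bexI[of _ "of_real (min (s/2) (e/2))"]) auto
    qed
  qed (use s eqr that in auto)
  have "eventually (\<lambda>w::complex. w \<in> ball 0 s) (nhds 0)" using s by (intro eventually_nhds_in_open) auto
  then have "\<forall>\<^sub>F w in nhds 0. ?F w = f w" by eventually_elim (use eq in auto)
  then show ?thesis using pos cr by (simp add: has_fps_expansion_def)
qed

lemma higher_deriv_restrict_real:
  assumes "f holomorphic_on ball 0 r" and "\<And>t. \<bar>t\<bar> < r \<Longrightarrow> f (of_real t) = of_real (g t)" and "\<bar>x\<bar> < r"
  shows "(deriv ^^ n) f (of_real x) = of_real ((deriv ^^ n) g x)"
  using assms(3)
proof (induction n arbitrary: x)
  case (Suc n)
  have x: "complex_of_real x \<in> ball 0 r" using Suc.prems by simp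
  have d: "((deriv ^^ n) f has_field_derivative (deriv ^^ Suc n) f (of_real x)) (at (of_real x))"
    using has_field_derivative_higher_deriv[OF assms(1) open_ball x] by simp
  have *: "\<bar>t\<bar> < r" if "\<bar>t - x\<bar> < r - \<bar>x\<bar>" for t using that by linarith
  have Im: "Im ((deriv ^^ n) f (of_real t)) = 0" if "\<bar>t - x\<bar> < r - \<bar>x\<bar>" for t using Suc.IH[OF *[OF that]] by simp
  have "0 < r - \<bar>x\<bar>" using Suc.prems by simp
  note dr = deriv_real_on_reals[OF d this Im]
  have "((deriv ^^ n) g has_field_derivative Re ((deriv ^^ Suc n) f (of_real x))) (at x)"
  proof (rule has_field_derivative_transform_within_open[OF dr(2), where S = "{-r<..<r}"])
    show "Re ((deriv ^^ n) f (of_real t)) = (deriv ^^ n) g t" if "t \<in> {-r<..<r}" for t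
      using Suc.IH[of t] that by (simp add: abs_less_iff)
  qed (use Suc.prems in auto)
  then have "(deriv ^^ Suc n) g x = Re ((deriv ^^ Suc n) f (of_real x))" by (simp add: DERIV_imp_deriv)
  then show ?case using dr(1) by (simp add: complex_eq_iff)
qed (use assms in auto)

lemma fps_remainder_bound:
  assumes "(f::complex \<Rightarrow> complex) has_fps_expansion P"
  obtains r C where "0 < r" "0 \<le> C" "\<And>h. cmod h < r \<Longrightarrow> cmod (f h - (\<Sum>k\<le>n. fps_nth P k * h ^ k)) \<le> C * cmod h ^ Suc n"
proof -
  obtain S where S: "open S" "0 \<in> S" "f holomorphic_on S"
    using has_fps_expansion_imp_holomorphic[OF assms] by metis
  obtain s where s: "0 < s" "cball 0 s \<subseteq> S" using S open_contains_cball by blast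
  have "compact (f ` cball 0 s)"
    by (intro compact_continuous_image holomorphic_on_imp_continuous_on holomorphic_on_subset[OF S(3) s(2)]) auto
  then obtain M where M: "\<And>z. z \<in> cball 0 s \<Longrightarrow> cmod (f z) \<le> M" using compact_imp_bounded bounded_iff by (metis imageI)
  have M0: "0 \<le> M" using M[of 0] s(1) norm_ge_zero order_trans by (metis centre_in_cball less_imp_le)
  show ?thesis
  proof (rule that[of "s/2" "2 * M / s ^ Suc n"])
    fix h assume h: "cmod h < s/2"
    have "cmod (f h - (\<Sum>k<Suc n. (deriv ^^ k) f 0 / fact k * h ^ k)) \<le> 2 * M * (cmod h / s) ^ Suc n"
      by (rule Taylor_tail_bound) (use s M h in \<open>auto intro: holomorphic_on_subset[OF S(3)] simp: subset_iff\<close>)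
    then show "cmod (f h - (\<Sum>k\<le>n. fps_nth P k * h ^ k)) \<le> 2 * M / s ^ Suc n * cmod h ^ Suc n"
      by (simp add: fps_nth_fps_expansion[OF assms] lessThan_Suc_atMost power_divide del: power_Suc)
  qed (use s M0 in auto)
qed

context dim
begin

text \<open>The convergent curve \<open>\<gamma>\<close> represents the formal vector
  \<open>v\<close>; at this interface formal substitution meets composition of functions.\<close>

definition expands :: "complex nvec \<Rightarrow> (complex \<Rightarrow> complex nvec) \<Rightarrow> real fps nvec \<Rightarrow> bool" where
  "expands c \<gamma> v \<longleftrightarrow> (\<exists>r>0. hcurve (ball 0 r) (nvecs D) \<gamma>) \<and> \<gamma> 0 = c \<and> v \<in> nvecs D \<and>
     (\<forall>q<D. (\<lambda>h. \<gamma> h q) has_fps_expansion cfps (v q))"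

lemma curve_near:
  assumes "\<And>q. q < D \<Longrightarrow> isCont (\<lambda>h. \<gamma> h q) 0" and "\<gamma> (0::complex) = c" and "0 < r"
    and "\<And>h. h \<in> ball 0 r \<Longrightarrow> \<gamma> h \<in> nvecs D" and "0 < \<rho>"
  obtains s where "0 < s" "s \<le> r" "\<And>h. h \<in> ball 0 s \<Longrightarrow> \<gamma> h \<in> nball D c \<rho>"
proof -
  have "\<forall>\<^sub>F h in at 0. \<forall>q\<in>{..<D}. dist (\<gamma> h q) (\<gamma> 0 q) < \<rho>"
  proof (rule eventually_ball_finite)
    show "\<forall>q\<in>{..<D}. \<forall>\<^sub>F h in at 0. dist (\<gamma> h q) (\<gamma> 0 q) < \<rho>"
      using assms(1) by (auto simp: isCont_def intro!: tendstoD[OF _ assms(5)])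
  qed simp
  then obtain d where d: "0 < d" "\<And>h q. h \<noteq> 0 \<Longrightarrow> cmod h < d \<Longrightarrow> q < D \<Longrightarrow> dist (\<gamma> h q) (\<gamma> 0 q) < \<rho>"
    by (auto simp: eventually_at)
  have "dist (\<gamma> h q) (\<gamma> 0 q) < \<rho>" if "cmod h < d" "q < D" for h q
    using d(2)[of h q] that assms(5) by (cases "h = 0") auto
  then show ?thesis
    using assms d(1) by (intro that[of "min r d"]) (auto simp: in_nball_iff dist_norm)
qed

text \<open>\<open>formal_subst\<close> truncates \<open>v\<close> at degree \<open>n\<close> before
  taking the \<open>n\<close>-th derivative. The curve and its truncation \<open>\<beta>\<close>
  differ at order \<open>n + 1\<close>, and the Lipschitz function \<open>\<phi>\<close> preserves
  this, so the \<open>n\<close>-th derivatives at 0 coincide. Restriction to real parameters leads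
  from \<open>\<phi>\<close> to \<open>g\<close>.\<close>

lemma formal_subst_expansion:
  assumes hf: "hfun {0} (nball D (cvec z) \<rho>) M (\<lambda>_. \<phi>)" and \<rho>: "0 < \<rho>" and ex: "expands (cvec z) \<gamma> v"
    and g: "\<And>y. cvec y \<in> nball D (cvec z) \<rho> \<Longrightarrow> \<phi> (cvec y) = of_real (g y)"
  shows "(\<lambda>h. \<phi> (\<gamma> h)) has_fps_expansion cfps (formal_subst g v)"
proof -
  let ?c = "cvec z"
  obtain r0 where r0: "0 < r0" "hcurve (ball 0 r0) (nvecs D) \<gamma>" and \<gamma>0: "\<gamma> 0 = ?c" and v: "v \<in> nvecs D"
    and ve: "\<And>q. q < D \<Longrightarrow> (\<lambda>h. \<gamma> h q) has_fps_expansion cfps (v q)"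
    using ex by (auto simp: expands_def)
  have z: "?c \<in> nvecs D" using r0 \<gamma>0 by (auto simp: hcurve_def dest!: bspec[of _ _ 0])
  obtain r where r: "0 < r" "r \<le> r0" "\<And>h. h \<in> ball 0 r \<Longrightarrow> \<gamma> h \<in> nball D ?c (\<rho>/2)"
  proof (rule curve_near[where \<gamma> = \<gamma> and c = ?c and r = r0 and \<rho> = "\<rho>/2"])
    show "isCont (\<lambda>h. \<gamma> h q) 0" if "q < D" for q
      using has_fps_expansion_imp_continuous[OF ve[OF that], of UNIV] by simp
  qed (use r0 \<rho> \<gamma>0 that in \<open>auto simp: hcurve_def\<close>)
  have sub: "w \<in> nball D ?c \<rho>" if "w \<in> nball D ?c (\<rho>/2)" for w
    by (rule nball_mono[OF _ that]) (use \<rho> in auto)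
  have hol: "(\<lambda>h. \<phi> (\<beta> h)) holomorphic_on ball 0 s" if "hcurve (ball 0 s) (nball D ?c (\<rho>/2)) \<beta>" for \<beta> s
    using hfun_hol[OF hf, of "ball 0 s" "\<lambda>_. 0" \<beta>] hcurve_mono[OF that order_refl] sub by auto
  have "hcurve (ball 0 r) (nball D ?c (\<rho>/2)) \<gamma>"
    using r0(2) r by (auto simp: hcurve_def intro: holomorphic_on_subset)
  note hol\<gamma> = hol[OF this]
  have "(deriv ^^ n) (\<lambda>h. \<phi> (\<gamma> h)) 0 / fact n = of_real (fps_nth (formal_subst g v) n)" for n
  proof -
    define \<beta> where "\<beta> h q = (\<Sum>k\<le>n. of_real (fps_nth (v q) k) * h ^ k)" for h :: complex and q
    have \<beta>v: "\<beta> h \<in> nvecs D" for h using v by (auto simp: \<beta>_def nvecs_def)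
    have v0: "of_real (fps_nth (v q) 0) = ?c q" for q
    proof (cases "q < D")
      case True
      then show ?thesis using has_fps_expansion_imp_0_eq_fps_nth_0[OF ve[OF True]] \<gamma>0 by simp
    next
      case False
      then show ?thesis using v z by (simp add: nvecs_def)
    qed
    have \<beta>0: "\<beta> 0 = ?c"
    proof
      fix q
      have "\<beta> 0 q = (\<Sum>k\<le>n. if k = 0 then of_real (fps_nth (v q) 0) else 0)"
        unfolding \<beta>_def by (rule sum.cong) auto
      then show "\<beta> 0 q = ?c q" by (simp add: v0)
    qed
    obtain s where s: "0 < s" "s \<le> r" "\<And>h. h \<in> ball 0 s \<Longrightarrow> \<beta> h \<in> nball D ?c (\<rho>/2)"
    proof (rule curve_near[where \<gamma> = \<beta> and c = ?c and r = r and \<rho> = "\<rho>/2"])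
      show "isCont (\<lambda>h. \<beta> h q) 0" for q unfolding \<beta>_def by (intro continuous_intros)
    qed (use \<beta>v \<rho> \<beta>0 r that in auto)
    have "\<forall>q<D. \<exists>t C. 0 < t \<and> 0 \<le> C \<and> (\<forall>h. cmod h < t \<longrightarrow> cmod (\<gamma> h q - \<beta> h q) \<le> C * cmod h ^ Suc n)"
    proof (intro allI impI)
      fix q assume "q < D"
      then show "\<exists>t C. 0 < t \<and> 0 \<le> C \<and> (\<forall>h. cmod h < t \<longrightarrow> cmod (\<gamma> h q - \<beta> h q) \<le> C * cmod h ^ Suc n)"
        by (rule_tac fps_remainder_bound[OF ve[of q], of n]) (auto simp: \<beta>_def simp del: power_Suc)
    qed
    then obtain t C where tC: "\<And>q. q < D \<Longrightarrow> 0 < t q" "\<And>q. q < D \<Longrightarrow> 0 \<le> C q"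
      "\<And>q h. q < D \<Longrightarrow> cmod h < t q \<Longrightarrow> cmod (\<gamma> h q - \<beta> h q) \<le> C q * cmod h ^ Suc n" by metis
    define e where "e = min s (Min (t ` {..<D}))"
    have e: "0 < e" "e \<le> s" "\<And>q. q < D \<Longrightarrow> e \<le> t q"
      using tC(1) s(1) D_pos by (auto simp: e_def min_le_iff_disj lessThan_empty_iff)
    define K where "K = (\<Sum>q<D. C q)"
    have K: "0 \<le> K" "\<And>q. q < D \<Longrightarrow> C q \<le> K" using tC(2) by (auto simp: K_def intro!: sum_nonneg member_le_sum)
    have hol\<beta>: "(\<lambda>h. \<phi> (\<beta> h)) holomorphic_on ball 0 e"
      by (rule hol) (use s e in \<open>auto simp: hcurve_def \<beta>_def intro!: holomorphic_intros\<close>)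
    have "(deriv ^^ n) (\<lambda>h. \<phi> (\<gamma> h)) 0 = (deriv ^^ n) (\<lambda>h. \<phi> (\<beta> h)) 0"
    proof (rule higher_deriv_agree[OF _ hol\<beta> e(1)])
      show "(\<lambda>h. \<phi> (\<gamma> h)) holomorphic_on ball 0 e" by (rule holomorphic_on_subset[OF hol\<gamma>]) (use e s in auto)
      fix h :: complex assume h: "h \<in> ball 0 e"
      have "cmod (\<gamma> h q - \<beta> h q) \<le> K * cmod h ^ Suc n" if q: "q < D" for q
      proof -
        have "cmod (\<gamma> h q - \<beta> h q) \<le> C q * cmod h ^ Suc n" by (rule tC(3)[OF q]) (use h e(3)[OF q] in simp)
        also have "\<dots> \<le> K * cmod h ^ Suc n" by (rule mult_right_mono[OF K(2)[OF q]]) simp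
        finally show ?thesis .
      qed
      then have "cmod (\<phi> (\<gamma> h) - \<phi> (\<beta> h)) \<le> M / (\<rho>/2) * (K * cmod h ^ Suc n)"
        using hf r s e h K \<rho> by (intro hfun_Lipschitz[where T = "{0}" and c = ?c and \<rho> = "\<rho>/2"]) (auto simp del: power_Suc)
      then show "cmod (\<phi> (\<gamma> h) - \<phi> (\<beta> h)) \<le> (M / (\<rho>/2) * K) * cmod h ^ Suc n" by (simp only: mult.assoc)
    qed simp
    also have "\<dots> = of_real ((deriv ^^ n) (\<lambda>t. g (\<lambda>q. \<Sum>k\<le>n. fps_nth (v q) k * t ^ k)) 0)"
    proof (rule higher_deriv_restrict_real[OF hol\<beta>, of _ 0, simplified])
      fix t :: real assume "\<bar>t\<bar> < e"
      then have "\<beta> (of_real t) \<in> nball D ?c \<rho>" using s(3)[of "of_real t"] sub e by simp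
      moreover have "\<beta> (of_real t) = cvec (\<lambda>q. \<Sum>k\<le>n. fps_nth (v q) k * t ^ k)" by (simp add: \<beta>_def cvec_def fun_eq_iff)
      ultimately show "\<phi> (\<beta> (of_real t)) = of_real (g (\<lambda>q. \<Sum>k\<le>n. fps_nth (v q) k * t ^ k))" using g by simp
    qed (use e in simp)
    finally show ?thesis by (simp add: formal_subst_def)
  qed
  moreover have P: "(\<lambda>h. \<phi> (\<gamma> h)) has_fps_expansion fps_expansion (\<lambda>h. \<phi> (\<gamma> h)) 0"
    by (rule has_fps_expansion_fps_expansion[of "ball 0 r"]) (use hol\<gamma> r in auto)
  moreover have "fps_expansion (\<lambda>h. \<phi> (\<gamma> h)) 0 = cfps (formal_subst g v)"
    using calculation by (simp add: fps_eq_iff fps_nth_fps_expansion[OF P])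
  ultimately show ?thesis by simp
qed

text \<open>A full modified field may diverge, so the convergent side is a polynomial in
  \<open>h\<close>; with vanishing coefficients beyond \<open>n\<close> the formal sum is the
  matching series.\<close>

lemma formal_sum_expansion:
  assumes hf: "\<And>k. k \<le> n \<Longrightarrow> hfun {0} (nball D (cvec z) \<rho>) M (\<lambda>_. \<phi> k)" and \<rho>: "0 < \<rho>" and ex: "expands (cvec z) \<gamma> v"
    and g: "\<And>k y. k \<le> n \<Longrightarrow> cvec y \<in> nball D (cvec z) \<rho> \<Longrightarrow> \<phi> k (cvec y) = of_real (g k y)"
    and g0: "\<And>k y. n < k \<Longrightarrow> g k y = 0"
  shows "(\<lambda>h. \<Sum>k\<le>n. h ^ k * \<phi> k (\<gamma> h)) has_fps_expansion cfps (formal_sum g v)"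
proof -
  have "(\<lambda>h. \<Sum>k\<le>n. h ^ k * \<phi> k (\<gamma> h)) has_fps_expansion (\<Sum>k\<le>n. fps_X ^ k * cfps (formal_subst (g k) v))"
    by (intro fps_expansion_intros formal_subst_expansion[OF hf \<rho> ex g]) auto
  moreover have "(\<Sum>k\<le>n. fps_X ^ k * cfps (formal_subst (g k) v)) = cfps (formal_sum g v)"
  proof (rule fps_ext)
    fix m
    have z: "fps_nth (formal_subst (g k) v) j = 0" if "n < k" for k j
    proof -
      have "(deriv ^^ i) (\<lambda>t::real. 0::real) = (\<lambda>t. 0)" for i by (induction i) auto
      then show ?thesis using g0[OF that] by (simp add: formal_subst_def)
    qed
    have "fps_nth (\<Sum>k\<le>n. fps_X ^ k * cfps (formal_subst (g k) v)) m =
        (\<Sum>k\<le>n. if m < k then 0 else of_real (fps_nth (formal_subst (g k) v) (m - k)))"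
      by (simp add: fps_sum_nth fps_X_power_mult_nth cong: if_cong)
    also have "\<dots> = (\<Sum>k\<in>{..n} \<inter> {..m}. of_real (fps_nth (formal_subst (g k) v) (m - k)))"
      by (rule sum.mono_neutral_cong_right) auto
    also have "\<dots> = (\<Sum>k\<le>m. of_real (fps_nth (formal_subst (g k) v) (m - k)))"
      by (rule sum.mono_neutral_left) (auto, meson not_le z)
    also have "\<dots> = fps_nth (cfps (formal_sum g v)) m" by (simp add: formal_sum_def)
    finally show "fps_nth (\<Sum>k\<le>n. fps_X ^ k * cfps (formal_subst (g k) v)) m = fps_nth (cfps (formal_sum g v)) m" .
  qed
  ultimately show ?thesis by simp
qed

end

section \<open>Formal Runge--Kutta steps\<close>

text \<open>Congruence modulo the \<open>n\<close>-th power of the series variable.\<close>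

definition agree :: "nat \<Rightarrow> 'a::zero fps \<Rightarrow> 'a fps \<Rightarrow> bool" where
  "agree n A B \<longleftrightarrow> (\<forall>k<n. fps_nth A k = fps_nth B k)"

lemma agree_refl [simp]: "agree n A A" and agree_0 [simp]: "agree 0 A B"
  by (auto simp: agree_def)

lemma agree_add: "agree n A B \<Longrightarrow> agree n A' B' \<Longrightarrow> agree n (A + A') (B + (B' :: 'a::comm_ring_1 fps))"
  and agree_diff: "agree n A B \<Longrightarrow> agree n A' B' \<Longrightarrow> agree n (A - A') (B - B')"
  and agree_mult: "agree n A B \<Longrightarrow> agree n A' B' \<Longrightarrow> agree n (A * A') (B * B')"
  by (auto simp: agree_def fps_mult_nth intro!: sum.cong)

lemma agree_sum: "(\<And>i. i \<in> S \<Longrightarrow> agree n (A i) (B i)) \<Longrightarrow> agree n (\<Sum>i\<in>S. A i) (\<Sum>i\<in>S. B i :: 'a::comm_ring_1 fps)"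
  by (simp add: agree_def fps_sum_nth)

lemma agree_X: "agree n A B \<Longrightarrow> agree (Suc n) (fps_X * A) (fps_X * (B :: 'a::comm_ring_1 fps))"
  by (auto simp: agree_def)

lemma agree_mono: "agree n A B \<Longrightarrow> m \<le> n \<Longrightarrow> agree m A B"
  by (auto simp: agree_def)

lemma agree_eqI: "(\<And>n. agree n A B) \<Longrightarrow> A = B"
  by (auto simp: agree_def fps_eq_iff)

text \<open>\<open>S\<close> contracts in the X-adic sense. The coefficient of index
  \<open>k\<close> is stable from iterate \<open>Suc k\<close> on, so the diagonal \<open>w\<close>
  is a fixed point, and two fixed points agree to every order.\<close>

lemma formal_fixpoint:
  fixes S :: "('i \<Rightarrow> 'j \<Rightarrow> 'a::zero fps) \<Rightarrow> 'i \<Rightarrow> 'j \<Rightarrow> 'a fps"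
  assumes S: "\<And>n w w' i p. (\<And>i p. agree n (w i p) (w' i p)) \<Longrightarrow> agree (Suc n) (S w i p) (S w' i p)"
  shows "(THE w. w = S w) = S (THE w. w = S w)"
proof -
  define Z where "Z n = (S ^^ n) (\<lambda>_ _. 0)" for n
  have Z: "agree n (Z n i p) (Z (n + m) i p)" for n m i p
  proof (induction n arbitrary: i p)
    case (Suc n)
    then show ?case using S[of n "Z n" "Z (n + m)"] by (simp add: Z_def)
  qed simp
  define w where "w i p = Abs_fps (\<lambda>k. fps_nth (Z (Suc k) i p) k)" for i p
  have wZ: "agree n (w i p) (Z n i p)" for n i p
    unfolding agree_def
  proof (intro allI impI)
    fix k assume "k < n"
    then obtain m where "n = Suc k + m" by (metis less_iff_Suc_add add_Suc)
    then show "fps_nth (w i p) k = fps_nth (Z n i p) k"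
      using Z[of "Suc k" i p m] by (simp add: agree_def w_def)
  qed
  have w: "w = S w"
  proof (intro ext agree_eqI)
    fix i p n
    have "agree (Suc n) (S w i p) (Z (Suc n) i p)" using S[of n w "Z n"] wZ by (simp add: Z_def)
    then show "agree n (w i p) (S w i p)" using wZ[of n i p] wZ[of "Suc n" i p] by (simp add: agree_def)
  qed
  have uniq: "w' = w''" if "w' = S w'" "w'' = S w''" for w' w''
  proof (intro ext agree_eqI)
    fix i p n
    show "agree n (w' i p) (w'' i p)"
    proof (induction n arbitrary: i p)
      case (Suc n)
      then show ?case using S[of n w' w''] that by metis
    qed simp
  qed
  show ?thesis by (rule theI[where P = "\<lambda>w. w = S w", OF w uniq[OF _ w]])
qed

lemma formal_subst_agree:
  assumes "\<And>q. agree (Suc j) (v q) (v' q)"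
  shows "fps_nth (formal_subst g v) j = fps_nth (formal_subst g v') j"
proof -
  have "(\<Sum>k\<le>j. fps_nth (v q) k * t ^ k) = (\<Sum>k\<le>j. fps_nth (v' q) k * t ^ k)" for q and t :: real
    using assms[of q] by (intro sum.cong) (auto simp: agree_def)
  then show ?thesis by (simp add: formal_subst_def)
qed

context dim
begin

text \<open>The coefficients see \<open>g\<close> along polynomial curves that start at
  \<open>z\<close>, so its germ at \<open>z\<close> determines them.\<close>

lemma formal_subst_cong:
  assumes r: "0 < r" and g: "\<And>y. y \<in> nball D z r \<Longrightarrow> g y = g' y" and v: "v \<in> nvecs D" and v0: "\<And>q. fps_nth (v q) 0 = z q"
  shows "formal_subst g v = formal_subst g' v"
proof -
  have "(deriv ^^ n) (\<lambda>t. g (\<lambda>q. \<Sum>k\<le>n. fps_nth (v q) k * t ^ k)) 0 = (deriv ^^ n) (\<lambda>t. g' (\<lambda>q. \<Sum>k\<le>n. fps_nth (v q) k * t ^ k)) 0" for n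
  proof (rule higher_deriv_cong_ev)
    let ?c = "\<lambda>(t::real) q. \<Sum>k\<le>n. fps_nth (v q) k * t ^ k"
    have "(\<Sum>k\<le>n. fps_nth (v q) k * 0 ^ k) = (\<Sum>k\<le>n. if k = 0 then z q else 0)" for q
      by (rule sum.cong) (auto simp: v0)
    then have c0: "?c 0 q = z q" for q by simp
    have "\<forall>\<^sub>F t in nhds 0. dist (?c t q) (z q) < r" for q
    proof -
      have "isCont (\<lambda>t. ?c t q) 0" by (intro continuous_intros)
      then have "((\<lambda>t. ?c t q) \<longlongrightarrow> ?c 0 q) (nhds 0)" unfolding isCont_def tendsto_nhds_iff by simp
      then show ?thesis unfolding c0 using r by (rule tendstoD)
    qed
    then have "\<forall>\<^sub>F t in nhds 0. \<forall>q\<in>{..<D}. dist (?c t q) (z q) < r" by (intro eventually_ball_finite) auto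
    then show "\<forall>\<^sub>F t in nhds 0. g (?c t) = g' (?c t)"
    proof eventually_elim
      case (elim t)
      then have "?c t \<in> nball D z r" using v by (auto simp: in_nball_iff dist_norm nvecs_def)
      then show ?case by (rule g)
    qed
  qed simp
  then show ?thesis by (simp add: formal_subst_def)
qed

lemma formal_sum_agree:
  assumes r: "0 < r" and g: "\<And>k y. k < n \<Longrightarrow> y \<in> nball D z r \<Longrightarrow> g k y = g' k y"
    and v: "v \<in> nvecs D" "\<And>q. fps_nth (v q) 0 = z q" and v': "\<And>q. agree n (v q) (v' q)"
  shows "agree n (formal_sum g v) (formal_sum g' v')"
  unfolding agree_def
proof (intro allI impI)
  fix m assume m: "m < n"
  have "fps_nth (formal_subst (g k) v) (m - k) = fps_nth (formal_subst (g' k) v') (m - k)" if "k \<le> m" for k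
  proof -
    have "formal_subst (g k) v = formal_subst (g' k) v"
      by (rule formal_subst_cong[OF r g v]) (use that m in auto)
    then show ?thesis using formal_subst_agree[of "m - k" v v' "g' k"] agree_mono[OF v'] m by simp
  qed
  then show "fps_nth (formal_sum g v) m = fps_nth (formal_sum g' v') m" by (simp add: formal_sum_def)
qed

lemma formal_sum_zero:
  assumes r: "0 < r" and g: "\<And>k y. y \<in> nball D z r \<Longrightarrow> g k y = 0"
    and v: "v \<in> nvecs D" "\<And>q. fps_nth (v q) 0 = z q"
  shows "formal_sum g v = 0"
proof -
  have "formal_subst (\<lambda>_. 0) v = 0"
  proof -
    have "(deriv ^^ i) (\<lambda>t::real. 0::real) = (\<lambda>t. 0)" for i by (induction i) auto
    then show ?thesis by (simp add: formal_subst_def fps_eq_iff)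
  qed
  then have "formal_sum (\<lambda>_ _. 0) v = 0" by (simp add: formal_sum_def fps_eq_iff)
  moreover have "agree n (formal_sum g v) (formal_sum (\<lambda>_ _. 0) v)" for n
    by (rule formal_sum_agree[OF r]) (use g v in auto)
  ultimately show ?thesis using agree_eqI by metis
qed

lemma pd_cong:
  fixes g g' :: "real nvec \<Rightarrow> real"
  assumes g: "\<And>y. y \<in> nball D z r \<Longrightarrow> g y = g' y" and y: "y \<in> nball D z r" and q: "q < D"
  shows "pd g y q = pd g' y q"
  unfolding pd_def
proof (rule deriv_cong_ev)
  obtain \<delta> where \<delta>: "0 < \<delta>" "y \<in> nball D z (r - \<delta>)" using nball_margin[OF y] by metis
  have "\<forall>\<^sub>F t in nhds (y q). t \<in> ball (y q) \<delta>" using \<delta> by (intro eventually_nhds_in_open) auto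
  then show "\<forall>\<^sub>F t in nhds (y q). g (y(q := t)) = g' (y(q := t))"
  proof eventually_elim
    case (elim t)
    have "y(q := t) \<in> nball D z r"
      by (rule nball_shift[OF \<delta>(2)]) (use elim nball_nvecs[OF y] q \<delta>(1) in \<open>auto simp: nvecs_def dist_norm norm_minus_commute\<close>)
    then show ?case by (rule g)
  qed
qed simp

end

context rk
begin

definition fvals :: "(nat \<Rightarrow> real nvec \<Rightarrow> real nvec) \<Rightarrow> real fps nvec \<Rightarrow> real fps nvec" where
  "fvals fs v = (\<lambda>p. formal_sum (\<lambda>k y. fs k y p) v)"

definition fjac :: "(nat \<Rightarrow> real nvec \<Rightarrow> real nvec) \<Rightarrow> real fps nvec \<Rightarrow> nat \<Rightarrow> nat \<Rightarrow> real fps" where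
  "fjac fs v = (\<lambda>p q. formal_sum (\<lambda>k y. jacobian (fs k) y p q) v)"

definition fstage :: "(nat \<Rightarrow> real nvec \<Rightarrow> real nvec) \<Rightarrow> real nvec \<Rightarrow> nat \<Rightarrow> nat \<Rightarrow> real fps nvec" where
  "fstage fs z l = rk_stages fps_const sv I a D fps_X (fvals fs) (fjac fs) (\<lambda>p. fps_const (z p)) l"

definition fnmap :: "(nat \<Rightarrow> real nvec \<Rightarrow> real nvec) \<Rightarrow> real nvec \<Rightarrow> (nat \<Rightarrow> real fps nvec) \<Rightarrow> (nat \<Rightarrow> real fps nvec) \<Rightarrow> nat \<Rightarrow> real fps nvec" where
  "fnmap fs z v w = (\<lambda>i p. fps_const (z p) + fps_X * (\<Sum>j<I. fps_const (a i j) *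
      (fvals fs (v j) p + (\<Sum>q<D. fjac fs (v j) p q * (w j q - v j q)))))"

lemma formal_unrolled_eq:
  "formal_unrolled sv I a b L D fs z p = fps_const (z p) + fps_X * (\<Sum>i<I. fps_const (b i) * fvals fs (fstage fs z L i) p)"
  unfolding formal_unrolled_def rk_unrolled_def fstage_def fvals_def fjac_def ..

lemma fstage_0: "fstage fs z 0 i = (\<lambda>p. fps_const (z p))"
  by (simp add: fstage_def)

lemma fstage_FP: "sv = Fixed_Point \<Longrightarrow>
    fstage fs z (Suc l) i p = fps_const (z p) + fps_X * (\<Sum>j<I. fps_const (a i j) * fvals fs (fstage fs z l j) p)"
  unfolding fstage_def by simp

lemma fstage_NR: "sv = Newton_Raphson \<Longrightarrow> fstage fs z (Suc l) = fnmap fs z (fstage fs z l) (fstage fs z (Suc l))"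
proof -
  assume "sv = Newton_Raphson"
  then have "fstage fs z (Suc l) = (THE w. w = fnmap fs z (fstage fs z l) w)"
    unfolding fstage_def fnmap_def by (simp add: Let_def)
  also have "\<dots> = fnmap fs z (fstage fs z l) (THE w. w = fnmap fs z (fstage fs z l) w)"
    by (rule formal_fixpoint)
      (auto simp: fnmap_def intro!: agree_add agree_X agree_sum agree_mult agree_diff)
  finally show ?thesis using \<open>fstage fs z (Suc l) = (THE w. w = fnmap fs z (fstage fs z l) w)\<close> by simp
qed

text \<open>The constant terms are \<open>z\<close> because every correction carries a factor
  \<open>fps_X\<close>. Components beyond \<open>D\<close> vanish since those of the fields do so
  near \<open>z\<close>, which is all that formal substitution sees.\<close>

lemma fstage_wf:
  assumes r: "0 < r" and z: "z \<in> nvecs D" and fs: "\<And>k y. y \<in> nball D z r \<Longrightarrow> fs k y \<in> nvecs D"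
  shows "fstage fs z l i \<in> nvecs D" and "fps_nth (fstage fs z l i p) 0 = z p"
proof -
  have J0: "fjac fs v p q = 0" if "v \<in> nvecs D" "\<And>q. fps_nth (v q) 0 = z q" "D \<le> p" "q < D" for v p q
    unfolding fjac_def
  proof (rule formal_sum_zero[OF r _ that(1,2)])
    fix k y assume y: "y \<in> nball D z r"
    have "pd (\<lambda>y. fs k y p) y q = pd (\<lambda>y. 0) y q"
      by (rule pd_cong[OF _ y that(4)]) (use fs that(3) in \<open>auto simp: nvecs_def\<close>)
    then show "jacobian (fs k) y p q = 0" by (simp add: jacobian_eq_pd) (simp add: pd_def)
  qed
  have G0: "fvals fs v p = 0" if "v \<in> nvecs D" "\<And>q. fps_nth (v q) 0 = z q" "D \<le> p" for v p
    unfolding fvals_def by (rule formal_sum_zero[OF r _ that(1,2)]) (use fs that(3) in \<open>auto simp: nvecs_def\<close>)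
  have "\<forall>i. fstage fs z l i \<in> nvecs D \<and> (\<forall>p. fps_nth (fstage fs z l i p) 0 = z p)"
  proof (induction l)
    case 0
    then show ?case using z by (simp add: fstage_0 nvecs_def)
  next
    case (Suc l)
    then have IH: "fstage fs z l j \<in> nvecs D" "\<And>p. fps_nth (fstage fs z l j p) 0 = z p" for j by auto
    have "fstage fs z (Suc l) i p = 0" if p: "D \<le> p" for i p
    proof (cases sv)
      case Fixed_Point
      show ?thesis using z p G0[OF IH p] by (simp add: fstage_FP[OF Fixed_Point] nvecs_def)
    next
      case Newton_Raphson
      show ?thesis using z p G0[OF IH p] J0[OF IH p] by (subst fstage_NR[OF Newton_Raphson]) (simp add: fnmap_def nvecs_def)
    qed
    moreover have "fps_nth (fstage fs z (Suc l) i p) 0 = z p" for i p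
    proof (cases sv)
      case Fixed_Point
      show ?thesis by (simp add: fstage_FP[OF Fixed_Point])
    next
      case Newton_Raphson
      show ?thesis by (subst fstage_NR[OF Newton_Raphson]) (simp add: fnmap_def)
    qed
    ultimately show ?case by (auto simp: nvecs_def)
  qed
  then show "fstage fs z l i \<in> nvecs D" and "fps_nth (fstage fs z l i p) 0 = z p" by auto
qed

text \<open>The coefficient of index \<open>k\<close> enters the field at order \<open>k\<close>
  and, through \<open>fps_X\<close>, the step at order \<open>k + 1\<close>; indices from
  \<open>n\<close> on leave the orders up to \<open>n\<close> alone. A Newton stage occurs on both
  sides of its equation, and there \<open>fps_X\<close> lets an inner induction gain one order at a
  time.\<close>

lemma formal_unrolled_agree:
  assumes r: "0 < r" and z: "z \<in> nvecs D" and fs: "\<And>k y. y \<in> nball D z r \<Longrightarrow> fs k y \<in> nvecs D"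
    and eq: "\<And>k y. k < n \<Longrightarrow> y \<in> nball D z r \<Longrightarrow> fs k y = fs' k y"
  shows "agree (Suc n) (formal_unrolled sv I a b L D fs z p) (formal_unrolled sv I a b L D fs' z p)"
proof -
  have G: "agree n (fvals fs (fstage fs z l j) p) (fvals fs' v p)" if "\<And>q. agree n (fstage fs z l j q) (v q)" for l j v p
    unfolding fvals_def by (rule formal_sum_agree[OF r _ fstage_wf[OF r z fs] that]) (use eq in auto)
  have J: "agree n (fjac fs (fstage fs z l j) p q) (fjac fs' v p q)" if "q < D" "\<And>q. agree n (fstage fs z l j q) (v q)" for l j v p q
    unfolding fjac_def
  proof (rule formal_sum_agree[OF r _ fstage_wf[OF r z fs] that(2)])
    fix k y assume "k < n" and y: "y \<in> nball D z r"
    then show "jacobian (fs k) y p q = jacobian (fs' k) y p q"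
      unfolding jacobian_eq_pd by (intro pd_cong[OF _ y that(1)]) (use eq in auto)
  qed
  have S: "agree n (fstage fs z l i p) (fstage fs' z l i p)" for l i p
  proof (induction l arbitrary: i p)
    case 0
    then show ?case by (simp add: fstage_0)
  next
    case (Suc l)
    show ?case
    proof (cases sv)
      case Fixed_Point
      have "agree (Suc n) (fstage fs z (Suc l) i p) (fstage fs' z (Suc l) i p)"
        unfolding fstage_FP[OF Fixed_Point]
        by (intro agree_add agree_X agree_sum agree_mult agree_refl G Suc)
      then show ?thesis by (rule agree_mono) simp
    next
      case Newton_Raphson
      have "agree m (fstage fs z (Suc l) i p) (fstage fs' z (Suc l) i p)" if "m \<le> n" for m i p
        using that
      proof (induction m arbitrary: i p)
        case IH: (Suc m)
        have "agree (Suc m) (fnmap fs z (fstage fs z l) (fstage fs z (Suc l)) i p) (fnmap fs' z (fstage fs' z l) (fstage fs' z (Suc l)) i p)"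
          unfolding fnmap_def
          by (intro agree_add agree_X agree_sum agree_mult agree_diff agree_refl IH.IH agree_mono[OF G[OF Suc]] agree_mono[OF J[OF _ Suc]] agree_mono[OF Suc])
            (use IH.prems in auto)
        then show ?case by (simp flip: fstage_NR[OF Newton_Raphson])
      qed simp
      then show ?thesis by simp
    qed
  qed
  show ?thesis
    unfolding formal_unrolled_eq by (intro agree_add agree_X agree_sum agree_mult agree_refl G S)
qed

end

section \<open>The modified equation\<close>

lemma fps_agreeI:
  fixes f g :: "complex \<Rightarrow> complex"
  assumes f: "f has_fps_expansion A" and g: "g has_fps_expansion B" and s: "0 < s"
    and d: "\<And>h. cmod h < s \<Longrightarrow> cmod (f h - g h) \<le> C * cmod h ^ Suc n"
  shows "agree (Suc n) A B"
proof -
  obtain S1 where S1: "open S1" "0 \<in> S1" "f holomorphic_on S1" using has_fps_expansion_imp_holomorphic[OF f] by metis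
  obtain S2 where S2: "open S2" "0 \<in> S2" "g holomorphic_on S2" using has_fps_expansion_imp_holomorphic[OF g] by metis
  obtain e1 e2 where e: "0 < e1" "ball 0 e1 \<subseteq> S1" "0 < e2" "ball 0 e2 \<subseteq> S2"
    using S1 S2 open_contains_ball by metis
  define e where "e = min s (min e1 e2)"
  have "(deriv ^^ k) f 0 = (deriv ^^ k) g 0" if "k \<le> n" for k
    by (rule higher_deriv_agree[where r = e and C = C and n = n])
      (use e s d that in \<open>auto simp: e_def subset_iff simp del: power_Suc intro: holomorphic_on_subset[OF S1(3)] holomorphic_on_subset[OF S2(3)]\<close>)
  then show ?thesis by (simp add: agree_def fps_nth_fps_expansion[OF f] fps_nth_fps_expansion[OF g])
qed

lemma agree_cfps: "agree n (cfps A) (cfps B) \<longleftrightarrow> agree n A B"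
  by (simp add: agree_def)

lemma agree_sym: "agree n A B \<Longrightarrow> agree n B A" and agree_trans: "agree n A B \<Longrightarrow> agree n B C \<Longrightarrow> agree n A C"
  by (auto simp: agree_def)

text \<open>The truncated modified field as a family in a complex step size; being polynomial in
  \<open>h\<close>, it can be put into the actual step.\<close>

definition pfam :: "nat \<Rightarrow> (nat \<Rightarrow> complex nvec \<Rightarrow> complex nvec) \<Rightarrow> complex \<Rightarrow> complex nvec \<Rightarrow> complex nvec" where
  "pfam n Hs h y p = (\<Sum>k\<le>n. h ^ k * Hs k y p)"

context dim
begin

lemma cvec_nball: "cvec y \<in> nball D (cvec z) r \<longleftrightarrow> y \<in> nball D z r"
  by (auto simp: in_nball_iff nvecs_def cvec_def simp flip: of_real_diff)

lemma pd_sum: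
  assumes "\<And>k. k \<in> A \<Longrightarrow> hfun T (nball D c \<rho>) M (\<lambda>_. \<phi> k)" and "T \<noteq> {}" and "z \<in> nball D c \<rho>" and "q < D"
  shows "pd (\<lambda>y. \<Sum>k\<in>A. C k * \<phi> k y) z q = (\<Sum>k\<in>A. C k * pd (\<phi> k) z q)"
proof -
  define e :: "complex nvec" where "e = (\<lambda>p. if p = q then 1 else 0)"
  have e: "e \<in> nvecs D" using assms(4) by (auto simp: e_def nvecs_def)
  have pd: "pd \<phi> z q = dird \<phi> z e" for \<phi> by (simp add: dird_def pd_shift e_def)
  have "((\<lambda>\<eta>. \<Sum>k\<in>A. C k * \<phi> k (\<lambda>p. z p + \<eta> * e p)) has_field_derivative (\<Sum>k\<in>A. C k * dird (\<phi> k) z e)) (at 0)"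
    by (intro DERIV_sum DERIV_cmult dird_has_derivative[OF assms(1) assms(2,3) e])
  then show ?thesis by (simp add: pd) (simp add: dird_def DERIV_imp_deriv)
qed

lemma pfam_hfam:
  assumes "\<And>k. k \<le> n \<Longrightarrow> hfam {0} U B (\<lambda>_. Hs k)"
  shows "hfam (ball 0 1) U (real (Suc n) * B) (pfam n Hs)"
  unfolding hfam_def
proof (intro conjI ballI allI impI)
  fix h y assume "y \<in> U"
  then show "pfam n Hs h y \<in> nvecs D"
    using hfam_nvecs[OF assms] by (auto simp: nvecs_def pfam_def intro!: sum.neutral)
next
  fix p assume p: "p < D"
  have "hfun (ball 0 1) U (\<Sum>k\<in>{..n}. 1 * B) (\<lambda>h y. \<Sum>k\<in>{..n}. h ^ k * Hs k y p)"
  proof (intro hfun_sum)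
    fix k assume "k \<in> {..n}"
    then have "hfun (ball 0 1) U B (\<lambda>_ y. Hs k y p)"
      using hfun_fixed[of "{0}" U B "\<lambda>_ y. Hs k y p" 0] assms p by (auto simp: hfam_def)
    then show "hfun (ball 0 1) U (1 * B) (\<lambda>h y. h ^ k * Hs k y p)"
      by (rule hfun_scale) (auto intro!: holomorphic_intros simp: norm_power power_le_one)
  qed simp
  then show "hfun (ball 0 1) U (real (Suc n) * B) (\<lambda>h z. pfam n Hs h z p)" by (simp add: pfam_def)
qed

end

context rk
begin

text \<open>By induction over the iterations, each formal stage is the expansion of the actual one.
  Field values are covered by \<open>formal_sum_expansion\<close>, and so are the Jacobians of the
  Newton case, on half the radius.\<close>

lemma formal_unrolled_expansion:
  assumes H: "\<And>k. k \<le> n \<Longrightarrow> hfam {0} (nball D (cvec z) \<rho>) B (\<lambda>_. Hs k)" and \<rho>: "0 < \<rho>" and B: "0 < B" and z: "z \<in> nvecs D"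
    and re: "\<And>k y. k \<le> n \<Longrightarrow> y \<in> nball D z \<rho> \<Longrightarrow> Hs k (cvec y) = cvec (fs k y)"
    and fs0: "\<And>k y. n < k \<Longrightarrow> fs k y = (\<lambda>_. 0)" and p: "p < D"
  shows "(\<lambda>h. step h (pfam n Hs h) (cvec z) p) has_fps_expansion cfps (formal_unrolled sv I a b L D fs z p)"
proof -
  let ?c = "cvec z" and ?E = "pfam n Hs"
  define M where "M = real (Suc n) * B"
  have M: "0 < M" using B by (simp add: M_def)
  \<comment> \<open>A quarter of the radius, so that
    \<open>\<rho> / 2 + 2 * \<delta> = \<rho>\<close>. The step radius stays below 1, where
    \<open>pfam\<close> is bounded by \<open>M\<close>.\<close>
  define \<delta> where "\<delta> = \<rho> / 4"
  define r where "r = min 1 (\<delta> / (16 * \<kappa> * M))"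
  have \<delta>: "0 < \<delta>" and r: "0 < r" "r \<le> 1" using \<rho> M kappa1 by (auto simp: \<delta>_def r_def)
  have small: "16 * \<kappa> * cmod h * M \<le> \<delta>" if "h \<in> ball 0 r" for h
  proof -
    have "cmod h * (16 * \<kappa> * M) \<le> \<delta> / (16 * \<kappa> * M) * (16 * \<kappa> * M)"
      by (rule mult_right_mono) (use that M kappa1 in \<open>auto simp: r_def\<close>)
    then show ?thesis using M kappa1 by (simp add: mult_ac)
  qed
  have "hfam (ball 0 1) (nball D ?c \<rho>) M ?E" unfolding M_def by (rule pfam_hfam[OF H])
  then have E: "hfam (ball 0 r) (nball D ?c (\<rho> / 2 + 2 * \<delta>)) M ?E"
    by (rule hfam_mono) (use r(2) in \<open>auto simp: \<delta>_def\<close>)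
  have E0: "hfam {0} (nball D ?c (\<rho> / 2 + 2 * \<delta>)) M (\<lambda>_. ?E h)" if "h \<in> ball 0 r" for h
    by (rule hfam_fixed[OF E that])
  have c: "?c \<in> nvecs D" using z by (auto simp: nvecs_def cvec_def)
  have cb: "?c \<in> nball D ?c (\<rho> / 2)" using nball_centre[OF c] \<rho> by simp
  have wf: "fs k y \<in> nvecs D" if "y \<in> nball D z \<rho>" for k y
  proof (cases "k \<le> n")
    case True
    have "Hs k (cvec y) \<in> nvecs D" using hfam_nvecs[OF H[OF True], of 0 "cvec y"] that by (simp add: cvec_nball)
    then show ?thesis using re[OF True that] by (simp add: nvecs_def cvec_def)
  qed (use fs0 in \<open>auto simp: nvecs_def\<close>)
  have re': "Hs k (cvec y) q = of_real (fs k y q)" if "k \<le> n" "cvec y \<in> nball D ?c \<rho>" for k y q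
    using re[of k y] that by (simp add: cvec_nball) (simp add: cvec_def)
  define st where "st l i h = stage h (?E h) ?c l i" for l i h
  have st_in: "st l i h \<in> nball D ?c (\<rho> / 2 + \<delta>)" if "i < I" "h \<in> ball 0 r" for l i h
    unfolding st_def by (rule stage_in_nball[OF \<delta> less_imp_le[OF M] small E0 cb]) (use that in auto)
  have st_hol: "(\<lambda>h. st l i h q) holomorphic_on ball 0 r" if "i < I" for l i q
    unfolding st_def
    by (rule stage_holomorphic[OF open_ball \<delta> less_imp_le[OF M] small E]) (use cb that in \<open>auto intro: hcurve_const\<close>)
  have expands_st: "expands ?c (st l i) (fstage fs z l i)"
    if "i < I" "\<And>q. q < D \<Longrightarrow> (\<lambda>h. st l i h q) has_fps_expansion cfps (fstage fs z l i q)" for l i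
    unfolding expands_def
  proof (intro conjI allI impI exI[of _ r])
    show "hcurve (ball 0 r) (nvecs D) (st l i)"
      using st_hol[OF that(1)] nball_nvecs[OF st_in[OF that(1)]] by (auto simp: hcurve_def)
    show "fstage fs z l i \<in> nvecs D" by (rule fstage_wf(1)[OF \<rho> z wf])
  qed (use r that in \<open>auto simp: st_def stage_zero\<close>)
  have Gexp: "(\<lambda>h. ?E h (\<gamma> h) q) has_fps_expansion cfps (fvals fs v q)" if "expands ?c \<gamma> v" "q < D" for \<gamma> v q
    unfolding pfam_def fvals_def
    by (rule formal_sum_expansion[OF _ \<rho> that(1), where M = B])
      (use H re' fs0 that in \<open>auto simp: hfam_def\<close>)
  have Jexp: "(\<lambda>h. jacobian (?E h) (st l j h) q q') has_fps_expansion cfps (fjac fs v q q')"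
    if ex: "expands ?c (st l j) v" and q: "q < D" "q' < D" and j: "j < I" for l j v q q'
  proof -
    have Hq: "hfun {0} (nball D ?c \<rho>) B (\<lambda>_ y. Hs k y q)" if "k \<le> n" for k using H[OF that] q by (auto simp: hfam_def)
    have "(\<lambda>h. \<Sum>k\<le>n. h ^ k * pd (\<lambda>y. Hs k y q) (st l j h) q') has_fps_expansion cfps (fjac fs v q q')"
      unfolding fjac_def
    proof (rule formal_sum_expansion[where \<rho> = "\<rho> / 2" and M = "B / (\<rho> / 2)", OF _ _ ex])
      show "hfun {0} (nball D ?c (\<rho> / 2)) (B / (\<rho> / 2)) (\<lambda>_ z. pd (\<lambda>y. Hs k y q) z q')" if "k \<le> n" for k
        by (rule hfun_pd) (use Hq[OF that] \<rho> q in auto)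
      show "pd (\<lambda>y. Hs k y q) (cvec y) q' = of_real (jacobian (fs k) y q q')" if k: "k \<le> n" and "cvec y \<in> nball D ?c (\<rho> / 2)" for k y
      proof -
        have y: "y \<in> nball D z \<rho>" "cvec y \<in> nball D ?c \<rho>"
          using that(2) nball_mono[of "\<rho> / 2" \<rho>] \<rho> by (auto simp: cvec_nball)
        have rr: "Im (Hs k (cvec y) q) = 0" "Re (Hs k (cvec y) q) = fs k y q" if "y \<in> nball D z \<rho>" for y
          using re'[OF k] that by (auto simp: cvec_nball)
        note pr = pd_real[OF Hq[OF k] _ y(2) q(2)]
        have "jacobian (fs k) y q q' = pd (\<lambda>y. Re (Hs k (cvec y) q)) y q'"
          unfolding jacobian_eq_pd by (rule pd_cong[OF _ y(1) q(2)]) (simp add: rr)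
        then show ?thesis using pr rr by (simp add: complex_eq_iff cvec_nball)
      qed
      show "jacobian (fs k) y q q' = 0" if "n < k" for k y using fs0[OF that] by (simp add: jacobian_eq_pd pd_def)
    qed (use \<rho> in auto)
    moreover have "\<forall>\<^sub>F h in nhds 0. (\<Sum>k\<le>n. h ^ k * pd (\<lambda>y. Hs k y q) (st l j h) q') = jacobian (?E h) (st l j h) q q'"
    proof -
      have "\<forall>\<^sub>F h::complex in nhds 0. h \<in> ball 0 r" using r by (intro eventually_nhds_in_open) auto
      then show ?thesis
      proof eventually_elim
        case (elim h)
        have "st l j h \<in> nball D ?c \<rho>" by (rule nball_mono[OF _ st_in[OF j elim]]) (use \<rho> in \<open>auto simp: \<delta>_def\<close>)
        then show ?case unfolding jacobian_eq_pd pfam_def by (subst pd_sum[OF Hq]) (use q in auto)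
      qed
    qed
    ultimately show ?thesis by (subst (asm) has_fps_expansion_cong[OF _ refl]) auto
  qed
  have main: "\<forall>i<I. \<forall>q<D. (\<lambda>h. st l i h q) has_fps_expansion cfps (fstage fs z l i q)" for l
  proof (induction l)
    case 0
    then show ?case by (auto simp: st_def stage_0 fstage_0 cfps_hom cvec_def)
  next
    case (Suc l)
    have ex: "expands ?c (st l j) (fstage fs z l j)" if "j < I" for j using expands_st[OF that] Suc that by blast
    show ?case
    proof (cases sv)
      case Fixed_Point
      show ?thesis
      proof (intro allI impI)
        fix i q assume "i < I" and q: "q < D"
        have "(\<lambda>h. of_real (z q) + h * (\<Sum>j<I. of_real (a i j) * ?E h (st l j h) q)) has_fps_expansion
            fps_const (of_real (z q)) + fps_X * (\<Sum>j<I. fps_const (of_real (a i j)) * cfps (fvals fs (fstage fs z l j) q))"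
          by (intro fps_expansion_intros Gexp ex q) auto
        then show "(\<lambda>h. st (Suc l) i h q) has_fps_expansion cfps (fstage fs z (Suc l) i q)"
          by (simp add: st_def stage_FP[OF Fixed_Point] fstage_FP[OF Fixed_Point] cfps_hom cfps_sum) (simp add: cvec_def)
      qed
    next
      case Newton_Raphson
      \<comment> \<open>The new Newton stage is given implicitly, but it is holomorphic and so has
        some expansion \<open>P\<close>. The fixed-point equation carries over to \<open>P\<close>,
        and its factor \<open>fps_X\<close> identifies \<open>P\<close> with the formal stage order
        by order.\<close>
      define P where "P i q = fps_expansion (\<lambda>h. st (Suc l) i h q) 0" for i q
      have P: "(\<lambda>h. st (Suc l) i h q) has_fps_expansion P i q" if "i < I" for i q
        unfolding P_def by (rule has_fps_expansion_fps_expansion[of "ball 0 r"]) (use r st_hol[OF that] in auto)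
      have fixp: "st (Suc l) i h q = nmap h (?E h) ?c (\<lambda>j. st l j h) (\<lambda>j. st (Suc l) j h) i q" if h: "h \<in> ball 0 r" for i h q
      proof -
        interpret newton D sv I a b L \<kappa> ?c "\<rho> / 2" \<delta> M h "?E h" ?c "stage h (?E h) ?c l"
          by unfold_locales
            (use \<delta> M small[OF h] E0[OF h] cb stage_near[OF \<delta> less_imp_le[OF M] small[OF h] E0[OF h] cb] in auto)
        have "nmap h (?E h) ?c (stage h (?E h) ?c l) sol = nmap h (?E h) ?c (stage h (?E h) ?c l) (nmap h (?E h) ?c (stage h (?E h) ?c l) sol)"
          by (rule nmap_cong) (simp add: sol_fixed)
        then show ?thesis by (simp add: st_def stage_NR[OF Newton_Raphson] the_sol)
      qed
      have Peq: "P i q = fps_const (of_real (z q)) + fps_X * (\<Sum>j<I. fps_const (of_real (a i j)) *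
          (cfps (fvals fs (fstage fs z l j) q) + (\<Sum>q'<D. cfps (fjac fs (fstage fs z l j) q q') * (P j q' - cfps (fstage fs z l j q')))))"
        (is "_ = ?R") if i: "i < I" and q: "q < D" for i q
      proof (rule fps_expansion_unique_complex[OF P[OF i]])
        have "(\<lambda>h. of_real (z q) + h * (\<Sum>j<I. of_real (a i j) * (?E h (st l j h) q +
            (\<Sum>q'<D. jacobian (?E h) (st l j h) q q' * (st (Suc l) j h q' - st l j h q'))))) has_fps_expansion ?R"
          using Suc by (intro fps_expansion_intros Gexp Jexp ex q P) auto
        moreover have "\<forall>\<^sub>F h in nhds 0. of_real (z q) + h * (\<Sum>j<I. of_real (a i j) * (?E h (st l j h) q +
            (\<Sum>q'<D. jacobian (?E h) (st l j h) q q' * (st (Suc l) j h q' - st l j h q')))) = st (Suc l) i h q"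
        proof -
          have "\<forall>\<^sub>F h::complex in nhds 0. h \<in> ball 0 r" using r by (intro eventually_nhds_in_open) auto
          then show ?thesis by eventually_elim (subst fixp, auto simp: nmap_def cvec_def)
        qed
        ultimately show "(\<lambda>h. st (Suc l) i h q) has_fps_expansion ?R" by (subst (asm) has_fps_expansion_cong[OF _ refl]) auto
      qed
      have Qeq: "cfps (fstage fs z (Suc l) i q) = fps_const (of_real (z q)) + fps_X * (\<Sum>j<I. fps_const (of_real (a i j)) *
          (cfps (fvals fs (fstage fs z l j) q) + (\<Sum>q'<D. cfps (fjac fs (fstage fs z l j) q q') *
             (cfps (fstage fs z (Suc l) j q') - cfps (fstage fs z l j q')))))" for i q
        by (subst fstage_NR[OF Newton_Raphson]) (simp add: fnmap_def cfps_hom cfps_sum)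
      have "\<forall>i<I. \<forall>q<D. agree m (P i q) (cfps (fstage fs z (Suc l) i q))" for m
      proof (induction m)
        case IH: (Suc m)
        show ?case
        proof (intro allI impI)
          fix i q assume iq: "i < I" "q < D"
          show "agree (Suc m) (P i q) (cfps (fstage fs z (Suc l) i q))"
            unfolding Peq[OF iq] Qeq[of i q]
            by (intro agree_add agree_X agree_sum agree_mult agree_diff agree_refl) (use IH in auto)
        qed
      qed simp
      then have "P i q = cfps (fstage fs z (Suc l) i q)" if "i < I" "q < D" for i q
        using that by (intro agree_eqI) auto
      then show ?thesis using P by metis
    qed
  qed
  have "(\<lambda>h. of_real (z p) + h * (\<Sum>i<I. of_real (b i) * ?E h (st L i h) p)) has_fps_expansion
      fps_const (of_real (z p)) + fps_X * (\<Sum>i<I. fps_const (of_real (b i)) * cfps (fvals fs (fstage fs z L i) p))"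
    using main expands_st by (intro fps_expansion_intros Gexp p) auto
  then show ?thesis
    by (simp add: step_def inc_def st_def formal_unrolled_eq cfps_hom cfps_sum) (simp add: cvec_def)
qed

text \<open>Fields that differ at order \<open>n\<close> in \<open>h\<close> have increments that
  differ by the same amount up to order \<open>n + 1\<close>. The constants are left open, since
  only Taylor coefficients are at stake.\<close>

lemma inc_compare_small:
  assumes g: "hfam (ball 0 s) (nball D c \<rho>) B g" and g': "hfam (ball 0 s) (nball D c \<rho>) B g'"
    and pos: "0 < s" "0 < \<rho>" "0 < B" "0 < C" and c: "c \<in> nvecs D" and p: "p < D"
    and d: "\<And>h y q. h \<in> ball 0 s \<Longrightarrow> y \<in> nball D c \<rho> \<Longrightarrow> q < D \<Longrightarrow> cmod (g h y q - g' h y q) \<le> C * cmod h ^ n"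
  obtains s' C' where "0 < s'" "s' \<le> s" "\<And>h. cmod h < s' \<Longrightarrow>
    cmod (inc h (g h) c p - inc h (g' h) c p - (g h c p - g' h c p)) \<le> C' * cmod h ^ Suc n"
proof -
  define \<delta> where "\<delta> = \<rho> / 6"
  define s' where "s' = min s (\<delta> / (32 * \<kappa> * B))"
  have \<delta>: "0 < \<delta>" using pos by (simp add: \<delta>_def)
  show ?thesis
  proof (rule that[of s' "24 * \<kappa>\<^sup>2 * B / \<delta> * C"])
    show "0 < s'" "s' \<le> s" using pos \<delta> kappa1 by (auto simp: s'_def)
    fix h assume h: "cmod h < s'"
    show "cmod (inc h (g h) c p - inc h (g' h) c p - (g h c p - g' h c p)) \<le> 24 * \<kappa>\<^sup>2 * B / \<delta> * C * cmod h ^ Suc n"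
    proof (cases "h = 0")
      case True
      then show ?thesis by (simp add: inc_0)
    next
      case False
      have hb: "h \<in> ball 0 s" using h by (auto simp: s'_def)
      have "cmod h * (32 * \<kappa> * B) \<le> \<delta> / (32 * \<kappa> * B) * (32 * \<kappa> * B)"
        by (rule mult_right_mono) (use h pos kappa1 in \<open>auto simp: s'_def\<close>)
      then have "32 * \<kappa> * cmod h * B \<le> \<delta>" using pos kappa1 by (simp add: mult_ac)
      moreover have "\<rho> / 2 + 3 * \<delta> = \<rho>" by (simp add: \<delta>_def)
      ultimately have "cmod (inc h (g h) c p - inc h (g' h) c p - (g h c p - g' h c p)) \<le> 24 * \<kappa>\<^sup>2 * cmod h * B / \<delta> * (C * cmod h ^ n)"
        using \<delta> pos p d[OF hb] False hfam_fixed[OF g hb] hfam_fixed[OF g' hb] nball_centre[OF c]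
        by (intro inc_compare[where c = c and \<rho> = "\<rho> / 2"]) auto
      then show ?thesis by (simp add: mult_ac)
    qed
  qed
qed

text \<open>No ball enters the formula, so estimates around different centres speak of one and the
  same function.\<close>

definition Gs :: "(complex nvec \<Rightarrow> complex nvec) \<Rightarrow> nat \<Rightarrow> complex nvec \<Rightarrow> complex nvec" where
  "Gs F k z p = (deriv ^^ k) (\<lambda>h. giter F k h z p) 0 / fact k"

text \<open>With this \<open>\<delta>\<close>, \<open>N\<close> iterations at a cost of
  \<open>3 * \<delta>\<close> each use at most half of the radius; the step radius is the largest
  that the locale admits.\<close>

lemma modified_field_exists:
  fixes N :: nat
  assumes "hfam {0} (nball D c \<rho>) M (\<lambda>_. F)" and "0 < M" and "0 < \<rho>"
  defines "\<delta> \<equiv> \<rho> / (6 * (real N + 1))"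
  shows "modified_field D I a b \<kappa> c \<rho> \<delta> M (\<delta> / (192 * \<kappa>\<^sup>2 * M)) F"
    and "nball D c (\<rho> / 2) \<subseteq> nball D c (\<rho> - 3 * \<delta> * real N)"
proof -
  show "modified_field D I a b \<kappa> c \<rho> \<delta> M (\<delta> / (192 * \<kappa>\<^sup>2 * M)) F"
  proof unfold_locales
    show d: "0 < \<delta>" using assms(3) by (simp add: \<delta>_def)
    show "0 < \<delta> / (192 * \<kappa>\<^sup>2 * M)" using d assms(2) kappa1 by simp
    show "192 * (\<delta> / (192 * \<kappa>\<^sup>2 * M)) * \<kappa>\<^sup>2 * M \<le> \<delta>" using assms(2) kappa1 by simp
  qed (use assms in auto)
  have "3 * \<delta> * real N \<le> \<rho> / 2" using assms(3) by (simp add: \<delta>_def field_simps)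
  then show "nball D c (\<rho> / 2) \<subseteq> nball D c (\<rho> - 3 * \<delta> * real N)" by (auto elim!: nball_mono[rotated])
qed

end

context modified_field
begin

text \<open>Cauchy's inequality in \<open>h\<close> gives the bound; holomorphy in \<open>z\<close>
  is that of a higher parameter derivative.\<close>

lemma Gs_hfam: "hfam {0} (V k) (2 * M / r ^ k) (\<lambda>_. Gs F k)"
  unfolding hfam_def
proof (intro conjI ballI allI impI)
  fix z assume z: "z \<in> V k"
  have "(deriv ^^ k) (\<lambda>h. giter F k h z p) 0 = (deriv ^^ k) (\<lambda>h. 0) 0" if "D \<le> p" for p
  proof (rule higher_deriv_cong_ev)
    have "\<forall>\<^sub>F h::complex in nhds 0. h \<in> ball 0 r" using r0 by (intro eventually_nhds_in_open) auto
    then show "\<forall>\<^sub>F h in nhds 0. giter F k h z p = 0"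
      by eventually_elim (use hfam_nvecs[OF giter_hfam _ z] that in \<open>auto simp: nvecs_def\<close>)
  qed simp
  then show "Gs F k z \<in> nvecs D" by (simp add: nvecs_def Gs_def)
next
  fix p assume p: "p < D"
  have b: "cmod (giter F k h z p) \<le> 2 * M" if "h \<in> ball 0 r" "z \<in> V k" for h z
    using hfam_bound[OF giter_hfam that p] .
  show "hfun {0} (V k) (2 * M / r ^ k) (\<lambda>_ z. Gs F k z p)"
  proof (rule hfunI)
    fix z assume z: "z \<in> V k"
    have "cmod ((deriv ^^ k) (\<lambda>h. giter F k h z p) 0) \<le> fact k * (2 * M) / r ^ k"
      by (rule Cauchy_bound_ball[OF giter_hol[OF z p] r0 b[OF _ z]])
    then show "cmod (Gs F k z p) \<le> 2 * M / r ^ k" by (simp add: Gs_def norm_divide field_simps)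
  next
    fix S \<gamma> assume S: "open S" "hcurve S (V k) \<gamma>"
    have "(\<lambda>\<zeta>. (deriv ^^ k) (\<lambda>h. giter F k h (\<gamma> \<zeta>) p) 0) holomorphic_on S"
    proof (rule holomorphic_param_higher_deriv[OF S(1) r0, where M = "2 * M"])
      show "(\<lambda>\<zeta>. giter F k h (\<gamma> \<zeta>) p) holomorphic_on S" if "h \<in> ball 0 r" for h
        using giter_hfam[of k] p that
        by (intro hfun_hol[of "ball 0 r" "V k" "2 * M" "\<lambda>h z. giter F k h z p" S "\<lambda>_. h" \<gamma>] S) (auto simp: hfam_def)
    qed (use S p giter_hol b in \<open>auto simp: hcurve_def\<close>)
    then show "(\<lambda>\<zeta>. Gs F k (\<gamma> \<zeta>) p) holomorphic_on S" unfolding Gs_def by (intro holomorphic_intros) auto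
  qed
qed

lemma Gs_coeff: "z \<in> V n \<Longrightarrow> p < D \<Longrightarrow> k \<le> n \<Longrightarrow> (deriv ^^ k) (\<lambda>h. giter F n h z p) 0 / fact k = Gs F k z p"
  using giter_coeff[of z n p k n] by (simp add: Gs_def)

lemma Gs_real: "realf (nball D c \<rho>) F \<Longrightarrow> realf (V k) (Gs F k)"
  unfolding realf_def
proof (intro allI impI)
  fix y p assume re: "\<forall>y p. cvec y \<in> nball D c \<rho> \<longrightarrow> Im (F (cvec y) p) = 0" and y: "cvec y \<in> V k"
  show "Im (Gs F k (cvec y) p) = 0"
  proof (cases "p < D")
    case True
    have "Im ((deriv ^^ k) (\<lambda>h. giter F k h (cvec y) p) (of_real 0)) = 0"
      by (rule higher_deriv_real_on_reals[OF giter_hol[OF y True]])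
        (use giter_real[of _ k] re y r0 in \<open>auto simp: realf_def\<close>)
    then show ?thesis
      using Im_divide_of_real[of "(deriv ^^ k) (\<lambda>h. giter F k h (cvec y) p) 0" "fact k"] by (simp add: Gs_def)
  next
    case False
    then show ?thesis using hfam_nvecs[OF Gs_hfam _ y] by (simp add: nvecs_def)
  qed
qed

text \<open>As the lower coefficients are final, \<open>pfam n (Gs F)\<close> is the Taylor
  polynomial in \<open>h\<close> of the single function \<open>giter F n\<close>, and the tail bound
  applies to it.\<close>

lemma pfam_giter:
  assumes z: "z \<in> V n" and p: "p < D" and h: "cmod h \<le> r / 2"
  shows "cmod (giter F n h z p - pfam n (Gs F) h z p) \<le> 2 * (2 * M) * (cmod h / r) ^ Suc n"
proof -
  have "cmod (giter F n h z p - (\<Sum>k<Suc n. (deriv ^^ k) (\<lambda>h. giter F n h z p) 0 / fact k * h ^ k)) \<le> 2 * (2 * M) * (cmod h / r) ^ Suc n"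
    by (rule Taylor_tail_bound[OF giter_hol[OF z p] r0 _ h]) (use hfam_bound[OF giter_hfam _ z p] in auto)
  moreover have "(\<Sum>k<Suc n. (deriv ^^ k) (\<lambda>h. giter F n h z p) 0 / fact k * h ^ k) = pfam n (Gs F) h z p"
    unfolding pfam_def lessThan_Suc_atMost
    by (rule sum.cong[OF refl]) (subst Gs_coeff[OF z p], simp, rule mult.commute)
  ultimately show ?thesis by simp
qed

end

context modified_field
begin

text \<open>Replacing \<open>giter F n\<close> by its Taylor polynomial and the next change of the
  iteration both perturb the field at order \<open>Suc n\<close>; the factor \<open>h\<close> of the
  step adds one order.\<close>

lemma step_pfam_flowc:
  assumes sub: "nball D c \<rho>' \<subseteq> V (Suc n)" and pos: "0 < \<rho>'" and c: "c \<in> nvecs D" and p: "p < D"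
  obtains s C where "0 < s" "\<And>h. cmod h < s \<Longrightarrow> cmod (step h (pfam n (Gs F) h) c p - flowc F h c p) \<le> C * cmod h ^ Suc (Suc n)"
proof -
  define B0 where "B0 = (\<Sum>k\<le>n. 2 * M / r ^ k)"
  define B where "B = max (2 * M) (real (Suc n) * B0)"
  define C where "C = 4 * M / r ^ Suc n"
  have C: "0 < C" using M0 r0 by (simp add: C_def)
  have subk: "nball D c \<rho>' \<subseteq> V k" if "k \<le> Suc n" for k using sub V_mono[OF that] by blast
  have cV: "c \<in> V k" if "k \<le> Suc n" for k using subk[OF that] nball_centre[OF c pos] by auto
  define s where "s = min 1 (r / 2)"
  have s: "0 < s" "s \<le> 1" "s \<le> r / 2" using r0 by (auto simp: s_def)
  have "hfam (ball 0 1) (nball D c \<rho>') (real (Suc n) * B0) (pfam n (Gs F))"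
  proof (rule pfam_hfam)
    fix k assume k: "k \<le> n"
    have "2 * M / r ^ k \<le> B0" unfolding B0_def using k M0 r0 by (intro member_le_sum) auto
    then show "hfam {0} (nball D c \<rho>') B0 (\<lambda>_. Gs F k)" using subk[of k] k by (intro hfam_mono[OF Gs_hfam]) auto
  qed
  then have E: "hfam (ball 0 s) (nball D c \<rho>') B (pfam n (Gs F))"
    by (rule hfam_mono) (use s in \<open>auto simp: B_def\<close>)
  have G: "hfam (ball 0 s) (nball D c \<rho>') B (giter F n)"
    by (rule hfam_mono[OF giter_hfam[of n]]) (use s r0 subk[of n] in \<open>auto simp: B_def\<close>)
  have d: "cmod (giter F n h y q - pfam n (Gs F) h y q) \<le> C * cmod h ^ Suc n"
    if "h \<in> ball 0 s" "y \<in> nball D c \<rho>'" "q < D" for h y q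
  proof -
    have "cmod (giter F n h y q - pfam n (Gs F) h y q) \<le> 2 * (2 * M) * (cmod h / r) ^ Suc n"
      by (rule pfam_giter) (use that s subk[of n] in auto)
    then show ?thesis by (simp add: C_def power_divide del: power_Suc)
  qed
  have B: "0 < B" using M0 by (simp add: B_def)
  obtain s' C' where s': "0 < s'" "s' \<le> s" and d': "\<And>h. cmod h < s' \<Longrightarrow>
    cmod (inc h (giter F n h) c p - inc h (pfam n (Gs F) h) c p - (giter F n h c p - pfam n (Gs F) h c p)) \<le> C' * cmod h ^ Suc (Suc n)"
    using inc_compare_small[OF G E s(1) pos B C c p d] by blast
  show ?thesis
  proof (rule that[OF s'(1), of "\<bar>C'\<bar> + C + M * \<theta> ^ Suc n"])
    fix h assume h: "cmod h < s'"
    have hr: "h \<in> ball 0 r" and hs: "h \<in> ball 0 s" and h1: "cmod h \<le> 1" using h s s' r0 by auto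
    let ?i = "inc h (giter F n h) c p - inc h (pfam n (Gs F) h) c p" and ?g = "giter F n h c p - pfam n (Gs F) h c p"
    have "C' * cmod h ^ Suc (Suc n) \<le> \<bar>C'\<bar> * cmod h ^ Suc n"
      using h1 by (intro mult_mono power_decreasing) auto
    then have "cmod (?i - ?g) \<le> \<bar>C'\<bar> * cmod h ^ Suc n" using d'[OF h] by linarith
    moreover have "cmod ?g \<le> C * cmod h ^ Suc n" by (rule d[OF hs nball_centre[OF c pos] p])
    ultimately have i: "cmod ?i \<le> \<bar>C'\<bar> * cmod h ^ Suc n + C * cmod h ^ Suc n"
      using norm_triangle_mono[of "?i - ?g" _ ?g] by (simp only: diff_add_cancel)
    have j: "cmod (giter F (Suc n) h c p - giter F n h c p) \<le> M * \<theta> ^ Suc n * cmod h ^ Suc n"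
      using giter_props(3)[OF hr cV[OF order_refl] p] by (simp only: power_mult_distrib mult.assoc)
    \<comment> \<open>The premise has the shape of \<open>step_giter\<close>: \<open>A\<close> and
      \<open>E\<close> are the increments of the iterate and of the polynomial, \<open>w\<close> is
      the flow, \<open>g\<close> and \<open>g'\<close> are consecutive iterates.\<close>
    have alg: "z + h * A = w + h * (g - g') \<Longrightarrow> z + h * E - w = - (h * ((A - E) + (g' - g)))" for z A w g g' E :: complex
      by algebra
    define W where "W = ?i + (giter F (Suc n) h c p - giter F n h c p)"
    have eq: "step h (pfam n (Gs F) h) c p - flowc F h c p = - (h * W)"
      unfolding step_def[of h "pfam n (Gs F) h"] W_def
      by (rule alg) (rule step_giter[OF cV[OF order_refl] hr, of p, unfolded step_def[of h "giter F n h"]])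
    have W: "cmod W \<le> \<bar>C'\<bar> * cmod h ^ Suc n + C * cmod h ^ Suc n + M * \<theta> ^ Suc n * cmod h ^ Suc n"
      unfolding W_def by (rule norm_triangle_mono[OF i j])
    have distr: "u * (w * v + C * v + t * v) = (w + C + t) * (u * v)" for u v w t :: real
      by algebra
    show "cmod (step h (pfam n (Gs F) h) c p - flowc F h c p) \<le> (\<bar>C'\<bar> + C + M * \<theta> ^ Suc n) * cmod h ^ Suc (Suc n)"
      unfolding eq norm_minus_cancel norm_mult power_Suc[of "cmod h" "Suc n"] distr[symmetric]
      using W norm_ge_zero by (rule mult_left_mono)
  qed
qed

text \<open>The first claim produces a real expansion of the flow; the second complexifies any
  expansion that is given.\<close>

lemma flow_expansion:
  assumes f: "\<And>y. cvec y \<in> nball D c \<rho> \<Longrightarrow> F (cvec y) = cvec (f y)" and z: "cvec z \<in> nball D c (\<rho> - 2 * \<delta>)" and p: "p < D"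
  shows "\<exists>A. (\<lambda>h. flowc F h (cvec z) p) has_fps_expansion cfps A \<and> (\<lambda>h. flow (nvecs D) f h z p) has_fps_expansion A"
    and "(\<lambda>h. flow (nvecs D) f h z p) has_fps_expansion A \<Longrightarrow> (\<lambda>h. flowc F h (cvec z) p) has_fps_expansion cfps A"
proof -
  have hol: "(\<lambda>h. flowc F h (cvec z) p) holomorphic_on ball 0 r"
    unfolding holomorphic_on_def field_differentiable_def
  proof
    fix h :: complex assume "h \<in> ball 0 r"
    from pic.flowc_deriv[OF z this p]
    show "\<exists>f'. ((\<lambda>h. flowc F h (cvec z) p) has_field_derivative f') (at h within ball 0 r)"
      using has_field_derivative_at_within by blast
  qed
  have re: "flowc F (of_real t) (cvec z) p = of_real (flow (nvecs D) f t z p)" if "\<bar>t\<bar> < r" for t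
    using pic.real_flow_eq_flowc[OF _ z that, of f] f by (simp add: cvec_def[of "flow _ _ _ _"] fun_eq_iff)
  show "\<exists>A. (\<lambda>h. flowc F h (cvec z) p) has_fps_expansion cfps A \<and> (\<lambda>h. flow (nvecs D) f h z p) has_fps_expansion A"
    by (rule real_on_reals_expansion[OF hol r0 re])
  show "(\<lambda>h. flow (nvecs D) f h z p) has_fps_expansion A \<Longrightarrow> (\<lambda>h. flowc F h (cvec z) p) has_fps_expansion cfps A"
    by (rule real_expansion_complexify[OF hol r0 re])
qed

end

text \<open>The qualitative setting for existence and uniqueness of the IMDE on the whole ball. Any
  positive bound \<open>M\<close> will do, since every point is given a small ball of its
  own.\<close>

locale extended_field = rk +
  fixes x :: "real nvec" and R M :: real and f :: "real nvec \<Rightarrow> real nvec" and F :: "complex nvec \<Rightarrow> complex nvec"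
  assumes ext: "analytic_extension D x R f F" and M0: "0 < M"
    and bound: "\<And>z p. z \<in> nball D (cvec x) R \<Longrightarrow> p < D \<Longrightarrow> cmod (F z p) \<le> M"
begin

definition mod_coeff :: "nat \<Rightarrow> real nvec \<Rightarrow> real nvec" where
  "mod_coeff k y p = Re (Gs F k (cvec y) p)"

lemma F_hfam: "U \<subseteq> nball D (cvec x) R \<Longrightarrow> hfam {0} U M (\<lambda>_. F)"
  by (rule holomorphic_field_hfam[where U = "nball D (cvec x) R"])
    (use ext bound nball_nvecs in \<open>auto simp: analytic_extension_def\<close>)

lemma F_cvec: "cvec y \<in> nball D (cvec x) R \<Longrightarrow> F (cvec y) = cvec (f y)"
  using ext by (simp add: analytic_extension_def cvec_nball)

lemma F_real: "U \<subseteq> nball D (cvec x) R \<Longrightarrow> realf U F"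
  unfolding realf_def
proof (intro allI impI)
  fix y p assume "U \<subseteq> nball D (cvec x) R" "cvec y \<in> U"
  then have "F (cvec y) = cvec (f y)" using F_cvec by blast
  then show "Im (F (cvec y) p) = 0" by (simp add: cvec_def)
qed

lemma local_imp:
  assumes sub: "nball D z \<rho> \<subseteq> nball D (cvec x) R" and "0 < \<rho>"
  obtains \<delta> r where "modified_field D I a b \<kappa> z \<rho> \<delta> M r F" "nball D z (\<rho> / 2) \<subseteq> nball D z (\<rho> - 3 * \<delta> * real N)"
  by (rule that[OF modified_field_exists[OF F_hfam[OF sub] M0 assms(2), of N]])

lemma local_ball:
  assumes "z \<in> nball D (cvec x) R"
  obtains \<rho> where "0 < \<rho>" "nball D z \<rho> \<subseteq> nball D (cvec x) R"
proof (rule nball_margin[OF assms])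
  fix \<rho> assume "0 < \<rho>" "\<And>w. w \<in> nball D z \<rho> \<Longrightarrow> w \<in> nball D (cvec x) R"
  then show thesis by (intro that[of \<rho>]) auto
qed

lemma Gs_local:
  assumes z: "z \<in> nball D (cvec x) R"
  obtains \<rho> B where "0 < \<rho>" "nball D z \<rho> \<subseteq> nball D (cvec x) R" "0 < B"
    "\<And>k. k \<le> n \<Longrightarrow> hfam {0} (nball D z \<rho>) B (\<lambda>_. Gs F k)" "\<And>k. k \<le> n \<Longrightarrow> realf (nball D z \<rho>) (Gs F k)"
proof -
  obtain \<rho> where \<rho>: "0 < \<rho>" "nball D z \<rho> \<subseteq> nball D (cvec x) R" using local_ball[OF z] .
  obtain \<delta> r where im: "modified_field D I a b \<kappa> z \<rho> \<delta> M r F" and V: "nball D z (\<rho> / 2) \<subseteq> nball D z (\<rho> - 3 * \<delta> * real n)"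
    using local_imp[OF \<rho>(2,1)] by blast
  interpret modified_field D sv I a b L \<kappa> z \<rho> \<delta> M r F by (rule im)
  define B where "B = (\<Sum>k\<le>n. 2 * M / r ^ k)"
  have Vk: "nball D z (\<rho> / 2) \<subseteq> V k" if "k \<le> n" for k using V V_mono[OF that] by blast
  show ?thesis
  proof (rule that[of "\<rho> / 2" B])
    show "nball D z (\<rho> / 2) \<subseteq> nball D (cvec x) R" using \<rho> nball_mono[of "\<rho> / 2" \<rho>] by auto
    show "0 < B" unfolding B_def using M0 r0 by (intro sum_pos) auto
    fix k assume k: "k \<le> n"
    have "2 * M / r ^ k \<le> B" unfolding B_def using k M0 r0 by (intro member_le_sum) auto
    then show "hfam {0} (nball D z (\<rho> / 2)) B (\<lambda>_. Gs F k)" by (intro hfam_mono[OF Gs_hfam] Vk k) auto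
    show "realf (nball D z (\<rho> / 2)) (Gs F k)" using Gs_real[OF F_real[OF \<rho>(2)], of k] Vk[OF k] by (auto simp: realf_def)
  qed (use \<rho> in simp)
qed

lemma Gs_cvec:
  assumes y: "cvec y \<in> nball D (cvec x) R"
  shows "Gs F k (cvec y) = cvec (mod_coeff k y)"
proof -
  obtain \<rho> B where "0 < \<rho>" "\<And>k'. k' \<le> k \<Longrightarrow> realf (nball D (cvec y) \<rho>) (Gs F k')" using Gs_local[OF y, of k] by metis
  then have "Im (Gs F k (cvec y) p) = 0" for p using nball_centre[OF nball_nvecs[OF y]] by (auto simp: realf_def)
  from cvec_Re[OF this] show ?thesis by (simp add: mod_coeff_def[abs_def])
qed

text \<open>Frechet differentiability is a local matter, so at each point the bounds on a small ball
  around it suffice.\<close>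

lemma mod_coeff_extension: "analytic_extension D x R (mod_coeff k) (Gs F k)"
  unfolding analytic_extension_def
proof (intro conjI ballI)
  show "Gs F k (cvec y) = cvec (mod_coeff k y)" if "y \<in> nball D x R" for y by (rule Gs_cvec) (simp add: cvec_nball that)
  show "holomorphic_field D (nball D (cvec x) R) (Gs F k)"
    unfolding holomorphic_field_def
  proof (intro ballI conjI allI impI)
    fix z assume z: "z \<in> nball D (cvec x) R"
    obtain \<rho> B where \<rho>: "0 < \<rho>" and H: "\<And>k'. k' \<le> k \<Longrightarrow> hfam {0} (nball D z \<rho>) B (\<lambda>_. Gs F k')" using Gs_local[OF z, of k] by metis
    have zb: "z \<in> nball D z \<rho>" by (rule nball_centre[OF nball_nvecs[OF z] \<rho>])
    show "Gs F k z \<in> nvecs D" using hfam_nvecs[OF H[OF order_refl] _ zb] by simp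
    fix p assume "p < D"
    then have "hfun {0} (nball D z \<rho>) B (\<lambda>_ y. Gs F k y p)" using H[OF order_refl] by (auto simp: hfam_def)
    from hfun_Frechet[OF this _ zb]
    show "\<exists>c. \<forall>\<epsilon>>0. \<exists>\<delta>>0. \<forall>w\<in>nvecs D. supnorm D (\<lambda>q. w q - z q) < \<delta> \<longrightarrow>
          norm (Gs F k w p - Gs F k z p - (\<Sum>q<D. c q * (w q - z q))) \<le> \<epsilon> * supnorm D (\<lambda>q. w q - z q)" by simp
  qed
qed

definition trunc :: "nat \<Rightarrow> (nat \<Rightarrow> real nvec \<Rightarrow> real nvec) \<Rightarrow> nat \<Rightarrow> real nvec \<Rightarrow> real nvec" where
  "trunc n gs k y = (if k \<le> n then gs k y else (\<lambda>_. 0))"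

text \<open>The actual step of the truncated field differs from the flow at order
  \<open>n + 2\<close>. Both sides have expansions, so these agree through index
  \<open>n + 1\<close>.\<close>

lemma trunc_agree:
  assumes A: "(\<lambda>h. flow (nvecs D) f h z p) has_fps_expansion A" and z: "z \<in> nball D x R" and p: "p < D"
  shows "agree (Suc (Suc n)) (formal_unrolled sv I a b L D (trunc n mod_coeff) z p) A"
    and "(\<lambda>h. step h (pfam n (Gs F) h) (cvec z) p) has_fps_expansion cfps (formal_unrolled sv I a b L D (trunc n mod_coeff) z p)"
proof -
  have zc: "cvec z \<in> nball D (cvec x) R" using z by (simp add: cvec_nball)
  have zn: "z \<in> nvecs D" using nball_nvecs[OF z] .
  obtain \<rho>1 B where \<rho>1: "0 < \<rho>1" "nball D (cvec z) \<rho>1 \<subseteq> nball D (cvec x) R" and B: "0 < B"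
    and H: "\<And>k. k \<le> n \<Longrightarrow> hfam {0} (nball D (cvec z) \<rho>1) B (\<lambda>_. Gs F k)" using Gs_local[OF zc, of n] by metis
  show ex: "(\<lambda>h. step h (pfam n (Gs F) h) (cvec z) p) has_fps_expansion cfps (formal_unrolled sv I a b L D (trunc n mod_coeff) z p)"
  proof (rule formal_unrolled_expansion[OF H \<rho>1(1) B zn _ _ p])
    fix k y assume "k \<le> n" "y \<in> nball D z \<rho>1"
    then have "cvec y \<in> nball D (cvec z) \<rho>1" by (simp add: cvec_nball)
    then have "cvec y \<in> nball D (cvec x) R" using \<rho>1(2) by blast
    then show "Gs F k (cvec y) = cvec (trunc n mod_coeff k y)" using Gs_cvec \<open>k \<le> n\<close> by (simp add: trunc_def)
  qed (auto simp: trunc_def)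
  obtain \<rho> where \<rho>: "0 < \<rho>" "nball D (cvec z) \<rho> \<subseteq> nball D (cvec x) R" using local_ball[OF zc] .
  obtain \<delta> r where im: "modified_field D I a b \<kappa> (cvec z) \<rho> \<delta> M r F"
    and V: "nball D (cvec z) (\<rho> / 2) \<subseteq> nball D (cvec z) (\<rho> - 3 * \<delta> * real (Suc n))"
    using local_imp[OF \<rho>(2,1), of "Suc n"] by blast
  interpret modified_field D sv I a b L \<kappa> "cvec z" \<rho> \<delta> M r F by (rule im)
  have zV: "cvec z \<in> nball D (cvec z) (\<rho> - 2 * \<delta>)"
    using V_pic[of "cvec z" n] V nball_centre[OF nball_nvecs[OF zc], of "\<rho> / 2"] \<rho> by auto
  have fl: "(\<lambda>h. flowc F h (cvec z) p) has_fps_expansion cfps A"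
    by (rule flow_expansion(2)[OF F_cvec zV p A]) (use \<rho> in auto)
  obtain s C where s: "0 < s" and d: "\<And>h. cmod h < s \<Longrightarrow> cmod (step h (pfam n (Gs F) h) (cvec z) p - flowc F h (cvec z) p) \<le> C * cmod h ^ Suc (Suc n)"
    using step_pfam_flowc[OF V _ nball_nvecs[OF zc] p] \<rho> by (metis half_gt_zero)
  from fps_agreeI[OF ex fl s d] show "agree (Suc (Suc n)) (formal_unrolled sv I a b L D (trunc n mod_coeff) z p) A"
    by (simp add: agree_cfps)
qed

lemma flow_has_expansion:
  assumes z: "z \<in> nball D x R" and p: "p < D"
  obtains A where "(\<lambda>h. flow (nvecs D) f h z p) has_fps_expansion A"
proof -
  have zc: "cvec z \<in> nball D (cvec x) R" using z by (simp add: cvec_nball)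
  obtain \<rho> where \<rho>: "0 < \<rho>" "nball D (cvec z) \<rho> \<subseteq> nball D (cvec x) R" using local_ball[OF zc] .
  obtain \<delta> r where im: "modified_field D I a b \<kappa> (cvec z) \<rho> \<delta> M r F"
    and V: "nball D (cvec z) (\<rho> / 2) \<subseteq> nball D (cvec z) (\<rho> - 3 * \<delta> * real (Suc 0))"
    using local_imp[OF \<rho>(2,1), of "Suc 0"] by blast
  interpret modified_field D sv I a b L \<kappa> "cvec z" \<rho> \<delta> M r F by (rule im)
  have zV: "cvec z \<in> nball D (cvec z) (\<rho> - 2 * \<delta>)"
    using V_pic[of "cvec z" 0] V nball_centre[OF nball_nvecs[OF zc], of "\<rho> / 2"] \<rho> by auto
  have "\<And>y. cvec y \<in> nball D (cvec z) \<rho> \<Longrightarrow> F (cvec y) = cvec (f y)" using F_cvec \<rho> by auto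
  from flow_expansion(1)[OF this zV p] show ?thesis using that by blast
qed

lemma local_real:
  assumes z: "z \<in> nball D x R"
  obtains \<rho> where "0 < \<rho>" "\<And>y. y \<in> nball D z \<rho> \<Longrightarrow> y \<in> nball D x R"
  by (rule nball_margin[OF z]) (rule that)

lemma extension_nvecs: "analytic_extension D x R g G \<Longrightarrow> y \<in> nball D x R \<Longrightarrow> g y \<in> nvecs D"
proof -
  assume g: "analytic_extension D x R g G" and y: "y \<in> nball D x R"
  have "cvec y \<in> nball D (cvec x) R" using y by (simp only: cvec_nball)
  then have "G (cvec y) \<in> nvecs D" using g unfolding analytic_extension_def holomorphic_field_def by blast
  moreover have "G (cvec y) = cvec (g y)" using g y by (simp add: analytic_extension_def)
  ultimately show ?thesis by (simp add: nvecs_def) (simp add: cvec_def)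
qed

text \<open>Up to any given order the formal step sees finitely many coefficients, so it may be
  exchanged for that of a truncation, which matches the flow.\<close>

theorem imde_mod_coeff: "imde sv I a b L D x R f mod_coeff"
  unfolding imde_def
proof (intro conjI allI ballI impI)
  show "\<exists>G. analytic_extension D x R (mod_coeff k) G" for k using mod_coeff_extension by blast
  fix z p assume z: "z \<in> nball D x R" and p: "p < D"
  obtain A where A: "(\<lambda>h. flow (nvecs D) f h z p) has_fps_expansion A" using flow_has_expansion[OF z p] .
  obtain \<rho> where \<rho>: "0 < \<rho>" "\<And>y. y \<in> nball D z \<rho> \<Longrightarrow> y \<in> nball D x R" using local_real[OF z] by metis
  have "agree n (formal_unrolled sv I a b L D mod_coeff z p) A" for n
  proof -
    have "agree (Suc (Suc n)) (formal_unrolled sv I a b L D mod_coeff z p) (formal_unrolled sv I a b L D (trunc n mod_coeff) z p)"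
      by (rule formal_unrolled_agree[OF \<rho>(1) nball_nvecs[OF z]])
        (use extension_nvecs[OF mod_coeff_extension \<rho>(2)] in \<open>auto simp: trunc_def\<close>)
    then show ?thesis using trunc_agree(1)[OF A z p, of n] by (auto intro: agree_mono agree_trans)
  qed
  then have "formal_unrolled sv I a b L D mod_coeff z p = A" by (rule agree_eqI)
  with A show "(\<lambda>h. flow (nvecs D) f h z p) has_fps_expansion formal_unrolled sv I a b L D mod_coeff z p" by simp
qed

text \<open>Replacing the coefficient of order \<open>n\<close> of the modified field changes the step by
  \<open>h ^ Suc n\<close> times the change of that coefficient, up to higher order.\<close>

theorem imde_unique:
  assumes im: "imde sv I a b L D x R f fs'" and z: "z \<in> nball D x R"
  shows "fs' n z = mod_coeff n z"
  using z
proof (induction n arbitrary: z rule: less_induct)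
  case (less n)
  note z = less.prems
  have zc: "cvec z \<in> nball D (cvec x) R" using z by (simp add: cvec_nball)
  have zn: "z \<in> nvecs D" and zcn: "cvec z \<in> nvecs D" using nball_nvecs z zc by auto
  obtain G' where G': "analytic_extension D x R (fs' n) G'" using im unfolding imde_def by blast
  have ext': "fs' k y \<in> nvecs D" if "y \<in> nball D x R" for k y
    using im extension_nvecs[OF _ that] unfolding imde_def by blast
  obtain \<rho>1 B1 where \<rho>1: "0 < \<rho>1" "nball D (cvec z) \<rho>1 \<subseteq> nball D (cvec x) R" and B1: "0 < B1"
    and H: "\<And>k. k \<le> n \<Longrightarrow> hfam {0} (nball D (cvec z) \<rho>1) B1 (\<lambda>_. Gs F k)" using Gs_local[OF zc, of n] by metis
  obtain \<rho>2 B2 where \<rho>2: "0 < \<rho>2" and B2: "0 < B2" and H2: "hfam {0} (nball D (cvec z) \<rho>2) B2 (\<lambda>_. G')"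
    using holomorphic_field_locally_hfam[of "cvec x" R G' "cvec z"] G' zc unfolding analytic_extension_def by metis
  define \<rho> where "\<rho> = min \<rho>1 \<rho>2"
  define B where "B = max B1 B2"
  have \<rho>: "0 < \<rho>" and B: "0 < B" using \<rho>1 \<rho>2 B1 B2 by (auto simp: \<rho>_def B_def)
  have sub1: "nball D (cvec z) \<rho> \<subseteq> nball D (cvec z) \<rho>1" and sub2: "nball D (cvec z) \<rho> \<subseteq> nball D (cvec z) \<rho>2"
    using nball_mono[of \<rho> \<rho>1] nball_mono[of \<rho> \<rho>2] by (auto simp: \<rho>_def)
  have HG: "hfam {0} (nball D (cvec z) \<rho>) B (\<lambda>_. Gs F k)" if "k \<le> n" for k
    by (rule hfam_mono[OF H[OF that]]) (use sub1 in \<open>auto simp: B_def\<close>)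
  have HG': "hfam {0} (nball D (cvec z) \<rho>) B (\<lambda>_. G')"
    by (rule hfam_mono[OF H2]) (use sub2 in \<open>auto simp: B_def\<close>)
  have inR: "cvec y \<in> nball D (cvec x) R" "y \<in> nball D x R" if "y \<in> nball D z \<rho>" for y
  proof -
    have "cvec y \<in> nball D (cvec z) \<rho>" using that by (simp only: cvec_nball)
    then show "cvec y \<in> nball D (cvec x) R" using sub1 \<rho>1(2) by blast
    then show "y \<in> nball D x R" by (simp only: cvec_nball)
  qed
  \<comment> \<open>The lower coefficients agree by the induction hypothesis, so the competitor is
    represented by the \<open>Gs F k\<close> with the one of index \<open>n\<close> replaced by its
    extension \<open>G'\<close>.\<close>
  define Hs where "Hs k = (if k < n then Gs F k else G')" for k
  define fs'' where "fs'' = trunc n (\<lambda>k. if k < n then mod_coeff k else fs' n)"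
  have HHs: "hfam {0} (nball D (cvec z) \<rho>) B (\<lambda>_. Hs k)" if "k \<le> n" for k
    using HG[OF that] HG' by (simp add: Hs_def)
  show "fs' n z = mod_coeff n z"
  proof
    fix p
    show "fs' n z p = mod_coeff n z p"
    proof (cases "p < D")
      case p: True
      define A where "A = formal_unrolled sv I a b L D fs' z p"
      have A: "(\<lambda>h. flow (nvecs D) f h z p) has_fps_expansion A" using im z p by (auto simp: imde_def A_def)
      have ex1: "(\<lambda>h. step h (pfam n Hs h) (cvec z) p) has_fps_expansion cfps (formal_unrolled sv I a b L D fs'' z p)"
      proof (rule formal_unrolled_expansion[OF HHs \<rho> B zn _ _ p])
        fix k y assume "k \<le> n" "y \<in> nball D z \<rho>"
        then show "Hs k (cvec y) = cvec (fs'' k y)"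
          using Gs_cvec[OF inR(1)] G' inR(2) by (auto simp: Hs_def fs''_def trunc_def analytic_extension_def)
      qed (auto simp: fs''_def trunc_def)
      have "agree (Suc (Suc n)) (formal_unrolled sv I a b L D fs' z p) (formal_unrolled sv I a b L D fs'' z p)"
      proof (rule formal_unrolled_agree[OF \<rho> zn])
        show "fs' k y = fs'' k y" if "k < Suc n" "y \<in> nball D z \<rho>" for k y
          using less.IH[of k y] inR(2)[OF that(2)] that by (auto simp: fs''_def trunc_def less_Suc_eq)
      qed (use ext' inR in auto)
      then have ag1: "agree (Suc (Suc n)) (formal_unrolled sv I a b L D fs'' z p) A" by (simp add: A_def agree_sym)
      note ag2 = trunc_agree(1)[OF A z p, of n] and ex2 = trunc_agree(2)[OF A z p, of n]
      define w where "w = G' (cvec z) p - Gs F n (cvec z) p"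
      have diff: "pfam n Hs h y q - pfam n (Gs F) h y q = h ^ n * (G' y q - Gs F n y q)" for h y q
      proof -
        have "pfam n Hs h y q - pfam n (Gs F) h y q = (\<Sum>k\<le>n. if k = n then h ^ n * (G' y q - Gs F n y q) else 0)"
          unfolding pfam_def sum_subtractf[symmetric] by (rule sum.cong) (auto simp: Hs_def algebra_simps)
        then show ?thesis by simp
      qed
      have "cmod (pfam n Hs h y q - pfam n (Gs F) h y q) \<le> (2 * B) * cmod h ^ n" if "y \<in> nball D (cvec z) \<rho>" "q < D" for h y q
      proof -
        have "cmod (G' y q - Gs F n y q) \<le> B + B"
          using norm_triangle_ineq4[of "G' y q" "Gs F n y q"] hfam_bound[OF HG' _ that] hfam_bound[OF HG[OF order_refl] _ that] by simp
        then have "cmod h ^ n * cmod (G' y q - Gs F n y q) \<le> cmod h ^ n * (2 * B)" by (intro mult_left_mono) auto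
        then show ?thesis by (simp add: diff norm_mult norm_power mult.commute)
      qed
      note d = this
      have BB: "0 < real (Suc n) * B" "0 < 2 * B" using B by auto
      obtain s C where s: "0 < s" and dd: "\<And>h. cmod h < s \<Longrightarrow> cmod (inc h (pfam n Hs h) (cvec z) p - inc h (pfam n (Gs F) h) (cvec z) p
          - (pfam n Hs h (cvec z) p - pfam n (Gs F) h (cvec z) p)) \<le> C * cmod h ^ Suc n"
        using inc_compare_small[OF pfam_hfam[OF HHs] pfam_hfam[OF HG] zero_less_one \<rho> BB zcn p d] by blast
      have ex3: "(\<lambda>h. step h (pfam n (Gs F) h) (cvec z) p + h ^ Suc n * w) has_fps_expansion
          cfps (formal_unrolled sv I a b L D (trunc n mod_coeff) z p) + fps_X ^ Suc n * fps_const w"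
        by (intro fps_expansion_intros ex2)
      have "agree (Suc (Suc n)) (cfps (formal_unrolled sv I a b L D fs'' z p))
          (cfps (formal_unrolled sv I a b L D (trunc n mod_coeff) z p) + fps_X ^ Suc n * fps_const w)"
      proof (rule fps_agreeI[OF ex1 ex3 s])
        fix h assume h: "cmod h < s"
        have "step h (pfam n Hs h) (cvec z) p - (step h (pfam n (Gs F) h) (cvec z) p + h ^ Suc n * w)
          = h * (inc h (pfam n Hs h) (cvec z) p - inc h (pfam n (Gs F) h) (cvec z) p
          - (pfam n Hs h (cvec z) p - pfam n (Gs F) h (cvec z) p))"
          unfolding diff by (simp add: step_def[of h "pfam n Hs h"] step_def[of h "pfam n (Gs F) h"] w_def algebra_simps)
        also have "cmod \<dots> \<le> cmod h * (C * cmod h ^ Suc n)"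
          unfolding norm_mult by (rule mult_left_mono[OF dd[OF h]]) simp
        also have "\<dots> = C * cmod h ^ Suc (Suc n)" by simp
        finally show "cmod (step h (pfam n Hs h) (cvec z) p - (step h (pfam n (Gs F) h) (cvec z) p + h ^ Suc n * w)) \<le> C * cmod h ^ Suc (Suc n)" .
      qed
      \<comment> \<open>At index \<open>n + 1\<close> the two formal steps differ by
        \<open>w\<close>, yet both carry the coefficient of the flow.\<close>
      then have "fps_nth (cfps (formal_unrolled sv I a b L D fs'' z p)) (Suc n)
          = fps_nth (cfps (formal_unrolled sv I a b L D (trunc n mod_coeff) z p) + fps_X ^ Suc n * fps_const w) (Suc n)"
        by (simp only: agree_def lessI)
      also have "\<dots> = of_real (fps_nth A (Suc n)) + w"
        using ag2 by (simp add: agree_def fps_X_power_mult_nth del: power_Suc)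
      also have "fps_nth (cfps (formal_unrolled sv I a b L D fs'' z p)) (Suc n) = of_real (fps_nth A (Suc n))"
        using ag1 by (simp add: agree_def)
      finally have "w = 0" by simp
      then have "G' (cvec z) p = Gs F n (cvec z) p" by (simp add: w_def)
      moreover have "G' (cvec z) = cvec (fs' n z)" using G' z by (auto simp: analytic_extension_def)
      ultimately show ?thesis using Gs_cvec[OF zc, of n] by (simp add: cvec_def)
    next
      case False
      then show ?thesis
        using ext'[OF z, of n] extension_nvecs[OF mod_coeff_extension z, of n] by (simp add: nvecs_def)
    qed
  qed
qed

end

section \<open>Quantitative comparison of the learned field with the truncated IMDE\<close>

context modified_field
begin

lemma step_giter_flowc:
  assumes z: "z \<in> V (Suc j)" and h: "h \<in> ball 0 r" and p: "p < D"
  shows "cmod (step h (giter F j h) z p - flowc F h z p) \<le> cmod h * (M * (1 / 2) ^ j)"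
proof -
  have "(\<theta> * cmod h) ^ Suc j \<le> (1 / 4) ^ Suc j"
    using h_small(2)[OF h] theta_pos by (intro power_mono) auto
  also have "\<dots> \<le> (1 / 2) ^ Suc j" by (rule power_mono) auto
  also have "\<dots> \<le> (1 / 2) ^ j" by simp
  finally have le: "M * (\<theta> * cmod h) ^ Suc j \<le> M * (1 / 2) ^ j" using M0 by (intro mult_left_mono) auto
  have eq: "step h (giter F j h) z p - flowc F h z p = h * (giter F j h z p - giter F (Suc j) h z p)"
    by (subst step_giter[OF z h]) (rule add_diff_cancel_left')
  have "cmod (giter F (Suc j) h z p - giter F j h z p) \<le> M * (1 / 2) ^ j"
    using giter_props(3)[OF h z p] le by (rule order_trans)
  then show ?thesis unfolding eq norm_mult norm_minus_commute[of "giter F j h z p"] by (intro mult_left_mono) auto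
qed

end

context rk
begin

text \<open>The increment has Lipschitz constant \<open>\<kappa> * M / \<sigma>\<close>, which times
  \<open>h\<close> is at most 1. The crude factor 2 is affordable because it is only raised to the
  power \<open>s\<close>.\<close>

lemma step_Lipschitz:
  assumes g: "hfam {0} (nball D c (\<rho> + 2 * \<sigma>)) M (\<lambda>_. g)" and "0 < \<sigma>" "0 < M" and small: "32 * \<kappa> * cmod h * M \<le> \<sigma>"
    and z: "z \<in> nball D c \<rho>" and w: "w \<in> nball D c \<rho>" and W: "\<And>p. p < D \<Longrightarrow> cmod (z p - w p) \<le> W" and p: "p < D"
  shows "cmod (step h g z p - step h g w p) \<le> 2 * W"
proof -
  have W0: "0 \<le> W" using W[OF p] norm_ge_zero order_trans by blast
  have "hfam {0} (nball D c (\<rho> + \<sigma>)) (\<kappa> * M) (\<lambda>_. inc h g)"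
  proof (rule inc_hfam[where \<delta> = "\<sigma> / 2" and h = "\<lambda>_. h" and g = "\<lambda>_. g"])
    show "hfam {0} (nball D c (\<rho> + \<sigma> + 2 * (\<sigma> / 2))) M (\<lambda>_. g)" using g by (simp add: add.assoc)
    show "16 * \<kappa> * cmod h * M \<le> \<sigma> / 2" using small by simp
  qed (use assms in auto)
  then have "hfun {0} (nball D c (\<rho> + \<sigma>)) (\<kappa> * M) (\<lambda>_ z. inc h g z p)" using p by (simp add: hfam_def)
  then have "cmod (inc h g z p - inc h g w p) \<le> \<kappa> * M / \<sigma> * W"
    by (rule hfun_Lipschitz[OF _ _ z w W W0 \<open>0 < \<sigma>\<close>]) simp_all
  then have "cmod h * cmod (inc h g z p - inc h g w p) \<le> cmod h * (\<kappa> * M / \<sigma> * W)" by (intro mult_left_mono) auto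
  also have "\<dots> = (\<kappa> * cmod h * M / \<sigma>) * W" by simp
  also have "\<dots> \<le> 1 * W"
    using small W0 \<open>0 < \<sigma>\<close> \<open>0 < M\<close> kappa1 by (intro mult_right_mono) (auto simp: mult.assoc)
  finally have "cmod (h * (inc h g z p - inc h g w p)) \<le> W" by (simp add: norm_mult)
  moreover have "step h g z p - step h g w p = (z p - w p) + h * (inc h g z p - inc h g w p)"
    by (simp add: step_def algebra_simps)
  ultimately show ?thesis using W[OF p] norm_triangle_ineq[of "z p - w p" "h * (inc h g z p - inc h g w p)"] by simp
qed

lemma flow_near:
  assumes F: "hfam {0} (nball D c (\<rho> + 4 * \<sigma>)) M (\<lambda>_. F)" and pos: "0 < \<sigma>" "0 < M" "0 \<le> t" "4 * t * M < \<sigma>"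
    and z: "z \<in> nball D c \<rho>" and p: "p < D"
  shows "cmod (flow (nball D c (\<rho> + 4 * \<sigma>)) F t z p - z p) \<le> t * M"
proof -
  interpret pic: picard D c "\<rho> + 2 * \<sigma>" \<sigma> M "\<sigma> / (4 * M)" F
    by unfold_locales (use pos F in \<open>auto simp: add.assoc\<close>)
  have zb: "z \<in> nball D c (\<rho> + 2 * \<sigma>)" by (rule nball_mono[OF _ z]) (use pos in simp)
  have t: "t < \<sigma> / (4 * M)" using pos by (simp add: field_simps)
  show ?thesis
    using pic.flow_eq_flowc[OF zb, of t] pic.goodD(2)[OF pic.good_flowc _ zb p, of "of_real t"] t pos by (simp add: add.assoc)
qed

text \<open>Each step adds an error \<open>e\<close> and at most doubles the previous one, which
  gives \<open>(2 ^ i - 1) * e\<close> after \<open>i\<close> steps. Both orbits remain within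
  radius \<open>\<rho> + \<sigma>\<close>, where the one-step bound holds.\<close>

lemma iterated_step_flowc:
  fixes h :: real
  assumes F: "hfam {0} (nball D c (\<rho> + 4 * \<sigma>)) M (\<lambda>_. F)" and g: "hfam {0} (nball D c (\<rho> + 3 * \<sigma>)) (2 * M) (\<lambda>_. g)"
    and pos: "0 < \<sigma>" "0 < M" "0 < h" and s: "1 \<le> s" and small: "64 * \<kappa> * s * h * M \<le> \<sigma>"
    and one: "\<And>z p. z \<in> nball D c (\<rho> + \<sigma>) \<Longrightarrow> p < D \<Longrightarrow> cmod (step (of_real h) g z p - flowc F (of_real h) z p) \<le> e"
    and z: "z \<in> nball D c \<rho>" and p: "p < D" and e: "0 \<le> e"
  shows "cmod ((step (of_real h) g ^^ s) z p - flow (nball D c (\<rho> + 4 * \<sigma>)) F (real s * h) z p) \<le> 2 ^ s * e"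
proof -
  define r where "r = \<sigma> / (4 * M)"
  have r: "0 < r" using pos by (simp add: r_def)
  interpret pic: picard D c "\<rho> + 2 * \<sigma>" \<sigma> M r F
    by unfold_locales (use pos F in \<open>auto simp: r_def add.assoc\<close>)
  have sh: "64 * (real s * h * M) \<le> \<sigma>"
  proof -
    have "1 * (real s * h * M) \<le> \<kappa> * (real s * h * M)" using kappa1 pos by (intro mult_right_mono) auto
    then show ?thesis using small by (simp add: mult_ac)
  qed
  have ih: "real i * h * M \<le> \<sigma>" "real i * h < r" "0 \<le> real i * h" if "i \<le> s" for i
  proof -
    show "0 \<le> real i * h" using pos by simp
    have "real i * h * M \<le> real s * h * M" using that pos by (intro mult_right_mono) auto
    moreover have "0 < real s * h * M" using pos s by simp
    ultimately have "64 * (real i * h * M) \<le> \<sigma>" using sh by linarith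
    moreover have "0 \<le> real i * h * M" using pos by simp
    ultimately show "real i * h * M \<le> \<sigma>" by linarith
    have "real i * h * (4 * M) < \<sigma>" using \<open>64 * (real i * h * M) \<le> \<sigma>\<close> \<open>0 \<le> real i * h * M\<close> pos by linarith
    then show "real i * h < r" using pos by (simp add: r_def field_simps)
  qed
  have zb: "z \<in> nball D c (\<rho> + 2 * \<sigma>)" and zb1: "z \<in> nball D c (\<rho> + 2 * \<sigma> - \<sigma>)"
    by (rule nball_mono[OF _ z], use pos in simp)+
  have fl: "flow (nball D c (\<rho> + 4 * \<sigma>)) F (real s * h) z = flowc F (of_real (real s * h)) z"
    using pic.flow_eq_flowc[OF zb, of "real s * h"] ih[of s] by (simp add: add.assoc)
  have cm: "cmod (of_real (real i * h)) = real i * h" if "i \<le> s" for i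
    using ih(3)[OF that] by (simp only: norm_of_real abs_of_nonneg)
  have near: "cmod (flowc F (of_real (real i * h)) z q - z q) \<le> real i * h * M" if "i \<le> s" "q < D" for i q
  proof -
    note eq = cm[OF that(1)]
    have "cmod (flowc F (of_real (real i * h)) z q - z q) \<le> cmod (of_real (real i * h)) * M"
      by (rule pic.goodD(2)[OF pic.good_flowc _ zb that(2)]) (use ih(2)[OF that(1)] in \<open>simp only: mem_ball_0 eq\<close>)
    then show ?thesis unfolding eq .
  qed
  have fb: "flowc F (of_real (real i * h)) z \<in> nball D c (\<rho> + \<sigma>)" if "i \<le> s" for i
  proof (rule nball_shift[OF z])
    show "flowc F (of_real (real i * h)) z \<in> nvecs D"
      by (rule pic.goodD(1)[OF pic.good_flowc _ zb]) (use ih(2)[OF that] in \<open>simp only: mem_ball_0 cm[OF that]\<close>)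
    show "cmod (flowc F (of_real (real i * h)) z q - z q) \<le> \<sigma>" if "q < D" for q
      using near[OF \<open>i \<le> s\<close> that] ih(1)[OF \<open>i \<le> s\<close>] by linarith
  qed simp
  have sb: "(step (of_real h) g ^^ i) z \<in> nball D c (\<rho> + \<sigma>)" if "i \<le> s" for i
  proof (rule step_iter_near(1)[OF pos(1) _ s _ g z that])
    have "0 \<le> \<kappa> * s * h * M" using kappa1 pos by simp
    then show "16 * \<kappa> * real s * cmod (of_real h) * (2 * M) \<le> \<sigma>" using small pos by simp
  qed (use pos in simp)
  have main: "i \<le> s \<longrightarrow> (\<forall>q<D. cmod ((step (of_real h) g ^^ i) z q - flowc F (of_real (real i * h)) z q) \<le> (2 ^ i - 1) * e)" for i
  proof (induction i)
    case 0
    then show ?case using pic.flowc_0[OF zb] by simp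
  next
    case (Suc i)
    show ?case
    proof (intro impI allI)
      fix q assume i: "Suc i \<le> s" and q: "q < D"
      let ?u = "(step (of_real h) g ^^ i) z" and ?w = "flowc F (of_real (real i * h)) z"
      have i': "i \<le> s" using i by simp
      have "flowc F (of_real (real i * h + h)) z = flowc F (of_real h) ?w"
        by (rule pic.flowc_add[OF zb1]) (use pos ih[OF i] ih[OF i'] in \<open>auto simp: algebra_simps\<close>)
      moreover have "real i * h + h = real (Suc i) * h" by (simp add: algebra_simps)
      ultimately have eq: "flowc F (of_real (real (Suc i) * h)) z = flowc F (of_real h) ?w" by simp
      have "cmod (step (of_real h) g ?u q - step (of_real h) g ?w q) \<le> 2 * ((2 ^ i - 1) * e)"
      proof (rule step_Lipschitz[where c = c and \<rho> = "\<rho> + \<sigma>" and \<sigma> = \<sigma> and M = "2 * M"])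
        show "hfam {0} (nball D c (\<rho> + \<sigma> + 2 * \<sigma>)) (2 * M) (\<lambda>_. g)" using g by (simp add: add.assoc)
        have "(64 * \<kappa> * h * M) * 1 \<le> (64 * \<kappa> * h * M) * s" using kappa1 pos s by (intro mult_left_mono) auto
        also have "\<dots> \<le> \<sigma>" using small by (simp add: mult_ac)
        finally show "32 * \<kappa> * cmod (of_real h) * (2 * M) \<le> \<sigma>" using pos by simp
      qed (use Suc.IH i' pos sb[OF i'] fb[OF i'] q in auto)
      moreover have "cmod (step (of_real h) g ?w q - flowc F (of_real h) ?w q) \<le> e" by (rule one[OF fb[OF i'] q])
      moreover have "(step (of_real h) g ^^ Suc i) z q - flowc F (of_real (real (Suc i) * h)) z q
        = (step (of_real h) g ?u q - step (of_real h) g ?w q) + (step (of_real h) g ?w q - flowc F (of_real h) ?w q)"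
        unfolding eq by simp
      ultimately have "cmod ((step (of_real h) g ^^ Suc i) z q - flowc F (of_real (real (Suc i) * h)) z q) \<le> 2 * ((2 ^ i - 1) * e) + e"
        using norm_triangle_mono by (simp only:)
      also have "\<dots> = (2 ^ Suc i - 1) * e" by (simp add: algebra_simps)
      finally show "cmod ((step (of_real h) g ^^ Suc i) z q - flowc F (of_real (real (Suc i) * h)) z q) \<le> (2 ^ Suc i - 1) * e" .
    qed
  qed
  have "cmod ((step (of_real h) g ^^ s) z p - flowc F (of_real (real s * h)) z p) \<le> (2 ^ s - 1) * e"
    using main[of s] p by blast
  also have "\<dots> \<le> 2 ^ s * e" using e by (intro mult_right_mono) auto
  finally show "cmod ((step (of_real h) g ^^ s) z p - flow (nball D c (\<rho> + 4 * \<sigma>)) F (real s * h) z p) \<le> 2 ^ s * e"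
    unfolding fl .
qed

text \<open>If the \<open>s\<close>-fold steps of two fields agree up to \<open>s * h * E\<close>, then the fields agree up to \<open>E\<close> plus
  \<open>exp (- 1)\<close> times their distance on a slightly larger ball. This is iterated \<open>n\<close> times on
  shrinking balls.\<close>

lemma field_compare:
  fixes h :: real
  assumes g1: "hfam {0} (nball D c \<rho>) M (\<lambda>_. g1)" and g2: "hfam {0} (nball D c \<rho>) M (\<lambda>_. g2)"
    and pos: "0 < \<rho>" "0 < M" "0 < h" "0 \<le> E" and s: "1 \<le> s" and n: "1 \<le> n" and small: "432 * s * \<kappa>\<^sup>2 * h * M * n \<le> \<rho>"
    and st: "\<And>z p. z \<in> nball D c \<rho> \<Longrightarrow> p < D \<Longrightarrow>
      cmod ((step (of_real h) g1 ^^ s) z p - (step (of_real h) g2 ^^ s) z p) \<le> real s * h * E"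
    and c: "c \<in> nvecs D" and p: "p < D"
  shows "cmod (g1 c p - g2 c p) \<le> exp 1 / (exp 1 - 1) * E + 2 * M * exp (- real n)"
proof -
  \<comment> \<open>\<open>n\<close> rounds at a cost of \<open>3 * \<delta>\<close> use half of the
    radius. The 432 in \<open>small\<close> is \<open>6 * 72\<close>, and 72 makes the contraction
    factor \<open>24 * s * \<kappa>\<^sup>2 * h * M / \<delta>\<close> at most 1/3, hence at most
    \<open>exp (-1)\<close>.\<close>
  define \<delta> where "\<delta> = \<rho> / (6 * real n)"
  have \<delta>: "0 < \<delta>" using pos n by (simp add: \<delta>_def)
  have sm: "72 * s * \<kappa>\<^sup>2 * h * M \<le> \<delta>" using small n by (simp add: \<delta>_def field_simps)
  \<comment> \<open>The solution of \<open>S (Suc j) = E + exp (-1) * S j\<close> that starts at the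
    trivial distance \<open>S 0 = 2 * M\<close>.\<close>
  define S where "S j = E * (\<Sum>i<j. exp (-1) ^ i) + exp (-1) ^ j * (2 * M)" for j :: nat
  have S: "0 < S j" for j unfolding S_def using pos by (intro add_nonneg_pos mult_nonneg_nonneg sum_nonneg) auto
  have e3: "exp 1 \<le> (3::real)" using exp_le by simp
  have e1: "(1/3::real) \<le> exp (-1)" using e3 by (simp add: exp_minus field_simps)
  have kk: "\<kappa> \<le> \<kappa>\<^sup>2" using kappa1 self_le_power[of \<kappa> 2] by simp
  have main: "j \<le> n \<longrightarrow> (\<forall>z\<in>nball D c (\<rho> - 3 * \<delta> * real j). \<forall>q<D. cmod (g1 z q - g2 z q) \<le> S j)" for j
  proof (induction j)
    case 0
    show ?case
    proof (intro impI ballI allI)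
      fix z q assume z: "z \<in> nball D c (\<rho> - 3 * \<delta> * real 0)" and q: "q < D"
      have "cmod (g1 z q - g2 z q) \<le> cmod (g1 z q) + cmod (g2 z q)" by (rule norm_triangle_ineq4)
      also have "\<dots> \<le> M + M" using z q by (intro add_mono hfam_bound[OF g1] hfam_bound[OF g2]) auto
      finally show "cmod (g1 z q - g2 z q) \<le> S 0" by (simp add: S_def)
    qed
  next
    case (Suc j)
    show ?case
    proof (intro impI ballI allI)
      fix z q assume j: "Suc j \<le> n" and z: "z \<in> nball D c (\<rho> - 3 * \<delta> * real (Suc j))" and q: "q < D"
      have rad: "\<rho> - 3 * \<delta> * real (Suc j) + 3 * \<delta> = \<rho> - 3 * \<delta> * real j" by (simp add: algebra_simps)
      have sub: "nball D c (\<rho> - 3 * \<delta> * real j) \<subseteq> nball D c \<rho>"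
        by (rule subsetI, rule nball_mono) (use \<delta> in auto)
      have zr: "z \<in> nball D c \<rho>" by (rule nball_mono[OF _ z]) (use \<delta> in simp)
      have "cmod ((step (of_real h) g1 ^^ s) z q - (step (of_real h) g2 ^^ s) z q - of_nat s * of_real h * (g1 z q - g2 z q))
        \<le> 24 * (real s)\<^sup>2 * \<kappa>\<^sup>2 * (cmod (of_real h))\<^sup>2 * M / \<delta> * S j"
      proof (rule step_iter_compare[OF \<delta> pos(2) s S _ _ _ _ z q])
        have "\<kappa> * (32 * s * h * M) \<le> \<kappa>\<^sup>2 * (72 * s * h * M)" using kk pos kappa1 by (intro mult_mono) auto
        also have "\<dots> \<le> \<delta>" using sm by (simp add: mult_ac)
        finally show "32 * \<kappa> * s * cmod (of_real h) * M \<le> \<delta>" using pos by (simp add: mult_ac)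
        show "hfam {0} (nball D c (\<rho> - 3 * \<delta> * real (Suc j) + 3 * \<delta>)) M (\<lambda>_. g1)"
          unfolding rad by (rule hfam_mono[OF g1]) (use sub in auto)
        show "hfam {0} (nball D c (\<rho> - 3 * \<delta> * real (Suc j) + 3 * \<delta>)) M (\<lambda>_. g2)"
          unfolding rad by (rule hfam_mono[OF g2]) (use sub in auto)
        show "cmod (g1 y p - g2 y p) \<le> S j" if "y \<in> nball D c (\<rho> - 3 * \<delta> * real (Suc j) + 3 * \<delta>)" "p < D" for y p
          using that Suc.IH j unfolding rad by simp
      qed
      also have "24 * (real s)\<^sup>2 * \<kappa>\<^sup>2 * (cmod (of_real h))\<^sup>2 * M / \<delta> * S j = (s * h) * ((24 * s * \<kappa>\<^sup>2 * h * M / \<delta>) * S j)"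
        by (simp add: power2_eq_square)
      also have "\<dots> \<le> (s * h) * (exp (-1) * S j)"
      proof (intro mult_left_mono mult_right_mono)
        have "24 * s * \<kappa>\<^sup>2 * h * M / \<delta> \<le> 1 / 3" using sm \<delta> by (simp add: field_simps)
        then show "24 * s * \<kappa>\<^sup>2 * h * M / \<delta> \<le> exp (-1)" using e1 by linarith
      qed (use S[of j] pos in auto)
      finally have A: "cmod ((step (of_real h) g1 ^^ s) z q - (step (of_real h) g2 ^^ s) z q - of_nat s * of_real h * (g1 z q - g2 z q))
        \<le> (s * h) * (exp (-1) * S j)" .
      have "cmod (of_nat s * of_real h * (g1 z q - g2 z q)) \<le> real s * h * E + (s * h) * (exp (-1) * S j)"
        using norm_triangle_ineq4[of "(step (of_real h) g1 ^^ s) z q - (step (of_real h) g2 ^^ s) z q"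
            "(step (of_real h) g1 ^^ s) z q - (step (of_real h) g2 ^^ s) z q - of_nat s * of_real h * (g1 z q - g2 z q)"]
          st[OF zr q] A by simp
      then have "(s * h) * cmod (g1 z q - g2 z q) \<le> (s * h) * (E + exp (-1) * S j)"
        using pos by (simp add: norm_mult distrib_left)
      then have "cmod (g1 z q - g2 z q) \<le> E + exp (-1) * S j" using pos s by simp
      also have "\<dots> = S (Suc j)"
        by (simp add: S_def sum.lessThan_Suc_shift sum_distrib_left distrib_left mult_ac del: sum.lessThan_Suc)
      finally show "cmod (g1 z q - g2 z q) \<le> S (Suc j)" .
    qed
  qed
  have "3 * \<delta> * real n < \<rho>" using pos n by (simp add: \<delta>_def)
  then have "cmod (g1 c p - g2 c p) \<le> S n" using main[of n] nball_centre[OF c] p by simp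
  also have "\<dots> \<le> exp 1 / (exp 1 - 1) * E + 2 * M * exp (- real n)"
  proof -
    have "(\<Sum>i<n. exp (-1) ^ i) \<le> (\<Sum>i. exp (-1::real) ^ i)"
      by (rule sum_le_suminf) (auto intro: summable_geometric)
    also have "\<dots> = exp 1 / (exp 1 - 1)"
      by (subst suminf_geometric) (simp_all add: exp_minus field_simps)
    finally have "E * (\<Sum>i<n. exp (-1) ^ i) \<le> E * (exp 1 / (exp 1 - 1))" using pos by (intro mult_left_mono) auto
    moreover have "exp (-1::real) ^ n = exp (- real n)" using exp_of_nat_mult[of n "-1::real"] by simp
    ultimately show ?thesis by (simp add: S_def mult_ac)
  qed
  finally show ?thesis .
qed

end

text \<open>One half is at most \<open>exp (- (1/2))\<close> because
  \<open>exp (1/2) \<le> 2\<close>; the factor 2 in front pays for rounding down.\<close>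

lemma half_power_le_exp:
  assumes "y \<le> real n + 1"
  shows "(1 / 2) ^ n \<le> 2 * exp (- (y / 2) :: real)"
proof -
  have e: "exp (1 / 2) \<le> (2::real)" using exp_bound_half[of "1/2 :: real"] by simp
  then have "(1/2::real) \<le> exp (- (1 / 2))" by (simp add: exp_minus field_simps)
  then have "(1 / 2 :: real) ^ n \<le> exp (- (1 / 2)) ^ n" by (rule power_mono) simp
  also have "\<dots> = exp (- (real n / 2))" using exp_of_nat_mult[of n "- (1 / 2) :: real"] by simp
  also have "\<dots> \<le> exp (1 / 2 + - (y / 2))" using assms by simp
  also have "\<dots> \<le> 2 * exp (- (y / 2))" unfolding exp_add using e by simp
  finally show ?thesis .
qed

lemma exp_minus_nat_le:
  assumes "y \<le> real n + 1"
  shows "exp (- real n) \<le> 3 * exp (- y)"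
proof -
  have "exp (- real n) \<le> exp (1 + - y)" using assms by simp
  also have "\<dots> \<le> 3 * exp (- y)" unfolding exp_add using exp_le by simp
  finally show ?thesis .
qed

context rk
begin

text \<open>A supremum of reals bounds its members only if they are bounded above; here both the
  \<open>s\<close>-fold step and the flow move points by a bounded amount.\<close>

lemma discrepancy_upper:
  fixes h :: real
  assumes F: "hfam {0} (nball D (cvec x) (r1 + r2)) M (\<lambda>_. F)" and G: "hfam {0} (nball D (cvec x) (r1 + r2)) M (\<lambda>_. G)"
    and pos: "0 < r1" "0 < r2" "0 < M" "0 < h" and s: "1 \<le> s" and small: "256 * \<kappa> * s * h * M \<le> r2" and x: "cvec x \<in> nvecs D"
  shows "0 \<le> discrepancy sv I a b L s D h x r1 r2 F G"
    and "z \<in> nball D (cvec x) r1 \<Longrightarrow> p < D \<Longrightarrow>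
      cmod ((step (of_real h) G ^^ s) z p - flow (nball D (cvec x) (r1 + r2)) F (real s * h) z p)
      \<le> real s * h * discrepancy sv I a b L s D h x r1 r2 F G"
proof -
  let ?e = "\<lambda>z p. (step (of_real h) G ^^ s) z p - flow (nball D (cvec x) (r1 + r2)) F (real s * h) z p"
  have sh: "0 < real s * h" using s pos by simp
  have kap: "1 * (real s * h * M) \<le> \<kappa> * (real s * h * M)" using kappa1 pos by (intro mult_right_mono) auto
  have bd: "cmod (?e z p) \<le> real s * (\<kappa> * h * M) + real s * h * M" if z: "z \<in> nball D (cvec x) r1" and p: "p < D" for z p
  proof -
    have "cmod (flow (nball D (cvec x) (r1 + 4 * (r2 / 4))) F (real s * h) z p - z p) \<le> real s * h * M"
    proof (rule flow_near[OF _ _ pos(3) _ _ z p])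
      have "0 < real s * h * M" using sh pos by simp
      then show "4 * (real s * h) * M < r2 / 4" using small kap by (simp add: mult_ac) 
    qed (use F pos in auto)
    moreover have "cmod ((step (of_real h) G ^^ s) z p - z p) \<le> real s * (\<kappa> * cmod (of_real h) * M)"
    proof (rule step_iter_near(2)[where c = "cvec x" and \<rho> = r1 and \<delta> = "r2 / 4"])
      have "0 \<le> \<kappa> * s * h * M" using kappa1 pos by simp
      then show "16 * \<kappa> * real s * cmod (of_real h) * M \<le> r2 / 4" using small pos by simp
      show "hfam {0} (nball D (cvec x) (r1 + 3 * (r2 / 4))) M (\<lambda>_. G)"
        by (rule hfam_mono[OF G]) (use pos in \<open>auto elim!: nball_mono[rotated]\<close>)
    qed (use pos s z p in auto)
    ultimately show ?thesis
      using pos norm_triangle_ineq4[of "(step (of_real h) G ^^ s) z p - z p" "flow (nball D (cvec x) (r1 + r2)) F (real s * h) z p - z p"]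
      by simp
  qed
  have bdd: "bdd_above ((\<lambda>z. supnorm D (?e z)) ` nball D (cvec x) r1)"
    by (rule bdd_aboveI2[of _ _ "real s * (\<kappa> * h * M) + real s * h * M"]) (use bd in \<open>simp add: supnorm_le_iff\<close>)
  have upper: "supnorm D (?e z) \<le> real s * h * discrepancy sv I a b L s D h x r1 r2 F G" if "z \<in> nball D (cvec x) r1" for z
    using cSUP_upper[OF that bdd] s pos by (simp add: discrepancy_def unrolled_eq_step)
  show "0 \<le> discrepancy sv I a b L s D h x r1 r2 F G"
    using order_trans[OF supnorm_nonneg upper[OF nball_centre[OF x pos(1)]]] sh by (simp add: zero_le_mult_iff)
  show "cmod (?e z p) \<le> real s * h * discrepancy sv I a b L s D h x r1 r2 F G" if "z \<in> nball D (cvec x) r1" "p < D"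
    using upper[OF that(1)] that(2) by (simp add: supnorm_le_iff)
qed

text \<open>The iterate \<open>giter F K\<close> mediates: its \<open>s\<close>-fold step is
  compared with that of \<open>G\<close> by way of the flow, and its distance to the truncation is a
  Taylor tail.\<close>

lemma field_pfam_bound:
  fixes h :: real
  assumes F: "hfam {0} (nball D c (r1 + r2)) M (\<lambda>_. F)" and G: "hfam {0} (nball D c (r1 + r2)) M (\<lambda>_. G)"
    and pos: "0 < r1" "0 < r2" "0 < M" "0 < h" "0 \<le> E" and s: "1 \<le> s" and n: "1 \<le> n" and c: "c \<in> nvecs D" and p: "p < D"
    and hK: "4608 * \<kappa>\<^sup>2 * M * (h * (real K + 3)) \<le> r2" and hs: "256 * \<kappa> * s * h * M \<le> r2"
    and hn: "864 * s * \<kappa>\<^sup>2 * M * (h * n) \<le> r1"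
    and st: "\<And>z p. z \<in> nball D c r1 \<Longrightarrow> p < D \<Longrightarrow>
      cmod ((step (of_real h) G ^^ s) z p - flow (nball D c (r1 + r2)) F (real s * h) z p) \<le> real s * h * E"
  shows "cmod (G c p - pfam K (Gs F) (of_real h) c p) \<le> exp 1 / (exp 1 - 1) * E + M * ((2 * 2 ^ s + 4) * (1 / 2) ^ K + 4 * exp (- real n))"
proof -
  \<comment> \<open>A quarter \<open>\<sigma>\<close> of the annulus pays for building the iterate,
    which thus lives on radius \<open>r1 + 3 * \<sigma>\<close>; indeed
    \<open>3 * \<delta> * (K + 3) = \<sigma>\<close>. With the largest admissible \<open>r\<close>,
    the condition \<open>hK\<close> says \<open>h \<le> r / 2\<close>; its constant is
    \<open>2 * 192 * 12\<close>.\<close>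
  define \<sigma> where "\<sigma> = r2 / 4"
  define \<delta> where "\<delta> = r2 / (12 * (real K + 3))"
  define r where "r = \<delta> / (192 * \<kappa>\<^sup>2 * M)"
  have \<sigma>: "0 < \<sigma>" and r12: "r1 + 4 * \<sigma> = r1 + r2" using pos by (auto simp: \<sigma>_def)
  have \<delta>: "0 < \<delta>" using pos by (simp add: \<delta>_def)
  have r: "0 < r" using \<delta> pos kappa1 by (simp add: r_def)
  interpret modified_field D sv I a b L \<kappa> c "r1 + r2" \<delta> M r F
    by unfold_locales (use \<delta> r pos F kappa1 in \<open>simp_all add: r_def\<close>)
  have "r / 2 = r2 / (4608 * \<kappa>\<^sup>2 * M * (real K + 3))" by (simp add: r_def \<delta>_def mult_ac)
  moreover have "0 < 4608 * \<kappa>\<^sup>2 * M * (real K + 3)" using pos kappa1 by simp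
  ultimately have hr: "h \<le> r / 2" using hK by (simp only: pos_le_divide_eq) (simp only: mult_ac)
  then have hb: "of_real h \<in> ball (0::complex) r" using pos r by simp
  have "3 * \<delta> * real (Suc K) \<le> \<sigma>"
  proof -
    have "3 * \<delta> * real (Suc K) \<le> 3 * \<delta> * (real K + 3)" using \<delta> by (intro mult_left_mono) auto
    also have "3 * (r2 / (12 * k)) * k = r2 / 4" if "0 < k" for k :: real using that by simp
    from this[of "real K + 3"] have "3 * \<delta> * (real K + 3) = \<sigma>" by (simp add: \<delta>_def \<sigma>_def del: times_divide_eq_left times_divide_eq_right)
    finally show ?thesis .
  qed
  then have VK: "nball D c (r1 + 3 * \<sigma>) \<subseteq> V (Suc K)" using r12 by (intro subsetI, elim nball_mono[rotated]) simp
  have g: "hfam {0} (nball D c (r1 + 3 * \<sigma>)) (2 * M) (\<lambda>_. giter F K (of_real h))"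
    by (rule hfam_mono[OF hfam_fixed[OF giter_hfam hb]]) (use VK V_mono[of K "Suc K"] in auto)
  have sub1: "nball D c r1 \<subseteq> nball D c (r1 + 3 * \<sigma>)" and sub2: "nball D c r1 \<subseteq> nball D c (r1 + r2)"
    using \<sigma> pos by (auto elim!: nball_mono[rotated])
  define e where "e = h * (M * (1 / 2) ^ K)"
  have e: "0 \<le> e" using pos by (simp add: e_def)
  \<comment> \<open>The defect of the iterate enters like an additional discrepancy.\<close>
  define E' where "E' = E + 2 ^ s * (M * (1 / 2) ^ K)"
  have E': "0 \<le> E'" using pos by (simp add: E'_def)
  have gE: "cmod ((step (of_real h) G ^^ s) z q - (step (of_real h) (giter F K (of_real h)) ^^ s) z q) \<le> real s * h * E'"
    if z: "z \<in> nball D c r1" and q: "q < D" for z q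
  proof -
    let ?fl = "flow (nball D c (r1 + r2)) F (real s * h) z q"
    have "cmod ((step (of_real h) (giter F K (of_real h)) ^^ s) z q - flow (nball D c (r1 + 4 * \<sigma>)) F (real s * h) z q) \<le> 2 ^ s * e"
    proof (rule iterated_step_flowc[OF _ g \<sigma> pos(3,4) s _ _ z q e])
      show "64 * \<kappa> * real s * h * M \<le> \<sigma>" using hs by (simp add: \<sigma>_def)
      show "cmod (step (of_real h) (giter F K (of_real h)) z p - flowc F (of_real h) z p) \<le> e"
        if "z \<in> nball D c (r1 + \<sigma>)" "p < D" for z p
      proof -
        have "z \<in> V (Suc K)" using VK nball_mono[OF _ that(1), of "r1 + 3 * \<sigma>"] \<sigma> by auto
        from step_giter_flowc[OF this hb that(2)] show ?thesis using pos by (simp add: e_def)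
      qed
    qed (use F r12 in simp)
    then have "cmod ((step (of_real h) (giter F K (of_real h)) ^^ s) z q - ?fl) \<le> 2 ^ s * e" by (simp only: r12)
    moreover have "2 ^ s * e \<le> real s * h * (2 ^ s * (M * (1 / 2) ^ K))"
    proof -
      have "1 * (2 ^ s * e) \<le> real s * (2 ^ s * e)" using s e by (intro mult_right_mono) auto
      then show ?thesis by (simp add: e_def mult_ac)
    qed
    moreover have "cmod ((step (of_real h) G ^^ s) z q - (step (of_real h) (giter F K (of_real h)) ^^ s) z q)
      \<le> cmod ((step (of_real h) G ^^ s) z q - ?fl) + cmod ((step (of_real h) (giter F K (of_real h)) ^^ s) z q - ?fl)"
      using norm_triangle_ineq4[of "(step (of_real h) G ^^ s) z q - ?fl" "(step (of_real h) (giter F K (of_real h)) ^^ s) z q - ?fl"] by simp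
    ultimately show ?thesis unfolding E'_def distrib_left using st[OF z q] by linarith
  qed
  have A: "cmod (G c p - giter F K (of_real h) c p) \<le> exp 1 / (exp 1 - 1) * E' + 2 * (2 * M) * exp (- real n)"
  \<comment> \<open>Both fields are taken with the bound \<open>2 * M\<close>, hence 864 as twice
    432.\<close>
  proof (rule field_compare[OF _ _ pos(1) _ pos(4) E' s n _ gE c p])
    show "hfam {0} (nball D c r1) (2 * M) (\<lambda>_. G)" by (rule hfam_mono[OF G]) (use sub2 pos in auto)
    show "hfam {0} (nball D c r1) (2 * M) (\<lambda>_. giter F K (of_real h))" by (rule hfam_mono[OF g]) (use sub1 in auto)
    show "432 * real s * \<kappa>\<^sup>2 * h * (2 * M) * real n \<le> r1" using hn by (simp add: mult_ac)
  qed (use pos in auto)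
  have "c \<in> V K" using VK V_mono[of K "Suc K"] nball_centre[OF c, of "r1 + 3 * \<sigma>"] pos \<sigma> by auto
  from pfam_giter[OF this p, of "of_real h"] have B: "cmod (giter F K (of_real h) c p - pfam K (Gs F) (of_real h) c p) \<le> 2 * (2 * M) * (h / r) ^ Suc K"
    using hr pos by simp
  have "(h / r) ^ Suc K \<le> (1 / 2) ^ Suc K" using hr r pos by (intro power_mono) (auto simp: field_simps)
  also have "\<dots> \<le> (1 / 2) ^ K" by simp
  finally have "2 * (2 * M) * (h / r) ^ Suc K \<le> 2 * (2 * M) * (1 / 2) ^ K" using pos by (intro mult_left_mono) auto
  with B have B: "cmod (giter F K (of_real h) c p - pfam K (Gs F) (of_real h) c p) \<le> 2 * (2 * M) * (1 / 2) ^ K" by linarith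
  have "exp 1 / (exp 1 - 1) \<le> (2::real)" using exp_ge_add_one_self[of 1] by (simp add: field_simps)
  then have "exp 1 / (exp 1 - 1) * (2 ^ s * (M * (1 / 2) ^ K)) \<le> 2 * (2 ^ s * (M * (1 / 2) ^ K))"
    using pos by (intro mult_right_mono) auto
  then have "exp 1 / (exp 1 - 1) * E' \<le> exp 1 / (exp 1 - 1) * E + 2 * (2 ^ s * (M * (1 / 2) ^ K))"
    unfolding E'_def distrib_left by simp
  moreover have "cmod (G c p - pfam K (Gs F) (of_real h) c p)
    \<le> cmod (G c p - giter F K (of_real h) c p) + cmod (giter F K (of_real h) c p - pfam K (Gs F) (of_real h) c p)"
    using norm_triangle_ineq[of "G c p - giter F K (of_real h) c p" "giter F K (of_real h) c p - pfam K (Gs F) (of_real h) c p"]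
    by (simp only: diff_add_cancel add_diff_eq)
  ultimately have "cmod (G c p - pfam K (Gs F) (of_real h) c p)
    \<le> exp 1 / (exp 1 - 1) * E + 2 * (2 ^ s * (M * (1 / 2) ^ K)) + 2 * (2 * M) * exp (- real n) + 2 * (2 * M) * (1 / 2) ^ K"
    using A B by linarith
  also have "\<dots> = exp 1 / (exp 1 - 1) * E + M * ((2 * 2 ^ s + 4) * (1 / 2) ^ K + 4 * exp (- real n))"
    by (simp add: algebra_simps)
  finally show ?thesis .
qed

end

context rk
begin

text \<open>The number of comparison rounds and the truncation index are \<open>\<eta>1 / h\<close>
  and \<open>\<eta>2 / h\<close> rounded down. The doubled \<open>\<eta>2\<close> makes room for the
  spare iterations: \<open>h * (K + 3)\<close> is at most \<open>\<eta>2 + 3 * h\<close>.\<close>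

theorem unrolled_field_bound:
  fixes h r1 r2 m \<mu>1 \<mu>2 \<eta>1 \<eta>2 :: real
  assumes F: "analytic_extension D x (r1 + r2) f F" and G: "analytic_extension D x (r1 + r2) g G" and x: "x \<in> nvecs D"
    and bF: "\<And>z. z \<in> nball D (cvec x) (r1 + r2) \<Longrightarrow> supnorm D (F z) \<le> m"
    and bG: "\<And>z. z \<in> nball D (cvec x) (r1 + r2) \<Longrightarrow> supnorm D (G z) \<le> m"
    and r12: "0 < r1" "0 < r2" and m: "m + r1 \<le> \<mu>1 * r1" "m + r2 \<le> \<mu>2 * r2" and s: "1 \<le> s" and h: "0 < h"
    and \<eta>1: "864 * real s * \<kappa>\<^sup>2 * \<mu>1 * \<eta>1 = 1" "h \<le> \<eta>1" and \<eta>2: "4608 * \<kappa>\<^sup>2 * \<mu>2 * (2 * \<eta>2) = 1" "3 * h \<le> \<eta>2"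
    and \<mu>2: "256 * \<kappa> * s * h * \<mu>2 \<le> 1" and p: "p < D"
  shows "cmod (G (cvec x) p - pfam (nat \<lfloor>\<eta>2 / h\<rfloor>) (Gs F) (of_real h) (cvec x) p)
    \<le> (4 * 2 ^ s + 20) * m * exp (- (min \<eta>1 (\<eta>2 / 2) / h)) + exp 1 / (exp 1 - 1) * discrepancy sv I a b L s D h x r1 r2 F G"
    (is "?lhs \<le> ?C * m * ?T + ?d")
proof (rule field_le_epsilon)
  fix \<epsilon> :: real assume \<epsilon>: "0 < \<epsilon>"
  let ?U = "nball D (cvec x) (r1 + r2)"
  have xc: "cvec x \<in> nvecs D" using x by (simp add: nvecs_def) (simp add: cvec_def)
  \<comment> \<open>The estimates ask for a positive bound, but \<open>m\<close> may be 0. The added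
    amount is at most the radii, which keeps \<open>M\<close> below \<open>\<mu>1 * r1\<close> and
    \<open>\<mu>2 * r2\<close>, and so small that the final bound grows by at most
    \<open>\<epsilon>\<close>.\<close>
  define M where "M = m + min (min r1 r2) (\<epsilon> / (?C * ?T))"
  have CT: "0 < ?C * ?T" by (intro mult_pos_pos add_nonneg_pos) auto
  have "0 \<le> m" using order_trans[OF supnorm_nonneg bF[OF nball_centre[OF xc]]] r12 by simp
  then have M: "0 < M" "m \<le> M" "M \<le> \<mu>1 * r1" "M \<le> \<mu>2 * r2" and ME: "M \<le> m + \<epsilon> / (?C * ?T)"
    using r12 m \<epsilon> CT unfolding M_def by (auto intro: add_nonneg_pos simp del: zero_less_mult_iff)
  have P: "0 \<le> \<mu>1 * r1" "0 \<le> \<mu>2 * r2" using M by auto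
  have eta: "0 < \<eta>1" "0 < \<eta>2" using \<eta>1(2) \<eta>2(2) h by auto
  have hF: "hfam {0} ?U M (\<lambda>_. F)" and hG: "hfam {0} ?U M (\<lambda>_. G)"
  proof -
    have "cmod (F z p) \<le> M" "cmod (G z p) \<le> M" if "z \<in> ?U" "p < D" for z p
      using bF[OF that(1)] bG[OF that(1)] M(2) that(2) norm_le_supnorm[OF that(2)] by (meson order_trans)+
    then show "hfam {0} ?U M (\<lambda>_. F)" "hfam {0} ?U M (\<lambda>_. G)"
      using F G nball_nvecs by (auto intro!: holomorphic_field_hfam[where U = ?U] simp: analytic_extension_def)
  qed
  define K where "K = nat \<lfloor>\<eta>2 / h\<rfloor>"
  define n where "n = nat \<lfloor>\<eta>1 / h\<rfloor>"
  have fl: "real (nat \<lfloor>y\<rfloor>) \<le> y" "y \<le> real (nat \<lfloor>y\<rfloor>) + 1" if "0 \<le> y" for y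
    using that by linarith+
  have K: "real K \<le> \<eta>2 / h" "\<eta>2 / h \<le> real K + 1" using fl[of "\<eta>2 / h"] eta h by (auto simp: K_def)
  have n: "real n \<le> \<eta>1 / h" "\<eta>1 / h \<le> real n + 1" using fl[of "\<eta>1 / h"] eta h by (auto simp: n_def)
  have n1: "1 \<le> n" using \<eta>1(2) h by (simp add: n_def le_nat_iff le_floor_iff)
  have hs: "256 * \<kappa> * s * h * M \<le> r2"
  proof -
    have "256 * \<kappa> * s * h * M \<le> 256 * \<kappa> * s * h * (\<mu>2 * r2)" using M kappa1 h by (intro mult_left_mono) auto
    also have "\<dots> = (256 * \<kappa> * s * h * \<mu>2) * r2" by simp
    also have "\<dots> \<le> 1 * r2" using \<mu>2 r12 by (intro mult_right_mono) auto
    finally show ?thesis by simp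
  qed
  have hK: "4608 * \<kappa>\<^sup>2 * M * (h * (real K + 3)) \<le> r2"
  proof -
    have "h * real K \<le> \<eta>2" using K(1) h by (simp add: field_simps)
    then have "h * (real K + 3) \<le> 2 * \<eta>2" using \<eta>2(2) by (simp add: distrib_left)
    then have "4608 * \<kappa>\<^sup>2 * M * (h * (real K + 3)) \<le> 4608 * \<kappa>\<^sup>2 * (\<mu>2 * r2) * (2 * \<eta>2)"
      using M h by (intro mult_mono[of "4608 * \<kappa>\<^sup>2 * M"] mult_left_mono mult_nonneg_nonneg[OF _ P(2)]) auto
    also have "\<dots> = (4608 * \<kappa>\<^sup>2 * \<mu>2 * (2 * \<eta>2)) * r2" by (simp only: mult_ac)
    finally show ?thesis using \<eta>2(1) by simp
  qed
  have hn: "864 * real s * \<kappa>\<^sup>2 * M * (h * n) \<le> r1"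
  proof -
    have "h * real n \<le> \<eta>1" using n(1) h by (simp add: field_simps)
    then have "864 * real s * \<kappa>\<^sup>2 * M * (h * n) \<le> 864 * real s * \<kappa>\<^sup>2 * (\<mu>1 * r1) * \<eta>1"
      using M h by (intro mult_mono[of "864 * real s * \<kappa>\<^sup>2 * M"] mult_left_mono mult_nonneg_nonneg[OF _ P(1)]) auto
    also have "\<dots> = (864 * real s * \<kappa>\<^sup>2 * \<mu>1 * \<eta>1) * r1" by (simp only: mult_ac)
    finally show ?thesis using \<eta>1(1) by simp
  qed
  note d = discrepancy_upper[OF hF hG r12 M(1) h s hs xc]
  have "?lhs \<le> ?d + M * ((2 * 2 ^ s + 4) * (1 / 2) ^ K + 4 * exp (- real n))"
    unfolding K_def[symmetric] by (rule field_pfam_bound[OF hF hG r12 M(1) h d(1) s n1 xc p hK hs hn d(2)])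
  also have "M * ((2 * 2 ^ s + 4) * (1 / 2) ^ K + 4 * exp (- real n)) \<le> M * (?C * ?T)"
  proof (intro mult_left_mono)
    have T: "exp (- (\<eta>2 / h / 2)) \<le> ?T" "exp (- (\<eta>1 / h)) \<le> ?T" using h by (simp_all add: divide_right_mono min_def field_simps)
    have "(1 / 2) ^ K \<le> 2 * ?T" "exp (- real n) \<le> 3 * ?T"
      using half_power_le_exp[OF K(2)] exp_minus_nat_le[OF n(2)] T by linarith+
    \<comment> \<open>The rounding factors 2 and 3 make the coefficient
      \<open>2 * (2 * 2 ^ s + 4) + 3 * 4\<close>, which is \<open>?C\<close>.\<close>
    then have "(2 * 2 ^ s + 4) * (1 / 2) ^ K + 4 * exp (- real n) \<le> (2 * 2 ^ s + 4) * (2 * ?T) + 4 * (3 * ?T)"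
      by (intro add_mono mult_left_mono) auto
    then show "(2 * 2 ^ s + 4) * (1 / 2) ^ K + 4 * exp (- real n) \<le> ?C * ?T" by (simp add: algebra_simps)
  qed (use M in simp)
  also have "M * (?C * ?T) \<le> (m + \<epsilon> / (?C * ?T)) * (?C * ?T)" using ME CT by (intro mult_right_mono) auto
  also have "\<dots> = ?C * m * ?T + \<epsilon>"
  proof -
    have "(m + \<epsilon> / c) * c = c * m + \<epsilon>" if "0 < c" for c :: real using that by (simp add: distrib_right)
    from this[OF CT] show ?thesis by (simp only: mult_ac)
  qed
  finally show "?lhs \<le> ?C * m * ?T + ?d + \<epsilon>" by simp
qed

end

theorem theorem3p1:
  fixes I :: nat and a :: "nat \<Rightarrow> nat \<Rightarrow> real" and b :: "nat \<Rightarrow> real"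
    and sv :: implicit_solver and s :: nat and \<rho>1 \<rho>2 :: real
  assumes "rk_consistent I b" and "\<not> rk_explicit I a" and "1 \<le> s"
  shows "\<exists>(K :: real \<Rightarrow> nat) (\<Delta>0 :: real) (q :: real) (\<gamma>1 :: real) (c1 :: real).
    0 < \<Delta>0 \<and> 0 < q \<and> 0 < \<gamma>1 \<and> 0 < c1 \<and>
    (\<forall>(D :: nat) (L :: nat) (h :: real) (x :: real nvec) (r1 :: real) (r2 :: real) (m :: real)
       (f :: real nvec \<Rightarrow> real nvec) (F :: complex nvec \<Rightarrow> complex nvec)
       (N :: nat) (M :: nat) (X :: nat \<Rightarrow> real nvec)
       (net :: (nat \<Rightarrow> real) \<Rightarrow> real nvec \<Rightarrow> real nvec) (\<Theta> :: (nat \<Rightarrow> real) set) (\<theta> :: nat \<Rightarrow> real)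
       (G :: complex nvec \<Rightarrow> complex nvec).
       1 \<le> D \<and> x \<in> nvecs D \<and> 0 < r1 \<and> 0 < r2 \<and> m / r1 = \<rho>1 \<and> m / r2 = \<rho>2 \<and>
       f \<in> nvecs D \<rightarrow> nvecs D \<and> (\<forall>\<eta>\<in>\<Theta>. net \<eta> \<in> nvecs D \<rightarrow> nvecs D) \<and>
       (\<forall>n\<in>{1..N}. X n \<in> nvecs D) \<and>
       is_arg_min (\<lambda>\<eta>. loss_unrolled sv I a b L s D h f N M X (net \<eta>)) (\<lambda>\<eta>. \<eta> \<in> \<Theta>) \<theta> \<and>
       analytic_extension D x (r1 + r2) f F \<and>
       analytic_extension D x (r1 + r2) (net \<theta>) G \<and>
       (\<forall>z\<in>nball D (cvec x) (r1 + r2). supnorm D (F z) \<le> m) \<and>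
       (\<forall>z\<in>nball D (cvec x) (r1 + r2). supnorm D (G z) \<le> m)
       \<longrightarrow>
       (\<exists>fs. imde sv I a b L D x (r1 + r2) f fs \<and>
          (\<forall>fs'. imde sv I a b L D x (r1 + r2) f fs' \<longrightarrow>
             (\<forall>k. \<forall>y\<in>nball D x (r1 + r2). fs' k y = fs k y)) \<and>
          (0 < real s * h \<and> real s * h < \<Delta>0 \<longrightarrow>
             supnorm D (\<lambda>p. net \<theta> x p - imde_truncation fs (K h) h x p)
             \<le> c1 * m * exp (- \<gamma>1 / (real s * h) powr (1 / q))
               + exp 1 / (exp 1 - 1) * discrepancy sv I a b L s D h x r1 r2 F G)))"
proof -
  \<comment> \<open>The total of all row sums exceeds each of them, and the summand 1 ensures
    \<open>1 \<le> \<kappa>\<close>.\<close>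
  define \<kappa> where "\<kappa> = 1 + (\<Sum>i<I. \<Sum>j<I. \<bar>a i j\<bar>) + (\<Sum>i<I. \<bar>b i\<bar>)"
  \<comment> \<open>The constants are fixed before the data, when the sign of \<open>\<rho>1\<close>
    is not known: the absolute value keeps them positive. The added 1 is the room for enlarging
    \<open>m\<close>.\<close>
  define \<mu>1 where "\<mu>1 = \<bar>\<rho>1\<bar> + 1"
  define \<mu>2 where "\<mu>2 = \<bar>\<rho>2\<bar> + 1"
  define \<eta>1 where "\<eta>1 = 1 / (864 * real s * \<kappa>\<^sup>2 * \<mu>1)"
  define \<eta>2 where "\<eta>2 = 1 / (4608 * \<kappa>\<^sup>2 * \<mu>2 * 2)"
  \<comment> \<open>The three smallness conditions on \<open>h\<close> of the preceding bound; they
    are imposed on \<open>real s * h\<close>, which is at least \<open>h\<close>.\<close>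
  define \<Delta> where "\<Delta> = min (\<eta>2 / 3) (min \<eta>1 (1 / (256 * \<kappa> * real s * \<mu>2)))"
  define K where "K h = nat \<lfloor>\<eta>2 / h\<rfloor>" for h
  \<comment> \<open>The exponents obtained are multiples of \<open>1 / h\<close>; the factor
    \<open>s\<close> expresses them through \<open>real s * h\<close>.\<close>
  define \<gamma> where "\<gamma> = s * min \<eta>1 (\<eta>2 / 2)"
  define C :: real where "C = 4 * 2 ^ s + 20"
  have \<kappa>: "1 \<le> \<kappa>" and \<kappa>b: "(\<Sum>i<I. \<bar>b i\<bar>) \<le> \<kappa>" by (simp_all add: \<kappa>_def sum_nonneg add_nonneg_nonneg)
  have \<kappa>a: "(\<Sum>j<I. \<bar>a i j\<bar>) \<le> \<kappa>" if "i < I" for i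
  proof -
    have "(\<Sum>j<I. \<bar>a i j\<bar>) \<le> (\<Sum>i<I. \<Sum>j<I. \<bar>a i j\<bar>)"
      by (rule member_le_sum[where f = "\<lambda>i. \<Sum>j<I. \<bar>a i j\<bar>"]) (use that in \<open>auto intro: sum_nonneg\<close>)
    moreover have "0 \<le> (\<Sum>i<I. \<bar>b i\<bar>)" by (simp add: sum_nonneg)
    ultimately show ?thesis unfolding \<kappa>_def by linarith
  qed
  have pos: "0 < \<mu>1" "0 < \<mu>2" "0 < real s" "0 < \<kappa>" using assms(3) \<kappa> by (auto simp: \<mu>1_def \<mu>2_def)
  then have e1: "864 * real s * \<kappa>\<^sup>2 * \<mu>1 * \<eta>1 = 1" and e2: "4608 * \<kappa>\<^sup>2 * \<mu>2 * (2 * \<eta>2) = 1" and eta: "0 < \<eta>1" "0 < \<eta>2"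
    by (simp_all add: \<eta>1_def \<eta>2_def)
  show ?thesis
  proof (rule exI[of _ K], rule exI[of _ \<Delta>], rule exI[of _ 1], rule exI[of _ \<gamma>], rule exI[of _ C], intro conjI allI impI)
    show "0 < \<Delta>" "0 < \<gamma>" using pos eta by (auto simp: \<Delta>_def \<gamma>_def)
    show "0 < C" by (simp add: C_def add_nonneg_pos)
    fix D L :: nat and h :: real and x :: "real nvec" and r1 r2 m :: real and f :: "real nvec \<Rightarrow> real nvec"
      and F :: "complex nvec \<Rightarrow> complex nvec" and N M :: nat and X :: "nat \<Rightarrow> real nvec"
      and net :: "(nat \<Rightarrow> real) \<Rightarrow> real nvec \<Rightarrow> real nvec" and \<Theta> :: "(nat \<Rightarrow> real) set" and \<theta> :: "nat \<Rightarrow> real"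
      and G :: "complex nvec \<Rightarrow> complex nvec"
    assume "1 \<le> D \<and> x \<in> nvecs D \<and> 0 < r1 \<and> 0 < r2 \<and> m / r1 = \<rho>1 \<and> m / r2 = \<rho>2 \<and>
       f \<in> nvecs D \<rightarrow> nvecs D \<and> (\<forall>\<eta>\<in>\<Theta>. net \<eta> \<in> nvecs D \<rightarrow> nvecs D) \<and>
       (\<forall>n\<in>{1..N}. X n \<in> nvecs D) \<and>
       is_arg_min (\<lambda>\<eta>. loss_unrolled sv I a b L s D h f N M X (net \<eta>)) (\<lambda>\<eta>. \<eta> \<in> \<Theta>) \<theta> \<and>
       analytic_extension D x (r1 + r2) f F \<and>
       analytic_extension D x (r1 + r2) (net \<theta>) G \<and>
       (\<forall>z\<in>nball D (cvec x) (r1 + r2). supnorm D (F z) \<le> m) \<and>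
       (\<forall>z\<in>nball D (cvec x) (r1 + r2). supnorm D (G z) \<le> m)"
    then have D: "1 \<le> D" and x: "x \<in> nvecs D" and r12: "0 < r1" "0 < r2" and m: "m / r1 = \<rho>1" "m / r2 = \<rho>2"
      and F: "analytic_extension D x (r1 + r2) f F" and G: "analytic_extension D x (r1 + r2) (net \<theta>) G"
      and bF: "\<And>z. z \<in> nball D (cvec x) (r1 + r2) \<Longrightarrow> supnorm D (F z) \<le> m"
      and bG: "\<And>z. z \<in> nball D (cvec x) (r1 + r2) \<Longrightarrow> supnorm D (G z) \<le> m" by blast+
    interpret rk D sv I a b L \<kappa>
      by unfold_locales (use D \<kappa> \<kappa>a \<kappa>b assms(1) in \<open>auto simp: rk_consistent_def\<close>)
    have xR: "x \<in> nball D x (r1 + r2)" by (rule nball_centre[OF x]) (use r12 in simp)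
    then have xcR: "cvec x \<in> nball D (cvec x) (r1 + r2)" by (simp only: cvec_nball)
    have "0 \<le> m" using order_trans[OF supnorm_nonneg bF[OF xcR]] .
    \<comment> \<open>\<open>m + 1\<close> is a positive bound even for \<open>m = 0\<close>; it
      serves existence and uniqueness, while the error bound works with \<open>m\<close>
      itself.\<close>
    interpret extended_field D sv I a b L \<kappa> x "r1 + r2" "m + 1" f F
    proof
      show "cmod (F z p) \<le> m + 1" if "z \<in> nball D (cvec x) (r1 + r2)" "p < D" for z p
        using bF[OF that(1)] norm_le_supnorm[OF that(2), of "F z"] by linarith
    qed (use F \<open>0 \<le> m\<close> in auto)
    have bound: "supnorm D (\<lambda>p. net \<theta> x p - imde_truncation mod_coeff (K h) h x p)
             \<le> C * m * exp (- \<gamma> / (real s * h) powr (1 / 1))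
               + exp 1 / (exp 1 - 1) * discrepancy sv I a b L s D h x r1 r2 F G"
      if sh: "0 < real s * h" "real s * h < \<Delta>"
      unfolding supnorm_le_iff
    proof (intro allI impI)
      fix p assume p: "p < D"
      have h: "0 < h" using sh(1) pos by (simp add: zero_less_mult_iff)
      have "1 * h \<le> real s * h" using h assms(3) by (intro mult_right_mono) auto
      then have h\<Delta>: "h < \<Delta>" using sh(2) by simp
      then have h': "h \<le> \<eta>1" "3 * h \<le> \<eta>2" "h \<le> 1 / (256 * \<kappa> * real s * \<mu>2)" by (auto simp: \<Delta>_def)
      from h'(3) have h3: "256 * \<kappa> * real s * h * \<mu>2 \<le> 1" using pos by (simp add: field_simps)
      have mr: "m + r1 \<le> \<mu>1 * r1" "m + r2 \<le> \<mu>2 * r2"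
      proof -
        have "0 \<le> m / r1" "0 \<le> m / r2" using r12 \<open>0 \<le> m\<close> by simp_all
        then have "\<mu>1 = m / r1 + 1" "\<mu>2 = m / r2 + 1" unfolding m by (simp_all add: \<mu>1_def \<mu>2_def)
        then show "m + r1 \<le> \<mu>1 * r1" "m + r2 \<le> \<mu>2 * r2" using r12 by (simp_all add: distrib_right)
      qed
      have eq: "of_real (net \<theta> x p - imde_truncation mod_coeff (K h) h x p) = G (cvec x) p - pfam (K h) (Gs F) (of_real h) (cvec x) p"
      proof -
        have "G (cvec x) p = of_real (net \<theta> x p)" using G xR by (simp add: analytic_extension_def) (simp add: cvec_def)
        moreover have "Gs F k (cvec x) p = of_real (mod_coeff k x p)" for k
          using Gs_cvec[OF xcR, of k] by (simp add: fun_eq_iff) (simp add: cvec_def)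
        ultimately show ?thesis by (simp add: pfam_def imde_truncation_def)
      qed
      have "norm (net \<theta> x p - imde_truncation mod_coeff (K h) h x p) = cmod (G (cvec x) p - pfam (K h) (Gs F) (of_real h) (cvec x) p)"
        unfolding eq[symmetric] by (simp only: norm_of_real real_norm_def)
      also have "\<dots> \<le> C * m * exp (- (min \<eta>1 (\<eta>2 / 2) / h)) + exp 1 / (exp 1 - 1) * discrepancy sv I a b L s D h x r1 r2 F G"
        unfolding K_def C_def
        by (rule unrolled_field_bound[OF F G x bF bG r12 mr assms(3) h e1 h'(1) e2 h'(2) h3 p])
      also have "- (min \<eta>1 (\<eta>2 / 2) / h) = - \<gamma> / (real s * h) powr (1 / 1)"
        using pos sh(1) by (simp add: \<gamma>_def)
      finally show "norm (net \<theta> x p - imde_truncation mod_coeff (K h) h x p)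
        \<le> C * m * exp (- \<gamma> / (real s * h) powr (1 / 1)) + exp 1 / (exp 1 - 1) * discrepancy sv I a b L s D h x r1 r2 F G" .
    qed
    show "\<exists>fs. imde sv I a b L D x (r1 + r2) f fs \<and>
          (\<forall>fs'. imde sv I a b L D x (r1 + r2) f fs' \<longrightarrow>
             (\<forall>k. \<forall>y\<in>nball D x (r1 + r2). fs' k y = fs k y)) \<and>
          (0 < real s * h \<and> real s * h < \<Delta> \<longrightarrow>
             supnorm D (\<lambda>p. net \<theta> x p - imde_truncation fs (K h) h x p)
             \<le> C * m * exp (- \<gamma> / (real s * h) powr (1 / 1))
               + exp 1 / (exp 1 - 1) * discrepancy sv I a b L s D h x r1 r2 F G)"
    proof (rule exI[of _ mod_coeff], intro conjI allI impI ballI)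
      show "imde sv I a b L D x (r1 + r2) f mod_coeff" by (rule imde_mod_coeff)
      show "fs' k y = mod_coeff k y" if "imde sv I a b L D x (r1 + r2) f fs'" "y \<in> nball D x (r1 + r2)" for fs' k y
        by (rule imde_unique[OF that])
    qed (rule bound, simp_all)
  qed simp
qed

end
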